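(* Let $d\ge1$ and let $V:\mathbb{R}^d\to\mathbb{C}$ satisfy (A1), (A2), (A3) and (C1), and let $H=-\Delta+V$. If $\lambda\in\partial\operatorname{Num}(H)$ is a point of unilateral infinite curvature of $\partial\overline{\operatorname{Num}}(H)$, then $\lambda\in\sigma_{ess}(H)$. In particular, if $\sigma_{ess}(H)=\emptyset$, then $\partial\operatorname{Num}(H)$ has no points of unilateral infinite curvature.
   Context: (A1): $V\in L^1_{loc}(\mathbb{R}^d)$ and the sesquilinear form $\mathcal{E}(f,g)=\langle\nabla f,\nabla g\rangle+\int V f\bar g\,dx$ on $\operatorname{D}(\mathcal{E})=H^1(\mathbb{R}^d)\cap\{f\in L^2: V|f|^2\in L^1\}$ is closed and sectorial; $H=-\Delta+V$ denotes the $m$-sectorial operator in $L^2(\mathbb{R}^d)$ associated with $\mathcal{E}$ by the first representation theorem. (A2): $\operatorname{D}(H)\subset\{f\in L^2(\mathbb{R}^d):\operatorname{Im}(V)f\in L^2\}$. (A3): $\operatorname{Re}(V)\in L^p_{loc}(\mathbb{R}^d)$ with $p=d/2$ if $d\ge3$ and some $p>1$ if $d=2$ (no condition if $d=1$). (C1): there exist $x_1\neq x_2$ in $\mathbb{R}^d$ at which $\operatorname{Im}V$ is continuous with $\operatorname{Im}V(x_1)\neq\operatorname{Im}V(x_2)$. $\operatorname{Num}(H)=\{\langle Hf,f\rangle:f\in\operatorname{D}(H),\|f\|=1\}$; $\sigma_{ess}(H)=\{\lambda: H-\lambda I\text{ is not Fredholm}\}$. Curvature conventions. Let $\Omega\subset\mathbb{C}$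 be a closed convex set with nonempty interior and $\lambda\in\partial\Omega$. There is at least one supporting line of $\Omega$ through $\lambda$; $\lambda$ is called a corner point if there is more than one. If $\lambda$ is a corner point, $\Omega$ lies in a closed sector with vertex $\lambda$ and semivertical angle $<\pi/2$; take the smallest such sector and let $l_\lambda$ be the supporting line through $\lambda$ orthogonal to the axis of this sector; otherwise $l_\lambda$ is the unique supporting line. Use rectangular coordinates $(\xi,\eta)$ with origin at $\lambda$, $\xi$-axis equal to $l_\lambda$, oriented so that $\Omega\subset\{\eta\ge 0\}$. Let $D'_\varepsilon=\{(\xi,\eta):\xi^2+\eta^2\le\varepsilon^2,\ \xi\neq 0\}$. Define $\gamma_u^+(\lambda)=\lim_{\varepsilon\downarrow 0}\sup\{\eta/\xi^2:(\xi,\eta)\in\partial\Omega\cap D'_\varepsilon,\ \xi>0\}$ and $\gamma_l^+(\lambda)$ the same with $\inf$ in place of $\sup$; $\gamma_u^-(\lambda),\gamma_l^-(\lambda)$ are defined analogously with $\xi<0$. Set $\gamma_u(\lambda)=\max(\gamma_u^+(\lambda),\gamma_u^-(\lambda))$, $\gamma_l(\lambda)=\min(\gamma_l^+(\lambda),\gamma_l^-(\lambda))$. The point $\lambda$ is of infinite upper curvature if $\gamma_u(\lambda)=\infty$, and of unilateral infinite curvature if $\gamma_l^+(\lambda)=\infty$ or $\gamma_l^-(\lambda)=\infty$. For an operator $A$, these notions at $\lambda\in\partial\operatorname{Num}(A)$ refer to $\Omega=\overline{\operatorname{Num}}(A)$. *)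

theory Defs
  imports "HOL-Analysis.Analysis"
begin

section \<open>The Hilbert space L2(R^d), functions represented pointwise (equality is a.e.)\<close>

definition L2 :: "(real^'n \<Rightarrow> complex) set" where
  "L2 = {f. f \<in> borel_measurable lebesgue \<and> integrable lebesgue (\<lambda>x. (cmod (f x))^2)}"

definition l2_inner :: "(real^'n \<Rightarrow> complex) \<Rightarrow> (real^'n \<Rightarrow> complex) \<Rightarrow> complex" where
  "l2_inner f g = (LINT x|lebesgue. f x * cnj (g x))"

definition l2_norm :: "(real^'n \<Rightarrow> complex) \<Rightarrow> real" where
  "l2_norm f = sqrt (LINT x|lebesgue. (cmod (f x))^2)"

definition pdiff :: "'n \<Rightarrow> (real^'n \<Rightarrow> real) \<Rightarrow> (real^'n \<Rightarrow> real)" where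
  "pdiff j \<phi> = (\<lambda>x. deriv (\<lambda>t. \<phi> (x + t *\<^sub>R axis j 1)) 0)"

definition smooth_fun :: "(real^'n \<Rightarrow> real) \<Rightarrow> bool" where
  "smooth_fun \<phi> \<longleftrightarrow> (\<forall>js::'n list. continuous_on UNIV (fold pdiff js \<phi>) \<and>
      (\<forall>j x. (\<lambda>t. fold pdiff js \<phi> (x + t *\<^sub>R axis j 1)) differentiable (at 0)))"

definition test_fun :: "(real^'n \<Rightarrow> real) \<Rightarrow> bool" where
  "test_fun \<phi> \<longleftrightarrow> smooth_fun \<phi> \<and> compact (closure {x. \<phi> x \<noteq> 0})"

definition has_weak_pd :: "(real^'n \<Rightarrow> complex) \<Rightarrow> 'n \<Rightarrow> (real^'n \<Rightarrow> complex) \<Rightarrow> bool" where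
  "has_weak_pd f j g \<longleftrightarrow> (\<forall>\<phi>. test_fun \<phi> \<longrightarrow>
      (LINT x|lebesgue. f x * of_real (pdiff j \<phi> x)) = - (LINT x|lebesgue. g x * of_real (\<phi> x)))"

definition H1 :: "(real^'n \<Rightarrow> complex) set" where
  "H1 = {f \<in> L2. \<forall>j. \<exists>g \<in> L2. has_weak_pd f j g}"

definition wgrad :: "(real^'n \<Rightarrow> complex) \<Rightarrow> 'n \<Rightarrow> (real^'n \<Rightarrow> complex)" where
  "wgrad f j = (SOME g. g \<in> L2 \<and> has_weak_pd f j g)"

definition form_dom :: "(real^'n \<Rightarrow> complex) \<Rightarrow> (real^'n \<Rightarrow> complex) set" where
  "form_dom V = {f \<in> H1. integrable lebesgue (\<lambda>x. V x * of_real ((cmod (f x))^2))}"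

definition form :: "(real^'n \<Rightarrow> complex) \<Rightarrow> (real^'n \<Rightarrow> complex) \<Rightarrow> (real^'n \<Rightarrow> complex) \<Rightarrow> complex" where
  "form V f g = (\<Sum>j\<in>UNIV. l2_inner (wgrad f j) (wgrad g j)) + (LINT x|lebesgue. V x * f x * cnj (g x))"

definition sectorial_form :: "(real^'n \<Rightarrow> complex) \<Rightarrow> bool" where
  "sectorial_form V \<longleftrightarrow> (\<exists>\<gamma>::real. \<exists>\<theta>::real. 0 \<le> \<theta> \<and> \<theta> < pi/2 \<and>
     (\<forall>f \<in> form_dom V. \<bar>Im (form V f f)\<bar> \<le> tan \<theta> * (Re (form V f f) - \<gamma> * (l2_norm f)^2)))"

definition closed_form :: "(real^'n \<Rightarrow> complex) \<Rightarrow> bool" where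
  "closed_form V \<longleftrightarrow> (\<forall>fs f. (\<forall>n. fs n \<in> form_dom V) \<and> f \<in> L2 \<and>
      (\<lambda>n. l2_norm (\<lambda>x. fs n x - f x)) \<longlonglongrightarrow> 0 \<and>
      (\<forall>\<epsilon>>0. \<exists>N. \<forall>n\<ge>N. \<forall>m\<ge>N.
          cmod (form V (\<lambda>x. fs n x - fs m x) (\<lambda>x. fs n x - fs m x)) < \<epsilon>)
    \<longrightarrow> f \<in> form_dom V \<and> (\<lambda>n. form V (\<lambda>x. fs n x - f x) (\<lambda>x. fs n x - f x)) \<longlonglongrightarrow> 0)"

definition L1_loc :: "(real^'n \<Rightarrow> complex) \<Rightarrow> bool" where
  "L1_loc V \<longleftrightarrow> V \<in> borel_measurable lebesgue \<and> (\<forall>K. compact K \<longrightarrow> set_integrable lebesgue K V)"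

text \<open>First representation theorem: H is the operator associated with the form.\<close>
definition H_rel :: "(real^'n \<Rightarrow> complex) \<Rightarrow> (real^'n \<Rightarrow> complex) \<Rightarrow> (real^'n \<Rightarrow> complex) \<Rightarrow> bool" where
  "H_rel V f u \<longleftrightarrow> f \<in> form_dom V \<and> u \<in> L2 \<and> (\<forall>v \<in> form_dom V. form V f v = l2_inner u v)"

definition H_dom :: "(real^'n \<Rightarrow> complex) \<Rightarrow> (real^'n \<Rightarrow> complex) set" where
  "H_dom V = {f. \<exists>u. H_rel V f u}"

definition H_op :: "(real^'n \<Rightarrow> complex) \<Rightarrow> (real^'n \<Rightarrow> complex) \<Rightarrow> (real^'n \<Rightarrow> complex)" where
  "H_op V f = (SOME u. H_rel V f u)"

definition numrange :: "(real^'n \<Rightarrow> complex) \<Rightarrow> complex set" where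
  "numrange V = {l2_inner (H_op V f) f | f. f \<in> H_dom V \<and> l2_norm f = 1}"

definition hypA1 :: "(real^'n \<Rightarrow> complex) \<Rightarrow> bool" where
  "hypA1 V \<longleftrightarrow> L1_loc V \<and> closed_form V \<and> sectorial_form V"

definition hypA2 :: "(real^'n \<Rightarrow> complex) \<Rightarrow> bool" where
  "hypA2 V \<longleftrightarrow> (\<forall>f \<in> H_dom V. (\<lambda>x. of_real (Im (V x)) * f x) \<in> L2)"

definition Lp_loc :: "real \<Rightarrow> (real^'n \<Rightarrow> real) \<Rightarrow> bool" where
  "Lp_loc p W \<longleftrightarrow> W \<in> borel_measurable lebesgue \<and>
     (\<forall>K. compact K \<longrightarrow> set_integrable lebesgue K (\<lambda>x. \<bar>W x\<bar> powr p))"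

definition hypA3 :: "(real^'n \<Rightarrow> complex) \<Rightarrow> bool" where
  "hypA3 V \<longleftrightarrow>
     (CARD('n) \<ge> 3 \<longrightarrow> Lp_loc (real CARD('n) / 2) (\<lambda>x. Re (V x))) \<and>
     (CARD('n) = 2 \<longrightarrow> (\<exists>p>1. Lp_loc p (\<lambda>x. Re (V x))))"

definition hypC1 :: "(real^'n \<Rightarrow> complex) \<Rightarrow> bool" where
  "hypC1 V \<longleftrightarrow> (\<exists>x1 x2. x1 \<noteq> x2 \<and> isCont (\<lambda>x. Im (V x)) x1 \<and> isCont (\<lambda>x. Im (V x)) x2
                    \<and> Im (V x1) \<noteq> Im (V x2))"

definition fin_dim_ae :: "(real^'n \<Rightarrow> complex) set \<Rightarrow> bool" where
  "fin_dim_ae S \<longleftrightarrow> (\<exists>B. finite B \<and> B \<subseteq> L2 \<and>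
      (\<forall>f \<in> S. \<exists>c. AE x in lebesgue. f x = (\<Sum>b\<in>B. c b * b x)))"

definition H_kernel :: "(real^'n \<Rightarrow> complex) \<Rightarrow> complex \<Rightarrow> (real^'n \<Rightarrow> complex) set" where
  "H_kernel V lam = {f \<in> H_dom V. AE x in lebesgue. H_op V f x = lam * f x}"

definition H_range :: "(real^'n \<Rightarrow> complex) \<Rightarrow> complex \<Rightarrow> (real^'n \<Rightarrow> complex) set" where
  "H_range V lam = {g. \<exists>f \<in> H_dom V. AE x in lebesgue. g x = H_op V f x - lam * f x}"

definition l2_closed :: "(real^'n \<Rightarrow> complex) set \<Rightarrow> bool" where
  "l2_closed R \<longleftrightarrow> (\<forall>gs g. (\<forall>n. gs n \<in> R) \<and> g \<in> L2 \<and>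
      (\<lambda>n. l2_norm (\<lambda>x. gs n x - g x)) \<longlonglongrightarrow> 0 \<longrightarrow> g \<in> R)"

definition fin_codim_ae :: "(real^'n \<Rightarrow> complex) set \<Rightarrow> bool" where
  "fin_codim_ae R \<longleftrightarrow> (\<exists>B. finite B \<and> B \<subseteq> L2 \<and>
      (\<forall>g \<in> L2. \<exists>r \<in> R. \<exists>c. AE x in lebesgue. g x = r x + (\<Sum>b\<in>B. c b * b x)))"

definition H_fredholm :: "(real^'n \<Rightarrow> complex) \<Rightarrow> complex \<Rightarrow> bool" where
  "H_fredholm V lam \<longleftrightarrow> fin_dim_ae (H_kernel V lam) \<and> l2_closed (H_range V lam)
      \<and> fin_codim_ae (H_range V lam)"

definition sigma_ess :: "(real^'n \<Rightarrow> complex) \<Rightarrow> complex set" where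
  "sigma_ess V = {lam. \<not> H_fredholm V lam}"

definition supporting_line :: "complex set \<Rightarrow> complex \<Rightarrow> complex set \<Rightarrow> bool" where
  "supporting_line \<Omega> lam L \<longleftrightarrow> (\<exists>u. cmod u = 1 \<and> L = {z. Re ((z - lam) * cnj u) = 0}
      \<and> \<Omega> \<subseteq> {z. Re ((z - lam) * cnj u) \<ge> 0})"

definition corner_point :: "complex set \<Rightarrow> complex \<Rightarrow> bool" where
  "corner_point \<Omega> lam \<longleftrightarrow> (\<exists>L1 L2. supporting_line \<Omega> lam L1 \<and> supporting_line \<Omega> lam L2 \<and> L1 \<noteq> L2)"

definition csector :: "complex \<Rightarrow> complex \<Rightarrow> real \<Rightarrow> complex set" where
  "csector lam u \<theta> = {z. Re ((z - lam) * cnj u) \<ge> cos \<theta> * cmod (z - lam)}"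

text \<open>Unit normal u to the line l_lam, pointing into the half-plane containing Omega
  (i.e. the eta-axis direction).\<close>
definition eta_dir :: "complex set \<Rightarrow> complex \<Rightarrow> complex" where
  "eta_dir \<Omega> lam = (if corner_point \<Omega> lam then
      (SOME u. cmod u = 1 \<and> (\<exists>\<theta>. 0 \<le> \<theta> \<and> \<theta> < pi/2 \<and> \<Omega> \<subseteq> csector lam u \<theta> \<and>
          (\<forall>u' \<theta>'. cmod u' = 1 \<and> 0 \<le> \<theta>' \<and> \<theta>' < pi/2 \<and> \<Omega> \<subseteq> csector lam u' \<theta>' \<longrightarrow> \<theta> \<le> \<theta>')))
    else (SOME u. cmod u = 1 \<and> \<Omega> \<subseteq> {z. Re ((z - lam) * cnj u) \<ge> 0}))"

definition eta_coord :: "complex set \<Rightarrow> complex \<Rightarrow> complex \<Rightarrow> real" where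
  "eta_coord \<Omega> lam z = Re ((z - lam) * cnj (eta_dir \<Omega> lam))"

definition xi_coord :: "complex set \<Rightarrow> complex \<Rightarrow> complex \<Rightarrow> real" where
  "xi_coord \<Omega> lam z = Re ((z - lam) * cnj (- \<i> * eta_dir \<Omega> lam))"

definition gamma_l_plus :: "complex set \<Rightarrow> complex \<Rightarrow> ereal" where
  "gamma_l_plus \<Omega> lam = Lim (at_right (0::real)) (\<lambda>\<epsilon>.
     INF z \<in> {z \<in> frontier \<Omega>. (xi_coord \<Omega> lam z)^2 + (eta_coord \<Omega> lam z)^2 \<le> \<epsilon>^2
                  \<and> xi_coord \<Omega> lam z \<noteq> 0 \<and> xi_coord \<Omega> lam z > 0}.
       ereal (eta_coord \<Omega> lam z / (xi_coord \<Omega> lam z)^2))"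

definition gamma_l_minus :: "complex set \<Rightarrow> complex \<Rightarrow> ereal" where
  "gamma_l_minus \<Omega> lam = Lim (at_right (0::real)) (\<lambda>\<epsilon>.
     INF z \<in> {z \<in> frontier \<Omega>. (xi_coord \<Omega> lam z)^2 + (eta_coord \<Omega> lam z)^2 \<le> \<epsilon>^2
                  \<and> xi_coord \<Omega> lam z \<noteq> 0 \<and> xi_coord \<Omega> lam z < 0}.
       ereal (eta_coord \<Omega> lam z / (xi_coord \<Omega> lam z)^2))"

definition unilateral_infinite_curvature :: "complex set \<Rightarrow> complex \<Rightarrow> bool" where
  "unilateral_infinite_curvature \<Omega> lam \<longleftrightarrow> gamma_l_plus \<Omega> lam = \<infinity> \<or> gamma_l_minus \<Omega> lam = \<infinity>"

end

(* Suppose that H - lam has closed range. If the form E - lam had no kernel, nearly minimising vectors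
   could be perturbed by uniformly bounded approximate preimages, and the numerical range would contain
   points (xi, eta) with eta <= C xi^2 arbitrarily close to lam and on both sides of it (or stay away
   from lam altogether), which unilateral infinite curvature forbids. Hence there is f <> 0 with
   E(f,.) = lam <f,.> and E(.,f) = lam <.,f>. Comparing imaginary parts gives (Im V - Im lam) f = 0, so
   f vanishes on a ball around one of the two continuity points. A supporting half-plane at lam, whose
   normal w has Re w > 0, makes f a minimiser of the quadratic form of Re (w* (E - lam)); then so is
   |f|, which is therefore a supersolution. Testing with phi^2 / (|f| + eps) bounds the L2 norm of the
   increments of log (|f| + eps) independently of eps, so a zero of |f| on a ball spreads to all of
   space: f = 0, a contradiction. *)
theory Submission
  imports Defs "HOL-Library.Function_Algebras" "HOL-Computational_Algebra.Polynomial"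
begin

section \<open>Semi-inner products and sesquilinear forms\<close>

text \<open>Functions stand for themselves and not for classes modulo null sets, so the
  \<open>L2\<close> inner product is only positive semidefinite. The abstract theory therefore works
  with semi-inner products on a carrier set; operators become relations, and vectors are determined
  up to null vectors. A second obstacle is that \<open>H - lam\<close> may have a kernel. Vectors
  killed by both \<open>H - lam\<close> and its adjoint split off orthogonally, and the question is
  whether the values of \<open>E - lam\<close> on unit vectors of the complement stay away from 0. A
  corner gives this gap through its two transversal lines, any other point of unilateral infinite
  curvature through the parabola. The gap does two jobs: it forces a kernel vector, and it leaves
  room to tilt the half-plane until \<open>Re w\<close> is nonzero; rapidly oscillating vectors then
  exclude \<open>Re w < 0\<close>. Weak derivatives are handled by difference quotients, so that the
  logarithmic estimate rests on an algebraic identity between the values at two points instead of a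
  chain rule. Dividing by \<open>|f| + eps\<close> also tames the potential term, because
  \<open>|f| phi^2 / (|f| + eps)\<close> is at most \<open>phi^2\<close>.\<close>

lemma quadratic_bound:
  fixes A B C :: real
  assumes "\<And>r. 0 \<le> A - 2 * r * B + r^2 * B * C" "0 \<le> A" "0 \<le> B" "0 \<le> C"
  shows "B \<le> A * C"
proof (cases "C = 0")
  case True
  have "0 \<le> A - 2 * ((A + 1) / B) * B" if "B \<noteq> 0" using assms(1)[of "(A+1)/B"] True by simp
  then have "B = 0" using assms(2) by (cases "B = 0") auto
  then show ?thesis using True by simp
next
  case False
  then have "C > 0" using assms(4) by simp
  have "0 \<le> A - 2 * (1/C) * B + (1/C)^2 * B * C" by (rule assms(1))
  also have "\<dots> = A - B / C" using \<open>C > 0\<close> by (simp add: power2_eq_square field_simps)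
  finally show ?thesis using \<open>C > 0\<close> by (simp add: field_simps)
qed

text \<open>No definiteness: functions that agree almost everywhere differ by a vector of norm 0
  without being equal. The carrier \<open>X\<close> is a subset of the type because integrals of
  products behave linearly only on square integrable functions.\<close>

locale semi_ip = vector_space sc for sc :: "complex \<Rightarrow> 'v::ab_group_add \<Rightarrow> 'v" +
  fixes X :: "'v set" and ip :: "'v \<Rightarrow> 'v \<Rightarrow> complex"
  assumes sub: "subspace X"
    and ip_add: "\<lbrakk>x \<in> X; y \<in> X; z \<in> X\<rbrakk> \<Longrightarrow> ip (x + y) z = ip x z + ip y z"
    and ip_scale: "\<lbrakk>x \<in> X; y \<in> X\<rbrakk> \<Longrightarrow> ip (sc c x) y = c * ip x y"
    and ip_cnj: "\<lbrakk>x \<in> X; y \<in> X\<rbrakk> \<Longrightarrow> ip y x = cnj (ip x y)"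
    and ip_nonneg: "x \<in> X \<Longrightarrow> 0 \<le> Re (ip x x)"
begin

definition nrm :: "'v \<Rightarrow> real" where "nrm x = sqrt (Re (ip x x))"

lemma add_mem [simp, intro]: "\<lbrakk>x \<in> X; y \<in> X\<rbrakk> \<Longrightarrow> x + y \<in> X"
  using sub by (rule subspace_add)
lemma diff_mem [simp, intro]: "\<lbrakk>x \<in> X; y \<in> X\<rbrakk> \<Longrightarrow> x - y \<in> X"
  using sub by (rule subspace_diff)
lemma scale_mem [simp, intro]: "x \<in> X \<Longrightarrow> sc c x \<in> X"
  using sub by (rule subspace_scale)
lemma zero_mem [simp, intro]: "0 \<in> X"
  using sub by (rule subspace_0)

lemma ip_add2: "\<lbrakk>x \<in> X; y \<in> X; z \<in> X\<rbrakk> \<Longrightarrow> ip z (x + y) = ip z x + ip z y"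
  by (metis add_mem complex_cnj_add ip_add ip_cnj)
lemma ip_scale2: "\<lbrakk>x \<in> X; y \<in> X\<rbrakk> \<Longrightarrow> ip x (sc c y) = cnj c * ip x y"
  by (metis complex_cnj_mult ip_cnj ip_scale scale_mem)
lemma ip_diff: "\<lbrakk>x \<in> X; y \<in> X; z \<in> X\<rbrakk> \<Longrightarrow> ip (x - y) z = ip x z - ip y z"
  using ip_add[of "x - y" y z] by simp
lemma ip_diff2: "\<lbrakk>x \<in> X; y \<in> X; z \<in> X\<rbrakk> \<Longrightarrow> ip z (x - y) = ip z x - ip z y"
  using ip_add2[of "x - y" y z] by simp
lemma ip_zero [simp]: "x \<in> X \<Longrightarrow> ip 0 x = 0" "x \<in> X \<Longrightarrow> ip x 0 = 0"
  using ip_diff[of x x x] ip_diff2[of x x x] by simp_all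

lemma nrm_ge0 [simp]: "x \<in> X \<Longrightarrow> 0 \<le> nrm x"
  using ip_nonneg by (simp add: nrm_def)
lemma nrm_sq: "x \<in> X \<Longrightarrow> (nrm x)\<^sup>2 = Re (ip x x)"
  using ip_nonneg by (simp add: nrm_def)
lemma ip_self: "x \<in> X \<Longrightarrow> ip x x = of_real ((nrm x)\<^sup>2)"
  using ip_cnj[of x x] by (auto simp: nrm_sq complex_eq_iff)
lemma nrm_zero [simp]: "nrm 0 = 0"
  by (simp add: nrm_def)

lemma nrm_add_sq: "\<lbrakk>x \<in> X; y \<in> X\<rbrakk> \<Longrightarrow> (nrm (x + y))\<^sup>2 = (nrm x)\<^sup>2 + 2 * Re (ip x y) + (nrm y)\<^sup>2"
  using ip_cnj[of x y] by (simp add: nrm_sq ip_add ip_add2)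
lemma nrm_diff_sq: "\<lbrakk>x \<in> X; y \<in> X\<rbrakk> \<Longrightarrow> (nrm (x - y))\<^sup>2 = (nrm x)\<^sup>2 - 2 * Re (ip x y) + (nrm y)\<^sup>2"
  using ip_cnj[of x y] by (simp add: nrm_sq ip_diff ip_diff2)
lemma nrm_scale: "x \<in> X \<Longrightarrow> nrm (sc c x) = cmod c * nrm x"
proof -
  assume x: "x \<in> X"
  have "ip (sc c x) (sc c x) = (c * cnj c) * ip x x"
    using x by (simp add: ip_scale ip_scale2 mult_ac)
  then have "(nrm (sc c x))\<^sup>2 = (cmod c * nrm x)\<^sup>2"
    using x by (simp add: nrm_sq power_mult_distrib complex_mult_cnj flip: of_real_mult of_real_power cmod_power2)
  then show ?thesis using x by (simp add: power2_eq_iff_nonneg)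
qed

lemma cauchy_schwarz:
  assumes x: "x \<in> X" and y: "y \<in> X"
  shows "cmod (ip x y) \<le> nrm x * nrm y"
proof -
  let ?p = "ip x y"
  have "(cmod ?p)\<^sup>2 \<le> (nrm x)\<^sup>2 * (nrm y)\<^sup>2"
  proof (rule quadratic_bound)
    fix r :: real
    \<comment> \<open>Perturbing by a real multiple of the inner product itself makes the mixed term
      real whatever its phase. This is why the same B sits in both coefficients of
      \<open>quadratic_bound\<close>.\<close>
    let ?t = "of_real r * ?p"
    have "0 \<le> (nrm (x - sc ?t y))\<^sup>2" by simp
    also have "\<dots> = (nrm x)\<^sup>2 - 2 * Re (cnj ?t * ?p) + (cmod ?t * nrm y)\<^sup>2"
      using x y by (simp only: nrm_diff_sq scale_mem ip_scale2 nrm_scale)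
    also have "Re (cnj ?t * ?p) = r * (cmod ?p)\<^sup>2"
      by (simp add: cmod_power2) (simp add: power2_eq_square algebra_simps)
    finally show "0 \<le> (nrm x)\<^sup>2 - 2 * r * (cmod ?p)\<^sup>2 + r\<^sup>2 * (cmod ?p)\<^sup>2 * (nrm y)\<^sup>2"
      by (simp add: norm_mult power_mult_distrib)
  qed auto
  then have "(cmod ?p)\<^sup>2 \<le> (nrm x * nrm y)\<^sup>2" by (simp add: power_mult_distrib)
  then show ?thesis using x y by (simp add: abs_le_square_iff[symmetric])
qed

lemma nrm_triangle:
  assumes x: "x \<in> X" and y: "y \<in> X"
  shows "nrm (x + y) \<le> nrm x + nrm y"
proof -
  have "(nrm (x + y))\<^sup>2 \<le> (nrm x + nrm y)\<^sup>2"
    using cauchy_schwarz[OF x y] complex_Re_le_cmod[of "ip x y"] x y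
    by (simp add: nrm_add_sq power2_sum)
  then show ?thesis using x y by (simp add: abs_le_square_iff[symmetric])
qed

lemma nrm_minus: "\<lbrakk>x \<in> X; y \<in> X\<rbrakk> \<Longrightarrow> nrm (x - y) = nrm (y - x)"
  using nrm_scale[of "y - x" "-1"] by simp
lemma nrm_diff_le: "\<lbrakk>x \<in> X; y \<in> X\<rbrakk> \<Longrightarrow> nrm (x - y) \<le> nrm x + nrm y"
  using nrm_triangle[of x "sc (-1) y"] nrm_scale[of y "-1"] scale_mem[of y "-1"] by simp
lemma nrm_triangle3: "\<lbrakk>x \<in> X; y \<in> X; z \<in> X\<rbrakk> \<Longrightarrow> nrm (x - z) \<le> nrm (x - y) + nrm (y - z)"
  using nrm_triangle[of "x - y" "y - z"] by simp
lemma nrm_rev_triangle: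
  assumes "x \<in> X" "y \<in> X" shows "\<bar>nrm x - nrm y\<bar> \<le> nrm (x - y)"
  using nrm_triangle[of "x - y" y] nrm_triangle[of "y - x" x] nrm_minus[of x y] assms by simp

lemma tendsto_ip:
  assumes "\<And>n. s n \<in> X" "x \<in> X" "y \<in> X" "(\<lambda>n. nrm (s n - x)) \<longlonglongrightarrow> 0"
  shows "(\<lambda>n. ip (s n) y) \<longlonglongrightarrow> ip x y" and "(\<lambda>n. ip y (s n)) \<longlonglongrightarrow> ip y x"
proof -
  have l: "(\<lambda>n. nrm (s n - x) * nrm y) \<longlonglongrightarrow> 0"
    using tendsto_mult_left_zero[OF assms(4)] .
  have "(\<lambda>n. ip (s n) y - ip x y) \<longlonglongrightarrow> 0"
    by (rule Lim_null_comparison[OF _ l]) (use assms cauchy_schwarz in \<open>simp add: ip_diff[symmetric]\<close>)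
  then show 1: "(\<lambda>n. ip (s n) y) \<longlonglongrightarrow> ip x y" by (simp add: LIM_zero_iff)
  show "(\<lambda>n. ip y (s n)) \<longlonglongrightarrow> ip y x"
    using tendsto_cnj[OF 1] ip_cnj[OF assms(1) assms(3)] ip_cnj[OF assms(2,3)] by simp
qed

lemma tendsto_nrm:
  assumes "\<And>n. s n \<in> X" "x \<in> X" "(\<lambda>n. nrm (s n - x)) \<longlonglongrightarrow> 0"
  shows "(\<lambda>n. nrm (s n)) \<longlonglongrightarrow> nrm x"
proof -
  have "(\<lambda>n. nrm (s n) - nrm x) \<longlonglongrightarrow> 0"
    by (rule Lim_null_comparison[OF _ assms(3)]) (use assms nrm_rev_triangle in simp)
  then show ?thesis by (simp add: LIM_zero_iff)
qed

lemma null_ip: "\<lbrakk>x \<in> X; y \<in> X; nrm x = 0\<rbrakk> \<Longrightarrow> ip x y = 0" "\<lbrakk>x \<in> X; y \<in> X; nrm x = 0\<rbrakk> \<Longrightarrow> ip y x = 0"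
  using cauchy_schwarz[of x y] cauchy_schwarz[of y x] by simp_all

lemma nrm_eqI:
  assumes "x \<in> X" "y \<in> X" "nrm (x - y) = 0" shows "nrm x = nrm y"
  using nrm_rev_triangle[OF assms(1,2)] assms(3) by simp

end

section \<open>Complete spaces: Riesz, projections, Lax-Milgram, bounded preimages\<close>

locale semi_hilbert = semi_ip +
  assumes complete: "\<lbrakk>\<And>n. s n \<in> X; \<And>e. e > 0 \<Longrightarrow> \<exists>N. \<forall>n\<ge>N. \<forall>m\<ge>N. nrm (s n - s m) < e\<rbrakk>
      \<Longrightarrow> \<exists>x\<in>X. (\<lambda>n. nrm (s n - x)) \<longlonglongrightarrow> 0"
begin

text \<open>Besides the limit, the explicit tail \<open>K * q ^ n / (1 - q)\<close> matters: the
  gliding hump in \<open>bounded_preimages\<close> is calibrated against it.\<close>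

lemma geometric_limit:
  assumes s: "\<And>n. s n \<in> X" and le: "\<And>n. nrm (s (Suc n) - s n) \<le> K * q ^ n"
    and K: "0 \<le> K" and q: "0 \<le> q" "q < 1"
  obtains x where "x \<in> X" "(\<lambda>n. nrm (s n - x)) \<longlonglongrightarrow> 0" "\<And>n. nrm (s n - x) \<le> K * q ^ n / (1 - q)"
proof -
  have tail: "nrm (s (n + k) - s n) \<le> K * q ^ n / (1 - q)" for n k
  proof -
    have "nrm (s (n + k) - s n) \<le> K * q ^ n * (1 - q ^ k) / (1 - q)"
    proof (induction k)
      case (Suc k)
      have "nrm (s (n + Suc k) - s n) \<le> nrm (s (Suc (n + k)) - s (n + k)) + nrm (s (n + k) - s n)"
        using nrm_triangle3[OF s s s] by simp
      also have "\<dots> \<le> K * q ^ (n + k) + K * q ^ n * (1 - q ^ k) / (1 - q)"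
        using Suc le by (intro add_mono) auto
      also have "\<dots> = K * q ^ n * (1 - q ^ Suc k) / (1 - q)"
        using q by (simp add: field_simps power_add)
      finally show ?case .
    qed simp
    also have "\<dots> \<le> K * q ^ n / (1 - q)"
      using K q by (intro divide_right_mono mult_left_le) (auto simp: mult_nonneg_nonneg)
    finally show ?thesis .
  qed
  have lim0: "(\<lambda>n. K * q ^ n / (1 - q)) \<longlonglongrightarrow> 0"
    using LIMSEQ_realpow_zero[OF q] tendsto_mult_right_zero tendsto_divide_zero by blast
  have "\<exists>N. \<forall>n\<ge>N. \<forall>m\<ge>N. nrm (s n - s m) < e" if "e > 0" for e
  proof -
    have "e / 2 > 0" using that by simp
    from order_tendstoD(2)[OF lim0 this] obtain N where N: "K * q ^ N / (1 - q) < e / 2"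
      unfolding eventually_sequentially by blast
    have *: "nrm (s n - s N) < e / 2" if "n \<ge> N" for n
      using tail[of N "n - N"] N that by (simp only: le_add_diff_inverse)
    have "nrm (s n - s m) < e" if "n \<ge> N" "m \<ge> N" for n m
      using nrm_triangle3[OF s[of n] s[of N] s[of m]] *[OF that(1)] *[OF that(2)] nrm_minus[OF s[of m] s[of N]] by simp
    then show ?thesis by blast
  qed
  then obtain x where x: "x \<in> X" and lim: "(\<lambda>n. nrm (s n - x)) \<longlonglongrightarrow> 0"
    using complete[of s] s by blast
  have "nrm (s n - x) \<le> K * q ^ n / (1 - q)" for n
  proof (rule LIMSEQ_le_const)
    have "(\<lambda>k. nrm (s (n + k) - x)) \<longlonglongrightarrow> 0"
      using LIMSEQ_ignore_initial_segment[OF lim, of n] by (simp add: add.commute)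
    then show "(\<lambda>k. K * q ^ n / (1 - q) + nrm (s (n + k) - x)) \<longlonglongrightarrow> K * q ^ n / (1 - q)"
      using tendsto_add[OF tendsto_const] by fastforce
    show "\<exists>N. \<forall>k\<ge>N. nrm (s n - x) \<le> K * q ^ n / (1 - q) + nrm (s (n + k) - x)"
    proof (intro exI allI impI)
      fix k
      show "nrm (s n - x) \<le> K * q ^ n / (1 - q) + nrm (s (n + k) - x)"
        using nrm_triangle3[OF s[of n] s[of "n + k"] x] tail[of n k] nrm_minus[OF s[of n] s[of "n + k"]] by linarith
    qed
  qed
  then show ?thesis using x lim that by blast
qed

text \<open>Minimise \<open>J x = |x|^2 - 2 Re (l x)\<close> over T; the parallelogram law makes a
  minimising sequence Cauchy. T need not be closed, so the representing vector lies in
  \<open>X\<close> and comes with a sequence from T that approximates it. Projections and density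
  arguments thus become corollaries.\<close>

lemma riesz:
  assumes T: "subspace T" "T \<subseteq> X"
    and add: "\<And>x y. \<lbrakk>x \<in> T; y \<in> T\<rbrakk> \<Longrightarrow> l (x + y) = l x + l y"
    and scl: "\<And>c x. x \<in> T \<Longrightarrow> l (sc c x) = c * l x"
    and M: "0 \<le> M" "\<And>x. x \<in> T \<Longrightarrow> cmod (l x) \<le> M * nrm x"
  obtains g s where "g \<in> X" "\<And>n. s n \<in> T" "(\<lambda>n. nrm (s n - g)) \<longlonglongrightarrow> 0" "\<And>x. x \<in> T \<Longrightarrow> ip x g = l x" "nrm g \<le> M"
proof -
  define J where "J x = (nrm x)\<^sup>2 - 2 * Re (l x)" for x
  have TX: "x \<in> T \<Longrightarrow> x \<in> X" for x using T by blast
  have Tadd: "\<lbrakk>x \<in> T; y \<in> T\<rbrakk> \<Longrightarrow> x + y \<in> T" and Tsc: "x \<in> T \<Longrightarrow> sc c x \<in> T" for x y c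
    using T subspace_add subspace_scale by blast+
  have lb: "- M\<^sup>2 \<le> J x" if "x \<in> T" for x
  proof -
    have "Re (l x) \<le> M * nrm x" using M(2)[OF that] complex_Re_le_cmod order_trans by blast
    then have "J x \<ge> (nrm x)\<^sup>2 - 2 * (M * nrm x)" by (simp add: J_def)
    moreover have "(nrm x)\<^sup>2 - 2 * (M * nrm x) + M\<^sup>2 = (nrm x - M)\<^sup>2" by (simp add: power2_eq_square algebra_simps)
    ultimately show ?thesis using zero_le_power2[of "nrm x - M"] by linarith
  qed
  have ne: "J ` T \<noteq> {}" using T subspace_0 by blast
  have bdd: "bdd_below (J ` T)" using lb by (auto intro!: bdd_belowI)
  define d where "d = Inf (J ` T)"
  have dle: "d \<le> J x" if "x \<in> T" for x unfolding d_def using bdd that by (intro cInf_lower) auto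
  have "\<exists>x\<in>T. J x < d + 1 / real (Suc n)" for n
    using cInf_lessD[OF ne, of "d + 1 / real (Suc n)"] by (force simp: d_def)
  then obtain s where s: "\<And>n. s n \<in> T" and sJ: "\<And>n. J (s n) < d + 1 / real (Suc n)" by metis
  have par: "(nrm (x - y))\<^sup>2 \<le> 2 * (J x + J y - 2 * d)" if "x \<in> T" "y \<in> T" for x y
  proof -
    let ?m = "sc (1/2) (x + y)"
    have m: "?m \<in> T" using that Tadd Tsc by blast
    have "l ?m = (1/2) * (l x + l y)" using that by (simp only: scl Tadd add)
    then have l: "2 * Re (l ?m) = Re (l x) + Re (l y)" by (simp only:) simp
    have "(nrm ?m)\<^sup>2 = (nrm (x + y))\<^sup>2 / 4"
      using that TX Tadd by (simp add: nrm_scale power_mult_distrib power_divide)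
    then have "2 * (J x + J y - 2 * J ?m) = (nrm (x - y))\<^sup>2"
      using that TX l by (simp add: J_def nrm_add_sq nrm_diff_sq)
    moreover have "2 * (J x + J y - 2 * J ?m) \<le> 2 * (J x + J y - 2 * d)"
      using dle[OF m] by (intro mult_left_mono diff_left_mono) auto
    ultimately show ?thesis by (simp only:)
  qed
  have "\<exists>N. \<forall>n\<ge>N. \<forall>m\<ge>N. nrm (s n - s m) < e" if e: "e > 0" for e
  proof -
    obtain N where N: "1 / real (Suc N) < e\<^sup>2 / 4" using nat_approx_posE[of "e\<^sup>2/4"] e by auto
    have "nrm (s n - s m) < e" if nm: "n \<ge> N" "m \<ge> N" for n m
    proof -
      have "1 / real (Suc n) \<le> 1 / real (Suc N)" "1 / real (Suc m) \<le> 1 / real (Suc N)"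
        using nm by (auto simp: frac_le)
      then have "(nrm (s n - s m))\<^sup>2 < e\<^sup>2"
        using par[OF s s, of n m] sJ[of n] sJ[of m] N by argo
      then show ?thesis using e power2_less_imp_less by fastforce
    qed
    then show ?thesis by blast
  qed
  then obtain g where g: "g \<in> X" and lim: "(\<lambda>n. nrm (s n - g)) \<longlonglongrightarrow> 0"
    using complete[of s] s TX by blast
  have sX: "s n \<in> X" for n using s TX by blast
  have rep: "ip x g = l x" if x: "x \<in> T" for x
  proof -
    define q where "q = ip x g - l x"
    \<comment> \<open>First variation: \<open>s n\<close> is optimal up to 1/(n+1), so moving it by
      any complex multiple of x lowers J by no more than that. In the limit a quadratic expression
      in t stays nonnegative, which forces its linear coefficient q to vanish.\<close>
    have main: "0 \<le> 2 * Re (t * q) + (cmod t)\<^sup>2 * (nrm x)\<^sup>2" for t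
    proof (rule LIMSEQ_le)
      have "(\<lambda>n. ip x (s n)) \<longlonglongrightarrow> ip x g" using tendsto_ip(2)[OF sX g TX[OF x] lim] .
      then show "(\<lambda>n. 2 * Re (t * (ip x (s n) - l x)) + (cmod t)\<^sup>2 * (nrm x)\<^sup>2) \<longlonglongrightarrow> 2 * Re (t * q) + (cmod t)\<^sup>2 * (nrm x)\<^sup>2"
        unfolding q_def by (intro tendsto_intros)
      show "(\<lambda>n. - (1 / real (Suc n))) \<longlonglongrightarrow> 0"
        using tendsto_minus[OF LIMSEQ_inverse_real_of_nat] by (simp add: inverse_eq_divide)
      have "- (1 / real (Suc n)) \<le> 2 * Re (t * (ip x (s n) - l x)) + (cmod t)\<^sup>2 * (nrm x)\<^sup>2" for n
      proof -
        have "J (s n + sc t x) = J (s n) + 2 * Re (ip (s n) (sc t x)) + (nrm (sc t x))\<^sup>2 - 2 * Re (t * l x)"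
          using sX x TX s Tsc by (simp add: J_def nrm_add_sq add scl)
        also have "Re (ip (s n) (sc t x)) = Re (t * ip x (s n))"
          using ip_cnj[OF scale_mem[OF TX[OF x]] sX, of n t] x TX sX by (simp add: ip_scale)
        finally show ?thesis using sJ[of n] dle[OF Tadd[OF s[of n] Tsc[OF x, of t]]] TX[OF x]
          by (simp add: nrm_scale power_mult_distrib algebra_simps)
      qed
      then show "\<exists>N. \<forall>n\<ge>N. - (1 / real (Suc n)) \<le> 2 * Re (t * (ip x (s n) - l x)) + (cmod t)\<^sup>2 * (nrm x)\<^sup>2" by blast
    qed
    have "(cmod q)\<^sup>2 \<le> 0 * (nrm x)\<^sup>2"
    proof (rule quadratic_bound)
      fix r :: real
      have "Re ((- of_real r * cnj q) * q) = - r * (cmod q)\<^sup>2"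
        by (simp add: cmod_power2) (simp add: power2_eq_square algebra_simps)
      then show "0 \<le> 0 - 2 * r * (cmod q)\<^sup>2 + r\<^sup>2 * (cmod q)\<^sup>2 * (nrm x)\<^sup>2"
        using main[of "- of_real r * cnj q"] by (simp add: norm_mult power_mult_distrib)
    qed auto
    then show ?thesis by (simp add: q_def)
  qed
  have "nrm g \<le> M"
  proof (rule ccontr)
    assume c: "\<not> nrm g \<le> M"
    have l1: "(\<lambda>n. ip (s n) g) \<longlonglongrightarrow> ip g g" using tendsto_ip(1)[OF sX g g lim] .
    have l2: "(\<lambda>n. M * nrm (s n)) \<longlonglongrightarrow> M * nrm g" using tendsto_nrm[OF sX g lim] by (intro tendsto_intros)
    have "cmod (ip g g) \<le> M * nrm g"
      by (rule LIMSEQ_le[OF tendsto_norm[OF l1] l2]) (use rep s M(2) in auto)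
    then have "nrm g * nrm g \<le> M * nrm g" using ip_self[OF g] by (simp add: power2_eq_square norm_mult)
    then show False using c M(1) by (simp add: mult_le_cancel_right)
  qed
  then show ?thesis using that[OF g s lim rep] by blast
qed

lemma projection:
  assumes T: "subspace T" "T \<subseteq> X" and y: "y \<in> X"
  obtains g s where "g \<in> X" "\<And>n. s n \<in> T" "(\<lambda>n. nrm (s n - g)) \<longlonglongrightarrow> 0" "\<And>x. x \<in> T \<Longrightarrow> ip x (y - g) = 0"
proof -
  have TX: "x \<in> T \<Longrightarrow> x \<in> X" for x using T by blast
  obtain g s where *: "g \<in> X" "\<And>n. s n \<in> T" "(\<lambda>n. nrm (s n - g)) \<longlonglongrightarrow> 0" "\<And>x. x \<in> T \<Longrightarrow> ip x g = ip x y"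
    by (rule riesz[OF T, of "\<lambda>x. ip x y" "nrm y"])
      (use TX y cauchy_schwarz in \<open>auto simp: ip_add ip_scale mult.commute\<close>)
  show ?thesis by (rule that[OF *(1-3)]) (use * y TX in \<open>auto simp: ip_diff2\<close>)
qed

text \<open>The residual of the projection onto the closure of T is orthogonal to T, hence null, so
  the approximants of the projection approximate y as well.\<close>

lemma dense_approx:
  assumes T: "subspace T" "T \<subseteq> X" and y: "y \<in> X"
    and dense: "\<And>e. \<lbrakk>e \<in> X; \<And>x. x \<in> T \<Longrightarrow> ip x e = 0\<rbrakk> \<Longrightarrow> nrm e = 0"
  obtains s where "\<And>n. s n \<in> T" "(\<lambda>n. nrm (s n - y)) \<longlonglongrightarrow> 0"
proof -
  obtain g s where *: "g \<in> X" "\<And>n. s n \<in> T" "(\<lambda>n. nrm (s n - g)) \<longlonglongrightarrow> 0" "\<And>x. x \<in> T \<Longrightarrow> ip x (y - g) = 0"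
    using projection[OF T y] by blast
  have "nrm (y - g) = 0" using dense * y by blast
  then have "nrm (s n - y) = nrm (s n - g)" for n
    using nrm_eqI[of "s n - g" "s n - y"] * y T(2) by (auto simp: subset_iff)
  then have "(\<lambda>n. nrm (s n - y)) \<longlonglongrightarrow> 0" using *(3) by simp
  with *(2) show ?thesis using that by blast
qed

text \<open>Riesz turns \<open>B x\<close> into a vector \<open>A x\<close>, and the iteration x -
  \<rho> (A x - h) contracts the residual. The residual is followed through B, because A comes from
  a choice and is linear only modulo null vectors.\<close>

lemma lax_milgram:
  assumes B_add: "\<And>x y z. \<lbrakk>x \<in> X; y \<in> X; z \<in> X\<rbrakk> \<Longrightarrow> B (x + y) z = B x z + B y z"
    and B_scale: "\<And>x y c. \<lbrakk>x \<in> X; y \<in> X\<rbrakk> \<Longrightarrow> B (sc c x) y = c * B x y"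
    and B_add2: "\<And>x y z. \<lbrakk>x \<in> X; y \<in> X; z \<in> X\<rbrakk> \<Longrightarrow> B z (x + y) = B z x + B z y"
    and B_scale2: "\<And>x y c. \<lbrakk>x \<in> X; y \<in> X\<rbrakk> \<Longrightarrow> B x (sc c y) = cnj c * B x y"
    and bound: "\<And>x y. \<lbrakk>x \<in> X; y \<in> X\<rbrakk> \<Longrightarrow> cmod (B x y) \<le> C * nrm x * nrm y"
    and coerc: "\<And>x. x \<in> X \<Longrightarrow> \<alpha> * (nrm x)\<^sup>2 \<le> Re (B x x)"
    and \<alpha>: "0 < \<alpha>" "\<alpha> \<le> C" and h: "h \<in> X"
  shows "\<exists>x\<in>X. \<forall>v\<in>X. B x v = ip h v"
proof -
  have "\<exists>y\<in>X. (\<forall>v\<in>X. ip y v = B x v) \<and> nrm y \<le> C * nrm x" if x: "x \<in> X" for x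
  proof -
    obtain g where g: "g \<in> X" "\<And>v. v \<in> X \<Longrightarrow> ip v g = cnj (B x v)" "nrm g \<le> C * nrm x"
      by (rule riesz[OF sub order_refl, of "\<lambda>v. cnj (B x v)" "C * nrm x"])
        (use x \<alpha> bound in \<open>auto simp: B_add2 B_scale2\<close>)
    then have "ip g v = B x v" if "v \<in> X" for v using ip_cnj[OF that g(1)] that by simp
    then show ?thesis using g by blast
  qed
  then obtain A where A: "\<And>x. x \<in> X \<Longrightarrow> A x \<in> X" and Aip: "\<And>x v. \<lbrakk>x \<in> X; v \<in> X\<rbrakk> \<Longrightarrow> ip (A x) v = B x v"
      and An: "\<And>x. x \<in> X \<Longrightarrow> nrm (A x) \<le> C * nrm x" by metis
  \<comment> \<open>The minimiser of 1 - 2 \<rho> \<alpha> + \<rho>^2 C^2, the factor by which the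
    squared residual shrinks; the minimum is 1 - \<alpha>^2 / C^2.\<close>
  define \<rho> where "\<rho> = \<alpha> / C\<^sup>2"
  have C: "C > 0" using \<alpha> by simp
  have \<rho>: "\<rho> > 0" using \<alpha> C by (simp add: \<rho>_def)
  define \<kappa> where "\<kappa> = sqrt (1 - \<alpha>\<^sup>2 / C\<^sup>2)"
  have \<alpha>C: "\<alpha>\<^sup>2 / C\<^sup>2 \<le> 1" "\<alpha>\<^sup>2 / C\<^sup>2 > 0" using \<alpha> C by (auto simp: power_mono)
  then have \<kappa>: "0 \<le> \<kappa>" "\<kappa> < 1" "\<kappa>\<^sup>2 = 1 - \<alpha>\<^sup>2 / C\<^sup>2" by (auto simp: \<kappa>_def real_sqrt_lt_1_iff)
  define x where "x = rec_nat 0 (\<lambda>_ y. y - sc (of_real \<rho>) (A y - h))"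
  have xS: "x (Suc n) = x n - sc (of_real \<rho>) (A (x n) - h)" for n by (simp add: x_def)
  have xX: "x n \<in> X" for n by (induction n) (use A h in \<open>auto simp: x_def\<close>)
  define r where "r n = A (x n) - h" for n
  have rX: "r n \<in> X" for n using xX A h by (auto simp: r_def)
  have rS: "nrm (r (Suc n)) \<le> \<kappa> * nrm (r n)" for n
  proof -
    let ?z = "r n - sc (of_real \<rho>) (A (r n))"
    have z: "?z \<in> X" using rX A by auto
    have Bd: "B (x n - sc c (r n)) v = B (x n) v - c * B (r n) v" if "v \<in> X" for c v
      using B_add[of "x n - sc c (r n)" "sc c (r n)" v] that xX rX by (simp add: B_scale)
    \<comment> \<open>The expected recursion for the residual holds only up to a null vector, which
      is detected by pairing with every v.\<close>
    have "ip (r (Suc n) - ?z) v = 0" if v: "v \<in> X" for v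
    proof -
      have "ip (r (Suc n)) v = B (x n - sc (of_real \<rho>) (r n)) v - ip h v"
        using xX A h v by (simp add: r_def ip_diff Aip flip: xS)
      moreover have "ip ?z v = B (x n) v - ip h v - of_real \<rho> * B (r n) v"
        using xX A h v rX by (simp add: ip_diff ip_scale Aip) (simp add: r_def ip_diff Aip A xX h v)
      ultimately show ?thesis using v rX z Bd by (simp add: ip_diff)
    qed
    then have "nrm (r (Suc n) - ?z) = 0" using rX z by (simp add: nrm_def)
    then have eq: "nrm (r (Suc n)) = nrm ?z" using nrm_eqI rX z by blast
    have "(nrm ?z)\<^sup>2 = (nrm (r n))\<^sup>2 - 2 * \<rho> * Re (ip (r n) (A (r n))) + \<rho>\<^sup>2 * (nrm (A (r n)))\<^sup>2"
      using rX A by (simp add: nrm_diff_sq ip_scale2 nrm_scale power_mult_distrib)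
    also have "Re (ip (r n) (A (r n))) = Re (B (r n) (r n))"
      using ip_cnj[OF A[OF rX] rX, of n n] rX by (simp add: Aip)
    also have "(nrm (r n))\<^sup>2 - 2 * \<rho> * Re (B (r n) (r n)) + \<rho>\<^sup>2 * (nrm (A (r n)))\<^sup>2
        \<le> (nrm (r n))\<^sup>2 - 2 * \<rho> * (\<alpha> * (nrm (r n))\<^sup>2) + \<rho>\<^sup>2 * (C * nrm (r n))\<^sup>2"
      using coerc[OF rX] An[OF rX] \<rho> rX A
      by (intro add_mono diff_mono mult_left_mono power_mono) auto
    also have "\<dots> = \<kappa>\<^sup>2 * (nrm (r n))\<^sup>2"
      using C unfolding \<kappa>(3) \<rho>_def by (simp add: field_simps power2_eq_square)
    finally have "(nrm ?z)\<^sup>2 \<le> (\<kappa> * nrm (r n))\<^sup>2" by (simp add: power_mult_distrib)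
    then show ?thesis unfolding eq using \<kappa> rX z by (simp add: abs_le_square_iff[symmetric])
  qed
  have rn: "nrm (r n) \<le> \<kappa> ^ n * nrm (r 0)" for n
  proof (induction n)
    case (Suc n)
    have "nrm (r (Suc n)) \<le> \<kappa> * (\<kappa> ^ n * nrm (r 0))"
      using rS[of n] Suc \<kappa>(1) by (meson mult_left_mono order_trans)
    then show ?case by (simp add: mult.assoc)
  qed simp
  have step: "nrm (x (Suc n) - x n) \<le> (\<rho> * nrm (r 0)) * \<kappa> ^ n" for n
  proof -
    have "nrm (x (Suc n) - x n) = nrm (x n - x (Suc n))" using nrm_minus xX by blast
    also have "\<dots> = \<rho> * nrm (r n)" using \<rho> rX by (simp add: xS nrm_scale flip: r_def)
    finally show ?thesis using rn[of n] \<rho> by (simp add: mult_ac)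
  qed
  have K: "0 \<le> \<rho> * nrm (r 0)" using \<rho> rX by simp
  obtain z where z: "z \<in> X" "(\<lambda>n. nrm (x n - z)) \<longlonglongrightarrow> 0"
    using geometric_limit[OF xX step K \<kappa>(1,2)] by metis
  have "B z v = ip h v" if v: "v \<in> X" for v
  proof -
    have Bd: "B (x n - z) v = B (x n) v - B z v" for n
      using B_add[of "x n - z" z v] xX z v by simp
    have "(\<lambda>n. B (x n - z) v) \<longlonglongrightarrow> 0"
    proof (rule Lim_null_comparison)
      show "\<forall>\<^sub>F n in sequentially. norm (B (x n - z) v) \<le> C * nrm (x n - z) * nrm v"
        using bound[OF _ v] xX z by auto
      show "(\<lambda>n. C * nrm (x n - z) * nrm v) \<longlonglongrightarrow> 0"
        using tendsto_mult_left_zero[OF tendsto_mult_right_zero[OF z(2)]] .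
    qed
    then have l1: "(\<lambda>n. B (x n) v) \<longlonglongrightarrow> B z v" by (simp add: Bd LIM_zero_iff)
    have "(\<lambda>n. ip (r n) v) \<longlonglongrightarrow> 0"
    proof (rule Lim_null_comparison)
      show "\<forall>\<^sub>F n in sequentially. norm (ip (r n) v) \<le> \<kappa> ^ n * nrm (r 0) * nrm v"
        using cauchy_schwarz[OF rX v] rn v by (intro always_eventually allI) (meson mult_right_mono nrm_ge0 order_trans)
      show "(\<lambda>n. \<kappa> ^ n * nrm (r 0) * nrm v) \<longlonglongrightarrow> 0"
        using LIMSEQ_realpow_zero[OF \<kappa>(1,2)] by (intro tendsto_mult_left_zero)
    qed
    then have "(\<lambda>n. B (x n) v) \<longlonglongrightarrow> ip h v"
      using xX v A h by (simp add: r_def ip_diff Aip LIM_zero_iff)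
    then show ?thesis using l1 LIMSEQ_unique by blast
  qed
  then show ?thesis using z by blast
qed

text \<open>An open mapping argument that replaces Baire's theorem by a gliding hump, after Sokal:
  of the two points \<open>x \<plusminus> r f\<close> at least one is as badly approximable as \<open>r f\<close>.\<close>

lemma bounded_preimages:
  assumes R: "R \<subseteq> X" "subspace R"
    and closed: "\<And>s x. \<lbrakk>\<And>n. s n \<in> R; x \<in> X; (\<lambda>n. nrm (s n - x)) \<longlonglongrightarrow> 0\<rbrakk> \<Longrightarrow> x \<in> R"
    and PX: "\<And>g y. P g y \<Longrightarrow> g \<in> X \<and> y \<in> X"
    and Pdiff: "\<And>g y g' y'. \<lbrakk>P g y; P g' y'\<rbrakk> \<Longrightarrow> P (g - g') (y - y')"
    and Psc: "\<And>g y c. P g y \<Longrightarrow> P (sc c g) (sc c y)"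
    and Pex: "\<And>y. y \<in> R \<Longrightarrow> \<exists>g. P g y"
  shows "\<exists>k>0. \<forall>f\<in>R. nrm f = 1 \<longrightarrow> (\<exists>g y. P g y \<and> nrm g \<le> k \<and> nrm (y - f) \<le> 1/2)"
proof (rule ccontr)
  assume "\<not> ?thesis"
  then have bad: "\<And>k. k > 0 \<Longrightarrow> \<exists>f\<in>R. nrm f = 1 \<and> (\<forall>g y. P g y \<longrightarrow> nrm g \<le> k \<longrightarrow> nrm (y - f) > 1/2)"
    by (meson not_le)
  have RX: "x \<in> R \<Longrightarrow> x \<in> X" for x using R by blast
  have step: "\<exists>x'\<in>R. nrm (x' - x) \<le> r \<and> (\<forall>g y. P g y \<longrightarrow> nrm g \<le> k \<longrightarrow> nrm (y - x') > r/2)"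
    if x: "x \<in> R" and r: "r > 0" and k: "k > 0" for x r k
  proof -
    obtain f where f: "f \<in> R" "nrm f = 1" and fb: "\<And>g y. \<lbrakk>P g y; nrm g \<le> k / r\<rbrakk> \<Longrightarrow> nrm (y - f) > 1/2"
      using bad[of "k/r"] r k by auto
    let ?rf = "sc (of_real r) f"
    have rf: "?rf \<in> R" using f R subspace_scale by blast
    have mem: "x + ?rf \<in> R" "x - ?rf \<in> R" using x rf R subspace_add subspace_diff by blast+
    have n: "nrm (x + ?rf - x) \<le> r" "nrm (x - ?rf - x) \<le> r"
      using nrm_minus[of x "x - ?rf"] f r x mem RX by (auto simp: nrm_scale)
    show ?thesis
    proof (rule ccontr)
      assume "\<not> ?thesis"
      then obtain g1 y1 g2 y2 where 1: "P g1 y1" "nrm g1 \<le> k" "nrm (y1 - (x + ?rf)) \<le> r/2"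
        and 2: "P g2 y2" "nrm g2 \<le> k" "nrm (y2 - (x - ?rf)) \<le> r/2"
        using mem n by (metis linorder_not_less)
      \<comment> \<open>If both \<open>x + r f\<close> and \<open>x - r f\<close> had good
        preimages, half their difference divided by r would serve f: the errors combine to at most
        1/2 and the norm to at most k/r, against the choice of f.\<close>
      let ?c = "of_real (1 / (2*r)) :: complex"
      have X: "g1 \<in> X" "y1 \<in> X" "g2 \<in> X" "y2 \<in> X" using 1 2 PX by auto
      have P: "P (sc ?c (g1 - g2)) (sc ?c (y1 - y2))" using 1 2 Pdiff Psc by blast
      have cn: "cmod ?c = 1 / (2*r)" using r by (simp only: norm_of_real) simp
      have "nrm (sc ?c (g1 - g2)) = 1/(2*r) * nrm (g1 - g2)" using X by (simp only: nrm_scale diff_mem cn)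
      also have "\<dots> \<le> 1/(2*r) * (2 * k)"
        using nrm_diff_le[OF X(1,3)] 1 2 r by (intro mult_left_mono) auto
      finally have gk: "nrm (sc ?c (g1 - g2)) \<le> k / r" using r by simp
      let ?e1 = "y1 - (x + ?rf)" and ?e2 = "y2 - (x - ?rf)"
      have eX: "?e1 \<in> X" "?e2 \<in> X" using X mem RX by auto
      have "?e1 - ?e2 = (y1 - y2) - sc (2 * of_real r) f"
        by (simp add: algebra_simps flip: scale_left_distrib mult_2)
      moreover have "sc ?c (sc (2 * of_real r) f) = f" using r by simp
      ultimately have "sc ?c (?e1 - ?e2) = sc ?c (y1 - y2) - f"
        by (simp only: scale_right_diff_distrib)
      moreover have "nrm (sc ?c (?e1 - ?e2)) \<le> 1/(2*r) * r"
        using nrm_diff_le[OF eX] 1 2 r eX by (simp only: nrm_scale diff_mem cn) (intro mult_left_mono, auto)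
      ultimately show False using fb[OF P gk] r by simp
    qed
  qed
  \<comment> \<open>The ratio 1/3 is balanced: all moves after stage n add up to at most (1/3)^(n+1)
    / (1 - 1/3) = (1/3)^n / 2. This is exactly the distance kept from images of vectors of norm at
    most n, and the latter inequality is strict. Stage 0 imposes nothing because \<open>step\<close>
    needs a positive bound.\<close>
  define Q where "Q n x = (x \<in> R \<and> (\<forall>g y. P g y \<longrightarrow> nrm g \<le> real n \<longrightarrow> n > 0 \<longrightarrow> nrm (y - x) > (1/3)^n / 2))" for n x
  obtain x where x: "\<And>n. Q n (x n)" and xs: "\<And>n. nrm (x (Suc n) - x n) \<le> (1/3) ^ Suc n"
  proof (rule dependent_nat_choice[of Q "\<lambda>n a b. nrm (b - a) \<le> (1/3) ^ Suc n", THEN exE])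
    show "\<exists>x. Q 0 x" using R subspace_0 by (auto simp: Q_def)
    show "\<exists>y. Q (Suc n) y \<and> nrm (y - x) \<le> (1/3) ^ Suc n" if q: "Q n x" for x n
    proof -
      have "x \<in> R" using q by (simp add: Q_def)
      from step[OF this, of "(1/3) ^ Suc n" "real (Suc n)"]
      obtain x' where "x' \<in> R" "nrm (x' - x) \<le> (1/3) ^ Suc n"
          "\<forall>g y. P g y \<longrightarrow> nrm g \<le> real (Suc n) \<longrightarrow> nrm (y - x') > (1/3) ^ Suc n/2" by auto
      then show ?thesis by (auto simp: Q_def simp del: power_Suc)
    qed
  qed blast
  have xR: "x n \<in> R" for n using x by (simp add: Q_def)
  obtain z where z: "z \<in> X" "(\<lambda>n. nrm (x n - z)) \<longlonglongrightarrow> 0" and zt: "\<And>n. nrm (x n - z) \<le> (1/3) * (1/3)^n / (1 - 1/3)"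
    by (rule geometric_limit[of x "1/3" "1/3"]) (use xR RX xs in auto)
  then have "z \<in> R" using closed xR by blast
  then obtain g where g: "P g z" using Pex by blast
  obtain n :: nat where n: "nrm g \<le> real n" "n > 0"
    using real_arch_simple[of "max 1 (nrm g)"] by (metis max.bounded_iff not_gr_zero of_nat_0 not_one_le_zero)
  then have "nrm (z - x n) > (1/3)^n / 2" using x[of n] g by (simp add: Q_def)
  then show False using zt[of n] nrm_minus[OF z(1) RX[OF xR], of n] by simp
qed

end

section \<open>Sesquilinear forms and supporting half-planes\<close>

locale sesq = vector_space sc for sc :: "complex \<Rightarrow> 'v::ab_group_add \<Rightarrow> 'v" +
  fixes D :: "'v set" and a :: "'v \<Rightarrow> 'v \<Rightarrow> complex"
  assumes D_sub: "subspace D"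
    and a_add: "\<lbrakk>x \<in> D; y \<in> D; z \<in> D\<rbrakk> \<Longrightarrow> a (x + y) z = a x z + a y z"
    and a_scale: "\<lbrakk>x \<in> D; y \<in> D\<rbrakk> \<Longrightarrow> a (sc c x) y = c * a x y"
    and a_add2: "\<lbrakk>x \<in> D; y \<in> D; z \<in> D\<rbrakk> \<Longrightarrow> a z (x + y) = a z x + a z y"
    and a_scale2: "\<lbrakk>x \<in> D; y \<in> D\<rbrakk> \<Longrightarrow> a x (sc c y) = cnj c * a x y"
begin

lemma D_add [simp, intro]: "\<lbrakk>x \<in> D; y \<in> D\<rbrakk> \<Longrightarrow> x + y \<in> D"
  using D_sub by (rule subspace_add)
lemma D_diff [simp, intro]: "\<lbrakk>x \<in> D; y \<in> D\<rbrakk> \<Longrightarrow> x - y \<in> D"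
  using D_sub by (rule subspace_diff)
lemma D_scale [simp, intro]: "x \<in> D \<Longrightarrow> sc c x \<in> D"
  using D_sub by (rule subspace_scale)
lemma D_zero [simp, intro]: "0 \<in> D"
  using D_sub by (rule subspace_0)
lemma a_diff: "\<lbrakk>x \<in> D; y \<in> D; z \<in> D\<rbrakk> \<Longrightarrow> a (x - y) z = a x z - a y z"
  using a_add[of "x - y" y z] by simp
lemma a_diff2: "\<lbrakk>x \<in> D; y \<in> D; z \<in> D\<rbrakk> \<Longrightarrow> a z (x - y) = a z x - a z y"
  using a_add2[of "x - y" y z] by simp
lemma a_zero [simp]: "x \<in> D \<Longrightarrow> a 0 x = 0" "x \<in> D \<Longrightarrow> a x 0 = 0"
  using a_diff[of x x x] a_diff2[of x x x] by simp_all
lemma a_self_scale: "x \<in> D \<Longrightarrow> a (sc c x) (sc c x) = of_real ((cmod c)\<^sup>2) * a x x"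
  unfolding complex_norm_square by (simp add: a_scale a_scale2 mult_ac)

text \<open>The Hermitian part of \<open>cnj u\<close> times the form. For a unit normal u its
  diagonal is the height of \<open>a x x\<close> above the line through 0 orthogonal to u, so a
  supporting half-plane amounts to positivity of this form.\<close>

definition herm :: "complex \<Rightarrow> 'v \<Rightarrow> 'v \<Rightarrow> complex" where
  "herm u x y = (cnj u * a x y + u * cnj (a y x)) / 2"

lemma herm_self: "Re (herm u x x) = Re (cnj u * a x x)"
  by (simp add: herm_def)

lemma semi_ip_herm:
  assumes "\<And>x. x \<in> D \<Longrightarrow> 0 \<le> Re (cnj u * a x x)"
  shows "semi_ip sc D (herm u)"
proof
  show "subspace D" by (rule D_sub)
qed (use assms in \<open>simp_all add: herm_self, simp_all add: herm_def a_add a_add2 a_scale a_scale2 algebra_simps add_divide_distrib\<close>)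

text \<open>Two transversal supporting half-planes determine \<open>a\<close> through two positive forms.\<close>

lemma two_supports:
  assumes u1: "\<And>x. x \<in> D \<Longrightarrow> 0 \<le> Re (cnj u1 * a x x)" and u2: "\<And>x. x \<in> D \<Longrightarrow> 0 \<le> Re (cnj u2 * a x x)"
    and ne: "Im (cnj u1 * u2) \<noteq> 0"
  shows "\<exists>C\<ge>0. \<forall>x\<in>D. \<forall>y\<in>D. cmod (a x y) \<le> C * sqrt (cmod (a x x)) * sqrt (cmod (a y y))"
proof -
  have cs: "cmod (herm u x y) \<le> cmod u * (sqrt (cmod (a x x)) * sqrt (cmod (a y y)))"
    if u: "\<And>x. x \<in> D \<Longrightarrow> 0 \<le> Re (cnj u * a x x)" and xy: "x \<in> D" "y \<in> D" for u x y
  proof -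
    interpret b: semi_ip sc D "herm u" by (rule semi_ip_herm) (rule u)
    have "b.nrm z \<le> sqrt (cmod u) * sqrt (cmod (a z z))" for z
      unfolding b.nrm_def herm_self real_sqrt_mult[symmetric]
      using complex_Re_le_cmod[of "cnj u * a z z"] by (simp add: norm_mult)
    then have "b.nrm x * b.nrm y \<le> (sqrt (cmod u) * sqrt (cmod (a x x))) * (sqrt (cmod u) * sqrt (cmod (a y y)))"
      using xy by (intro mult_mono) auto
    also have "\<dots> = (sqrt (cmod u) * sqrt (cmod u)) * (sqrt (cmod (a x x)) * sqrt (cmod (a y y)))"
      by (simp only: mult_ac)
    finally show ?thesis using b.cauchy_schwarz[OF xy] by simp
  qed
  define d where "d = cmod (cnj u1 * u2 - cnj u2 * u1)"
  have "Im (cnj u1 * u2 - cnj u2 * u1) = 2 * Im (cnj u1 * u2)" by simp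
  then have "cnj u1 * u2 - cnj u2 * u1 \<noteq> 0" using ne by (metis mult_eq_0_iff zero_complex.sel(2) zero_neq_numeral)
  then have d: "d > 0" by (simp add: d_def)
  have "cmod (a x y) \<le> (4 * cmod u1 * cmod u2 / d) * sqrt (cmod (a x x)) * sqrt (cmod (a y y))" if xy: "x \<in> D" "y \<in> D" for x y
  proof -
    let ?m = "sqrt (cmod (a x x)) * sqrt (cmod (a y y))"
    \<comment> \<open>The conjugated values \<open>cnj (a y x)\<close> are eliminated from the two
      Hermitian parts. The determinant is 2i Im (cnj u1 u2), nonzero because the normals are not
      parallel.\<close>
    have "a x y * (cnj u1 * u2 - cnj u2 * u1) = 2 * (u2 * herm u1 x y - u1 * herm u2 x y)"
      by (simp add: herm_def algebra_simps)
    then have "cmod (a x y) * d = 2 * cmod (u2 * herm u1 x y - u1 * herm u2 x y)"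
      by (metis d_def norm_mult norm_numeral)
    also have "\<dots> \<le> 2 * (cmod u2 * cmod (herm u1 x y) + cmod u1 * cmod (herm u2 x y))"
      using norm_triangle_ineq4[of "u2 * herm u1 x y" "u1 * herm u2 x y"] by (simp add: norm_mult)
    also have "\<dots> \<le> 2 * (cmod u2 * (cmod u1 * ?m) + cmod u1 * (cmod u2 * ?m))"
      using cs[OF u1 xy] cs[OF u2 xy] by (intro mult_left_mono add_mono) auto
    finally show ?thesis using d by (simp add: field_simps)
  qed
  moreover have "0 \<le> 4 * cmod u1 * cmod u2 / d" using d by simp
  ultimately show ?thesis by blast
qed

end

section \<open>Closed sectorial forms\<close>

text \<open>\<open>\<kappa>\<close> is the tangent of the semivertical angle of the sector and
  \<open>\<gamma>\<close> its vertex. \<open>null_D\<close> makes the form compatible with equality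
  up to null vectors; density of D is stated as triviality of its orthogonal complement.\<close>

locale closed_sectorial = semi_hilbert sc X ip + sesq sc D a
  for sc :: "complex \<Rightarrow> 'v::ab_group_add \<Rightarrow> 'v" and X ip D a +
  fixes \<kappa> \<gamma> :: real
  assumes DX: "D \<subseteq> X"
    and null_D: "\<lbrakk>x \<in> X; nrm x = 0\<rbrakk> \<Longrightarrow> x \<in> D \<and> a x x = 0"
    and \<kappa>: "\<kappa> > 0"
    and sect: "x \<in> D \<Longrightarrow> \<bar>Im (a x x)\<bar> \<le> \<kappa> * (Re (a x x) - \<gamma> * (nrm x)\<^sup>2)"
    and closed_a: "\<lbrakk>\<And>n. s n \<in> D; x \<in> X; (\<lambda>n. nrm (s n - x)) \<longlonglongrightarrow> 0;
        \<And>e. e > 0 \<Longrightarrow> \<exists>N. \<forall>n\<ge>N. \<forall>m\<ge>N. cmod (a (s n - s m) (s n - s m)) < e\<rbrakk>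
      \<Longrightarrow> x \<in> D \<and> (\<lambda>n. a (s n - x) (s n - x)) \<longlonglongrightarrow> 0"
    and dense_D: "\<lbrakk>y \<in> X; \<And>v. v \<in> D \<Longrightarrow> ip v y = 0\<rbrakk> \<Longrightarrow> nrm y = 0"
begin

lemma D_X [simp, intro]: "x \<in> D \<Longrightarrow> x \<in> X" using DX by blast

text \<open>The shift puts the vertex of the sector at 1, so that the real part dominates the
  squared norm.\<close>

definition ac :: "'v \<Rightarrow> 'v \<Rightarrow> complex" where "ac x y = a x y + of_real (1 - \<gamma>) * ip x y"

sublocale ac: sesq sc D ac
proof
  show "subspace D" by (rule D_sub)
qed (simp_all add: ac_def a_add a_add2 a_scale a_scale2 ip_add ip_add2 ip_scale ip_scale2 algebra_simps)

lemma Re_ac: "x \<in> D \<Longrightarrow> Re (ac x x) = Re (a x x) + (1 - \<gamma>) * (nrm x)\<^sup>2"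
  by (simp add: ac_def ip_self)

lemma Im_ac: "x \<in> D \<Longrightarrow> Im (ac x x) = Im (a x x)"
  by (simp add: ac_def ip_self)

lemma Re_a_ge: "x \<in> D \<Longrightarrow> \<gamma> * (nrm x)\<^sup>2 \<le> Re (a x x)"
  using sect[of x] \<kappa> by (smt (verit) zero_le_mult_iff)

abbreviation "sip \<equiv> ac.herm 1"

lemma S_semi: "semi_ip sc D sip"
proof (rule ac.semi_ip_herm)
  fix x assume x: "x \<in> D"
  have "0 \<le> (nrm x)\<^sup>2 + (Re (a x x) - \<gamma> * (nrm x)\<^sup>2)"
    using Re_a_ge[OF x] by (intro add_nonneg_nonneg) auto
  also have "\<dots> = Re (cnj 1 * ac x x)" by (simp add: Re_ac x left_diff_distrib)
  finally show "0 \<le> Re (cnj 1 * ac x x)" .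
qed

sublocale S: semi_ip sc D sip by (rule S_semi)

lemma S_sq: "x \<in> D \<Longrightarrow> (S.nrm x)\<^sup>2 = Re (a x x) + (1 - \<gamma>) * (nrm x)\<^sup>2"
  by (simp add: S.nrm_sq ac.herm_self Re_ac)

lemma nrm_le_S: "x \<in> D \<Longrightarrow> nrm x \<le> S.nrm x"
proof -
  assume x: "x \<in> D"
  have "(nrm x)\<^sup>2 \<le> (S.nrm x)\<^sup>2" using S_sq[OF x] Re_a_ge[OF x] by (simp add: algebra_simps)
  then show ?thesis using x by (simp add: abs_le_square_iff[symmetric])
qed

text \<open>The sector lies in the half-planes with normals 1 and \<kappa> + i, so
  \<open>two_supports\<close> applies. One is added to the constant so that C is at least the
  coercivity constant 1, as \<open>lax_milgram\<close> demands.\<close>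

lemma ac_bounded: "\<exists>C\<ge>1. \<forall>x\<in>D. \<forall>y\<in>D. cmod (ac x y) \<le> C * S.nrm x * S.nrm y"
proof -
  have 1: "0 \<le> Re (cnj 1 * ac x x)" if "x \<in> D" for x
    using S.ip_nonneg[OF that] by (simp add: ac.herm_self)
  have 2: "0 \<le> Re (cnj (Complex \<kappa> 1) * ac x x)" if x: "x \<in> D" for x
  proof -
    have "0 \<le> \<kappa> * (nrm x)\<^sup>2" using \<kappa> by simp
    then show ?thesis using sect[OF x] by (simp add: Re_ac Im_ac x algebra_simps)
  qed
  obtain C where C: "C \<ge> 0" "\<And>x y. \<lbrakk>x \<in> D; y \<in> D\<rbrakk> \<Longrightarrow> cmod (ac x y) \<le> C * sqrt (cmod (ac x x)) * sqrt (cmod (ac y y))"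
    using ac.two_supports[OF 1 2] by auto
  have s: "sqrt (cmod (ac x x)) \<le> sqrt (1 + \<kappa>) * S.nrm x" if x: "x \<in> D" for x
  proof -
    have "cmod (ac x x) \<le> \<bar>Re (ac x x)\<bar> + \<bar>Im (ac x x)\<bar>" by (rule cmod_le)
    also have "\<dots> \<le> (S.nrm x)\<^sup>2 + \<kappa> * (S.nrm x)\<^sup>2"
    proof (rule add_mono)
      show "\<bar>Re (ac x x)\<bar> \<le> (S.nrm x)\<^sup>2" using 1[OF x] by (simp add: S.nrm_sq ac.herm_self x)
      have "\<bar>Im (ac x x)\<bar> \<le> \<kappa> * (Re (a x x) - \<gamma> * (nrm x)\<^sup>2)" using sect[OF x] by (simp add: Im_ac x)
      also have "\<dots> \<le> \<kappa> * (S.nrm x)\<^sup>2" using \<kappa> by (simp add: S_sq x algebra_simps)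
      finally show "\<bar>Im (ac x x)\<bar> \<le> \<kappa> * (S.nrm x)\<^sup>2" .
    qed
    finally have "cmod (ac x x) \<le> (1 + \<kappa>) * (S.nrm x)\<^sup>2" by (simp add: algebra_simps)
    then have "sqrt (cmod (ac x x)) \<le> sqrt ((1 + \<kappa>) * (S.nrm x)\<^sup>2)" by simp
    then show ?thesis using x by (simp add: real_sqrt_mult)
  qed
  have "cmod (ac x y) \<le> (C * (1 + \<kappa>) + 1) * S.nrm x * S.nrm y" if xy: "x \<in> D" "y \<in> D" for x y
  proof -
    have "cmod (ac x y) \<le> C * (sqrt (cmod (ac x x)) * sqrt (cmod (ac y y)))" using C(2)[OF xy] by (simp add: mult.assoc)
    also have "\<dots> \<le> C * ((sqrt (1 + \<kappa>) * S.nrm x) * (sqrt (1 + \<kappa>) * S.nrm y))"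
      using C(1) xy s \<kappa> by (intro mult_left_mono mult_mono) auto
    also have "\<dots> = C * (sqrt (1 + \<kappa>) * sqrt (1 + \<kappa>)) * S.nrm x * S.nrm y" by (simp only: mult_ac)
    also have "\<dots> = C * (1 + \<kappa>) * S.nrm x * S.nrm y" using \<kappa> by simp
    also have "\<dots> \<le> (C * (1 + \<kappa>) + 1) * S.nrm x * S.nrm y"
      using xy by (intro mult_right_mono) auto
    finally show ?thesis .
  qed
  moreover have "1 \<le> C * (1 + \<kappa>) + 1" using C \<kappa> by simp
  ultimately show ?thesis by blast
qed

lemma a_le_S: "x \<in> D \<Longrightarrow> cmod (a x x) \<le> (1 + \<kappa> + \<bar>1 - \<gamma>\<bar>) * (S.nrm x)\<^sup>2"
proof -
  assume x: "x \<in> D"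
  have le: "(nrm x)\<^sup>2 \<le> (S.nrm x)\<^sup>2" using nrm_le_S x by (simp add: power_mono)
  have "cmod (a x x) \<le> \<bar>Re (a x x)\<bar> + \<bar>Im (a x x)\<bar>" by (rule cmod_le)
  moreover have "\<bar>Re (a x x)\<bar> \<le> (S.nrm x)\<^sup>2 + \<bar>1 - \<gamma>\<bar> * (nrm x)\<^sup>2"
  proof -
    have "Re (a x x) = (S.nrm x)\<^sup>2 - (1 - \<gamma>) * (nrm x)\<^sup>2" using S_sq[OF x] by simp
    then have "\<bar>Re (a x x)\<bar> \<le> \<bar>(S.nrm x)\<^sup>2\<bar> + \<bar>(1 - \<gamma>) * (nrm x)\<^sup>2\<bar>"
      by (metis abs_triangle_ineq4)
    then show ?thesis by (simp add: abs_mult)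
  qed
  moreover have "\<bar>1 - \<gamma>\<bar> * (nrm x)\<^sup>2 \<le> \<bar>1 - \<gamma>\<bar> * (S.nrm x)\<^sup>2" using le by (intro mult_left_mono) auto
  moreover have "\<bar>Im (a x x)\<bar> \<le> \<kappa> * (S.nrm x)\<^sup>2"
  proof -
    have "\<kappa> * (Re (a x x) - \<gamma> * (nrm x)\<^sup>2) \<le> \<kappa> * (S.nrm x)\<^sup>2"
      using S_sq[OF x] \<kappa> by (intro mult_left_mono) (auto simp: algebra_simps)
    then show ?thesis using sect[OF x] by linarith
  qed
  ultimately show ?thesis by (simp add: algebra_simps)
qed

text \<open>Closedness of the form is completeness of the form norm: a Cauchy sequence converges in
  the ambient space, and closedness puts the limit into D with convergence of the form.\<close>

lemma S_hilbert: "semi_hilbert sc D sip"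
proof
  fix s :: "nat \<Rightarrow> 'v"
  assume s: "\<And>n. s n \<in> D" and cau: "\<And>e. e > 0 \<Longrightarrow> \<exists>N. \<forall>n\<ge>N. \<forall>m\<ge>N. S.nrm (s n - s m) < e"
  have "\<exists>N. \<forall>n\<ge>N. \<forall>m\<ge>N. nrm (s n - s m) < e" if "e > 0" for e
    using cau[OF that] nrm_le_S s by (meson D_diff le_less_trans)
  then obtain x where x: "x \<in> X" and lim: "(\<lambda>n. nrm (s n - x)) \<longlonglongrightarrow> 0"
    using complete[of s] s by blast
  have "\<exists>N. \<forall>n\<ge>N. \<forall>m\<ge>N. cmod (a (s n - s m) (s n - s m)) < e" if e: "e > 0" for e
  proof -
    let ?K = "1 + \<kappa> + \<bar>1 - \<gamma>\<bar>"
    have K: "?K > 0" using \<kappa> by linarith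
    obtain N where N: "\<And>n m. \<lbrakk>n \<ge> N; m \<ge> N\<rbrakk> \<Longrightarrow> S.nrm (s n - s m) < sqrt (e / ?K)"
      using cau[of "sqrt (e / ?K)"] e K by fastforce
    have "cmod (a (s n - s m) (s n - s m)) < e" if "n \<ge> N" "m \<ge> N" for n m
    proof -
      have "(S.nrm (s n - s m))\<^sup>2 < (sqrt (e / ?K))\<^sup>2" using N[OF that] s by (intro power_strict_mono) auto
      then have "(S.nrm (s n - s m))\<^sup>2 < e / ?K" using e K by simp
      then have "?K * (S.nrm (s n - s m))\<^sup>2 < e" using K by (simp add: pos_less_divide_eq mult.commute)
      then show ?thesis using a_le_S[of "s n - s m"] s by fastforce
    qed
    then show ?thesis by blast
  qed
  then have xD: "x \<in> D" and la: "(\<lambda>n. a (s n - x) (s n - x)) \<longlonglongrightarrow> 0"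
    using closed_a[OF s x lim] by blast+
  have "(\<lambda>n. Re (a (s n - x) (s n - x)) + (1 - \<gamma>) * (nrm (s n - x))\<^sup>2) \<longlonglongrightarrow> Re 0 + (1 - \<gamma>) * 0\<^sup>2"
    by (intro tendsto_intros la lim)
  then have "(\<lambda>n. (S.nrm (s n - x))\<^sup>2) \<longlonglongrightarrow> 0" using s xD by (simp add: S_sq)
  then have "(\<lambda>n. sqrt ((S.nrm (s n - x))\<^sup>2)) \<longlonglongrightarrow> sqrt 0" by (rule tendsto_real_sqrt)
  then have "(\<lambda>n. S.nrm (s n - x)) \<longlonglongrightarrow> 0" using s xD by simp
  then show "\<exists>x\<in>D. (\<lambda>n. S.nrm (s n - x)) \<longlonglongrightarrow> 0" using xD by blast
qed

sublocale S: semi_hilbert sc D sip by (rule S_hilbert)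

lemma S_null: "\<lbrakk>x \<in> X; nrm x = 0\<rbrakk> \<Longrightarrow> S.nrm x = 0"
  using S_sq[of x] null_D[of x] by simp

lemma ac_null:
  assumes "x \<in> X" "nrm x = 0" "y \<in> D" shows "ac x y = 0" "ac y x = 0"
proof -
  obtain C where C: "\<forall>x\<in>D. \<forall>y\<in>D. cmod (ac x y) \<le> C * S.nrm x * S.nrm y" using ac_bounded by blast
  have "cmod (ac x y) \<le> 0" "cmod (ac y x) \<le> 0"
    using bspec[OF bspec[OF C, of x], of y] bspec[OF bspec[OF C, of y], of x] assms null_D S_null by force+
  then show "ac x y = 0" "ac y x = 0" by simp_all
qed

lemma a_null:
  assumes "x \<in> X" "nrm x = 0" "y \<in> D" shows "a x y = 0" "a y x = 0"
  using ac_null[OF assms] null_ip[of x y] assms by (auto simp: ac_def)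

section \<open>The associated operator as a relation, its resolvent and its domain as a core\<close>

definition rel :: "'v \<Rightarrow> 'v \<Rightarrow> bool" where
  "rel f u \<longleftrightarrow> f \<in> D \<and> u \<in> X \<and> (\<forall>v\<in>D. a f v = ip u v)"

definition Dom :: "'v set" where "Dom = {f. \<exists>u. rel f u}"

lemma rel_mem: "rel f u \<Longrightarrow> f \<in> D" "rel f u \<Longrightarrow> u \<in> X" by (auto simp: rel_def)
lemma rel_add: "\<lbrakk>rel f u; rel g w\<rbrakk> \<Longrightarrow> rel (f + g) (u + w)" by (auto simp: rel_def a_add ip_add)
lemma rel_diff: "\<lbrakk>rel f u; rel g w\<rbrakk> \<Longrightarrow> rel (f - g) (u - w)" by (auto simp: rel_def a_diff ip_diff)
lemma rel_scale: "rel f u \<Longrightarrow> rel (sc c f) (sc c u)" by (auto simp: rel_def a_scale ip_scale)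
lemma rel_zero: "rel 0 0" by (auto simp: rel_def)
lemma subspace_Dom: "subspace Dom"
  using rel_add rel_scale rel_zero by (auto simp: Dom_def subspace_def) blast+
lemma Dom_D: "Dom \<subseteq> D" by (auto simp: Dom_def rel_def)

text \<open>Surjectivity of H + (1 - \<gamma>): the functional of y is represented in the form inner
  product and then transported to \<open>ac\<close> by Lax-Milgram.\<close>

lemma solve:
  assumes y: "y \<in> X" shows "\<exists>f. rel f (y - sc (of_real (1 - \<gamma>)) f)"
proof -
  obtain C where C: "C \<ge> 1" "\<And>x y. \<lbrakk>x \<in> D; y \<in> D\<rbrakk> \<Longrightarrow> cmod (ac x y) \<le> C * S.nrm x * S.nrm y"
    using ac_bounded by blast
  obtain g where g: "g \<in> D" "\<And>v. v \<in> D \<Longrightarrow> sip v g = ip v y"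
  proof (rule S.riesz[OF D_sub order_refl, of "\<lambda>v. ip v y" "nrm y"])
    show "cmod (ip x y) \<le> nrm y * S.nrm x" if "x \<in> D" for x
      using cauchy_schwarz[of x y] nrm_le_S[OF that] that y mult_right_mono[of "nrm x" "S.nrm x" "nrm y"]
      by (simp add: mult.commute)
  qed (use y in \<open>auto simp: ip_add ip_scale\<close>)
  obtain f where f: "f \<in> D" "\<And>v. v \<in> D \<Longrightarrow> ac f v = sip g v"
    using S.lax_milgram[of ac C 1 g] g C
    by (auto simp: ac.a_add ac.a_add2 ac.a_scale ac.a_scale2 S.nrm_sq ac.herm_self)
  have "a f v = ip (y - sc (of_real (1 - \<gamma>)) f) v" if v: "v \<in> D" for v
  proof -
    have "ac f v = ip y v" using f(2)[OF v] S.ip_cnj[OF v g(1)] g(2)[OF v] ip_cnj[of v y] v y by simp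
    moreover have "ip (y - sc (of_real (1 - \<gamma>)) f) v = ip y v - of_real (1 - \<gamma>) * ip f v"
      using f v y by (simp only: ip_diff ip_scale scale_mem D_X)
    ultimately show ?thesis unfolding ac_def by (metis add_diff_cancel_right')
  qed
  then show ?thesis using f y by (auto simp: rel_def)
qed

text \<open>Lax-Milgram for the adjoint form, the conjugate of \<open>ac\<close> with exchanged
  slots.\<close>

lemma solve_dual:
  assumes l: "\<exists>g\<in>D. \<forall>v\<in>D. l v = sip v g"
  shows "\<exists>e\<in>D. \<forall>v\<in>D. ac v e = l v"
proof -
  obtain C where C: "C \<ge> 1" "\<And>x y. \<lbrakk>x \<in> D; y \<in> D\<rbrakk> \<Longrightarrow> cmod (ac x y) \<le> C * S.nrm x * S.nrm y"
    using ac_bounded by blast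
  obtain g where g: "g \<in> D" "\<And>v. v \<in> D \<Longrightarrow> l v = sip v g" using l by blast
  obtain f where f: "f \<in> D" "\<And>v. v \<in> D \<Longrightarrow> cnj (ac v f) = sip g v"
  proof -
    have "cmod (cnj (ac y x)) \<le> C * S.nrm x * S.nrm y" if "x \<in> D" "y \<in> D" for x y
      using C(2)[of y x] that by (simp add: mult_ac)
    then have "\<exists>x\<in>D. \<forall>v\<in>D. cnj (ac v x) = sip g v"
      by (intro S.lax_milgram[of "\<lambda>x y. cnj (ac y x)" C 1 g])
        (use g C in \<open>auto simp: ac.a_add ac.a_add2 ac.a_scale ac.a_scale2 S.nrm_sq ac.herm_self\<close>)
    then show ?thesis using that by blast
  qed
  have "ac v f = l v" if "v \<in> D" for v
    using f(2)[OF that] g(2)[OF that] S.ip_cnj[OF that g(1)] by (metis complex_cnj_cnj)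
  then show ?thesis using f by blast
qed

lemma ip_via_S: "y \<in> X \<Longrightarrow> \<exists>g\<in>D. \<forall>v\<in>D. ip v y = sip v g"
proof -
  assume y: "y \<in> X"
  obtain g where g: "g \<in> D" "\<And>v. v \<in> D \<Longrightarrow> sip v g = ip v y"
  proof (rule S.riesz[OF D_sub order_refl, of "\<lambda>v. ip v y" "nrm y"])
    show "cmod (ip x y) \<le> nrm y * S.nrm x" if "x \<in> D" for x
      using cauchy_schwarz[of x y] nrm_le_S[OF that] that y mult_right_mono[of "nrm x" "S.nrm x" "nrm y"]
      by (simp add: mult.commute)
  qed (use y in \<open>auto simp: ip_add ip_scale\<close>)
  then show ?thesis by metis
qed

text \<open>The operator domain is a core. If e is orthogonal to it in the form inner product, write
  \<open>sip v e\<close> as \<open>ac v e'\<close> and solve (H + 1 - \<gamma>) f = e'. Then the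
  squared norm of e' is \<open>ac f e' = sip f e = 0\<close>, so that e' and hence e are
  null.\<close>

lemma Dom_dense:
  assumes x: "x \<in> D"
  obtains s where "\<And>n. s n \<in> Dom" "(\<lambda>n. S.nrm (s n - x)) \<longlonglongrightarrow> 0"
proof (rule S.dense_approx[OF subspace_Dom Dom_D x])
  fix e assume e: "e \<in> D" and orth: "\<And>v. v \<in> Dom \<Longrightarrow> sip v e = 0"
  obtain e' where e': "e' \<in> D" "\<And>v. v \<in> D \<Longrightarrow> ac v e' = sip v e"
    using solve_dual[of "\<lambda>v. sip v e"] e by blast
  obtain f where f: "rel f (e' - sc (of_real (1 - \<gamma>)) f)" using solve e' by blast
  have fD: "f \<in> D" "f \<in> Dom" using f by (auto simp: Dom_def rel_def)
  have "ac f e' = ip e' e'"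
    using f fD e' by (simp add: rel_def ac_def ip_diff ip_scale)
  then have "ip e' e' = 0" using e' fD orth by simp
  then have "nrm e' = 0" by (simp add: nrm_def)
  then have "sip e e = 0" using e'(2)[OF e] ac_null(2)[of e' e] e e' by simp
  then show "S.nrm e = 0" by (simp add: S.nrm_def)
qed (use that in blast)

lemma tendsto_ac:
  assumes s: "\<And>n. s n \<in> D" and x: "x \<in> D" and lim: "(\<lambda>n. S.nrm (s n - x)) \<longlonglongrightarrow> 0"
  shows "(\<lambda>n. ac (s n) (s n)) \<longlonglongrightarrow> ac x x"
proof -
  obtain C where C: "C \<ge> 1" "\<And>x y. \<lbrakk>x \<in> D; y \<in> D\<rbrakk> \<Longrightarrow> cmod (ac x y) \<le> C * S.nrm x * S.nrm y"
    using ac_bounded by blast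
  have "(\<lambda>n. ac (s n) (s n) - ac x x) \<longlonglongrightarrow> 0"
  proof (rule Lim_null_comparison)
    have "cmod (ac (s n) (s n) - ac x x) \<le> C * S.nrm (s n - x) * S.nrm (s n) + C * S.nrm x * S.nrm (s n - x)" for n
    proof -
      have "ac (s n) (s n) - ac x x = ac (s n - x) (s n) + ac x (s n - x)"
        using s x by (simp add: ac.a_diff ac.a_diff2)
      then show ?thesis using C(2)[of "s n - x" "s n"] C(2)[of x "s n - x"] s x
          norm_triangle_ineq[of "ac (s n - x) (s n)" "ac x (s n - x)"] by simp
    qed
    then show "\<forall>\<^sub>F n in sequentially. norm (ac (s n) (s n) - ac x x) \<le> C * S.nrm (s n - x) * S.nrm (s n) + C * S.nrm x * S.nrm (s n - x)"
      by simp
    have "(\<lambda>n. C * S.nrm (s n - x) * S.nrm (s n) + C * S.nrm x * S.nrm (s n - x)) \<longlonglongrightarrow> C * 0 * S.nrm x + C * S.nrm x * 0"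
      by (intro tendsto_intros lim S.tendsto_nrm s x)
    then show "(\<lambda>n. C * S.nrm (s n - x) * S.nrm (s n) + C * S.nrm x * S.nrm (s n - x)) \<longlonglongrightarrow> 0" by simp
  qed
  then show ?thesis by (simp add: LIM_zero_iff)
qed

definition numr :: "complex set" where "numr = {a f f |f. f \<in> Dom \<and> nrm f = 1}"

end

section \<open>The form shifted by \<open>lam\<close>: kernel, range, complement, convexity of the
  values\<close>

locale spectral_point = closed_sectorial sc X ip D a \<kappa> \<gamma>
  for sc :: "complex \<Rightarrow> 'v::ab_group_add \<Rightarrow> 'v" and X ip D a \<kappa> \<gamma> +
  fixes lam :: complex
begin

definition al :: "'v \<Rightarrow> 'v \<Rightarrow> complex" where "al x y = a x y - lam * ip x y"

sublocale al: sesq sc D al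
proof
  show "subspace D" by (rule D_sub)
qed (simp_all add: al_def a_add a_add2 a_scale a_scale2 ip_add ip_add2 ip_scale ip_scale2 algebra_simps)

lemma al_null:
  assumes "x \<in> X" "nrm x = 0" "y \<in> D" shows "al x y = 0" "al y x = 0"
  using a_null[OF assms] null_ip[of x y] assms by (auto simp: al_def)

text \<open>The operator domain is a core and the form is continuous in the form norm, so the
  inequality passes to limits.\<close>

lemma support_extend:
  assumes u: "\<And>f. f \<in> Dom \<Longrightarrow> 0 \<le> Re (cnj u * al f f)" and x: "x \<in> D"
  shows "0 \<le> Re (cnj u * al x x)"
proof -
  obtain s where s: "\<And>n. s n \<in> Dom" and lim: "(\<lambda>n. S.nrm (s n - x)) \<longlonglongrightarrow> 0"
    using Dom_dense[OF x] by blast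
  have sD: "s n \<in> D" for n using s Dom_D by blast
  have "(\<lambda>n. nrm (s n - x)) \<longlonglongrightarrow> 0"
    by (rule Lim_null_comparison[OF _ lim]) (use sD x nrm_le_S in simp)
  then have ln: "(\<lambda>n. nrm (s n)) \<longlonglongrightarrow> nrm x" using tendsto_nrm[of s x] sD x by simp
  have e: "al y y = ac y y - (of_real (1 - \<gamma>) + lam) * of_real ((nrm y)\<^sup>2)" if "y \<in> D" for y
    using that by (simp add: al_def ac_def ip_self algebra_simps)
  have "(\<lambda>n. Re (cnj u * (ac (s n) (s n) - (of_real (1 - \<gamma>) + lam) * of_real ((nrm (s n))\<^sup>2)))) \<longlonglongrightarrow>
      Re (cnj u * (ac x x - (of_real (1 - \<gamma>) + lam) * of_real ((nrm x)\<^sup>2)))"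
    by (intro tendsto_intros ln tendsto_ac sD x lim)
  then have "(\<lambda>n. Re (cnj u * al (s n) (s n))) \<longlonglongrightarrow> Re (cnj u * al x x)"
    using sD x by (simp only: e)
  then show ?thesis using u s by (intro LIMSEQ_le_const) auto
qed

text \<open>The common kernel of H - lam and its adjoint, expressed by the form so that no operator
  domains have to be compared.\<close>

definition N :: "'v set" where "N = {f \<in> D. \<forall>v\<in>D. al f v = 0 \<and> al v f = 0}"

lemma N_D: "n \<in> N \<Longrightarrow> n \<in> D" by (simp add: N_def)
lemma subspace_N: "subspace N"
  by (auto simp: N_def subspace_def al.a_add al.a_add2 al.a_scale al.a_scale2)
lemma rel_N: "n \<in> N \<Longrightarrow> rel n (sc lam n)"
  by (auto simp: N_def rel_def al_def ip_scale)

text \<open>On N the form is lam times the squared norm, so convergence in the ambient norm is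
  already convergence in the form, and closedness puts the limit into D. The two kernel identities
  pass to the limit because \<open>ac\<close> is bounded.\<close>

lemma N_closed:
  assumes s: "\<And>n. s n \<in> N" and x: "x \<in> X" and lim: "(\<lambda>n. nrm (s n - x)) \<longlonglongrightarrow> 0"
  shows "x \<in> N"
proof -
  have sD: "s n \<in> D" for n using s N_D by blast
  have az: "a y y = lam * of_real ((nrm y)\<^sup>2)" if "y \<in> N" for y
    using that by (auto simp: N_def al_def ip_self)
  have "\<exists>M. \<forall>n\<ge>M. \<forall>m\<ge>M. cmod (a (s n - s m) (s n - s m)) < e" if e: "e > 0" for e
  proof -
    define d where "d = sqrt (e / (1 + cmod lam)) / 2"
    have d: "d > 0" using e by (simp add: d_def add_pos_nonneg)
    obtain M where M: "\<And>n. n \<ge> M \<Longrightarrow> nrm (s n - x) < d"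
      using order_tendstoD(2)[OF lim d] by (auto simp: eventually_sequentially)
    have "cmod (a (s n - s m) (s n - s m)) < e" if nm: "n \<ge> M" "m \<ge> M" for n m
    proof -
      have "nrm (s n - s m) < 2 * d"
        using nrm_triangle3[of "s n" x "s m"] nrm_minus[of x "s m"] M[OF nm(1)] M[OF nm(2)] sD x by simp
      then have "(nrm (s n - s m))\<^sup>2 < (2 * d)\<^sup>2" using sD by (intro power_strict_mono) auto
      then have lt: "(nrm (s n - s m))\<^sup>2 < e / (1 + cmod lam)" using e by (simp add: d_def add_pos_nonneg power_mult_distrib)
      have "s n - s m \<in> N" using s subspace_N subspace_diff by blast
      then have "cmod (a (s n - s m) (s n - s m)) = cmod lam * (nrm (s n - s m))\<^sup>2" by (simp add: az norm_mult flip: of_real_power)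
      also have "\<dots> \<le> (1 + cmod lam) * (nrm (s n - s m))\<^sup>2" by (intro mult_right_mono) auto
      also have "\<dots> < e" using lt by (simp add: pos_less_divide_eq add_pos_nonneg mult.commute)
      finally show ?thesis .
    qed
    then show ?thesis by blast
  qed
  then have xD: "x \<in> D" and la: "(\<lambda>n. a (s n - x) (s n - x)) \<longlonglongrightarrow> 0"
    using closed_a[OF sD x lim] by blast+
  have "(\<lambda>n. Re (a (s n - x) (s n - x)) + (1 - \<gamma>) * (nrm (s n - x))\<^sup>2) \<longlonglongrightarrow> Re 0 + (1 - \<gamma>) * 0\<^sup>2"
    by (intro tendsto_intros la lim)
  then have "(\<lambda>n. (S.nrm (s n - x))\<^sup>2) \<longlonglongrightarrow> 0" using sD xD by (simp add: S_sq)
  then have "(\<lambda>n. sqrt ((S.nrm (s n - x))\<^sup>2)) \<longlonglongrightarrow> sqrt 0" by (rule tendsto_real_sqrt)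
  then have lS: "(\<lambda>n. S.nrm (s n - x)) \<longlonglongrightarrow> 0" using sD xD by simp
  obtain C where C: "C \<ge> 1" "\<And>x y. \<lbrakk>x \<in> D; y \<in> D\<rbrakk> \<Longrightarrow> cmod (ac x y) \<le> C * S.nrm x * S.nrm y"
    using ac_bounded by blast
  have "al x v = 0 \<and> al v x = 0" if v: "v \<in> D" for v
  proof -
    have 1: "cmod (ac x v - ac (s n) v) \<le> C * S.nrm v * S.nrm (s n - x)" for n
      using C(2)[of "x - s n" v] v sD xD S.nrm_minus[of x "s n"] by (simp add: ac.a_diff mult_ac)
    have 2: "cmod (ac v x - ac v (s n)) \<le> C * S.nrm v * S.nrm (s n - x)" for n
      using C(2)[of v "x - s n"] v sD xD S.nrm_minus[of x "s n"] by (simp add: ac.a_diff2 mult_ac)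
    have l0: "(\<lambda>n. C * S.nrm v * S.nrm (s n - x)) \<longlonglongrightarrow> 0" using tendsto_mult_right_zero[OF lS] .
    have z: "a (s n) v = lam * ip (s n) v" "a v (s n) = lam * ip v (s n)" for n
      using s[of n] v by (auto simp: N_def al_def)
    have "(\<lambda>n. ac x v - ac (s n) v) \<longlonglongrightarrow> 0" "(\<lambda>n. ac v x - ac v (s n)) \<longlonglongrightarrow> 0"
      by (rule Lim_null_comparison[OF _ l0], use 1 2 in simp)+
    moreover have "(\<lambda>n. ac x v - ac (s n) v) \<longlonglongrightarrow> ac x v - (lam * ip x v + of_real (1 - \<gamma>) * ip x v)"
      unfolding ac_def[of "s _"] z by (intro tendsto_intros tendsto_ip) (use sD x v lim in auto)
    moreover have "(\<lambda>n. ac v x - ac v (s n)) \<longlonglongrightarrow> ac v x - (lam * ip v x + of_real (1 - \<gamma>) * ip v x)"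
      unfolding ac_def[of v "s _"] z by (intro tendsto_intros tendsto_ip) (use sD x v lim in auto)
    ultimately have "ac x v - (lam * ip x v + of_real (1 - \<gamma>) * ip x v) = 0"
        "ac v x - (lam * ip v x + of_real (1 - \<gamma>) * ip v x) = 0"
      by (metis LIMSEQ_unique)+
    then show ?thesis by (simp add: ac_def al_def)
  qed
  then show ?thesis using xD by (simp add: N_def)
qed

text \<open>Saturated under null vectors, so that membership is insensitive to the choice of a
  representative.\<close>

definition Rng :: "'v set" where
  "Rng = {g \<in> X. \<exists>f u. rel f u \<and> nrm (g - (u - sc lam f)) = 0}"

lemma Rng_iff: "g \<in> Rng \<longleftrightarrow> g \<in> X \<and> (\<exists>f. rel f (g + sc lam f))"
proof
  assume "g \<in> Rng"
  then obtain f u where g: "g \<in> X" "rel f u" "nrm (g - (u - sc lam f)) = 0" by (auto simp: Rng_def)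
  have fu: "f \<in> D" "u \<in> X" using g rel_mem by auto
  have "a f v = ip (g + sc lam f) v" if "v \<in> D" for v
  proof -
    have "ip (g - (u - sc lam f)) v = 0" using null_ip(1)[OF _ _ g(3)] fu g that by simp
    then show ?thesis using g fu that by (simp add: rel_def ip_diff ip_add ip_scale algebra_simps)
  qed
  then show "g \<in> X \<and> (\<exists>f. rel f (g + sc lam f))" using g fu by (auto simp: rel_def)
next
  assume "g \<in> X \<and> (\<exists>f. rel f (g + sc lam f))"
  then show "g \<in> Rng" by (auto simp: Rng_def intro: exI[of _ "_ + _"] dest: rel_mem) (metis add_diff_cancel_right' cancel_comm_monoid_add_class.diff_cancel nrm_zero)
qed

lemma subspace_Rng: "subspace Rng"
  unfolding subspace_def
proof (intro conjI ballI allI)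
  show "0 \<in> Rng" using rel_zero by (auto simp: Rng_iff intro!: exI[of _ 0])
  fix x assume "x \<in> Rng"
  then obtain f where f: "x \<in> X" "rel f (x + sc lam f)" by (auto simp: Rng_iff)
  fix y assume "y \<in> Rng"
  then obtain g where g: "y \<in> X" "rel g (y + sc lam g)" by (auto simp: Rng_iff)
  have "rel (f + g) ((x + y) + sc lam (f + g))"
    using rel_add[OF f(2) g(2)] by (simp add: scale_right_distrib algebra_simps)
  then show "x + y \<in> Rng" using f g Rng_iff by blast
next
  fix c x assume "x \<in> Rng"
  then obtain f where f: "x \<in> X" "rel f (x + sc lam f)" by (auto simp: Rng_iff)
  have "rel (sc c f) (sc c x + sc lam (sc c f))"
    using rel_scale[OF f(2), of c] by (simp add: scale_right_distrib mult.commute)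
  then show "sc c x \<in> Rng" using f Rng_iff by blast
qed

lemma Rng_orth_N: "\<lbrakk>r \<in> Rng; n \<in> N\<rbrakk> \<Longrightarrow> ip r n = 0"
  by (auto simp: Rng_iff N_def rel_def al_def ip_add ip_scale)

definition M :: "'v set" where "M = {f \<in> Dom. \<forall>n\<in>N. ip f n = 0}"

lemma M_Dom: "M \<subseteq> Dom" by (auto simp: M_def)
lemma M_D: "f \<in> M \<Longrightarrow> f \<in> D" using M_Dom Dom_D by blast
lemma subspace_M: "subspace M"
proof -
  have "x \<in> D" if "x \<in> Dom" for x using that Dom_D by blast
  then show ?thesis using subspace_Dom N_D unfolding subspace_def M_def
    by (auto simp: ip_add ip_scale)
qed

text \<open>N is closed and contained in the operator domain, so the orthogonal projection splits f
  inside that domain. The component in N drops out of the form because N is annihilated in both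
  slots.\<close>

lemma decompose:
  assumes f: "f \<in> Dom"
  obtains n m where "n \<in> N" "m \<in> M" "f = n + m" "al f f = al m m"
proof -
  have fD: "f \<in> D" using f Dom_D by blast
  have NX: "N \<subseteq> X" using N_D by blast
  obtain n s where n: "n \<in> X" "\<And>k. s k \<in> N" "(\<lambda>k. nrm (s k - n)) \<longlonglongrightarrow> 0" "\<And>x. x \<in> N \<Longrightarrow> ip x (f - n) = 0"
    using projection[OF subspace_N NX, of f] fD by blast
  have nN: "n \<in> N" using N_closed[OF n(2,1,3)] .
  then have nDom: "n \<in> Dom" using rel_N by (auto simp: Dom_def)
  have "ip (f - n) x = 0" if "x \<in> N" for x
    using n(4)[OF that] ip_cnj[of x "f - n"] fD n that N_D by simp
  then have m: "f - n \<in> M" using f nDom subspace_Dom subspace_diff by (auto simp: M_def)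
  have nD: "n \<in> D" using nN N_D by blast
  have "al f f = al (f - n) (f - n)"
    using nN fD nD by (simp add: al.a_diff al.a_diff2) (simp add: N_def)
  then show ?thesis using that[OF nN m] by simp
qed

lemma scaled_support:
  assumes Y: "subspace Y" "Y \<subseteq> D"
    and w: "\<And>f. \<lbrakk>f \<in> Y; nrm f = 1\<rbrakk> \<Longrightarrow> 0 \<le> Re (cnj w * al f f)" and m: "m \<in> Y"
  shows "0 \<le> Re (cnj w * al m m)"
proof (cases "nrm m = 0")
  case True
  then show ?thesis using al_null[of m m] m Y by (auto simp: subset_iff)
next
  case False
  have mD: "m \<in> D" using m Y by blast
  then have n0: "nrm m > 0" using nrm_ge0[of m] False by (simp add: less_le)
  let ?c = "complex_of_real (1 / nrm m)"
  have cc: "cmod ?c = 1 / nrm m" using n0 by (simp only: norm_of_real) simp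
  have "nrm (sc ?c m) = 1" using mD n0 by (simp only: nrm_scale D_X cc) simp
  moreover have "sc ?c m \<in> Y" using m Y subspace_scale by blast
  ultimately have "0 \<le> Re (cnj w * al (sc ?c m) (sc ?c m))" using w by blast
  then have "0 \<le> Re (cnj w * (of_real ((1 / nrm m)\<^sup>2) * al m m))"
    by (simp only: al.a_self_scale[OF mD] cc)
  also have "cnj w * (of_real ((1 / nrm m)\<^sup>2) * al m m) = of_real ((1 / nrm m)\<^sup>2) * (cnj w * al m m)" by (simp only: mult_ac)
  also have "Re \<dots> = (1 / nrm m)\<^sup>2 * Re (cnj w * al m m)" by simp
  finally show ?thesis using n0 by (simp add: zero_le_mult_iff)
qed

text \<open>The Toeplitz-Hausdorff theorem on a subspace. The affine normalisation \<open>b\<close>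
  sends the two given values to 0 and 1; a path from f to g along which \<open>b\<close> is real
  then covers the interval by continuity.\<close>

lemma convex_values:
  assumes Y: "subspace Y" "Y \<subseteq> D"
  shows "convex {al f f |f. f \<in> Y \<and> nrm f = 1}"
  unfolding convex_contains_segment
proof (intro ballI)
  have YD: "x \<in> Y \<Longrightarrow> x \<in> D" for x using Y by blast
  fix \<alpha> \<beta> assume "\<alpha> \<in> {al f f |f. f \<in> Y \<and> nrm f = 1}" "\<beta> \<in> {al f f |f. f \<in> Y \<and> nrm f = 1}"
  then obtain f g where f: "f \<in> Y" "nrm f = 1" "\<alpha> = al f f" and g: "g \<in> Y" "nrm g = 1" "\<beta> = al g g" by auto
  show "closed_segment \<alpha> \<beta> \<subseteq> {al f f |f. f \<in> Y \<and> nrm f = 1}"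
  proof (cases "\<alpha> = \<beta>")
    case True
    then show ?thesis using f by auto
  next
    case False
    define b where "b x y = (al x y - \<alpha> * ip x y) / (\<beta> - \<alpha>)" for x y
    define p where "p = b f g" define r where "r = b g f"
    \<comment> \<open>With this phase the sum of the two mixed terms is real, so \<open>b\<close> is
      real along the whole path \<open>F\<close>.\<close>
    obtain \<zeta> where \<zeta>: "cmod \<zeta> = 1" "Im (\<zeta> * (p - cnj r)) = 0"
    proof (cases "p - cnj r = 0")
      case True
      then show ?thesis using that[of 1] by simp
    next
      case False
      have e: "cnj (p - cnj r) / of_real (cmod (p - cnj r)) * (p - cnj r) = of_real (cmod (p - cnj r))"
        using False complex_norm_square[of "p - cnj r"] by (simp add: power2_eq_square field_simps)
      have "cmod (cnj (p - cnj r) / of_real (cmod (p - cnj r))) = 1"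
        using False unfolding norm_divide complex_mod_cnj by simp
      then show ?thesis by (rule that) (simp only: e Im_complex_of_real)
    qed
    define k where "k = Re (\<zeta> * p + cnj \<zeta> * r)"
    have k: "\<zeta> * p + cnj \<zeta> * r = of_real k" using \<zeta>(2) by (simp add: k_def complex_eq_iff algebra_simps)
    define F where "F t = sc (of_real t) g + sc (of_real (1 - t) * \<zeta>) f" for t
    have FY: "F t \<in> Y" for t using f g Y subspace_add subspace_scale by (simp add: F_def)
    have FD: "F t \<in> D" for t using FY YD by blast
    have fgD: "f \<in> D" "g \<in> D" using f g YD by auto
    have bff: "b f f = 0" and bgg: "b g g = 1"
      using f g False fgD by (simp_all add: b_def ip_self divide_simps)
    interpret b: sesq sc D b
    proof
      show "subspace D" by (rule D_sub)
    qed (simp_all add: b_def al.a_add al.a_add2 al.a_scale al.a_scale2 ip_add ip_add2 ip_scale ip_scale2 algebra_simps add_divide_distrib diff_divide_distrib)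
    have zz: "\<zeta> * cnj \<zeta> = 1" using \<zeta>(1) complex_norm_square[of \<zeta>] by simp
    have bF: "b (F t) (F t) = of_real (t\<^sup>2 + t * (1 - t) * k)" for t
    proof -
      have "b (F t) (F t) = of_real (t\<^sup>2) + of_real (t * (1-t)) * (\<zeta> * p + cnj \<zeta> * r)"
        using fgD by (simp add: F_def b.a_add b.a_add2 b.a_scale b.a_scale2 bff bgg flip: p_def r_def)
          (simp add: algebra_simps power2_eq_square)
      then show ?thesis by (simp only: k of_real_add of_real_mult)
    qed
    \<comment> \<open>A null \<open>F t\<close> would make \<open>b\<close> vanish against f and g;
      that forces t = 0, but \<open>F 0\<close> is a unit vector.\<close>
    have Fne: "nrm (F t) \<noteq> 0" if t: "0 \<le> t" "t \<le> 1" for t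
    proof
      assume z: "nrm (F t) = 0"
      have bn: "b (F t) y = 0" "b y (F t) = 0" if "y \<in> D" for y
        using al_null[OF D_X[OF FD] z that] null_ip[OF D_X[OF FD] D_X[OF that] z] by (simp_all add: b_def)
      have "b (F t) g = of_real t + of_real (1-t) * \<zeta> * p"
        using fgD by (simp add: F_def b.a_add b.a_scale bgg flip: p_def)
      moreover have "b (F t) f = of_real t * r"
        using fgD by (simp add: F_def b.a_add b.a_scale bff flip: r_def)
      moreover have "b f (F t) = of_real t * p"
        using fgD by (simp add: F_def b.a_add2 b.a_scale2 bff flip: p_def)
      ultimately have 0: "of_real t + of_real (1-t) * \<zeta> * p = 0" "of_real t * r = 0" "of_real t * p = 0"
        using bn fgD by auto
      have "t = 0" using 0 by (cases "t = 0") auto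
      then have "F t = sc \<zeta> f" by (simp add: F_def)
      then show False using z f fgD \<zeta> by (simp add: nrm_scale)
    qed
    define G where "G t = (t\<^sup>2 + t * (1 - t) * k) / (nrm (F t))\<^sup>2" for t
    have nF: "(nrm (F t))\<^sup>2 = t\<^sup>2 + 2 * t * (1-t) * Re (cnj \<zeta> * ip g f) + (1-t)\<^sup>2" for t
      using fgD f g \<zeta>(1) by (simp add: F_def nrm_add_sq nrm_scale ip_scale ip_scale2 norm_mult power_mult_distrib flip: of_real_diff) (simp add: algebra_simps)
    have cont: "continuous_on {0..1} G"
    proof -
      have "t\<^sup>2 + 2 * t * (1-t) * Re (cnj \<zeta> * ip g f) + (1-t)\<^sup>2 \<noteq> 0" if "t \<in> {0..1}" for t
        using Fne[of t] that unfolding nF[of t, symmetric] by simp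
      then show ?thesis unfolding G_def nF by (intro continuous_intros) auto
    qed
    have ends: "G 0 = 0" "G 1 = 1" using f g nF[of 1] by (simp_all add: G_def F_def)
    have "\<exists>h\<in>Y. nrm h = 1 \<and> b h h = of_real x" if x: "x \<in> {0..1}" for x
    proof -
      obtain t where t: "0 \<le> t" "t \<le> 1" "G t = x"
        using IVT'[of G 0 x 1] ends x cont by auto
      let ?c = "complex_of_real (1 / nrm (F t))"
      have n0: "nrm (F t) > 0" using Fne[OF t(1,2)] nrm_ge0[OF D_X[OF FD[of t]]] by linarith
      have cc: "cmod ?c = 1 / nrm (F t)" using n0 by (simp only: norm_of_real) simp
      have "nrm (sc ?c (F t)) = 1" using FD n0 by (simp only: nrm_scale D_X cc) simp
      moreover have "b (sc ?c (F t)) (sc ?c (F t)) = of_real x"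
        unfolding b.a_self_scale[OF FD] cc bF t(3)[symmetric] G_def by (simp add: power_divide)
      moreover have "sc ?c (F t) \<in> Y" using FY Y subspace_scale by blast
      ultimately show ?thesis by blast
    qed
    note ex = this
    show ?thesis
    proof
      fix z assume "z \<in> closed_segment \<alpha> \<beta>"
      then obtain x where x: "0 \<le> x" "x \<le> 1" "z = (1 - x) *\<^sub>R \<alpha> + x *\<^sub>R \<beta>" by (auto simp: closed_segment_def)
      obtain h where h: "h \<in> Y" "nrm h = 1" "b h h = of_real x" using ex[of x] x by auto
      have "al h h - \<alpha> = of_real x * (\<beta> - \<alpha>)"
        using h YD False by (simp add: b_def ip_self divide_simps)
      then have "al h h = z" unfolding x by (simp add: algebra_simps scaleR_conv_of_real)
      then show "z \<in> {al f f |f. f \<in> Y \<and> nrm f = 1}" using h by blast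
    qed
  qed
qed

end

section \<open>Boundary points with closed range\<close>

locale closed_range_point = spectral_point sc X ip D a \<kappa> \<gamma> lam
  for sc :: "complex \<Rightarrow> 'v::ab_group_add \<Rightarrow> 'v" and X ip D a \<kappa> \<gamma> lam +
  fixes u :: complex
  assumes Rng_closed: "\<lbrakk>\<And>n. s n \<in> Rng; x \<in> X; (\<lambda>n. nrm (s n - x)) \<longlonglongrightarrow> 0\<rbrakk> \<Longrightarrow> x \<in> Rng"
    and u: "cmod u = 1"
    and supp_Dom: "f \<in> Dom \<Longrightarrow> 0 \<le> Re (cnj u * al f f)"
begin

lemma supp: "f \<in> D \<Longrightarrow> 0 \<le> Re (cnj u * al f f)"
  using support_extend supp_Dom by blast

sublocale b: semi_ip sc D "al.herm u"
  by (rule al.semi_ip_herm) (rule supp)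

lemma u_ne: "u \<noteq> 0" using u by auto

text \<open>A vector killed from one side has height 0 over the supporting line, hence lies in the
  radical of the positive form \<open>al.herm u\<close>; vanishing in one slot then transfers to the
  other.\<close>

lemma N_right:
  assumes "f \<in> D" "\<And>v. v \<in> D \<Longrightarrow> al v f = 0" shows "f \<in> N"
proof -
  have "b.nrm f = 0" using assms by (simp add: b.nrm_def al.herm_self)
  then have "al.herm u f v = 0" if "v \<in> D" for v using b.null_ip assms that by blast
  then have "al f v = 0" if "v \<in> D" for v using assms that u_ne by (simp add: al.herm_def)
  then show ?thesis using assms by (simp add: N_def)
qed

text \<open>The obstacle is that e is not yet known to lie in D. Solve the adjoint problem for
  \<open>ac\<close> with right-hand side (1 - \<gamma> + lam) <v, e>; the solution e' lies in D.
  Testing with the resolvent preimage f of e' - e shows that e' - e is null, so e is in D after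
  all.\<close>

lemma Rng_perp_N:
  assumes e: "e \<in> X" and orth: "\<And>r. r \<in> Rng \<Longrightarrow> ip r e = 0"
  shows "e \<in> N"
proof -
  let ?c = "complex_of_real (1 - \<gamma>)"
  let ?y = "sc (cnj (?c + lam)) e"
  have "\<exists>g\<in>D. \<forall>v\<in>D. ip v ?y = sip v g" using ip_via_S e by blast
  then obtain e' where e': "e' \<in> D" "\<And>v. v \<in> D \<Longrightarrow> ac v e' = ip v ?y"
    using solve_dual[of "\<lambda>v. ip v ?y"] by blast
  have eX: "e' - e \<in> X" using e e' by simp
  obtain f where f: "rel f ((e' - e) - sc ?c f)" using solve[OF eX] by blast
  have fD: "f \<in> D" using f rel_mem by blast
  let ?u = "(e' - e) - sc ?c f"
  have uX: "?u \<in> X" using f rel_mem by blast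
  have "?u - sc lam f \<in> Rng" using f fD uX by (auto simp: Rng_iff intro!: exI[of _ f])
  then have "ip (?u - sc lam f) e = 0" by (rule orth)
  then have ue: "ip ?u e = lam * ip f e" using uX fD e by (simp only: ip_diff ip_scale scale_mem D_X) simp
  have "a f e' = ip ?u e'" using f e' by (simp add: rel_def)
  moreover have "ac f e' = (?c + lam) * ip f e" using e'(2)[OF fD] fD e by (simp only: ip_scale2 D_X) simp
  ultimately have ue': "ip ?u e' = (?c + lam) * ip f e - ?c * ip f e'" by (simp add: ac_def algebra_simps)
  have "ip (e' - e) (e' - e) = ip (?u + sc ?c f) (e' - e)" by simp
  also have "\<dots> = ip ?u e' - ip ?u e + ?c * (ip f e' - ip f e)"
    using uX fD e e' by (simp only: ip_add ip_diff2 ip_scale scale_mem D_X diff_mem) (simp add: ip_diff2 fD e e' right_diff_distrib)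
  also have "\<dots> = 0" unfolding ue ue' by (simp add: algebra_simps)
  finally have n0: "nrm (e' - e) = 0" by (simp add: nrm_def)
  have "e' - e \<in> D" using null_D[OF eX n0] by blast
  then have eD: "e \<in> D" using D_diff[OF e'(1), of "e' - e"] by simp
  have "al v e = 0" if v: "v \<in> D" for v
  proof -
    have "ac v (e' - e) = 0" using ac_null(2)[OF eX n0 v] .
    then have "ac v e = (?c + lam) * ip v e"
      using e'(2)[OF v] v e eD e'(1) by (simp add: ac.a_diff2 ip_scale2)
    then show ?thesis by (simp add: ac_def al_def algebra_simps)
  qed
  then show ?thesis using N_right[OF eD] by blast
qed

text \<open>The projection of f onto the closed range differs from f by a vector of N. Both f and
  the projection are orthogonal to N, so the difference is null.\<close>

lemma M_Rng: assumes f: "f \<in> M" shows "f \<in> Rng"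
proof -
  have fX: "f \<in> X" using f M_D by blast
  have RX: "Rng \<subseteq> X" by (auto simp: Rng_def)
  obtain g s where g: "g \<in> X" "\<And>n. s n \<in> Rng" "(\<lambda>n. nrm (s n - g)) \<longlonglongrightarrow> 0" "\<And>x. x \<in> Rng \<Longrightarrow> ip x (f - g) = 0"
    using projection[OF subspace_Rng RX fX] by blast
  have gR: "g \<in> Rng" using Rng_closed[OF g(2,1,3)] .
  have eN: "f - g \<in> N" using Rng_perp_N g fX by blast
  have "ip (f - g) (f - g) = 0"
    using f eN Rng_orth_N[OF gR eN] g fX by (simp add: M_def ip_diff)
  then have "nrm (f - g) = 0" by (simp add: nrm_def)
  then obtain h w where h: "rel h w" "nrm (g - (w - sc lam h)) = 0" using gR by (auto simp: Rng_def)
  have hX: "h \<in> X" "w \<in> X" using h rel_mem by auto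
  have "nrm (f - (w - sc lam h)) \<le> nrm (f - g) + nrm (g - (w - sc lam h))"
    using nrm_triangle3 fX g hX by simp
  then have "nrm (f - (w - sc lam h)) = 0"
    using h \<open>nrm (f - g) = 0\<close> fX hX by (intro antisym) auto
  then show ?thesis using fX h by (auto simp: Rng_def)
qed

text \<open>Here (H - lam) g = y with y within 1/2 of f. Thus \<open>al g f\<close> is within 1/2 of
  1 while \<open>al g g\<close> is bounded in terms of k alone: g is a direction in which the form
  reacts at f at a definite rate.\<close>

lemma uniform_preimage:
  obtains k where "k \<ge> 1"
    "\<And>f. \<lbrakk>f \<in> M; nrm f = 1\<rbrakk> \<Longrightarrow> \<exists>g\<in>Dom. nrm g \<le> k \<and> 1/2 \<le> cmod (al g f) \<and> cmod (al g f) \<le> 3/2 \<and> cmod (al g g) \<le> 3/2 * k"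
proof -
  have *: "\<exists>k>0. \<forall>f\<in>Rng. nrm f = 1 \<longrightarrow> (\<exists>g y. (rel g (y + sc lam g) \<and> y \<in> X) \<and> nrm g \<le> k \<and> nrm (y - f) \<le> 1/2)"
  proof (rule bounded_preimages)
    show "Rng \<subseteq> X" by (auto simp: Rng_def)
    fix g y g' y' c assume 1: "rel g (y + sc lam g) \<and> y \<in> X" and 2: "rel g' (y' + sc lam g') \<and> y' \<in> X"
    have "rel (g - g') ((y - y') + sc lam (g - g'))"
      using rel_diff[of g "y + sc lam g" g' "y' + sc lam g'"] 1 2 by (simp add: scale_right_diff_distrib algebra_simps)
    then show "rel (g - g') (y - y' + sc lam (g - g')) \<and> y - y' \<in> X" using 1 2 by simp
  next
    fix g y c assume 1: "rel g (y + sc lam g) \<and> y \<in> X"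
    then show "rel (sc c g) (sc c y + sc lam (sc c g)) \<and> sc c y \<in> X"
      using rel_scale[of g "y + sc lam g" c] by (simp add: scale_right_distrib mult.commute)
  next
    show "g \<in> X \<and> y \<in> X" if "rel g (y + sc lam g) \<and> y \<in> X" for g y using that rel_mem by blast
    show "\<exists>g. rel g (y + sc lam g) \<and> y \<in> X" if "y \<in> Rng" for y using that by (auto simp: Rng_iff)
  qed (use subspace_Rng Rng_closed in auto)
  then obtain k where k: "k > 0" "\<And>f. \<lbrakk>f \<in> Rng; nrm f = 1\<rbrakk> \<Longrightarrow> \<exists>g y. rel g (y + sc lam g) \<and> y \<in> X \<and> nrm g \<le> k \<and> nrm (y - f) \<le> 1/2"
    by blast
  have "\<exists>g\<in>Dom. nrm g \<le> max 1 k \<and> 1/2 \<le> cmod (al g f) \<and> cmod (al g f) \<le> 3/2 \<and> cmod (al g g) \<le> 3/2 * max 1 k"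
    if f: "f \<in> M" "nrm f = 1" for f
  proof -
    have fD: "f \<in> D" using f M_D by blast
    obtain g y where g: "rel g (y + sc lam g)" "y \<in> X" "nrm g \<le> k" "nrm (y - f) \<le> 1/2"
      using k(2)[OF M_Rng[OF f(1)] f(2)] by blast
    have gD: "g \<in> D" "g \<in> Dom" using g rel_mem by (auto simp: Dom_def)
    have al: "al g v = ip y v" if "v \<in> D" for v
      using g that gD by (simp add: rel_def al_def ip_add ip_scale)
    have 1: "cmod (ip y f - 1) \<le> 1/2"
      using cauchy_schwarz[of "y - f" f] g f fD by (simp add: ip_diff ip_self)
    have 2: "nrm y \<le> 3/2"
      using nrm_triangle[of "y - f" f] g f fD by simp
    have "cmod (al g f) \<ge> 1/2"
      using norm_triangle_ineq2[of 1 "1 - ip y f"] 1 fD al norm_minus_commute[of 1 "ip y f"] by simp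
    moreover have "cmod (al g f) \<le> 3/2"
      using cauchy_schwarz[of y f] 2 g f fD al by simp
    moreover have "cmod (al g g) \<le> 3/2 * max 1 k"
    proof -
      have "cmod (al g g) \<le> nrm y * nrm g" using cauchy_schwarz[of y g] g gD al by simp
      also have "\<dots> \<le> 3/2 * max 1 k" using 2 g gD by (intro mult_mono) auto
      finally show ?thesis .
    qed
    ultimately show ?thesis using g(3) gD by (intro bexI[of _ g]) auto
  qed
  then show ?thesis using that[of "max 1 k"] by simp
qed

text \<open>Two transversal supporting lines bound \<open>al g f\<close> by a multiple of the
  geometric mean of \<open>cmod (al g g)\<close> and \<open>cmod (al f f)\<close>. For an
  approximate preimage g the left side is at least 1/2 and the first factor is bounded, so the
  second cannot be small.\<close>

lemma corner_gap:
  assumes u': "\<And>f. f \<in> Dom \<Longrightarrow> 0 \<le> Re (cnj u' * al f f)" and ne: "Im (cnj u * u') \<noteq> 0"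
  shows "\<exists>\<delta>>0. \<forall>f\<in>M. nrm f = 1 \<longrightarrow> \<delta> \<le> cmod (al f f)"
proof -
  obtain k where k: "k \<ge> 1" "\<And>f. \<lbrakk>f \<in> M; nrm f = 1\<rbrakk> \<Longrightarrow> \<exists>g\<in>Dom. nrm g \<le> k \<and> 1/2 \<le> cmod (al g f) \<and> cmod (al g f) \<le> 3/2 \<and> cmod (al g g) \<le> 3/2 * k"
    using uniform_preimage by blast
  obtain C where C: "C \<ge> 0" "\<And>x y. \<lbrakk>x \<in> D; y \<in> D\<rbrakk> \<Longrightarrow> cmod (al x y) \<le> C * sqrt (cmod (al x x)) * sqrt (cmod (al y y))"
    using al.two_supports[OF supp support_extend[OF u'] ne] by auto
  define K where "K = C * sqrt (3/2 * k) + 1"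
  have K: "K > 0" using C k by (simp add: K_def add_nonneg_pos)
  have "(1 / (2 * K))\<^sup>2 \<le> cmod (al f f)" if f: "f \<in> M" "nrm f = 1" for f
  proof -
    obtain g where g: "g \<in> Dom" "1/2 \<le> cmod (al g f)" "cmod (al g g) \<le> 3/2 * k" using k(2)[OF f] by blast
    have "1/2 \<le> C * sqrt (cmod (al g g)) * sqrt (cmod (al f f))"
      using g C(2)[of g f] f M_D Dom_D by fastforce
    also have "\<dots> \<le> K * sqrt (cmod (al f f))"
    proof (rule mult_right_mono)
      have "C * sqrt (cmod (al g g)) \<le> C * sqrt (3/2 * k)" using g C by (intro mult_left_mono) auto
      then show "C * sqrt (cmod (al g g)) \<le> K" by (simp add: K_def)
    qed simp
    finally have "1 / (2 * K) \<le> sqrt (cmod (al f f))" using K by (simp add: field_simps)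
    then have "(1 / (2 * K))\<^sup>2 \<le> (sqrt (cmod (al f f)))\<^sup>2" using K by (intro power_mono) auto
    then show ?thesis by simp
  qed
  then show ?thesis using K by (intro exI[of _ "(1 / (2 * K))\<^sup>2"]) auto
qed

text \<open>After Huebner: pushing a nearly minimising \<open>f\<close> in the direction of an approximate preimage \<open>g\<close> moves
  the value of the form by order \<open>\<tau>\<close> along the supporting line, but only by order \<open>\<tau>\<^sup>2\<close> away from it.\<close>

lemma no_gap_parabola:
  assumes nogap: "\<And>\<delta>. \<delta> > 0 \<Longrightarrow> \<exists>f\<in>M. nrm f = 1 \<and> cmod (al f f) < \<delta>"
  shows "\<exists>C>0. \<forall>\<sigma>\<in>{1,-1::real}. \<forall>\<epsilon>>0. \<exists>F\<in>Dom. nrm F = 1 \<and> cmod (al F F) \<le> \<epsilon> \<and>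
     \<sigma> * - Im (cnj u * al F F) > 0 \<and> Re (cnj u * al F F) \<le> C * (Im (cnj u * al F F))\<^sup>2"
proof -
  obtain k where k: "k \<ge> 1" "\<And>f. \<lbrakk>f \<in> M; nrm f = 1\<rbrakk> \<Longrightarrow> \<exists>g\<in>Dom. nrm g \<le> k \<and> 1/2 \<le> cmod (al g f) \<and> cmod (al g f) \<le> 3/2 \<and> cmod (al g g) \<le> 3/2 * k"
    using uniform_preimage by blast
  \<comment> \<open>2 + 3k bounds the height in units of \<tau>^2. The tangential displacement is at
    least \<tau>/4, which costs a factor 16, and normalising a vector of norm at most 2 costs
    another 4.\<close>
  define C where "C = 64 * (2 + 3 * k)"
  have C: "C > 0" using k by (simp add: C_def)
  have "\<exists>F\<in>Dom. nrm F = 1 \<and> cmod (al F F) \<le> \<epsilon> \<and>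
     \<sigma> * - Im (cnj u * al F F) > 0 \<and> Re (cnj u * al F F) \<le> C * (Im (cnj u * al F F))\<^sup>2"
    if \<sigma>: "\<sigma> = 1 \<or> \<sigma> = -1" and \<epsilon>: "\<epsilon> > 0" for \<sigma> \<epsilon> :: real
  proof -
    \<comment> \<open>The first bound keeps the norm of the perturbed vector between 1/2 and 2 and
      its quadratic terms small against \<tau>; the second keeps its value within \<epsilon> of
      0.\<close>
    define \<tau> where "\<tau> = min (1 / (10 * k)) (\<epsilon> / (24 * (2 + k)))"
    have \<tau>: "\<tau> > 0" "\<tau> * k \<le> 1/10" "\<tau> \<le> 1/10" "\<tau> * (24 * (2 + k)) \<le> \<epsilon>"
    proof -
      show "\<tau> > 0" using k \<epsilon> by (simp add: \<tau>_def)
      show 1: "\<tau> * k \<le> 1/10" using k by (simp add: \<tau>_def min_def field_simps)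
      show "\<tau> * (24 * (2 + k)) \<le> \<epsilon>" proof -
        have "\<tau> \<le> \<epsilon> / (24 * (2 + k))" by (simp add: \<tau>_def)
        then show ?thesis using k by (subst (asm) pos_le_divide_eq) auto
      qed
      have "\<tau> * 1 \<le> \<tau> * k" using k \<open>\<tau> > 0\<close> by (intro mult_left_mono) auto
      then show "\<tau> \<le> 1/10" using 1 by simp
    qed
    have \<tau>2: "\<tau>\<^sup>2 \<le> \<tau> / 10" "\<tau>\<^sup>2 * k \<le> \<tau> / 10"
      using mult_left_mono[OF \<tau>(3), of \<tau>] mult_left_mono[OF \<tau>(2), of \<tau>] \<tau>(1) by (simp_all add: power2_eq_square mult.assoc)
    \<comment> \<open>The bound 1/(24 k) makes \<open>cmod (al.herm u g f)\<close> at most sqrt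
      ((3k/2) / (24 k)) = 1/4. As \<open>cmod (al g f)\<close> is at least 1/2, the tangential part
      \<open>c g f\<close> keeps modulus at least 1/4.\<close>
    have "min (\<tau>\<^sup>2) (1 / (24 * k)) > 0" using \<tau> k by simp
    then obtain f where f: "f \<in> M" "nrm f = 1" and fs: "cmod (al f f) < min (\<tau>\<^sup>2) (1 / (24 * k))"
      using nogap by blast
    obtain g where g: "g \<in> Dom" "nrm g \<le> k" "1/2 \<le> cmod (al g f)" "cmod (al g f) \<le> 3/2" "cmod (al g g) \<le> 3/2 * k"
      using k(2)[OF f] by blast
    have fD: "f \<in> D" "f \<in> Dom" and gD: "g \<in> D" using f g M_D M_Dom Dom_D by auto
    have fs1: "cmod (al f f) \<le> \<tau>\<^sup>2" "cmod (al f f) \<le> 1 / (24 * k)" using fs by auto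
    define c where "c x y = \<i> * (cnj u * al x y - u * cnj (al y x)) / 2" for x y
    let ?b = "al.herm u"
    have uu: "u * cnj u = 1" using u complex_norm_square[of u] by simp
    have bnd: "(b.nrm x)\<^sup>2 \<le> cmod (al x x)" if "x \<in> D" for x
      using complex_Re_le_cmod[of "cnj u * al x x"] u that by (simp only: b.nrm_sq al.herm_self norm_mult complex_mod_cnj)
    have bgf: "cmod (?b g f) \<le> 1/4"
    proof -
      have "(b.nrm g * b.nrm f)\<^sup>2 \<le> (3/2 * k) * (1 / (24 * k))"
        unfolding power_mult_distrib using bnd[OF gD] bnd[OF fD(1)] fs1(2) g(5) k(1)
        by (intro mult_mono) (auto intro: order_trans)
      also have "\<dots> = (1/4)\<^sup>2" using k by (simp add: power2_eq_square)
      finally have "b.nrm g * b.nrm f \<le> 1/4" using fD gD by (simp only: power_mono_iff[of _ "1/4" 2, simplified] mult_nonneg_nonneg b.nrm_ge0)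
      then show ?thesis using b.cauchy_schwarz[OF gD fD(1)] by simp
    qed
    have split: "cnj u * al x y = ?b x y - \<i> * c x y" for x y by (simp add: al.herm_def c_def field_simps)
    have nA: "cmod (al x y) = cmod (?b x y - \<i> * c x y)" for x y
      using u by (simp add: split[symmetric] norm_mult)
    have cgf: "1/4 \<le> cmod (c g f)" "cmod (c g f) \<le> 7/4"
      using norm_triangle_ineq4[of "?b g f" "\<i> * c g f"] norm_triangle_ineq3[of "?b g f" "\<i> * c g f"]
        norm_triangle_ineq2[of "\<i> * c g f" "?b g f"] norm_minus_commute[of "?b g f" "\<i> * c g f"] bgf g nA[of g f]
      by (auto simp: norm_mult)
    \<comment> \<open>This phase aligns the tangential cross terms: the value moves along the
      supporting line by 2 \<tau> \<open>cmod (c g f)\<close> towards the side \<sigma>, up to terms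
      of order \<tau>^2.\<close>
    define \<zeta> where "\<zeta> = of_real \<sigma> * cnj (c g f) / of_real (cmod (c g f))"
    have \<zeta>: "cmod \<zeta> = 1" "\<zeta> * c g f = of_real (\<sigma> * cmod (c g f))"
    proof -
      have ne: "cmod (c g f) \<noteq> 0" using cgf by linarith
      then show "cmod \<zeta> = 1" using \<sigma> by (auto simp: \<zeta>_def norm_divide norm_mult)
      have "cnj (c g f) * c g f = of_real (cmod (c g f)) * of_real (cmod (c g f))"
        using complex_norm_square[of "c g f"] by (simp add: power2_eq_square mult.commute)
      then have "cnj (c g f) * c g f / of_real (cmod (c g f)) = of_real (cmod (c g f))" using ne by simp
      then show "\<zeta> * c g f = of_real (\<sigma> * cmod (c g f))"
        unfolding \<zeta>_def of_real_mult times_divide_eq_left mult.assoc by (simp only: times_divide_eq_right[symmetric])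
    qed
    let ?t = "complex_of_real \<tau> * \<zeta>"
    define F where "F = f + sc ?t g"
    have F: "F \<in> Dom" "F \<in> D" using fD gD g subspace_Dom subspace_add subspace_scale by (auto simp: F_def)
    have ct: "cmod ?t = \<tau>" using \<zeta> \<tau> by (simp add: norm_mult)
    have nF: "1/2 \<le> nrm F" "nrm F \<le> 2"
    proof -
      have "nrm (sc ?t g) = \<tau> * nrm g" using gD by (simp only: nrm_scale ct D_X)
      also have "\<dots> \<le> \<tau> * k" using g \<tau> by (intro mult_left_mono) auto
      finally have "nrm (sc ?t g) \<le> 1/10" using \<tau> by simp
      moreover have "nrm f \<le> nrm F + nrm (sc ?t g)" "nrm F \<le> nrm f + nrm (sc ?t g)"
        using nrm_diff_le[of F "sc ?t g"] nrm_triangle[of f "sc ?t g"] F fD gD by (simp_all add: F_def)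
      ultimately show "1/2 \<le> nrm F" "nrm F \<le> 2" using f by auto
    qed
    have exp: "al F F = al f f + (?t * al g f + cnj ?t * al f g) + of_real (\<tau>\<^sup>2) * al g g"
    proof -
      have "al F F = al f f + (?t * al g f + cnj ?t * al f g) + (?t * cnj ?t) * al g g"
        using fD gD by (simp add: F_def al.a_add al.a_add2 al.a_scale al.a_scale2 algebra_simps)
      then show ?thesis using complex_norm_square[of ?t] ct by simp
    qed
    have cfg: "c f g = cnj (c g f)" by (simp add: c_def algebra_simps)
    have bfg: "?b f g = cnj (?b g f)" using b.ip_cnj[OF gD fD(1)] .
    have Imc: "- Im (cnj u * al x x) = Re (c x x)" for x by (simp add: c_def)
    have "- Im (cnj u * al F F) = - Im (cnj u * al f f) + Re (?t * c g f + cnj ?t * c f g) + \<tau>\<^sup>2 * - Im (cnj u * al g g)"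
    proof -
      have "- Im (?t * (?b g f - \<i> * c g f) + cnj ?t * (?b f g - \<i> * c f g)) = Re (?t * c g f + cnj ?t * c f g)"
        unfolding bfg cfg by (simp add: algebra_simps)
      moreover have "cnj u * (?t * al g f + cnj ?t * al f g) = ?t * (?b g f - \<i> * c g f) + cnj ?t * (?b f g - \<i> * c f g)"
        unfolding split[symmetric] by (simp only: algebra_simps)
      moreover have "cnj u * al F F = cnj u * al f f + cnj u * (?t * al g f + cnj ?t * al f g) + of_real (\<tau>\<^sup>2) * (cnj u * al g g)"
        unfolding exp by (simp only: algebra_simps)
      moreover have "Im (of_real (\<tau>\<^sup>2) * (cnj u * al g g)) = \<tau>\<^sup>2 * Im (cnj u * al g g)"
        by (simp only: Im_complex_of_real Re_complex_of_real times_complex.sel)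
      ultimately show ?thesis by (simp add: right_diff_distrib)
    qed
    also have "Re (?t * c g f + cnj ?t * c f g) = 2 * \<tau> * (\<sigma> * cmod (c g f))"
    proof -
      have "?t * c g f = of_real (\<tau> * (\<sigma> * cmod (c g f)))" using \<zeta>(2) by (simp add: mult.assoc)
      moreover have "cnj ?t * c f g = cnj (?t * c g f)" by (simp add: cfg)
      ultimately show ?thesis by (simp only: complex_cnj_complex_of_real plus_complex.sel Re_complex_of_real)
    qed
    finally have ImF: "- Im (cnj u * al F F) = - Im (cnj u * al f f) + 2 * \<tau> * (\<sigma> * cmod (c g f)) + \<tau>\<^sup>2 * - Im (cnj u * al g g)" .
    have ss: "\<sigma> * \<sigma> = 1" and as: "\<bar>\<sigma>\<bar> = 1" using \<sigma> by auto
    have xi: "\<tau> / 4 \<le> \<sigma> * - Im (cnj u * al F F)"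
    proof -
      have 1: "\<bar>Im (cnj u * al x x)\<bar> \<le> cmod (al x x)" for x
        using abs_Im_le_cmod[of "cnj u * al x x"] u by (simp only: norm_mult complex_mod_cnj, simp?)
      have "\<sigma> * - Im (cnj u * al F F) = - (\<sigma> * Im (cnj u * al f f)) + 2 * \<tau> * ((\<sigma> * \<sigma>) * cmod (c g f)) - \<tau>\<^sup>2 * (\<sigma> * Im (cnj u * al g g))"
        unfolding ImF by (simp only: algebra_simps)
      also have "\<dots> = - (\<sigma> * Im (cnj u * al f f)) + 2 * \<tau> * cmod (c g f) - \<tau>\<^sup>2 * (\<sigma> * Im (cnj u * al g g))"
        unfolding ss by simp
      also have "\<dots> \<ge> - \<tau>\<^sup>2 + 2 * \<tau> * (1/4) - \<tau>\<^sup>2 * (3/2 * k)"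
      proof (intro diff_mono add_mono mult_left_mono)
        have "\<bar>\<sigma> * Im (cnj u * al f f)\<bar> \<le> \<tau>\<^sup>2" using 1[of f] fs1 as by (simp only: abs_mult, simp?)
        then show "- \<tau>\<^sup>2 \<le> - (\<sigma> * Im (cnj u * al f f))" by linarith
        have "\<bar>\<sigma> * Im (cnj u * al g g)\<bar> \<le> 3/2 * k" using 1[of g] g as by (simp only: abs_mult, simp?)
        then show "\<sigma> * Im (cnj u * al g g) \<le> 3/2 * k" by linarith
      qed (use cgf \<tau> in auto)
      moreover have "- \<tau>\<^sup>2 + 2 * \<tau> * (1/4) - \<tau>\<^sup>2 * (3/2 * k) = \<tau> / 2 - \<tau>\<^sup>2 - 3/2 * (\<tau>\<^sup>2 * k)" by simp
      ultimately show ?thesis using \<tau>2 by linarith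
    qed
    have eta: "Re (cnj u * al F F) \<le> (2 + 3 * k) * \<tau>\<^sup>2"
    proof -
      let ?w = "sc ?t g"
      have wD: "?w \<in> D" using gD by simp
      \<comment> \<open>The parallelogram law bounds the height of \<open>F\<close> by the heights
        of f and g, without any cross term of first order in \<tau>.\<close>
      have "(b.nrm F)\<^sup>2 + (b.nrm (f - ?w))\<^sup>2 = 2 * (b.nrm f)\<^sup>2 + 2 * (b.nrm ?w)\<^sup>2"
        using fD wD by (simp add: F_def b.nrm_add_sq b.nrm_diff_sq)
      then have "(b.nrm F)\<^sup>2 \<le> 2 * (b.nrm f)\<^sup>2 + 2 * (b.nrm ?w)\<^sup>2" by (smt (verit) zero_le_power2)
      also have "(b.nrm ?w)\<^sup>2 = \<tau>\<^sup>2 * (b.nrm g)\<^sup>2" using gD by (simp only: b.nrm_scale ct power_mult_distrib)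
      also have "2 * (b.nrm f)\<^sup>2 + 2 * (\<tau>\<^sup>2 * (b.nrm g)\<^sup>2) \<le> 2 * \<tau>\<^sup>2 + 2 * (\<tau>\<^sup>2 * (3/2 * k))"
        using bnd[OF fD(1)] bnd[OF gD] fs1 g by (intro add_mono mult_left_mono) auto
      finally show ?thesis using F by (simp add: b.nrm_sq al.herm_self algebra_simps)
    qed
    have abs: "cmod (al F F) \<le> \<epsilon> / 4"
    proof -
      have fg: "cmod (al f g) \<le> 2"
        using norm_triangle_ineq4[of "?b f g" "\<i> * c f g"] bgf cgf(2) nA[of f g] by (simp add: bfg cfg norm_mult)
      have "cmod (al F F) \<le> cmod (al f f) + (\<tau> * cmod (al g f) + \<tau> * cmod (al f g)) + \<tau>\<^sup>2 * cmod (al g g)"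
      proof -
        have "cmod (al F F) \<le> cmod (al f f) + (cmod (?t * al g f) + cmod (cnj ?t * al f g)) + cmod (of_real (\<tau>\<^sup>2) * al g g)"
          unfolding exp by (intro norm_triangle_le add_mono order_refl)
        then show ?thesis by (simp only: norm_mult complex_mod_cnj norm_of_real \<zeta>(1)) (use \<tau> in simp)
      qed
      also have "\<dots> \<le> \<tau>\<^sup>2 + (\<tau> * (3/2) + \<tau> * 2) + \<tau>\<^sup>2 * (3/2 * k)"
        using fs1 g fg \<tau> by (intro add_mono mult_left_mono) auto
      also have "\<dots> \<le> \<tau> * (6 * (2 + k))"
      proof -
        have "0 \<le> \<tau> * k" using \<tau> k by simp
        then show ?thesis using \<tau>2 \<tau>(1) by (simp add: algebra_simps)
      qed
      also have "\<dots> \<le> \<epsilon> / 4" using \<tau>(4) by (simp add: algebra_simps)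
      finally show ?thesis .
    qed
    let ?c = "complex_of_real (1 / nrm F)"
    have n0: "nrm F > 0" using nF by linarith
    have cc: "cmod ?c = 1 / nrm F" using n0 by (simp only: norm_of_real, simp?)
    define G where "G = sc ?c F"
    have GD: "G \<in> Dom" using F subspace_Dom subspace_scale by (auto simp: G_def)
    have G1: "nrm G = 1" unfolding G_def using F n0 by (simp only: nrm_scale D_X cc, simp?)
    define q where "q = (1 / nrm F)\<^sup>2"
    have q: "1/4 \<le> q" "q \<le> 4"
    proof -
      have "1/2 \<le> 1 / nrm F" "1 / nrm F \<le> 2" using nF n0 by (auto simp: field_simps)
      then have "(1/2)\<^sup>2 \<le> q" "q \<le> 2\<^sup>2" unfolding q_def by (intro power_mono; simp add: n0 less_imp_le)+
      then show "1/4 \<le> q" "q \<le> 4" by (auto simp: power2_eq_square)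
    qed
    have alG: "al G G = of_real q * al F F" unfolding G_def al.a_self_scale[OF F(2)] cc q_def ..
    have cu: "cnj u * al G G = of_real q * (cnj u * al F F)" unfolding alG by (simp only: algebra_simps)
    have ReG: "Re (cnj u * al G G) = q * Re (cnj u * al F F)" and ImG: "Im (cnj u * al G G) = q * Im (cnj u * al F F)"
      unfolding cu by (simp_all only: times_complex.sel Re_complex_of_real Im_complex_of_real, simp_all?)
    have "cmod (al G G) \<le> \<epsilon>"
    proof -
      have "cmod (al G G) = q * cmod (al F F)" unfolding alG using q by (simp add: norm_mult)
      also have "\<dots> \<le> 4 * (\<epsilon> / 4)" using q abs by (intro mult_mono) auto
      finally show ?thesis by simp
    qed
    moreover have "\<sigma> * - Im (cnj u * al G G) > 0"
    proof -
      have "0 < q * (\<sigma> * - Im (cnj u * al F F))" using q xi \<tau>(1) by (intro mult_pos_pos[of q]) linarith+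
      then show ?thesis unfolding ImG by (simp only: algebra_simps)
    qed
    moreover have "Re (cnj u * al G G) \<le> C * (Im (cnj u * al G G))\<^sup>2"
    proof -
      have "(\<tau> / 4)\<^sup>2 \<le> (\<sigma> * - Im (cnj u * al F F))\<^sup>2" using xi \<tau> by (intro power_mono) auto
      also have "\<dots> = (Im (cnj u * al F F))\<^sup>2" unfolding power_mult_distrib power2_minus using \<sigma> by (elim disjE) simp_all
      finally have I: "\<tau>\<^sup>2 / 16 \<le> (Im (cnj u * al F F))\<^sup>2" by (simp add: power_divide)
      have "q * Re (cnj u * al F F) \<le> q * ((2 + 3 * k) * \<tau>\<^sup>2)" using eta q by (intro mult_left_mono) auto
      also have "\<dots> = 16 * (2 + 3 * k) * q * (\<tau>\<^sup>2 / 16)" by simp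
      also have "\<dots> \<le> 16 * (2 + 3 * k) * q * (Im (cnj u * al F F))\<^sup>2" using I q k by (intro mult_left_mono) auto
      also have "\<dots> \<le> 16 * (2 + 3 * k) * q * (4 * q * (Im (cnj u * al F F))\<^sup>2)"
      proof (rule mult_left_mono)
        have "1 * (Im (cnj u * al F F))\<^sup>2 \<le> 4 * q * (Im (cnj u * al F F))\<^sup>2" using q by (intro mult_right_mono) auto
        then show "(Im (cnj u * al F F))\<^sup>2 \<le> 4 * q * (Im (cnj u * al F F))\<^sup>2" by simp
      qed (use q k in auto)
      also have "\<dots> = C * (q * Im (cnj u * al F F))\<^sup>2" unfolding C_def power2_eq_square by (simp only: mult.assoc mult.left_commute mult.commute numeral_times_numeral mult_numeral_1)
      finally show ?thesis unfolding ReG ImG .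
    qed
    ultimately show ?thesis using GD G1 by blast
  qed
  then show ?thesis using C by (intro exI[of _ C]) auto
qed

text \<open>Values of unit vectors come arbitrarily close to lam, but on M they keep a distance
  \<delta>; a unit vector whose value is near lam must therefore have a component in N. For the
  direction, the convex set of values on M misses a disc around 0 and is strictly separated from
  0.\<close>

lemma gap_conclusion:
  assumes \<delta>: "\<delta> > 0" and gap: "\<And>f. \<lbrakk>f \<in> M; nrm f = 1\<rbrakk> \<Longrightarrow> \<delta> \<le> cmod (al f f)"
    and cl: "lam \<in> closure numr"
  shows "(\<exists>f\<in>N. nrm f \<noteq> 0) \<and> (\<exists>w. Re w \<noteq> 0 \<and> (\<forall>f\<in>D. 0 \<le> Re (cnj w * al f f)))"
proof
  obtain z where z: "z \<in> numr" "dist z lam < \<delta>" using cl \<delta> by (auto simp: closure_approachable)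
  then obtain f where f: "f \<in> Dom" "nrm f = 1" "z = a f f" by (auto simp: numr_def)
  have fD: "f \<in> D" using f Dom_D by blast
  have small: "cmod (al f f) < \<delta>" using z f fD by (simp add: al_def ip_self dist_norm)
  obtain n m where nm: "n \<in> N" "m \<in> M" "f = n + m" "al f f = al m m" using decompose[OF f(1)] by blast
  have nmD: "n \<in> D" "m \<in> D" using nm N_D M_D by auto
  have "nrm n \<noteq> 0"
  proof
    assume "nrm n = 0"
    then have "nrm m = 1" using nrm_eqI[of f m] f nm nmD by simp
    then show False using gap[OF nm(2)] small nm by simp
  qed
  then show "\<exists>f\<in>N. nrm f \<noteq> 0" using nm by blast
next
  define K where "K = {al f f |f. f \<in> M \<and> nrm f = 1}"
  have MD: "M \<subseteq> D" using M_D by blast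
  have cvx: "convex K" unfolding K_def by (rule convex_values[OF subspace_M MD])
  have K: "\<delta> \<le> cmod z" if "z \<in> K" for z using that gap by (auto simp: K_def)
  have "0 \<notin> closure K"
  proof
    assume "0 \<in> closure K"
    then obtain z where "z \<in> K" "dist z 0 < \<delta>" using \<delta> unfolding closure_approachable by blast
    then show False using K by force
  qed
  then obtain w0 \<beta> where w0: "\<beta> > 0" "\<And>z. z \<in> closure K \<Longrightarrow> w0 \<bullet> z > \<beta>"
    using separating_hyperplane_closed_0[OF convex_closure[OF cvx] closed_closure] by blast
  have inner: "w0 \<bullet> z = Re (cnj w0 * z)" for z by (simp add: inner_complex_def)
  have Kp: "Re (cnj w0 * z) > \<beta>" if "z \<in> K" for z using w0(2)[of z] that closure_subset[of K] inner by auto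
  \<comment> \<open>A margin for tilting: the values have real part at least \<gamma> - Re lam, so
    adding \<eta> to a purely imaginary \<open>w0\<close> costs at most the separation margin
    \<beta>.\<close>
  define \<eta> where "\<eta> = \<beta> / (1 + \<bar>\<gamma> - Re lam\<bar>)"
  have \<eta>: "\<eta> > 0" "\<eta> * (1 + \<bar>\<gamma> - Re lam\<bar>) = \<beta>" using w0(1) by (auto simp: \<eta>_def add_pos_nonneg)
  define w where "w = (if Re w0 \<noteq> 0 then w0 else w0 + of_real \<eta>)"
  have wne: "Re w \<noteq> 0" using \<eta> by (simp add: w_def)
  have wK: "0 \<le> Re (cnj w * z)" if z: "z \<in> K" for z
  proof (cases "Re w0 \<noteq> 0")
    case True
    then show ?thesis using Kp[OF z] w0(1) by (simp add: w_def)
  next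
    case False
    obtain f where f: "f \<in> M" "nrm f = 1" "z = al f f" using z by (auto simp: K_def)
    have "Re z = Re (a f f) - Re lam" using f M_D[OF f(1)] by (simp add: al_def ip_self)
    moreover have "\<gamma> \<le> Re (a f f)" using Re_a_ge[OF M_D[OF f(1)]] f by simp
    ultimately have "- (1 + \<bar>\<gamma> - Re lam\<bar>) \<le> Re z" by linarith
    then have "\<eta> * - (1 + \<bar>\<gamma> - Re lam\<bar>) \<le> \<eta> * Re z" using \<eta> by (intro mult_left_mono) auto
    then have "- \<beta> \<le> \<eta> * Re z" using \<eta>(2) by (simp add: algebra_simps)
    moreover have "Re (cnj w * z) = Re (cnj w0 * z) + \<eta> * Re z" using False by (simp add: w_def algebra_simps)
    ultimately show ?thesis using Kp[OF z] by linarith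
  qed
  have "0 \<le> Re (cnj w * al f f)" if f: "f \<in> Dom" for f
  proof -
    obtain n m where nm: "n \<in> N" "m \<in> M" "f = n + m" "al f f = al m m" using decompose[OF f] by blast
    have "0 \<le> Re (cnj w * al m m)"
      by (rule scaled_support[OF subspace_M MD _ nm(2)]) (use wK in \<open>auto simp: K_def\<close>)
    then show ?thesis using nm by simp
  qed
  then show "\<exists>w. Re w \<noteq> 0 \<and> (\<forall>f\<in>D. 0 \<le> Re (cnj w * al f f))" using wne support_extend by blast
qed

end

section \<open>Curvature of plane convex sets\<close>

text \<open>S may be neither closed nor solid. If lam is a relative interior point, S has empty
  interior and a line containing it supports it; otherwise the supporting hyperplane theorem on the
  relative boundary applies.\<close>

lemma frontier_support:
  fixes S :: "complex set"
  assumes S: "convex S" and lam: "lam \<in> frontier S"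
  obtains u where "cmod u = 1" "\<And>z. z \<in> S \<Longrightarrow> 0 \<le> Re (cnj u * (z - lam))"
proof -
  obtain a where a: "a \<noteq> 0" "\<And>z. z \<in> S \<Longrightarrow> a \<bullet> lam \<le> a \<bullet> z"
  proof (cases "lam \<in> rel_interior S")
    case True
    have "interior S = {}"
      using lam True interior_rel_interior_gen[of S] by (auto simp: frontier_def split: if_splits)
    then obtain a b where a: "a \<noteq> 0" "S \<subseteq> {x. a \<bullet> x = b}" using empty_interior_subset_hyperplane S by blast
    have "lam \<in> S" using True rel_interior_subset by blast
    then have "a \<bullet> lam \<le> a \<bullet> z" if "z \<in> S" for z using a(2) that by (auto simp: subset_iff)
    then show ?thesis using that a(1) by blast
  next
    case False
    have "lam \<in> closure S" using lam by (simp add: frontier_def)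
    then obtain a where "a \<noteq> 0" "\<And>y. y \<in> closure S \<Longrightarrow> a \<bullet> lam \<le> a \<bullet> y"
      using supporting_hyperplane_relative_frontier[OF S _ False] by metis
    then show ?thesis using that closure_subset by (meson subsetD)
  qed
  have "0 \<le> Re (cnj (a / of_real (cmod a)) * (z - lam))" if "z \<in> S" for z
  proof -
    have "0 \<le> a \<bullet> (z - lam)" using a(2)[OF that] by (simp add: inner_diff_right)
    also have "\<dots> = Re (cnj a * (z - lam))" by (simp add: inner_complex_def)
    finally have "0 \<le> Re (cnj a * (z - lam)) / cmod a" by simp
    also have "\<dots> = Re (cnj a * (z - lam) / of_real (cmod a))" by (simp only: Re_divide_of_real)
    finally show ?thesis by simp
  qed
  moreover have "cmod (a / of_real (cmod a)) = 1" using a by (simp add: norm_divide)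
  ultimately show ?thesis using that by blast
qed

lemma tendsto_SUP_at_right:
  fixes F :: "real \<Rightarrow> ereal"
  assumes "\<And>x y. \<lbrakk>0 < x; x \<le> y\<rbrakk> \<Longrightarrow> F y \<le> F x"
  shows "(F \<longlongrightarrow> (SUP x\<in>{0<..}. F x)) (at_right 0)"
proof (rule order_tendstoI)
  fix a assume "a < (SUP x\<in>{0<..}. F x)"
  then obtain x where x: "x > 0" "a < F x" by (auto simp: less_SUP_iff)
  have "a < F y" if "y > 0" "y < x" for y using assms[of y x] that x by auto
  then show "\<forall>\<^sub>F x in at_right 0. a < F x" using x by (auto simp: eventually_at_right_field)
next
  fix a assume a: "(SUP x\<in>{0<..}. F x) < a"
  have "F y < a" if "y > 0" for y using SUP_upper[of y "{0<..}" F] a that by auto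
  then show "\<forall>\<^sub>F x in at_right 0. F x < a" by (auto simp: eventually_at_right_field intro: exI[of _ 1])
qed

text \<open>\<open>Lim\<close> carries information only when the limit exists. The infima increase
  as the sets shrink, so the limit is their supremum, and one good point in each set bounds
  it.\<close>

lemma Lim_INF_le:
  fixes E :: "real \<Rightarrow> complex set" and h :: "complex \<Rightarrow> ereal"
  assumes mono: "\<And>x y. \<lbrakk>0 < x; x \<le> y\<rbrakk> \<Longrightarrow> E x \<subseteq> E y"
    and le: "\<And>e. e > 0 \<Longrightarrow> \<exists>z\<in>E e. h z \<le> C"
  shows "Lim (at_right (0::real)) (\<lambda>e. INF z\<in>E e. h z) \<le> C"
proof -
  have "((\<lambda>e. INF z\<in>E e. h z) \<longlongrightarrow> (SUP x\<in>{0<..}. INF z\<in>E x. h z)) (at_right 0)"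
    by (rule tendsto_SUP_at_right) (use mono in \<open>auto intro: INF_superset_mono\<close>)
  then have "Lim (at_right (0::real)) (\<lambda>e. INF z\<in>E e. h z) = (SUP x\<in>{0<..}. INF z\<in>E x. h z)"
    by (intro tendsto_Lim) auto
  also have "\<dots> \<le> C"
  proof (rule SUP_least)
    fix x :: real assume "x \<in> {0<..}"
    then obtain z where "z \<in> E x" "h z \<le> C" using le by auto
    then show "(INF z\<in>E x. h z) \<le> C" by (rule INF_lower2)
  qed
  finally show ?thesis .
qed

text \<open>Slide z towards the supporting line as far as \<Omega> permits. The last admissible
  point is on the frontier, with unchanged tangential coordinate and no greater height.\<close>

lemma frontier_below:
  fixes \<Omega> :: "complex set"
  assumes cl: "closed \<Omega>" and z: "z \<in> \<Omega>" and u: "cmod u = 1"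
    and supp: "\<And>z. z \<in> \<Omega> \<Longrightarrow> 0 \<le> Re ((z - lam) * cnj u)"
  obtains t where "0 \<le> t" "t \<le> Re ((z - lam) * cnj u)" "z - of_real t * u \<in> frontier \<Omega>"
proof -
  have uu: "u * cnj u = 1" using u complex_norm_square[of u] by simp
  have eta: "Re ((z - of_real t * u - lam) * cnj u) = Re ((z - lam) * cnj u) - t" for t
  proof -
    have "(z - of_real t * u - lam) * cnj u = (z - lam) * cnj u - of_real t * (u * cnj u)" by (simp add: algebra_simps)
    then show ?thesis unfolding uu by simp
  qed
  define T where "T = {t \<in> {0..Re ((z - lam) * cnj u)}. z - of_real t * u \<in> \<Omega>}"
  have "continuous_on UNIV (\<lambda>t. z - complex_of_real t * u)" by (intro continuous_intros)
  then have "closed ((\<lambda>t. z - complex_of_real t * u) -` \<Omega>)" using cl by (simp add: continuous_closed_vimage continuous_on_eq_continuous_at)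
  moreover have "T = {0..Re ((z - lam) * cnj u)} \<inter> ((\<lambda>t. z - complex_of_real t * u) -` \<Omega>)" by (auto simp: T_def)
  ultimately have "compact T" by (simp add: compact_Int_closed)
  moreover have "0 \<in> T" using z supp by (simp add: T_def)
  ultimately obtain t where t: "t \<in> T" "\<And>s. s \<in> T \<Longrightarrow> s \<le> t"
    using compact_attains_sup[of T] by blast
  have "z - of_real t * u \<notin> interior \<Omega>"
  proof
    assume "z - of_real t * u \<in> interior \<Omega>"
    then obtain e where e: "e > 0" "ball (z - of_real t * u) e \<subseteq> \<Omega>" by (meson mem_interior)
    let ?s = "t + e/2"
    have "z - of_real ?s * u \<in> ball (z - of_real t * u) e" using e u by (simp add: dist_norm algebra_simps norm_mult)
    then have m: "z - of_real ?s * u \<in> \<Omega>" using e by blast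
    have "?s \<in> T" using supp[OF m] t(1) e m unfolding eta by (simp add: T_def)
    then show False using t(2)[of ?s] e by simp
  qed
  then have "z - of_real t * u \<in> frontier \<Omega>" using t cl by (simp add: T_def frontier_def)
  then show ?thesis using that t by (auto simp: T_def)
qed

text \<open>Sliding the given points down to the frontier keeps \<xi> and does not raise \<eta>, so
  the bound C on the quotient survives. Both signs \<sigma> are demanded because infinite curvature
  on one side is already unilateral.\<close>

lemma unilateral_curvature_finite:
  fixes \<Omega> :: "complex set"
  assumes cl: "closed \<Omega>" and u: "cmod (eta_dir \<Omega> lam) = 1"
    and supp: "\<And>z. z \<in> \<Omega> \<Longrightarrow> 0 \<le> eta_coord \<Omega> lam z"
    and par: "\<And>\<sigma> \<epsilon>. \<lbrakk>\<sigma> = 1 \<or> \<sigma> = -1; \<epsilon> > 0\<rbrakk> \<Longrightarrow> \<exists>z\<in>\<Omega>. cmod (z - lam) \<le> \<epsilon> \<and>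
       \<sigma> * xi_coord \<Omega> lam z > (0::real) \<and> eta_coord \<Omega> lam z \<le> C * (xi_coord \<Omega> lam z)\<^sup>2"
  shows "\<not> unilateral_infinite_curvature \<Omega> lam"
proof -
  let ?u = "eta_dir \<Omega> lam"
  have uu: "?u * cnj ?u = 1" using u complex_norm_square[of ?u] by simp
  have xi': "xi_coord \<Omega> lam w = - Im ((w - lam) * cnj ?u)" for w by (simp add: xi_coord_def algebra_simps)
  have nsq: "(xi_coord \<Omega> lam z)\<^sup>2 + (eta_coord \<Omega> lam z)\<^sup>2 = (cmod (z - lam))\<^sup>2" for z
  proof -
    have "(xi_coord \<Omega> lam z)\<^sup>2 + (eta_coord \<Omega> lam z)\<^sup>2 = (cmod ((z - lam) * cnj ?u))\<^sup>2"
      unfolding xi' eta_coord_def cmod_power2 by (simp only: power2_minus add.commute)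
    then show ?thesis using u by (simp add: norm_mult)
  qed
  have main: "\<exists>z\<in>{z \<in> frontier \<Omega>. (xi_coord \<Omega> lam z)\<^sup>2 + (eta_coord \<Omega> lam z)\<^sup>2 \<le> \<epsilon>\<^sup>2
                  \<and> xi_coord \<Omega> lam z \<noteq> 0 \<and> \<sigma> * xi_coord \<Omega> lam z > 0}.
       ereal (eta_coord \<Omega> lam z / (xi_coord \<Omega> lam z)\<^sup>2) \<le> ereal C"
    if \<sigma>: "\<sigma> = 1 \<or> \<sigma> = -1" and \<epsilon>: "\<epsilon> > 0" for \<sigma> \<epsilon> :: real
  proof -
    obtain z where z: "z \<in> \<Omega>" "cmod (z - lam) \<le> \<epsilon>" "\<sigma> * xi_coord \<Omega> lam z > 0" "eta_coord \<Omega> lam z \<le> C * (xi_coord \<Omega> lam z)\<^sup>2"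
      using par[OF \<sigma> \<epsilon>] by blast
    obtain t where t: "0 \<le> t" "t \<le> eta_coord \<Omega> lam z" "z - of_real t * ?u \<in> frontier \<Omega>"
      using frontier_below[OF cl z(1) u, of lam] supp by (auto simp: eta_coord_def)
    let ?z = "z - of_real t * ?u"
    have e: "(?z - lam) * cnj ?u = (z - lam) * cnj ?u - of_real t"
    proof -
      have "(?z - lam) * cnj ?u = (z - lam) * cnj ?u - of_real t * (?u * cnj ?u)" by (simp add: algebra_simps)
      then show ?thesis unfolding uu by simp
    qed
    have eta: "eta_coord \<Omega> lam ?z = eta_coord \<Omega> lam z - t" unfolding eta_coord_def e by simp
    have xi: "xi_coord \<Omega> lam ?z = xi_coord \<Omega> lam z" unfolding xi' e by simp
    have ne: "xi_coord \<Omega> lam z \<noteq> 0" using z by auto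
    have "(xi_coord \<Omega> lam ?z)\<^sup>2 + (eta_coord \<Omega> lam ?z)\<^sup>2 \<le> (xi_coord \<Omega> lam z)\<^sup>2 + (eta_coord \<Omega> lam z)\<^sup>2"
      unfolding eta xi using t by (intro add_left_mono power_mono) auto
    also have "\<dots> \<le> \<epsilon>\<^sup>2" unfolding nsq using z by (intro power_mono) auto
    finally have 1: "(xi_coord \<Omega> lam ?z)\<^sup>2 + (eta_coord \<Omega> lam ?z)\<^sup>2 \<le> \<epsilon>\<^sup>2" .
    have "eta_coord \<Omega> lam ?z / (xi_coord \<Omega> lam ?z)\<^sup>2 \<le> C"
      unfolding eta xi using z t ne by (simp add: divide_le_eq)
    then show ?thesis using 1 t(3) z(3) ne xi by (intro bexI[of _ ?z]) auto
  qed
  have mono: "x\<^sup>2 \<le> y\<^sup>2" if "0 < x" "x \<le> y" for x y :: real using that by (simp add: power_mono)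
  have "gamma_l_plus \<Omega> lam \<le> ereal C"
    unfolding gamma_l_plus_def by (rule Lim_INF_le) (use mono main[of 1] in \<open>auto intro: order_trans\<close>)
  moreover have "gamma_l_minus \<Omega> lam \<le> ereal C"
    unfolding gamma_l_minus_def by (rule Lim_INF_le) (use mono main[of "-1"] in \<open>auto intro: order_trans\<close>)
  ultimately show ?thesis by (auto simp: unilateral_infinite_curvature_def)
qed

section \<open>From infinite curvature to a kernel vector\<close>

context spectral_point
begin

lemma al_unit: "\<lbrakk>f \<in> D; nrm f = 1\<rbrakk> \<Longrightarrow> al f f = a f f - lam"
  by (simp add: al_def ip_self)

lemma convex_numr: "convex numr"
proof -
  have "numr = (\<lambda>z. lam + z) ` {al f f |f. f \<in> Dom \<and> nrm f = 1}"
    using Dom_D al_unit by (force simp: numr_def image_def)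
  then show ?thesis using convex_values[OF subspace_Dom Dom_D] by (simp add: convex_translation)
qed

lemma support_Dom:
  assumes u: "\<And>z. z \<in> numr \<Longrightarrow> 0 \<le> Re (cnj u * (z - lam))" and f: "f \<in> Dom"
  shows "0 \<le> Re (cnj u * al f f)"
proof (rule scaled_support[OF subspace_Dom Dom_D _ f])
  fix f assume "f \<in> Dom" "nrm f = 1"
  then have "a f f \<in> numr" "al f f = a f f - lam" using Dom_D al_unit by (auto simp: numr_def)
  then show "0 \<le> Re (cnj u * al f f)" using u by simp
qed

text \<open>Both cases lead to a gap on M: at a corner through two transversal supporting lines,
  elsewhere because without a gap the points of \<open>no_gap_parabola\<close> would bound the
  curvature on both sides.\<close>

theorem infinite_curvature_kernel:
  assumes Rc: "\<And>s x. \<lbrakk>\<And>n. s n \<in> Rng; x \<in> X; (\<lambda>n. nrm (s n - x)) \<longlonglongrightarrow> 0\<rbrakk> \<Longrightarrow> x \<in> Rng"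
    and fr: "lam \<in> frontier numr" and curv: "unilateral_infinite_curvature (closure numr) lam"
  shows "(\<exists>f\<in>N. nrm f \<noteq> 0) \<and> (\<exists>w. Re w \<noteq> 0 \<and> (\<forall>f\<in>D. 0 \<le> Re (cnj w * al f f)))"
proof -
  let ?\<Omega> = "closure numr"
  have cl: "lam \<in> ?\<Omega>" using fr by (simp add: frontier_def)
  have pt: "closed_range_point sc X ip D a \<kappa> \<gamma> lam u"
    if "cmod u = 1" "\<And>z. z \<in> numr \<Longrightarrow> 0 \<le> Re (cnj u * (z - lam))" for u
    by unfold_locales (use Rc that support_Dom in blast)+
  have numr_cl: "z \<in> ?\<Omega>" if "z \<in> numr" for z using that closure_subset by blast
  show ?thesis
  proof (cases "corner_point ?\<Omega> lam")
    case True
    then obtain L1 L2 where L: "supporting_line ?\<Omega> lam L1" "supporting_line ?\<Omega> lam L2" "L1 \<noteq> L2"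
      by (auto simp: corner_point_def)
    obtain u1 where u1: "cmod u1 = 1" "L1 = {z. Re ((z - lam) * cnj u1) = 0}" "?\<Omega> \<subseteq> {z. Re ((z - lam) * cnj u1) \<ge> 0}"
      using L(1) unfolding supporting_line_def by auto
    obtain u2 where u2: "cmod u2 = 1" "L2 = {z. Re ((z - lam) * cnj u2) = 0}" "?\<Omega> \<subseteq> {z. Re ((z - lam) * cnj u2) \<ge> 0}"
      using L(2) unfolding supporting_line_def by auto
    \<comment> \<open>Parallel unit normals would define the same line.\<close>
    have ne: "Im (cnj u1 * u2) \<noteq> 0"
    proof
      assume "Im (cnj u1 * u2) = 0"
      then obtain r where r: "cnj u1 * u2 = of_real r" by (metis complex_is_Real_iff Reals_cases)
      have "r \<noteq> 0" using r u1(1) u2(1) by auto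
      have "u1 * (cnj u1 * u2) = u2" using u1(1) complex_norm_square[of u1] by (simp flip: mult.assoc)
      then have "u2 = of_real r * u1" unfolding r by (simp add: mult.commute)
      then have "Re ((z - lam) * cnj u2) = r * Re ((z - lam) * cnj u1)" for z by (simp add: algebra_simps)
      then have "L1 = L2" using u1(2) u2(2) \<open>r \<noteq> 0\<close> by simp
      then show False using L by blast
    qed
    have s1: "0 \<le> Re (cnj u1 * (z - lam))" and s2: "0 \<le> Re (cnj u2 * (z - lam))" if "z \<in> numr" for z
      using u1(3) u2(3) numr_cl[OF that] by (auto simp: mult.commute)
    interpret closed_range_point sc X ip D a \<kappa> \<gamma> lam u1 by (rule pt[OF u1(1) s1])
    show ?thesis
      using corner_gap[OF support_Dom[OF s2] ne] gap_conclusion cl by blast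
  next
    case False
    let ?u = "eta_dir ?\<Omega> lam"
    obtain v where v: "cmod v = 1" "\<And>z. z \<in> numr \<Longrightarrow> 0 \<le> Re (cnj v * (z - lam))"
      using frontier_support[OF convex_numr fr] by blast
    have "closed {z. Re ((z - lam) * cnj v) \<ge> 0}"
      by (intro closed_Collect_le continuous_intros)
    then have "?\<Omega> \<subseteq> {z. Re ((z - lam) * cnj v) \<ge> 0}"
      using v(2) by (intro closure_minimal) (auto simp: mult.commute)
    then have "\<exists>u. cmod u = 1 \<and> ?\<Omega> \<subseteq> {z. Re ((z - lam) * cnj u) \<ge> 0}" using v(1) by blast
    \<comment> \<open>A supporting half-plane of the numerical range passes to its closure, so the
      choice in \<open>eta_dir\<close> is not vacuous and \<open>?u\<close> is an inner
      normal.\<close>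
    then have ue: "cmod ?u = 1" "?\<Omega> \<subseteq> {z. Re ((z - lam) * cnj ?u) \<ge> 0}"
      unfolding eta_dir_def using False someI_ex[of "\<lambda>u. cmod u = 1 \<and> ?\<Omega> \<subseteq> {z. Re ((z - lam) * cnj u) \<ge> 0}"] by simp_all
    have s: "0 \<le> Re (cnj ?u * (z - lam))" if "z \<in> numr" for z
      using ue(2) numr_cl[OF that] by (auto simp: mult.commute)
    interpret closed_range_point sc X ip D a \<kappa> \<gamma> lam ?u by (rule pt[OF ue(1) s])
    have "\<exists>\<delta>>0. \<forall>f\<in>M. nrm f = 1 \<longrightarrow> \<delta> \<le> cmod (al f f)"
    proof (rule ccontr)
      assume "\<not> ?thesis"
      then have "\<And>\<delta>. \<delta> > 0 \<Longrightarrow> \<exists>f\<in>M. nrm f = 1 \<and> cmod (al f f) < \<delta>" by (meson not_le)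
      from no_gap_parabola[OF this] obtain C where C: "C > 0"
        "\<forall>\<sigma>\<in>{1,-1::real}. \<forall>\<epsilon>>0. \<exists>F\<in>Dom. nrm F = 1 \<and> cmod (al F F) \<le> \<epsilon> \<and>
           \<sigma> * - Im (cnj ?u * al F F) > 0 \<and> Re (cnj ?u * al F F) \<le> C * (Im (cnj ?u * al F F))\<^sup>2" by blast
      have "\<not> unilateral_infinite_curvature ?\<Omega> lam"
      proof (rule unilateral_curvature_finite[where C = C])
        show "0 \<le> eta_coord ?\<Omega> lam z" if "z \<in> ?\<Omega>" for z using ue(2) that by (auto simp: eta_coord_def)
        fix \<sigma> \<epsilon> :: real assume se: "\<sigma> = 1 \<or> \<sigma> = -1" "\<epsilon> > 0"
        obtain F where F: "F \<in> Dom" "nrm F = 1" "cmod (al F F) \<le> \<epsilon>"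
           "\<sigma> * - Im (cnj ?u * al F F) > 0" "Re (cnj ?u * al F F) \<le> C * (Im (cnj ?u * al F F))\<^sup>2"
          using C(2) se by blast
        have FD: "F \<in> D" using F Dom_D by blast
        have al: "al F F = a F F - lam" using al_unit[OF FD F(2)] .
        have eta: "eta_coord ?\<Omega> lam (a F F) = Re (cnj ?u * al F F)" by (simp add: eta_coord_def al algebra_simps)
        have xi: "xi_coord ?\<Omega> lam (a F F) = - Im (cnj ?u * al F F)" by (simp add: xi_coord_def al algebra_simps)
        have "a F F \<in> ?\<Omega>" using F numr_cl by (auto simp: numr_def)
        then show "\<exists>z\<in>?\<Omega>. cmod (z - lam) \<le> \<epsilon> \<and> \<sigma> * xi_coord ?\<Omega> lam z > 0 \<and> eta_coord ?\<Omega> lam z \<le> C * (xi_coord ?\<Omega> lam z)\<^sup>2"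
          using F by (intro bexI[of _ "a F F"]) (simp_all only: eta xi power2_minus, simp_all add: al)
      qed (use ue in auto)
      then show False using curv by blast
    qed
    then show ?thesis using gap_conclusion cl by blast
  qed
qed

end

section \<open>The space L2\<close>

definition fsc :: "complex \<Rightarrow> ('x \<Rightarrow> complex) \<Rightarrow> 'x \<Rightarrow> complex" where "fsc c f = (\<lambda>x. c * f x)"

lemma vector_space_fsc: "vector_space fsc"
  by unfold_locales (auto simp: fsc_def fun_eq_iff algebra_simps)

lemma L2_measurable [measurable_dest]: "f \<in> L2 \<Longrightarrow> f \<in> borel_measurable lebesgue"
  and L2_square: "f \<in> L2 \<Longrightarrow> integrable lebesgue (\<lambda>x. (cmod (f x))\<^sup>2)"
  by (simp_all add: L2_def)

lemma integrable_product:
  fixes f g :: "'a \<Rightarrow> complex"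
  assumes [measurable]: "f \<in> borel_measurable M" "g \<in> borel_measurable M"
    and "integrable M (\<lambda>x. (cmod (f x))\<^sup>2)" "integrable M (\<lambda>x. (cmod (g x))\<^sup>2)"
  shows "integrable M (\<lambda>x. f x * g x)"
proof (rule Bochner_Integration.integrable_bound)
  show "integrable M (\<lambda>x. (cmod (f x))\<^sup>2 + (cmod (g x))\<^sup>2)" using assms by simp
  have "cmod (f x) * cmod (g x) \<le> (cmod (f x))\<^sup>2 + (cmod (g x))\<^sup>2" for x
  proof -
    have "2 * (cmod (f x) * cmod (g x)) \<le> (cmod (f x))\<^sup>2 + (cmod (g x))\<^sup>2"
      using sum_squares_bound[of "cmod (f x)" "cmod (g x)"] by simp
    moreover have "0 \<le> cmod (f x) * cmod (g x)" by simp
    ultimately show ?thesis by linarith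
  qed
  then show "AE x in M. norm (f x * g x) \<le> norm ((cmod (f x))\<^sup>2 + (cmod (g x))\<^sup>2)"
    by (simp add: norm_mult)
qed simp

lemma L2_mult: "\<lbrakk>f \<in> L2; g \<in> L2\<rbrakk> \<Longrightarrow> integrable lebesgue (\<lambda>x. f x * g x)"
  by (intro integrable_product) (auto simp: L2_def)

lemma L2_cnj: "f \<in> L2 \<Longrightarrow> (\<lambda>x. cnj (f x)) \<in> L2"
  using borel_measurable_continuous_onI[OF continuous_on_cnj[OF continuous_on_id], THEN measurable_compose[rotated]]
  by (auto simp: L2_def)

lemma L2_mult_cnj: "\<lbrakk>f \<in> L2; g \<in> L2\<rbrakk> \<Longrightarrow> integrable lebesgue (\<lambda>x. f x * cnj (g x))"
  using L2_mult[OF _ L2_cnj] by blast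

lemma L2_bound:
  assumes "g \<in> L2" "f \<in> borel_measurable lebesgue" "AE x in lebesgue. cmod (f x) \<le> cmod (g x)"
  shows "f \<in> L2"
proof -
  have [measurable]: "f \<in> borel_measurable lebesgue" by fact
  have "integrable lebesgue (\<lambda>x. (cmod (f x))\<^sup>2)"
    by (rule Bochner_Integration.integrable_bound[OF L2_square[OF assms(1)]])
      (use assms(3) in \<open>auto elim!: eventually_mono intro: power_mono\<close>)
  then show ?thesis by (simp add: L2_def)
qed

lemma L2_scale: "f \<in> L2 \<Longrightarrow> (\<lambda>x. c * f x) \<in> L2"
  by (auto simp: L2_def norm_mult power_mult_distrib)

lemma L2_add: assumes "f \<in> L2" "g \<in> L2" shows "(\<lambda>x. f x + g x) \<in> L2"
proof -
  have [measurable]: "f \<in> borel_measurable lebesgue" "g \<in> borel_measurable lebesgue" using assms by (auto simp: L2_def)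
  have le: "(cmod (f x + g x))\<^sup>2 \<le> 2 * (cmod (f x))\<^sup>2 + 2 * (cmod (g x))\<^sup>2" for x
  proof -
    have "(cmod (f x + g x))\<^sup>2 \<le> (cmod (f x) + cmod (g x))\<^sup>2" by (intro power_mono norm_triangle_ineq) simp
    also have "\<dots> = 2 * (cmod (f x))\<^sup>2 + 2 * (cmod (g x))\<^sup>2 - (cmod (f x) - cmod (g x))\<^sup>2"
      by (simp add: power2_eq_square algebra_simps)
    finally show ?thesis using zero_le_power2[of "cmod (f x) - cmod (g x)"] by linarith
  qed
  have "integrable lebesgue (\<lambda>x. (cmod (f x + g x))\<^sup>2)"
    by (rule Bochner_Integration.integrable_bound[where f = "\<lambda>x. 2 * (cmod (f x))\<^sup>2 + 2 * (cmod (g x))\<^sup>2"])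
      (use le assms in \<open>auto simp: L2_def intro!: AE_I2\<close>)
  then show ?thesis by (simp add: L2_def)
qed

lemma L2_diff: "\<lbrakk>f \<in> L2; g \<in> L2\<rbrakk> \<Longrightarrow> (\<lambda>x. f x - g x) \<in> L2"
  using L2_add[of f "\<lambda>x. (-1) * g x"] L2_scale[of g "-1"] by simp

lemma L2_zero: "(\<lambda>x. 0) \<in> L2" by (simp add: L2_def)

lemma l2_norm_sq: "f \<in> L2 \<Longrightarrow> (l2_norm f)\<^sup>2 = (LINT x|lebesgue. (cmod (f x))\<^sup>2)"
  by (simp add: l2_norm_def)

lemma l2_norm_ge0 [simp]: "0 \<le> l2_norm f"
  by (simp add: l2_norm_def)

text \<open>Membership and norm bound merge into one inequality of nonnegative integrals, the form
  in which Fatou's lemma speaks.\<close>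

lemma l2_norm_le_iff_nn:
  assumes [measurable]: "f \<in> borel_measurable lebesgue" and e: "0 \<le> e"
  shows "(f \<in> L2 \<and> l2_norm f \<le> e) \<longleftrightarrow> (\<integral>\<^sup>+x. ennreal ((cmod (f x))\<^sup>2) \<partial>lebesgue) \<le> ennreal (e\<^sup>2)" (is "?L \<longleftrightarrow> ?R")
proof
  assume ?L
  then have i: "integrable lebesgue (\<lambda>x. (cmod (f x))\<^sup>2)" and "(l2_norm f)\<^sup>2 \<le> e\<^sup>2"
    by (auto simp: L2_def intro: power_mono)
  then show ?R using \<open>?L\<close> by (simp add: nn_integral_eq_integral[OF i] l2_norm_sq ennreal_leI)
next
  assume R: ?R
  have i: "integrable lebesgue (\<lambda>x. (cmod (f x))\<^sup>2)"
    by (rule integrableI_bounded) (use R in \<open>auto simp: ennreal_power le_less_trans\<close>)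
  then have "f \<in> L2" by (simp add: L2_def)
  moreover have "(l2_norm f)\<^sup>2 \<le> e\<^sup>2"
    using R nn_integral_eq_integral[OF i] by (simp add: l2_norm_sq[OF \<open>f \<in> L2\<close>] ennreal_le_iff)
  ultimately show ?L using e by (auto simp: abs_le_square_iff[symmetric])
qed

lemma fatou_L2:
  assumes t: "\<And>k. t k \<in> borel_measurable lebesgue" and f[measurable]: "f \<in> borel_measurable lebesgue"
    and lim: "AE x in lebesgue. (\<lambda>k. t k x) \<longlonglongrightarrow> f x" and e: "0 \<le> e"
    and b: "\<forall>\<^sub>F k in sequentially. t k \<in> L2 \<and> l2_norm (t k) \<le> e"
  shows "f \<in> L2" "l2_norm f \<le> e"
proof -
  note [measurable] = t
  have "(\<integral>\<^sup>+x. ennreal ((cmod (f x))\<^sup>2) \<partial>lebesgue) = (\<integral>\<^sup>+x. liminf (\<lambda>k. ennreal ((cmod (t k x))\<^sup>2)) \<partial>lebesgue)"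
  proof (rule nn_integral_cong_AE, use lim in eventually_elim)
    fix x assume "(\<lambda>k. t k x) \<longlonglongrightarrow> f x"
    then have "(\<lambda>k. ennreal ((cmod (t k x))\<^sup>2)) \<longlonglongrightarrow> ennreal ((cmod (f x))\<^sup>2)"
      by (intro tendsto_intros)
    then show "ennreal ((cmod (f x))\<^sup>2) = liminf (\<lambda>k. ennreal ((cmod (t k x))\<^sup>2))"
      by (intro lim_imp_Liminf[symmetric]) auto
  qed
  also have "\<dots> \<le> liminf (\<lambda>k. \<integral>\<^sup>+x. ennreal ((cmod (t k x))\<^sup>2) \<partial>lebesgue)"
    by (rule nn_integral_liminf) simp
  also have "\<dots> \<le> ennreal (e\<^sup>2)"
  proof -
    have "\<forall>\<^sub>F k in sequentially. (\<integral>\<^sup>+x. ennreal ((cmod (t k x))\<^sup>2) \<partial>lebesgue) \<le> ennreal (e\<^sup>2)"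
      using b by eventually_elim (use l2_norm_le_iff_nn[OF t e] in blast)
    then have "liminf (\<lambda>k. \<integral>\<^sup>+x. ennreal ((cmod (t k x))\<^sup>2) \<partial>lebesgue) \<le> liminf (\<lambda>k. ennreal (e\<^sup>2))"
      by (rule Liminf_mono)
    then show ?thesis by (simp add: Liminf_const)
  qed
  finally show "f \<in> L2" "l2_norm f \<le> e" using l2_norm_le_iff_nn[OF f e] by auto
qed

lemma semi_ip_L2: "semi_ip fsc L2 l2_inner"
proof -
  interpret vector_space fsc by (rule vector_space_fsc)
  show ?thesis
  proof
    show "subspace L2" by (auto simp: subspace_def fsc_def plus_fun_def zero_fun_def intro: L2_add L2_scale L2_zero)
    show "l2_inner (x + y) z = l2_inner x z + l2_inner y z" if "x \<in> L2" "y \<in> L2" "z \<in> L2" for x y z :: "real^'n \<Rightarrow> complex"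
      using L2_mult_cnj[OF that(1,3)] L2_mult_cnj[OF that(2,3)] by (simp add: l2_inner_def algebra_simps)
    show "l2_inner (fsc c x) y = c * l2_inner x y" for c and x y :: "real^'n \<Rightarrow> complex"
      by (simp add: l2_inner_def fsc_def mult.assoc)
    show "l2_inner y x = cnj (l2_inner x y)" for x y :: "real^'n \<Rightarrow> complex"
      unfolding l2_inner_def by (subst Bochner_Integration.integral_cnj[symmetric]) (simp add: mult.commute)
    show "0 \<le> Re (l2_inner x x)" if "x \<in> L2" for x :: "real^'n \<Rightarrow> complex"
      using L2_mult_cnj[OF that that] unfolding l2_inner_def complex_norm_square[symmetric] by (simp del: of_real_power)
  qed
qed

interpretation L2: semi_ip fsc L2 l2_inner by (rule semi_ip_L2)

lemma L2_nrm [simp]: "L2.nrm f = l2_norm f"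
  unfolding L2.nrm_def l2_inner_def l2_norm_def complex_norm_square[symmetric] by (simp del: of_real_power)

lemma l2_self: "f \<in> L2 \<Longrightarrow> l2_inner f f = of_real ((l2_norm f)\<^sup>2)"
  using L2.ip_self by simp

lemma fsc_apply: "fsc c f x = c * f x" by (simp add: fsc_def)

lemma fun_diff_eq: "f - g = (\<lambda>x. f x - g x)" by (simp add: fun_eq_iff)

text \<open>Riesz-Fischer: a rapidly converging subsequence converges almost everywhere, and Fatou's
  lemma compares the original sequence with that pointwise limit.\<close>

lemma L2_complete:
  fixes s :: "nat \<Rightarrow> real^'n \<Rightarrow> complex"
  assumes s: "\<And>n. s n \<in> L2" and cau: "\<And>e. e > 0 \<Longrightarrow> \<exists>N. \<forall>n\<ge>N. \<forall>m\<ge>N. l2_norm (s n - s m) < e"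
  shows "\<exists>x\<in>L2. (\<lambda>n. l2_norm (s n - x)) \<longlonglongrightarrow> 0"
proof -
  have "\<exists>N. \<forall>n\<ge>N. \<forall>m\<ge>N. l2_norm (s n - s m) < (1/2)^k" for k using cau[of "(1/2)^k"] by simp
  then obtain N where N: "\<And>k n m. \<lbrakk>n \<ge> N k; m \<ge> N k\<rbrakk> \<Longrightarrow> l2_norm (s n - s m) < (1/2)^k" by metis
  \<comment> \<open>The sum dominates every \<open>N k\<close> whether or not N is monotone; the
    extra k makes \<open>r\<close> tend to infinity.\<close>
  define r where "r k = sum N {..k} + k" for k
  have rN: "r k \<ge> N k" "r (Suc k) \<ge> N k" "r k \<ge> k" for k
  proof -
    have "N k \<le> sum N {..k}" by (rule member_le_sum) auto
    then show "r k \<ge> N k" "r (Suc k) \<ge> N k" "r k \<ge> k" by (auto simp: r_def)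
  qed
  define t where "t k = s (r k)" for k
  have t: "t k \<in> L2" for k using s by (simp add: t_def)
  have [measurable]: "t k \<in> borel_measurable lebesgue" "s k \<in> borel_measurable lebesgue" for k using t s by (auto simp: L2_def)
  define \<Delta> where "\<Delta> k x = t (Suc k) x - t k x" for k x
  have \<Delta>: "\<Delta> k \<in> L2" for k using L2_diff[OF t t] by (simp add: \<Delta>_def[abs_def])
  have \<Delta>m[measurable]: "\<Delta> k \<in> borel_measurable lebesgue" for k using \<Delta> by (auto simp: L2_def)
  have \<Delta>n: "l2_norm (\<Delta> k) \<le> (1/2)^k" for k
  proof -
    have "\<Delta> k = s (r (Suc k)) - s (r k)" by (auto simp: \<Delta>_def t_def)
    then show ?thesis using N[OF rN(2) rN(1)] by (simp add: less_imp_le)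
  qed
  \<comment> \<open>The weight 2^k still leaves a convergent series, since 2^k (2^-k)^2 = 2^-k. It
    turns square summability into summability: an increment larger than 2^-k is at most 2^k times
    its square.\<close>
  have "(\<integral>\<^sup>+x. (\<Sum>k. ennreal (2^k * (cmod (\<Delta> k x))\<^sup>2)) \<partial>lebesgue) = (\<Sum>k. \<integral>\<^sup>+x. ennreal (2^k * (cmod (\<Delta> k x))\<^sup>2) \<partial>lebesgue)"
    by (rule nn_integral_suminf) simp
  also have "\<dots> \<le> (\<Sum>k. ennreal ((1/2)^k))"
  proof (rule suminf_le)
    fix k
    have "(\<integral>\<^sup>+x. ennreal (2^k * (cmod (\<Delta> k x))\<^sup>2) \<partial>lebesgue) = ennreal (2^k) * (\<integral>\<^sup>+x. ennreal ((cmod (\<Delta> k x))\<^sup>2) \<partial>lebesgue)"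
      by (subst nn_integral_cmult[symmetric]) (auto simp: ennreal_mult)
    also have "\<dots> \<le> ennreal (2^k) * ennreal (((1/2)^k)\<^sup>2)"
      using l2_norm_le_iff_nn[OF \<Delta>m, of "(1/2)^k" k] \<Delta> \<Delta>n by (intro mult_left_mono) auto
    also have "\<dots> = ennreal (2^k * ((1/2)^k)\<^sup>2)" by (simp add: ennreal_mult)
    also have "2^k * ((1/2)^k)\<^sup>2 = ((1/2)^k :: real)" by (simp add: power2_eq_square flip: power_mult_distrib)
    finally show "(\<integral>\<^sup>+x. ennreal (2^k * (cmod (\<Delta> k x))\<^sup>2) \<partial>lebesgue) \<le> ennreal ((1/2)^k)" .
  qed auto
  also have "\<dots> < \<infinity>"
    by (subst suminf_ennreal2) (auto intro: summable_geometric)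
  finally have fin: "(\<integral>\<^sup>+x. (\<Sum>k. ennreal (2^k * (cmod (\<Delta> k x))\<^sup>2)) \<partial>lebesgue) \<noteq> \<infinity>" by simp
  have "AE x in lebesgue. (\<Sum>k. ennreal (2^k * (cmod (\<Delta> k x))\<^sup>2)) \<noteq> \<infinity>"
    by (rule nn_integral_PInf_AE[OF _ fin]) simp
  then have conv: "AE x in lebesgue. (\<lambda>k. t k x) \<longlonglongrightarrow> lim (\<lambda>k. t k x)"
  proof eventually_elim
    fix x assume "(\<Sum>k. ennreal (2^k * (cmod (\<Delta> k x))\<^sup>2)) \<noteq> \<infinity>"
    then have "summable (\<lambda>k. 2^k * (cmod (\<Delta> k x))\<^sup>2)"
      by (intro summable_suminf_not_top) (auto simp: top_ennreal_def infinity_ennreal_def)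
    then have sm: "summable (\<lambda>k. (1/2)^k + 2^k * (cmod (\<Delta> k x))\<^sup>2)"
      by (intro summable_add summable_geometric) auto
    have "cmod (\<Delta> k x) \<le> (1/2)^k + 2^k * (cmod (\<Delta> k x))\<^sup>2" for k
    proof (cases "cmod (\<Delta> k x) \<le> (1/2)^k")
      case True
      have "0 \<le> 2^k * (cmod (\<Delta> k x))\<^sup>2" by simp
      then show ?thesis using True by linarith
    next
      case False
      have "cmod (\<Delta> k x) = 2^k * ((1/2)^k * cmod (\<Delta> k x))" by (simp flip: mult.assoc power_mult_distrib)
      also have "\<dots> \<le> 2^k * (cmod (\<Delta> k x) * cmod (\<Delta> k x))"
        using False by (intro mult_left_mono mult_right_mono) auto
      finally show ?thesis by (simp add: power2_eq_square add_increasing)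
    qed
    then have "summable (\<lambda>k. \<Delta> k x)" by (intro summable_comparison_test'[OF sm]) auto
    then have "(\<lambda>n. \<Sum>k<n. \<Delta> k x) \<longlonglongrightarrow> suminf (\<lambda>k. \<Delta> k x)" by (rule summable_LIMSEQ)
    then have "(\<lambda>n. t n x - t 0 x) \<longlonglongrightarrow> suminf (\<lambda>k. \<Delta> k x)"
      using sum_lessThan_telescope[of "\<lambda>k. t k x"] by (simp add: \<Delta>_def)
    then have "(\<lambda>n. (t n x - t 0 x) + t 0 x) \<longlonglongrightarrow> suminf (\<lambda>k. \<Delta> k x) + t 0 x" by (intro tendsto_intros)
    then have "convergent (\<lambda>k. t k x)" by (auto simp: convergent_def)
    then show "(\<lambda>k. t k x) \<longlonglongrightarrow> lim (\<lambda>k. t k x)" by (simp add: convergent_LIMSEQ_iff)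
  qed
  define f where "f x = lim (\<lambda>k. t k x)" for x
  have [measurable]: "f \<in> borel_measurable lebesgue" unfolding f_def by measurable
  have main: "(\<lambda>x. s n x - f x) \<in> L2 \<and> l2_norm (\<lambda>x. s n x - f x) \<le> e"
    if e: "e > 0" and M: "\<forall>n\<ge>M. \<forall>m\<ge>M. l2_norm (s n - s m) < e" and n: "n \<ge> M" for e n M
  proof -
    have l: "AE x in lebesgue. (\<lambda>k. s n x - t k x) \<longlonglongrightarrow> s n x - f x"
      using conv by eventually_elim (auto simp: f_def intro: tendsto_intros)
    have b: "\<forall>\<^sub>F k in sequentially. (\<lambda>x. s n x - t k x) \<in> L2 \<and> l2_norm (\<lambda>x. s n x - t k x) \<le> e"
    proof (rule eventually_sequentiallyI)
      fix k assume "k \<ge> M"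
      then have "r k \<ge> M" using rN(3)[of k] by simp
      then show "(\<lambda>x. s n x - t k x) \<in> L2 \<and> l2_norm (\<lambda>x. s n x - t k x) \<le> e"
        using M n s t by (auto simp: t_def fun_diff_eq less_imp_le intro: L2_diff)
    qed
    show ?thesis using fatou_L2[OF _ _ l _ b] e by simp
  qed
  obtain M where M: "\<forall>n\<ge>M. \<forall>m\<ge>M. l2_norm (s n - s m) < 1" using cau[of 1] by auto
  have "f \<in> L2" using L2_diff[OF s[of M] conjunct1[OF main[OF _ M order_refl]]] by simp
  moreover have "(\<lambda>n. l2_norm (s n - f)) \<longlonglongrightarrow> 0"
  proof (rule LIMSEQ_I)
    fix e :: real assume e: "e > 0"
    obtain M where M: "\<forall>n\<ge>M. \<forall>m\<ge>M. l2_norm (s n - s m) < e/2" using cau[of "e/2"] e by auto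
    have "norm (l2_norm (s n - f) - 0) < e" if "n \<ge> M" for n
      using conjunct2[OF main[OF _ M that]] e by (simp add: fun_diff_eq)
    then show "\<exists>no. \<forall>n\<ge>no. norm (l2_norm (s n - f) - 0) < e" by blast
  qed
  ultimately show ?thesis by blast
qed

interpretation L2: semi_hilbert fsc L2 l2_inner
proof
  fix s :: "nat \<Rightarrow> real^'n \<Rightarrow> complex"
  assume "\<And>n. s n \<in> L2" "\<And>e. e > 0 \<Longrightarrow> \<exists>N. \<forall>n\<ge>N. \<forall>m\<ge>N. L2.nrm (s n - s m) < e"
  then show "\<exists>x\<in>L2. (\<lambda>n. L2.nrm (s n - x)) \<longlonglongrightarrow> 0" unfolding L2_nrm by (rule L2_complete)
qed

lemma l2_norm_zero_iff: "f \<in> L2 \<Longrightarrow> l2_norm f = 0 \<longleftrightarrow> (AE x in lebesgue. f x = 0)"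
  using integral_nonneg_eq_0_iff_AE[OF L2_square] by (simp add: l2_norm_def)

lemma l2_norm_cong_AE:
  assumes "AE x in lebesgue. f x = g x" "f \<in> borel_measurable lebesgue" "g \<in> borel_measurable lebesgue"
  shows "l2_norm f = l2_norm g"
proof -
  have [measurable]: "f \<in> borel_measurable lebesgue" "g \<in> borel_measurable lebesgue" by fact+
  have "(LINT x|lebesgue. (cmod (f x))\<^sup>2) = (LINT x|lebesgue. (cmod (g x))\<^sup>2)"
    by (rule integral_cong_AE) (use assms(1) in auto)
  then show ?thesis by (simp add: l2_norm_def)
qed

text \<open>Lebesgue measure is complete, so changing a function on a null set alters preimages by
  measurable sets only.\<close>

lemma measurable_lebesgue_cong_AE:
  fixes f g :: "'a::euclidean_space \<Rightarrow> 'b::topological_space"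
  assumes f: "f \<in> borel_measurable lebesgue" and eq: "AE x in lebesgue. f x = g x"
  shows "g \<in> borel_measurable lebesgue"
proof (rule measurableI)
  fix A :: "'b set" assume A: "A \<in> sets borel"
  obtain N where N: "N \<in> null_sets lebesgue" "{x. f x \<noteq> g x} \<subseteq> N"
    using eq by (auto simp: eventually_ae_filter)
  have "g -` A \<inter> N \<in> sets lebesgue"
    using N(1) by (intro completion.complete[of _ N]) auto
  moreover have "f -` A \<in> sets lebesgue" using measurable_sets[OF f A] by simp
  moreover have "g -` A \<inter> space lebesgue = (f -` A - N) \<union> (g -` A \<inter> N)"
    using N(2) by (auto simp: subset_iff) metis+
  ultimately show "g -` A \<inter> space lebesgue \<in> sets lebesgue" using null_setsD2[OF N(1)] by (metis sets.Un sets.Diff)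
qed simp

lemma L2_cong_AE:
  assumes "f \<in> L2" "AE x in lebesgue. f x = g x" shows "g \<in> L2"
proof (rule L2_bound[OF assms(1)])
  show "g \<in> borel_measurable lebesgue" using measurable_lebesgue_cong_AE assms by (auto simp: L2_def)
qed (use assms(2) in auto)

section \<open>Translation invariance\<close>

lemma distr_lebesgue_plus:
  fixes a :: "'a::euclidean_space"
  shows "(\<lambda>x. x + a) \<in> lebesgue \<rightarrow>\<^sub>M lebesgue" "distr lebesgue lebesgue (\<lambda>x. x + a) = lebesgue"
proof -
  have vim: "(\<lambda>x. x + a) -` A = (\<lambda>x. 1 *\<^sub>R x + (- a)) ` A" for A :: "'a set"
    by (auto simp: image_iff algebra_simps intro!: bexI[of _ "_ + a"])
  have vim': "(\<lambda>x. x + a) -` A = (+) (- a) ` A" for A :: "'a set"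
    by (auto simp: image_iff algebra_simps intro!: bexI[of _ "_ + a"])
  show m: "(\<lambda>x. x + a) \<in> lebesgue \<rightarrow>\<^sub>M lebesgue"
    by (rule measurableI) (simp_all only: vim' lebesgue_sets_translation Int_UNIV_right space_completion space_lborel space_borel UNIV_I)
  show "distr lebesgue lebesgue (\<lambda>x. x + a) = lebesgue"
  proof (rule measure_eqI)
    fix A assume "A \<in> sets (distr lebesgue lebesgue (\<lambda>x. x + a))"
    then have "emeasure (distr lebesgue lebesgue (\<lambda>x. x + a)) A = emeasure lebesgue ((\<lambda>x. x + a) -` A)"
      using m by (simp add: emeasure_distr)
    also have "\<dots> = emeasure lebesgue A"
      unfolding vim by (subst emeasure_lebesgue_affine) auto
    finally show "emeasure (distr lebesgue lebesgue (\<lambda>x. x + a)) A = emeasure lebesgue A" .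
  qed simp
qed

lemma lebesgue_integral_shift:
  fixes f :: "'a::euclidean_space \<Rightarrow> 'b::{banach, second_countable_topology}"
  assumes [measurable]: "f \<in> borel_measurable lebesgue"
  shows "(LINT x|lebesgue. f (x + a)) = (LINT x|lebesgue. f x)"
  using integral_distr[OF distr_lebesgue_plus(1), of f a] by (simp add: distr_lebesgue_plus(2))

lemma lebesgue_integrable_shift:
  fixes f :: "'a::euclidean_space \<Rightarrow> 'b::{banach, second_countable_topology}"
  assumes "f \<in> borel_measurable lebesgue"
  shows "integrable lebesgue (\<lambda>x. f (x + a)) \<longleftrightarrow> integrable lebesgue f"
  using integrable_distr_eq[OF distr_lebesgue_plus(1), of f a] assms by (simp add: distr_lebesgue_plus(2))

lemma measurable_shift:
  fixes f :: "'a::euclidean_space \<Rightarrow> 'b::topological_space"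
  assumes "f \<in> borel_measurable lebesgue"
  shows "(\<lambda>x. f (x + a)) \<in> borel_measurable lebesgue"
  using measurable_compose[OF distr_lebesgue_plus(1) assms] .

lemma AE_shift:
  fixes a :: "'a::euclidean_space"
  assumes "AE x in lebesgue. P x" shows "AE x in lebesgue. P (x + a)"
proof -
  have "AE x in distr lebesgue lebesgue (\<lambda>x. x + a). P x" unfolding distr_lebesgue_plus(2) by (rule assms)
  then show ?thesis by (rule AE_distrD[OF distr_lebesgue_plus(1)])
qed

lemma L2_shift: "f \<in> L2 \<Longrightarrow> (\<lambda>x. f (x + a)) \<in> L2"
  using lebesgue_integrable_shift[of "\<lambda>x. (cmod (f x))\<^sup>2" a] measurable_shift[of f a] by (auto simp: L2_def)

lemma l2_norm_shift: "f \<in> L2 \<Longrightarrow> l2_norm (\<lambda>x. f (x + a)) = l2_norm f"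
  using lebesgue_integral_shift[of "\<lambda>x. (cmod (f x))\<^sup>2" a] by (auto simp: L2_def l2_norm_def)

section \<open>Test functions\<close>

definition smooth1 :: "(real \<Rightarrow> real) \<Rightarrow> bool" where
  "smooth1 h \<longleftrightarrow> (\<forall>n t. (deriv ^^ n) h differentiable (at t))"

text \<open>Coinduction: it suffices to exhibit a set of functions closed under differentiation,
  instead of formulas for all higher derivatives.\<close>

lemma smooth1_coinduct:
  assumes "h \<in> S" and S: "\<And>h. h \<in> S \<Longrightarrow> \<exists>h'\<in>S. \<forall>t. (h has_real_derivative h' t) (at t)"
  shows "smooth1 h"
proof -
  have d: "deriv g \<in> S" if g: "g \<in> S" for g
  proof -
    obtain g' where "g' \<in> S" "\<forall>t. (g has_real_derivative g' t) (at t)" using S[OF g] by blast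
    then show ?thesis using DERIV_imp_deriv by (metis ext)
  qed
  have "(deriv ^^ n) h \<in> S" for n by (induction n) (use assms(1) d in auto)
  then show ?thesis unfolding smooth1_def using S by (metis real_differentiable_def)
qed

lemma smooth1_deriv:
  assumes "smooth1 h" shows "(h has_real_derivative deriv h t) (at t)" "smooth1 (deriv h)"
proof -
  have "(deriv ^^ 0) h differentiable (at t)" using assms unfolding smooth1_def by blast
  then show "(h has_real_derivative deriv h t) (at t)"
    by (auto simp: real_differentiable_def DERIV_imp_deriv)
  have "(deriv ^^ n) (deriv h) differentiable (at t)" for n t
    using assms unfolding smooth1_def by (metis funpow_Suc_right comp_apply)
  then show "smooth1 (deriv h)" by (simp add: smooth1_def)
qed

lemma smooth1_continuous: "smooth1 h \<Longrightarrow> continuous_on UNIV h"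
  using DERIV_isCont[OF smooth1_deriv(1)] by (auto simp: continuous_on_eq_continuous_at)

text \<open>The invariant for the product rule: derivatives of sums of products are sums of
  products.\<close>

inductive_set product_sums :: "(real \<Rightarrow> real) set" where
  "\<lbrakk>smooth1 f; smooth1 g\<rbrakk> \<Longrightarrow> (\<lambda>t. f t * g t) \<in> product_sums"
| "\<lbrakk>p \<in> product_sums; q \<in> product_sums\<rbrakk> \<Longrightarrow> (\<lambda>t. p t + q t) \<in> product_sums"

lemma smooth1_mult:
  assumes "smooth1 f" "smooth1 g" shows "smooth1 (\<lambda>t. f t * g t)"
proof (rule smooth1_coinduct[of _ product_sums])
  show "(\<lambda>t. f t * g t) \<in> product_sums" using assms by (rule product_sums.intros)
  fix h assume "h \<in> product_sums"
  then show "\<exists>h'\<in>product_sums. \<forall>t. (h has_real_derivative h' t) (at t)"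
  proof induction
    case (1 f g)
    have "(\<lambda>t. deriv f t * g t + f t * deriv g t) \<in> product_sums"
      using 1 smooth1_deriv(2) by (intro product_sums.intros) auto
    moreover have "((\<lambda>t. f t * g t) has_real_derivative deriv f t * g t + f t * deriv g t) (at t)" for t
      using DERIV_mult[OF smooth1_deriv(1)[OF 1(1)] smooth1_deriv(1)[OF 1(2)]] by (simp add: mult.commute)
    ultimately show ?case by (intro bexI[of _ "\<lambda>t. deriv f t * g t + f t * deriv g t"]) auto
  next
    case (2 p q)
    then obtain p' q' where pq: "p' \<in> product_sums" "q' \<in> product_sums"
      "\<forall>t. (p has_real_derivative p' t) (at t)" "\<forall>t. (q has_real_derivative q' t) (at t)" by blast
    then have "(\<lambda>t. p' t + q' t) \<in> product_sums" by (intro product_sums.intros)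
    moreover have "\<forall>t. ((\<lambda>t. p t + q t) has_real_derivative p' t + q' t) (at t)" using pq by (auto intro: DERIV_add)
    ultimately show ?case by (intro bexI[of _ "\<lambda>t. p' t + q' t"]) auto
  qed
qed

lemma smooth1_affine:
  assumes "smooth1 f" shows "smooth1 (\<lambda>t. f (c * t + d))"
proof (rule smooth1_coinduct[of _ "{\<lambda>t. k * f (c * t + d) |k f. smooth1 f}"])
  show "(\<lambda>t. f (c * t + d)) \<in> {\<lambda>t. k * f (c * t + d) |k f. smooth1 f}"
    using assms by (auto intro!: exI[of _ 1] exI[of _ f])
  fix h assume "h \<in> {\<lambda>t. k * f (c * t + d) |k f. smooth1 f}"
  then obtain k f where h: "h = (\<lambda>t. k * f (c * t + d))" "smooth1 f" by auto
  have "(h has_real_derivative (k * c) * deriv f (c * t + d)) (at t)" for t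
  proof -
    have "((\<lambda>t. c * t + d) has_real_derivative c) (at t)" by (auto intro!: derivative_eq_intros)
    from DERIV_cmult[OF DERIV_chain2[OF smooth1_deriv(1)[OF h(2)] this], of k] show ?thesis
      unfolding h(1) by (simp add: mult_ac)
  qed
  moreover have "(\<lambda>t. (k * c) * deriv f (c * t + d)) \<in> {\<lambda>t. k * f (c * t + d) |k f. smooth1 f}"
    using smooth1_deriv(2)[OF h(2)] by blast
  ultimately show "\<exists>h'\<in>{\<lambda>t. k * f (c * t + d) |k f. smooth1 f}. \<forall>t. (h has_real_derivative h' t) (at t)"
    by (intro bexI[of _ "\<lambda>t. (k * c) * deriv f (c * t + d)"]) auto
qed

text \<open>Polynomials in 1/t times exp (-1/t), extended by 0. The family is closed under
  differentiation: the derivative belongs to the polynomial X^2 (p - p').\<close>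

definition flat :: "real poly \<Rightarrow> real \<Rightarrow> real" where
  "flat p t = (if t > 0 then poly p (1/t) * exp (- (1/t)) else 0)"

lemma poly_exp_tendsto_0: "((\<lambda>y::real. y ^ k * poly p y * exp (- y)) \<longlongrightarrow> 0) at_top"
proof (induction p arbitrary: k)
  case 0
  then show ?case by simp
next
  case (pCons a p)
  have "((\<lambda>y::real. a * (y ^ k / exp y) + y ^ Suc k * poly p y * exp (- y)) \<longlongrightarrow> a * 0 + 0) at_top"
    by (intro tendsto_intros tendsto_power_div_exp_0 pCons.IH)
  then show ?case by (simp add: exp_minus field_simps)
qed

lemma flat_derivative: "(flat p has_real_derivative flat ([:0, 0, 1:] * (p - pderiv p)) t) (at t)"
proof -
  consider "t > 0" | "t < 0" | "t = 0" by linarith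
  then show ?thesis
  proof cases
    case 1
    have e: "\<forall>\<^sub>F s in nhds t. flat p s = poly p (1/s) * exp (- (1/s))"
      using eventually_nhds_in_open[of "{0<..}" t] 1 by (auto simp: flat_def elim: eventually_mono)
    have "((\<lambda>s. poly p (1/s) * exp (- (1/s))) has_real_derivative
        flat ([:0, 0, 1:] * (p - pderiv p)) t) (at t)"
      using 1 by (auto intro!: derivative_eq_intros poly_DERIV[THEN DERIV_chain2] simp: flat_def field_simps power2_eq_square)
    then show ?thesis using DERIV_cong_ev[OF refl e refl] by simp
  next
    case 2
    have e: "\<forall>\<^sub>F s in nhds t. flat p s = 0"
      using eventually_nhds_in_open[of "{..<0}" t] 2 by (auto simp: flat_def elim: eventually_mono)
    have "(flat p has_real_derivative 0) (at t)" using DERIV_cong_ev[OF refl e refl, of 0] by simp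
    moreover have "flat ([:0, 0, 1:] * (p - pderiv p)) t = 0" using 2 by (simp add: flat_def)
    ultimately show ?thesis by simp
  next
    case 3
    \<comment> \<open>Substituting h = 1/y turns the right difference quotient at 0 into y p(y) exp
      (-y) with y tending to infinity.\<close>
    have "((\<lambda>h. (flat p (0 + h) - flat p 0) / h) \<longlongrightarrow> 0) (at_right 0)"
      unfolding filterlim_at_right_to_top
    proof (rule Lim_transform_eventually)
      show "((\<lambda>y. y ^ 1 * poly p y * exp (- y)) \<longlongrightarrow> 0) at_top" by (rule poly_exp_tendsto_0)
      show "\<forall>\<^sub>F y in at_top. y ^ 1 * poly p y * exp (- y) = (flat p (0 + inverse y) - flat p 0) / inverse y"
        using eventually_gt_at_top[of 0] by eventually_elim (simp add: flat_def field_simps)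
    qed
    moreover have "((\<lambda>h. (flat p (0 + h) - flat p 0) / h) \<longlongrightarrow> 0) (at_left 0)"
    proof (rule Lim_transform_eventually[OF tendsto_const])
      show "\<forall>\<^sub>F h in at_left 0. 0 = (flat p (0 + h) - flat p 0) / h"
        by (auto simp: flat_def eventually_at_filter intro!: always_eventually)
    qed
    ultimately have "((\<lambda>h. (flat p (0 + h) - flat p 0) / h) \<longlongrightarrow> 0) (at 0)"
      by (simp add: filterlim_split_at)
    then show ?thesis using 3 by (simp add: DERIV_def flat_def)
  qed
qed

lemma smooth1_flat: "smooth1 (flat p)"
proof (rule smooth1_coinduct[of _ "range flat"])
  fix h assume "h \<in> range flat"
  then obtain p where "h = flat p" by blast
  then show "\<exists>h'\<in>range flat. \<forall>t. (h has_real_derivative h' t) (at t)" using flat_derivative[of p] by blast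
qed simp

abbreviation bump :: "real \<Rightarrow> real" where "bump \<equiv> flat [:1:]"

lemma bump_bounds: "0 \<le> bump t" "bump t \<le> 1"
  by (auto simp: flat_def)

lemma bump_mono: "s \<le> t \<Longrightarrow> bump s \<le> bump t"
  by (auto simp: flat_def divide_simps)

lemma bump_scale_tendsto: "t > 0 \<Longrightarrow> (\<lambda>n. bump (real (Suc n) * t)) \<longlonglongrightarrow> 1"
proof -
  assume t: "t > 0"
  have "(\<lambda>n. exp (- (inverse (real (Suc n)) * (1/t)))) \<longlonglongrightarrow> exp (- (0 * (1/t)))"
    by (intro tendsto_intros LIMSEQ_inverse_real_of_nat)
  then show ?thesis using t by (simp add: flat_def inverse_eq_divide)
qed

section \<open>Test functions of several variables\<close>

definition tensor :: "('n \<Rightarrow> real \<Rightarrow> real) \<Rightarrow> real^'n \<Rightarrow> real" where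
  "tensor H x = (\<Prod>j\<in>UNIV. H j (x $ j))"

lemma tensor_derivative:
  fixes H :: "'n::finite \<Rightarrow> real \<Rightarrow> real"
  assumes "\<And>j. smooth1 (H j)"
  shows "((\<lambda>t. tensor H (x + t *\<^sub>R axis i 1)) has_real_derivative tensor (H(i := deriv (H i))) x) (at 0)"
proof -
  have t: "tensor K (x + t *\<^sub>R axis i 1) = K i (x $ i + t) * (\<Prod>j\<in>UNIV - {i}. K j (x $ j))" for K t
    unfolding tensor_def by (subst prod.remove[of UNIV i]) (auto simp: axis_def intro!: prod.cong)
  have "((\<lambda>t. H i (x $ i + t)) has_real_derivative deriv (H i) (x $ i)) (at 0)"
  proof -
    have "((\<lambda>t. x $ i + t) has_real_derivative 1) (at 0)" by (auto intro!: derivative_eq_intros)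
    from DERIV_chain2[OF smooth1_deriv(1)[OF assms] this, of i] show ?thesis by simp
  qed
  then have "((\<lambda>t. H i (x $ i + t) * (\<Prod>j\<in>UNIV - {i}. H j (x $ j))) has_real_derivative
      deriv (H i) (x $ i) * (\<Prod>j\<in>UNIV - {i}. H j (x $ j))) (at 0)"
    by (rule DERIV_cmult_right)
  moreover have "tensor (H(i := deriv (H i))) x = deriv (H i) (x $ i) * (\<Prod>j\<in>UNIV - {i}. H j (x $ j))"
    using t[of "H(i := deriv (H i))" 0] by simp
  ultimately show ?thesis unfolding t by simp
qed

text \<open>A partial derivative of a product of one-variable functions is again such a product, so
  iterated derivatives never leave the class.\<close>

lemma smooth_tensor:
  fixes H :: "'n::finite \<Rightarrow> real \<Rightarrow> real"
  assumes "\<And>j. smooth1 (H j)" shows "smooth_fun (tensor H)"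
proof -
  have K: "\<exists>K. (\<forall>j. smooth1 (K j)) \<and> fold pdiff js (tensor H) = tensor K" if "\<And>j. smooth1 (H j)" for H :: "'n \<Rightarrow> real \<Rightarrow> real" and js
    using that
  proof (induction js arbitrary: H)
    case (Cons i js)
    have "pdiff i (tensor H) = tensor (H(i := deriv (H i)))"
      unfolding pdiff_def using DERIV_imp_deriv[OF tensor_derivative[of H, OF Cons.prems]] by (simp add: fun_eq_iff)
    moreover have "smooth1 ((H(i := deriv (H i))) j)" for j using Cons.prems smooth1_deriv(2) by simp
    then have "\<exists>K. (\<forall>j. smooth1 (K j)) \<and> fold pdiff js (tensor (H(i := deriv (H i)))) = tensor K" by (rule Cons.IH)
    ultimately show ?case by (simp only: fold_simps)
  qed auto
  have c: "continuous_on UNIV (tensor K)" if "\<And>j. smooth1 (K j)" for K :: "'n \<Rightarrow> real \<Rightarrow> real"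
    unfolding tensor_def
    by (intro continuous_on_prod) (auto intro!: continuous_on_compose2[OF smooth1_continuous[OF that]] continuous_intros)
  have d: "(\<lambda>t. tensor K (x + t *\<^sub>R axis j 1)) differentiable (at 0)" if "\<And>j. smooth1 (K j)" for K :: "'n \<Rightarrow> real \<Rightarrow> real" and j x
    using tensor_derivative[of K, OF that] real_differentiable_def by blast
  show ?thesis
    unfolding smooth_fun_def
  proof
    fix js
    obtain K where "\<And>j. smooth1 (K j)" "fold pdiff js (tensor H) = tensor K" using K[of H, OF assms] by blast
    then show "continuous_on UNIV (fold pdiff js (tensor H)) \<and> (\<forall>j x. (\<lambda>t. fold pdiff js (tensor H) (x + t *\<^sub>R axis j 1)) differentiable at 0)"
      using c d by simp
  qed
qed

lemma smooth_fun_pdiff: "smooth_fun \<phi> \<Longrightarrow> smooth_fun (pdiff j \<phi>)"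
  unfolding smooth_fun_def using fold_simps(2)[of pdiff j] by metis

lemma smooth_fun_continuous: "smooth_fun \<phi> \<Longrightarrow> continuous_on UNIV \<phi>"
  unfolding smooth_fun_def by (metis fold_simps(1))

lemma pdiff_derivative:
  assumes "smooth_fun \<phi>"
  shows "((\<lambda>t. \<phi> (x + t *\<^sub>R axis j 1)) has_real_derivative pdiff j \<phi> (x + s *\<^sub>R axis j 1)) (at s)"
proof -
  have "(\<lambda>t. fold pdiff [] \<phi> ((x + s *\<^sub>R axis j 1) + t *\<^sub>R axis j 1)) differentiable (at 0)"
    using assms unfolding smooth_fun_def by blast
  then have "((\<lambda>t. \<phi> ((x + s *\<^sub>R axis j 1) + t *\<^sub>R axis j 1)) has_real_derivative pdiff j \<phi> (x + s *\<^sub>R axis j 1)) (at 0)"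
    unfolding pdiff_def by (auto simp: real_differentiable_def DERIV_imp_deriv)
  then have "((\<lambda>t. \<phi> (x + (s + t) *\<^sub>R axis j 1)) has_real_derivative pdiff j \<phi> (x + s *\<^sub>R axis j 1)) (at 0)"
    by (simp add: algebra_simps)
  then show ?thesis using DERIV_shift[of "\<lambda>t. \<phi> (x + t *\<^sub>R axis j 1)" _ 0 s] by (simp add: add.commute)
qed

lemma smooth_fun_lincomb:
  assumes "smooth_fun \<phi>" "smooth_fun \<psi>"
  shows "smooth_fun (\<lambda>x. a * \<phi> x + b * \<psi> x)" "pdiff j (\<lambda>x. a * \<phi> x + b * \<psi> x) = (\<lambda>x. a * pdiff j \<phi> x + b * pdiff j \<psi> x)"
proof -
  have d: "((\<lambda>t. a * \<phi> (x + t *\<^sub>R axis j 1) + b * \<psi> (x + t *\<^sub>R axis j 1)) has_real_derivative a * pdiff j \<phi> x + b * pdiff j \<psi> x) (at 0)"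
    if "smooth_fun \<phi>" "smooth_fun \<psi>" for \<phi> \<psi> j x
    using pdiff_derivative[OF that(1), of x j 0] pdiff_derivative[OF that(2), of x j 0]
    by (auto intro!: derivative_eq_intros)
  have p: "pdiff j (\<lambda>x. a * \<phi> x + b * \<psi> x) = (\<lambda>x. a * pdiff j \<phi> x + b * pdiff j \<psi> x)"
    if "smooth_fun \<phi>" "smooth_fun \<psi>" for \<phi> \<psi> j
    unfolding pdiff_def[of _ "\<lambda>x. a * \<phi> x + b * \<psi> x"] using DERIV_imp_deriv[OF d[OF that]] by (simp add: fun_eq_iff)
  show "pdiff j (\<lambda>x. a * \<phi> x + b * \<psi> x) = (\<lambda>x. a * pdiff j \<phi> x + b * pdiff j \<psi> x)" using p assms .
  have f: "fold pdiff js (\<lambda>x. a * \<phi> x + b * \<psi> x) = (\<lambda>x. a * fold pdiff js \<phi> x + b * fold pdiff js \<psi> x)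
      \<and> smooth_fun (fold pdiff js \<phi>) \<and> smooth_fun (fold pdiff js \<psi>)" if "smooth_fun \<phi>" "smooth_fun \<psi>" for js \<phi> \<psi>
    using that by (induction js arbitrary: \<phi> \<psi>) (auto simp: p smooth_fun_pdiff)
  show "smooth_fun (\<lambda>x. a * \<phi> x + b * \<psi> x)"
    unfolding smooth_fun_def
  proof (intro allI conjI)
    fix js
    show "continuous_on UNIV (fold pdiff js (\<lambda>x. a * \<phi> x + b * \<psi> x))"
    proof -
      have "continuous_on UNIV (fold pdiff js \<phi>)" "continuous_on UNIV (fold pdiff js \<psi>)"
        using f[OF assms, of js] smooth_fun_continuous by auto
      then show ?thesis using f[OF assms, of js] by (auto intro!: continuous_intros)
    qed
    show "(\<lambda>t. fold pdiff js (\<lambda>x. a * \<phi> x + b * \<psi> x) (x + t *\<^sub>R axis j 1)) differentiable (at 0)" for j x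
      using f[OF assms, of js] d[of "fold pdiff js \<phi>" "fold pdiff js \<psi>" x j] by (auto simp: real_differentiable_def)
  qed
qed

lemma smooth_fun_shift:
  assumes "smooth_fun \<phi>" shows "smooth_fun (\<lambda>x. \<phi> (x + a))" "pdiff j (\<lambda>x. \<phi> (x + a)) = (\<lambda>x. pdiff j \<phi> (x + a))"
proof -
  have p: "pdiff j (\<lambda>x. \<phi> (x + a)) = (\<lambda>x. pdiff j \<phi> (x + a))" for j \<phi>
  proof -
    have "x + t *\<^sub>R axis j 1 + a = x + a + t *\<^sub>R axis j 1" for x t by simp
    then show ?thesis by (simp only: pdiff_def)
  qed
  then show "pdiff j (\<lambda>x. \<phi> (x + a)) = (\<lambda>x. pdiff j \<phi> (x + a))" .
  have f: "fold pdiff js (\<lambda>x. \<phi> (x + a)) = (\<lambda>x. fold pdiff js \<phi> (x + a))" for js \<phi>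
    by (induction js arbitrary: \<phi>) (auto simp: p)
  show "smooth_fun (\<lambda>x. \<phi> (x + a))"
    unfolding smooth_fun_def f
  proof (intro allI conjI)
    fix js
    have "continuous_on UNIV (fold pdiff js \<phi>)" using assms by (simp add: smooth_fun_def)
    then show "continuous_on UNIV (\<lambda>x. fold pdiff js \<phi> (x + a))"
      by (rule continuous_on_compose2) (auto intro!: continuous_intros)
    fix j x
    have "(\<lambda>t. fold pdiff js \<phi> ((x + a) + t *\<^sub>R axis j 1)) differentiable (at 0)" using assms by (simp add: smooth_fun_def)
    then show "(\<lambda>t. fold pdiff js \<phi> (x + t *\<^sub>R axis j 1 + a)) differentiable (at 0)" by (simp add: algebra_simps)
  qed
qed

lemma test_fun_alt: "test_fun \<phi> \<longleftrightarrow> smooth_fun \<phi> \<and> bounded {x. \<phi> x \<noteq> 0}"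
  by (simp add: test_fun_def compact_closure)

lemma test_fun_radius:
  assumes "test_fun \<phi>" obtains R where "R > 0" "\<And>x. norm x > R \<Longrightarrow> \<phi> x = 0"
proof -
  obtain R where "\<forall>x\<in>{x. \<phi> x \<noteq> 0}. norm x \<le> R" using assms unfolding test_fun_alt bounded_iff by blast
  then show ?thesis using that[of "max 1 R"] by force
qed

lemma test_fun_lincomb: "\<lbrakk>test_fun \<phi>; test_fun \<psi>\<rbrakk> \<Longrightarrow> test_fun (\<lambda>x. a * \<phi> x + b * \<psi> x)"
  unfolding test_fun_alt using smooth_fun_lincomb(1)
  by (auto intro: bounded_subset[of "{x. \<phi> x \<noteq> 0} \<union> {x. \<psi> x \<noteq> 0}"])

lemma test_fun_shift: assumes "test_fun \<phi>" shows "test_fun (\<lambda>x. \<phi> (x + a))"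
proof -
  have "{x. \<phi> (x + a) \<noteq> 0} = (\<lambda>x. x - a) ` {x. \<phi> x \<noteq> 0}" by (force simp: image_iff)
  then show ?thesis using assms smooth_fun_shift(1)[of \<phi> a] by (auto simp: test_fun_alt bounded_translation_minus)
qed

lemma test_fun_pdiff:
  assumes "test_fun \<phi>" shows "test_fun (pdiff j \<phi>)"
proof -
  obtain R where R: "\<And>x. norm x > R \<Longrightarrow> \<phi> x = 0" using test_fun_radius[OF assms] by blast
  have "pdiff j \<phi> x = 0" if x: "norm x > R" for x
  proof -
    have "((\<lambda>t::real. norm (x + t *\<^sub>R axis j 1)) \<longlongrightarrow> norm (x + 0 *\<^sub>R axis j 1)) (nhds 0)"
      by (intro tendsto_intros filterlim_ident)
    then have "\<forall>\<^sub>F t::real in nhds 0. norm (x + t *\<^sub>R axis j 1) > R"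
      using x by (intro order_tendstoD(1)) auto
    then have "\<forall>\<^sub>F t in nhds 0. \<phi> (x + t *\<^sub>R axis j 1) = 0" by eventually_elim (rule R)
    then have "((\<lambda>t. \<phi> (x + t *\<^sub>R axis j 1)) has_real_derivative 0) (at 0)"
      using DERIV_cong_ev[OF refl _ refl, of "\<lambda>t. \<phi> (x + t *\<^sub>R axis j 1)" "\<lambda>_. 0" 0 0] by simp
    then show ?thesis by (simp add: pdiff_def DERIV_imp_deriv)
  qed
  then have "bounded {x. pdiff j \<phi> x \<noteq> 0}" by (intro boundedI[of _ R]) (meson mem_Collect_eq not_le)
  then show ?thesis using assms smooth_fun_pdiff by (auto simp: test_fun_alt)
qed

lemma bounded_support_L2:
  assumes "f \<in> borel_measurable lebesgue" "\<And>x. cmod (f x) \<le> C" "\<And>x. norm x > R \<Longrightarrow> f x = 0"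
  shows "f \<in> L2"
proof -
  have [measurable]: "f \<in> borel_measurable lebesgue" by fact
  have "integrable lebesgue (\<lambda>x::real^'n. indicator (cball 0 R) x * C\<^sup>2)"
    using lmeasurable_cball[of "0::real^'n" R] by (intro integrable_mult_left integrable_real_indicator) (auto simp: fmeasurable_def)
  then have "integrable lebesgue (\<lambda>x. (cmod (f x))\<^sup>2)"
  proof (rule Bochner_Integration.integrable_bound)
    show "AE x in lebesgue. norm ((cmod (f x))\<^sup>2) \<le> norm (indicator (cball 0 R) x * C\<^sup>2)"
      using assms(2,3) by (intro AE_I2) (auto simp: indicator_def intro: power_mono)
  qed simp
  then show ?thesis by (simp add: L2_def)
qed

lemma test_fun_continuous: "test_fun \<phi> \<Longrightarrow> continuous_on UNIV \<phi>"
  by (simp add: test_fun_def smooth_fun_continuous)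

lemma continuous_lebesgue:
  fixes f :: "real^'n \<Rightarrow> 'b::topological_space"
  assumes "continuous_on UNIV f" shows "f \<in> borel_measurable lebesgue"
  using borel_measurable_continuous_onI[OF assms] by (simp add: measurable_completion)

lemma test_fun_bounded:
  assumes "test_fun \<phi>" obtains C where "C > 0" "\<And>x. \<bar>\<phi> x\<bar> \<le> C"
proof -
  obtain R where R: "R > 0" "\<And>x. norm x > R \<Longrightarrow> \<phi> x = 0" using test_fun_radius[OF assms] by blast
  have "compact (\<phi> ` cball 0 R)"
    using test_fun_continuous[OF assms] by (intro compact_continuous_image) (auto intro: continuous_on_subset)
  then obtain B where "\<forall>y\<in>\<phi> ` cball 0 R. norm y \<le> B" using compact_imp_bounded bounded_iff by metis
  then have B: "\<bar>\<phi> x\<bar> \<le> B" if "norm x \<le> R" for x using that by simp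
  have "\<bar>\<phi> x\<bar> \<le> max 1 B" for x using R(2)[of x] B[of x] by (cases "norm x > R") (auto simp: le_max_iff_disj)
  then show ?thesis using that[of "max 1 B"] by simp
qed

lemma test_fun_L2: assumes "test_fun \<phi>" shows "(\<lambda>x. complex_of_real (\<phi> x)) \<in> L2"
proof -
  obtain R where R: "\<And>x. norm x > R \<Longrightarrow> \<phi> x = 0" using test_fun_radius[OF assms] by blast
  obtain C where "\<And>x. \<bar>\<phi> x\<bar> \<le> C" using test_fun_bounded[OF assms] by blast
  then show ?thesis using R test_fun_continuous[OF assms]
    by (intro bounded_support_L2[of _ C R] continuous_lebesgue) (auto intro!: continuous_intros)
qed

section \<open>Smooth approximation of boxes and the fundamental lemma\<close>

definition box_fun :: "nat \<Rightarrow> real^'n \<Rightarrow> real^'n \<Rightarrow> real^'n \<Rightarrow> real" where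
  "box_fun n a b = tensor (\<lambda>j t. bump (real (Suc n) * (t - a $ j)) * bump (real (Suc n) * (b $ j - t)))"

lemma box_fun_outside: "x \<notin> box a b \<Longrightarrow> box_fun n a b x = 0"
proof -
  assume "x \<notin> box a b"
  then obtain i where "x $ i - a $ i \<le> 0 \<or> b $ i - x $ i \<le> 0" unfolding mem_box_cart by (metis diff_le_0_iff_le linorder_not_less)
  then have "bump (real (Suc n) * (x $ i - a $ i)) * bump (real (Suc n) * (b $ i - x $ i)) = 0"
    by (auto simp: flat_def zero_less_mult_iff simp del: of_nat_Suc)
  then show ?thesis unfolding box_fun_def tensor_def by (intro prod_zero) auto
qed

lemma box_fun_bounds: "0 \<le> box_fun n a b x" "box_fun n a b x \<le> 1"
  by (auto simp: box_fun_def tensor_def bump_bounds intro!: prod_nonneg prod_le_1 mult_le_one)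

lemma test_fun_box: "test_fun (box_fun n a b)"
  unfolding test_fun_alt
proof
  have "smooth1 (\<lambda>t. bump (real (Suc n) * (t - c)))" "smooth1 (\<lambda>t. bump (real (Suc n) * (c - t)))" for c
    using smooth1_affine[OF smooth1_flat, of "[:1:]" "real (Suc n)" "- real (Suc n) * c"]
      smooth1_affine[OF smooth1_flat, of "[:1:]" "- real (Suc n)" "real (Suc n) * c"]
    by (simp_all only: right_diff_distrib mult_minus_left) (simp_all add: add.commute)
  then show "smooth_fun (box_fun n a b)" unfolding box_fun_def by (intro smooth_tensor smooth1_mult) auto
  show "bounded {x. box_fun n a b x \<noteq> 0}"
    by (rule bounded_subset[OF bounded_box[of a b]]) (use box_fun_outside in blast)
qed

lemma box_fun_tendsto: "(\<lambda>n. box_fun n a b x) \<longlonglongrightarrow> indicator (box a b) x"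
proof (cases "x \<in> box a b")
  case True
  have "(\<lambda>n. \<Prod>j\<in>UNIV. bump (real (Suc n) * (x $ j - a $ j)) * bump (real (Suc n) * (b $ j - x $ j))) \<longlonglongrightarrow> (\<Prod>j::'a\<in>UNIV. 1 * 1)"
    using True by (intro tendsto_intros bump_scale_tendsto) (auto simp: mem_box_cart)
  then show ?thesis using True by (simp add: box_fun_def tensor_def)
qed (simp add: box_fun_outside)

text \<open>Each coordinate is more than 1 away from the faces of the enlarged box, so each of the
  2d factors is at least \<open>bump 1\<close>. The positive lower bound lets a test function
  replace the indicator of a box when integrability is derived.\<close>

lemma box_fun_lower:
  assumes "x \<in> box (a::real^'n) b" shows "bump 1 ^ (2 * CARD('n)) \<le> box_fun 0 (a - 1) (b + 1) x"
proof -
  have "(\<Prod>j\<in>(UNIV::'n set). bump 1 * bump 1) \<le> box_fun 0 (a - 1) (b + 1) x"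
    unfolding box_fun_def tensor_def
    using assms by (intro prod_mono conjI mult_mono bump_mono) (auto simp: mem_box_cart bump_bounds algebra_simps less_imp_le)
  then show ?thesis by (simp add: power_mult power2_eq_square)
qed

text \<open>Boxes form an intersection stable generator of the Borel sets, so vanishing integrals
  extend to all Borel sets; confinement to one box yields the vanishing total integral that
  complements require. A Borel version of f then makes uniqueness of densities applicable.\<close>

lemma zero_box_integrals_real:
  fixes f :: "real^'n \<Rightarrow> real"
  assumes f: "integrable lebesgue f" and z: "\<And>a b. (LINT x:box a b|lebesgue. f x) = 0"
    and out: "\<And>x. x \<notin> box c d \<Longrightarrow> f x = 0"
  shows "AE x in lebesgue. f x = 0"
proof -
  have si: "set_integrable lebesgue A f" if "A \<in> sets borel" for A
    using integrable_mult_indicator[of A lebesgue f] f that by (simp add: set_integrable_def)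
  have tot: "(LINT x|lebesgue. f x) = 0"
  proof -
    have "(\<lambda>x. indicator (box c d) x *\<^sub>R f x) = f" using out by (auto simp: fun_eq_iff indicator_def)
    then show ?thesis using z[of c d] by (simp add: set_lebesgue_integral_def)
  qed
  have all: "(LINT x:A|lebesgue. f x) = 0" if "A \<in> sets borel" for A
  proof -
    have "A \<in> sigma_sets UNIV (range (\<lambda>(a, b). box a b :: (real^'n) set))"
      using that unfolding borel_eq_box by simp
    note A = this
    have IS: "Int_stable (range (\<lambda>(a, b). box a b :: (real^'n) set))"
      by (auto simp: Int_stable_def box_Int_box image_iff intro!: exI)
    have sub: "range (\<lambda>(a, b). box a b :: (real^'n) set) \<subseteq> Pow UNIV" by simp
    from IS sub A show ?thesis
    proof (induction A rule: sigma_sets_induct_disjoint)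
      case (basic A)
      then show ?case using z by auto
    next
      case empty
      then show ?case by (simp add: set_lebesgue_integral_def)
    next
      case (compl A)
      then have A: "A \<in> sets borel" unfolding borel_eq_box by simp
      have "(LINT x:UNIV - A|lebesgue. f x) = (LINT x|lebesgue. f x - indicator A x *\<^sub>R f x)"
        unfolding set_lebesgue_integral_def by (intro Bochner_Integration.integral_cong) (auto simp: indicator_def)
      also have "\<dots> = (LINT x|lebesgue. f x) - (LINT x:A|lebesgue. f x)"
        using f si[OF A] unfolding set_integrable_def set_lebesgue_integral_def by (rule Bochner_Integration.integral_diff)
      finally show ?case using tot compl by simp
    next
      case (union A)
      have A: "A i \<in> sets borel" for i using union unfolding borel_eq_box by auto
      then have U: "(\<Union>i. A i) \<in> sets borel" by auto
      have "(LINT x:(\<Union>i. A i)|lebesgue. f x) = (\<Sum>i. (LINT x:A i|lebesgue. f x))"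
        using union(1) A by (intro lebesgue_integral_countable_add si[OF U]) (auto simp: disjoint_family_on_def)
      then show ?case using union by simp
    qed
  qed
  obtain f' where f'[measurable]: "f' \<in> borel_measurable lborel" and eq: "AE x in lborel. f x = f' x"
    using completion_ex_borel_measurable_real[of f lborel] f by auto
  have eq': "AE x in lebesgue. f x = f' x" using eq by (rule AE_completion)
  have [measurable]: "f \<in> borel_measurable lebesgue" "f' \<in> borel_measurable lebesgue"
    using f f' by (auto intro: measurable_completion)
  have if': "integrable lborel f'"
    using integrable_cong_AE[OF _ _ eq'] f integrable_completion[of f' lborel] by simp
  have "AE x in lborel. f' x = 0"
  proof (rule density_unique_real[OF if'])
    fix A assume A: "A \<in> sets (lborel :: (real^'n) measure)"
    then have [measurable]: "A \<in> sets borel" "A \<in> sets lebesgue" by auto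
    have m: "(\<lambda>x. indicator A x *\<^sub>R f' x) \<in> borel_measurable lborel" by simp
    have "(LINT x:A|lborel. f' x) = (LINT x:A|lebesgue. f' x)"
      unfolding set_lebesgue_integral_def by (rule integral_completion[symmetric, OF m])
    also have "\<dots> = (LINT x:A|lebesgue. f x)"
      unfolding set_lebesgue_integral_def using A by (intro integral_cong_AE) (use eq' in auto)
    finally show "(LINT x:A|lborel. f' x) = (LINT x:A|lborel. 0)" using all[of A] A by simp
  qed simp
  then have "AE x in lebesgue. f' x = 0" by (rule AE_completion)
  then show ?thesis using eq' by eventually_elim simp
qed

text \<open>By \<open>box_fun_lower\<close> g is integrable on boxes, and dominated convergence
  along \<open>box_fun n\<close> gives vanishing integrals there. Real and imaginary parts are
  treated at once through an arbitrary bounded linear map to the reals.\<close>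

lemma fundamental_lemma:
  fixes g :: "real^'n \<Rightarrow> complex"
  assumes g[measurable]: "g \<in> borel_measurable lebesgue"
    and int: "\<And>\<phi>. test_fun \<phi> \<Longrightarrow> integrable lebesgue (\<lambda>x. g x * of_real (\<phi> x))"
    and zero: "\<And>\<phi>. test_fun \<phi> \<Longrightarrow> (LINT x|lebesgue. g x * of_real (\<phi> x)) = 0"
  shows "AE x in lebesgue. g x = 0"
proof -
  have box_int: "integrable lebesgue (\<lambda>x. indicator (box a b) x *\<^sub>R g x)" for a b
  proof (rule Bochner_Integration.integrable_bound)
    let ?c = "bump 1 ^ (2 * CARD('n))"
    have c: "?c > 0" by (simp add: flat_def)
    show "integrable lebesgue (\<lambda>x. (1 / ?c) *\<^sub>R (g x * of_real (box_fun 0 (a - 1) (b + 1) x)))"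
      by (intro integrable_scaleR_right int test_fun_box)
    have "norm (indicator (box a b) x *\<^sub>R g x) \<le> norm ((1 / ?c) *\<^sub>R (g x * of_real (box_fun 0 (a - 1) (b + 1) x)))" for x
    proof (cases "x \<in> box a b")
      case True
      have "cmod (g x) * ?c \<le> cmod (g x) * box_fun 0 (a - 1) (b + 1) x"
        using box_fun_lower[OF True] by (intro mult_left_mono) auto
      then show ?thesis using c True box_fun_bounds[of 0 "a - 1" "b + 1" x] by (simp add: norm_mult field_simps)
    qed simp
    then show "AE x in lebesgue. norm (indicator (box a b) x *\<^sub>R g x) \<le> norm ((1 / ?c) *\<^sub>R (g x * of_real (box_fun 0 (a - 1) (b + 1) x)))"
      by simp
  qed (auto intro!: borel_measurable_scaleR borel_measurable_indicator g)
  have box_zero: "(LINT x|lebesgue. indicator (box a b) x *\<^sub>R g x) = 0" for a b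
  proof -
    have "(\<lambda>n. LINT x|lebesgue. g x * of_real (box_fun n a b x)) \<longlonglongrightarrow> (LINT x|lebesgue. indicator (box a b) x *\<^sub>R g x)"
    proof (rule integral_dominated_convergence)
      show "integrable lebesgue (\<lambda>x. norm (indicator (box a b) x *\<^sub>R g x))" using box_int by (rule integrable_norm)
      show "AE x in lebesgue. (\<lambda>n. g x * of_real (box_fun n a b x)) \<longlonglongrightarrow> indicator (box a b) x *\<^sub>R g x"
      proof (rule AE_I2)
        fix x
        have "(\<lambda>n. g x * complex_of_real (box_fun n a b x)) \<longlonglongrightarrow> g x * complex_of_real (indicator (box a b) x)"
          by (intro tendsto_intros box_fun_tendsto)
        then show "(\<lambda>n. g x * of_real (box_fun n a b x)) \<longlonglongrightarrow> indicator (box a b) x *\<^sub>R g x"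
          by (simp add: scaleR_conv_of_real mult.commute)
      qed
      fix n
      show "(\<lambda>x. g x * of_real (box_fun n a b x)) \<in> borel_measurable lebesgue"
        using int[OF test_fun_box] by (rule borel_measurable_integrable)
      have "norm (g x * of_real (box_fun n a b x)) \<le> norm (indicator (box a b) x *\<^sub>R g x)" for x
        using box_fun_bounds[of n a b x] box_fun_outside[of x a b n]
        by (cases "x \<in> box a b") (auto simp: norm_mult intro: mult_left_le)
      then show "AE x in lebesgue. norm (g x * of_real (box_fun n a b x)) \<le> norm (indicator (box a b) x *\<^sub>R g x)" by simp
    qed (use box_int borel_measurable_integrable in blast)
    moreover have "(LINT x|lebesgue. g x * of_real (box_fun n a b x)) = 0" for n using zero[OF test_fun_box] .
    ultimately show ?thesis by (simp add: LIMSEQ_const_iff)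
  qed
  have boxes: "AE x in lebesgue. indicator (box c d) x *\<^sub>R g x = 0" for c d
  proof -
    have "AE x in lebesgue. L (indicator (box c d) x *\<^sub>R g x) = 0" if L: "bounded_linear L" for L :: "complex \<Rightarrow> real"
    proof (rule zero_box_integrals_real)
      show "integrable lebesgue (\<lambda>x. L (indicator (box c d) x *\<^sub>R g x))"
        by (rule integrable_bounded_linear[OF L box_int])
      show "L (indicator (box c d) x *\<^sub>R g x) = 0" if "x \<notin> box c d" for x
        using that L by (simp add: linear_simps(3))
      fix a b :: "real^'n"
      obtain p q where pq: "box a b \<inter> box c d = box p q" by (rule that[OF box_Int_box])
      have "(LINT x:box a b|lebesgue. L (indicator (box c d) x *\<^sub>R g x)) = (LINT x|lebesgue. L (indicator (box p q) x *\<^sub>R g x))"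
        unfolding set_lebesgue_integral_def pq[symmetric] using L
        by (intro Bochner_Integration.integral_cong) (auto simp: indicator_def linear_simps(3))
      also have "\<dots> = L (LINT x|lebesgue. indicator (box p q) x *\<^sub>R g x)"
        by (rule integral_bounded_linear[OF L box_int])
      finally show "(LINT x:box a b|lebesgue. L (indicator (box c d) x *\<^sub>R g x)) = 0"
        using box_zero L by (simp add: linear_simps(3))
    qed
    from this[OF bounded_linear_Re] this[OF bounded_linear_Im] show ?thesis
      by eventually_elim (simp add: complex_eq_iff)
  qed
  have "AE x in lebesgue. \<forall>n::nat. indicator (box (- (\<chi> i. real n)) (\<chi> i. real n)) x *\<^sub>R g x = 0"
    unfolding AE_all_countable using boxes by blast
  then show ?thesis
  proof eventually_elim
    fix x assume x: "\<forall>n::nat. indicator (box (- (\<chi> i. real n)) (\<chi> i. real n)) x *\<^sub>R g x = 0"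
    obtain n where n: "real n > norm x" using reals_Archimedean2 by blast
    have "- real n < x $ i \<and> x $ i < real n" for i using n component_le_norm_cart[of x i] by linarith
    then have "x \<in> box (- (\<chi> i. real n)) (\<chi> i. real n)" by (simp add: mem_box_cart)
    then show "g x = 0" using x[rule_format, of n] by simp
  qed
qed

section \<open>Weak derivatives and difference quotients\<close>

text \<open>Weak derivatives are tested with real functions, whereas Riesz and density arguments
  need a complex subspace of \<open>L2\<close>.\<close>

definition ctest :: "(real^'n \<Rightarrow> complex) \<Rightarrow> bool" where
  "ctest \<psi> \<longleftrightarrow> test_fun (\<lambda>x. Re (\<psi> x)) \<and> test_fun (\<lambda>x. Im (\<psi> x))"

definition cpd :: "'n \<Rightarrow> (real^'n \<Rightarrow> complex) \<Rightarrow> real^'n \<Rightarrow> complex" where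
  "cpd j \<psi> x = Complex (pdiff j (\<lambda>x. Re (\<psi> x)) x) (pdiff j (\<lambda>x. Im (\<psi> x)) x)"

definition dq :: "'n \<Rightarrow> real \<Rightarrow> (real^'n \<Rightarrow> complex) \<Rightarrow> real^'n \<Rightarrow> complex" where
  "dq j \<tau> f x = (f (x + \<tau> *\<^sub>R axis j 1) - f x) / of_real \<tau>"

lemma ctest_real: "test_fun \<phi> \<Longrightarrow> ctest (\<lambda>x. of_real (\<phi> x))"
  using test_fun_lincomb[of \<phi> \<phi> 0 0] by (simp add: ctest_def)

lemma ctest_add: "\<lbrakk>ctest \<psi>; ctest \<eta>\<rbrakk> \<Longrightarrow> ctest (\<lambda>x. \<psi> x + \<eta> x)"
  unfolding ctest_def
  using test_fun_lincomb[of "\<lambda>x. Re (\<psi> x)" "\<lambda>x. Re (\<eta> x)" 1 1] test_fun_lincomb[of "\<lambda>x. Im (\<psi> x)" "\<lambda>x. Im (\<eta> x)" 1 1] by simp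

lemma ctest_scale: "ctest \<psi> \<Longrightarrow> ctest (\<lambda>x. c * \<psi> x)"
  unfolding ctest_def
  using test_fun_lincomb[of "\<lambda>x. Re (\<psi> x)" "\<lambda>x. Im (\<psi> x)" "Re c" "- Im c"]
    test_fun_lincomb[of "\<lambda>x. Im (\<psi> x)" "\<lambda>x. Re (\<psi> x)" "Re c" "Im c"] by simp

lemma ctest_cnj: "ctest \<psi> \<Longrightarrow> ctest (\<lambda>x. cnj (\<psi> x))"
  unfolding ctest_def using test_fun_lincomb[of "\<lambda>x. Im (\<psi> x)" "\<lambda>x. Im (\<psi> x)" "-1" 0] by simp

lemma ctest_shift: "ctest \<psi> \<Longrightarrow> ctest (\<lambda>x. \<psi> (x + a))"
  unfolding ctest_def using test_fun_shift by auto

lemma cpd_add: "\<lbrakk>ctest \<psi>; ctest \<eta>\<rbrakk> \<Longrightarrow> cpd j (\<lambda>x. \<psi> x + \<eta> x) = (\<lambda>x. cpd j \<psi> x + cpd j \<eta> x)"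
  using smooth_fun_lincomb(2)[of "\<lambda>x. Re (\<psi> x)" "\<lambda>x. Re (\<eta> x)" j 1 1]
    smooth_fun_lincomb(2)[of "\<lambda>x. Im (\<psi> x)" "\<lambda>x. Im (\<eta> x)" j 1 1]
  by (simp add: ctest_def test_fun_def cpd_def fun_eq_iff complex_eq_iff)

lemma cpd_scale: "ctest \<psi> \<Longrightarrow> cpd j (\<lambda>x. c * \<psi> x) = (\<lambda>x. c * cpd j \<psi> x)"
  using smooth_fun_lincomb(2)[of "\<lambda>x. Re (\<psi> x)" "\<lambda>x. Im (\<psi> x)" j "Re c" "- Im c"]
    smooth_fun_lincomb(2)[of "\<lambda>x. Im (\<psi> x)" "\<lambda>x. Re (\<psi> x)" j "Re c" "Im c"]
  by (simp add: ctest_def test_fun_def cpd_def fun_eq_iff complex_eq_iff)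

lemma complex_L2: "\<lbrakk>(\<lambda>x. complex_of_real (p x)) \<in> L2; (\<lambda>x. complex_of_real (q x)) \<in> L2\<rbrakk> \<Longrightarrow> (\<lambda>x. Complex (p x) (q x)) \<in> L2"
  using L2_add[of "\<lambda>x. complex_of_real (p x)" "\<lambda>x. \<i> * complex_of_real (q x)"] L2_scale[of "\<lambda>x. complex_of_real (q x)" \<i>]
  by (simp add: Complex_eq)

lemma ctest_L2: "ctest \<psi> \<Longrightarrow> \<psi> \<in> L2"
  using complex_L2[of "\<lambda>x. Re (\<psi> x)" "\<lambda>x. Im (\<psi> x)"] test_fun_L2 by (auto simp: ctest_def)

lemma cpd_L2: "ctest \<psi> \<Longrightarrow> cpd j \<psi> \<in> L2"
  unfolding cpd_def[abs_def] ctest_def by (intro complex_L2 test_fun_L2 test_fun_pdiff) auto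

lemma subspace_ctest: "L2.subspace (Collect ctest)"
  using ctest_add ctest_scale[of _] ctest_scale[OF ctest_real[OF test_fun_box], of 0]
  by (auto simp: L2.subspace_def fsc_def plus_fun_def zero_fun_def)

lemma ctest_subset: "Collect ctest \<subseteq> L2" using ctest_L2 by blast

lemma ctest_dense:
  assumes e: "e \<in> L2" and z: "\<And>\<psi>. \<psi> \<in> Collect ctest \<Longrightarrow> l2_inner \<psi> e = 0"
  shows "l2_norm e = 0"
proof -
  have "AE x in lebesgue. cnj (e x) = 0"
  proof (rule fundamental_lemma)
    fix \<phi> :: "real^'a \<Rightarrow> real" assume t: "test_fun \<phi>"
    show "integrable lebesgue (\<lambda>x. cnj (e x) * of_real (\<phi> x))" using L2_mult[OF L2_cnj[OF e] test_fun_L2[OF t]] .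
    show "(LINT x|lebesgue. cnj (e x) * of_real (\<phi> x)) = 0"
      using z[of "\<lambda>x. of_real (\<phi> x)"] ctest_real[OF t] by (simp add: l2_inner_def mult.commute)
  qed (use L2_cnj[OF e] in \<open>simp add: L2_def\<close>)
  then show ?thesis using l2_norm_zero_iff[OF e] by simp
qed

lemma ctest_approx:
  assumes "y \<in> L2"
  obtains s where "\<And>n. ctest (s n)" "(\<lambda>n. l2_norm (s n - y)) \<longlonglongrightarrow> 0"
proof (rule L2.dense_approx[OF subspace_ctest ctest_subset assms])
  show "L2.nrm e = 0" if "e \<in> L2" "\<And>x. x \<in> Collect ctest \<Longrightarrow> l2_inner x e = 0" for e :: "real^'a \<Rightarrow> complex"
    using ctest_dense[OF that] by simp
qed (use that in auto)

lemma dense_norm_bound: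
  assumes y: "y \<in> L2" and M: "0 \<le> M" "\<And>\<psi>. ctest \<psi> \<Longrightarrow> cmod (l2_inner \<psi> y) \<le> M * l2_norm \<psi>"
  shows "l2_norm y \<le> M"
proof -
  obtain s where s: "\<And>n. ctest (s n)" "(\<lambda>n. l2_norm (s n - y)) \<longlonglongrightarrow> 0" using ctest_approx[OF y] by blast
  have sL: "s n \<in> L2" for n using s ctest_L2 by blast
  have "cmod (l2_inner y y) \<le> M * l2_norm y"
  proof (rule LIMSEQ_le)
    show "(\<lambda>n. cmod (l2_inner (s n) y)) \<longlonglongrightarrow> cmod (l2_inner y y)"
      using L2.tendsto_ip(1)[OF sL y y] s by (intro tendsto_norm) simp
    show "(\<lambda>n. M * l2_norm (s n)) \<longlonglongrightarrow> M * l2_norm y"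
      using L2.tendsto_nrm[OF sL y] s by (intro tendsto_intros) simp
    show "\<exists>N. \<forall>n\<ge>N. cmod (l2_inner (s n) y) \<le> M * l2_norm (s n)" using M s by blast
  qed
  then have "l2_norm y * l2_norm y \<le> M * l2_norm y" by (simp add: l2_self[OF y] norm_mult power2_eq_square)
  then show ?thesis using M(1) l2_norm_ge0[of y] by (cases "l2_norm y = 0") (auto simp: mult_le_cancel_right)
qed

text \<open>For a norm-bounded sequence weak convergence may be checked on a dense subspace; the
  usual three-term splitting.\<close>

lemma weak_limit_extend:
  assumes y: "\<And>n. y n \<in> L2" "\<And>n. l2_norm (y n) \<le> M" and g: "g \<in> L2" and z: "z \<in> L2"
    and lim: "\<And>\<psi>. ctest \<psi> \<Longrightarrow> (\<lambda>n. l2_inner (y n) \<psi>) \<longlonglongrightarrow> l2_inner g \<psi>"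
  shows "(\<lambda>n. l2_inner (y n) z) \<longlonglongrightarrow> l2_inner g z"
proof (rule LIMSEQ_I)
  fix e :: real assume e: "e > 0"
  have M: "0 \<le> M" using y(2)[of 0] l2_norm_ge0 order_trans by blast
  define K where "K = M + l2_norm g + 1"
  have K: "K > 0" using M by (simp add: K_def add_nonneg_pos)
  obtain s where s: "\<And>n. ctest (s n)" "(\<lambda>n. l2_norm (s n - z)) \<longlonglongrightarrow> 0" using ctest_approx[OF z] by blast
  have "e / (2 * K) > 0" using e K by simp
  from order_tendstoD(2)[OF s(2) this] obtain k where k: "l2_norm (s k - z) < e / (2 * K)"
    unfolding eventually_sequentially by blast
  have sk: "s k \<in> L2" using s ctest_L2 by blast
  have "(\<lambda>n. l2_inner (y n) (s k)) \<longlonglongrightarrow> l2_inner g (s k)" using lim s by blast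
  then obtain N where N: "\<And>n. n \<ge> N \<Longrightarrow> cmod (l2_inner (y n) (s k) - l2_inner g (s k)) < e/2"
    using LIMSEQ_D[of _ _ "e/2"] e by (metis half_gt_zero)
  have "cmod (l2_inner (y n) z - l2_inner g z) < e" if "n \<ge> N" for n
  proof -
    let ?d = "z - s k"
    have d: "?d \<in> L2" "l2_norm ?d < e / (2 * K)" using sk z k L2.nrm_minus[OF z sk] by auto
    have "l2_inner (y n) z - l2_inner g z = (l2_inner (y n) ?d - l2_inner g ?d) + (l2_inner (y n) (s k) - l2_inner g (s k))"
      using y g z sk by (simp add: L2.ip_diff2)
    also have "cmod \<dots> \<le> (M * l2_norm ?d + l2_norm g * l2_norm ?d) + e/2"
    proof -
      have "cmod (l2_inner (y n) ?d) \<le> M * l2_norm ?d"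
        using L2.cauchy_schwarz[OF y(1) d(1), of n] y(2)[of n] mult_right_mono[of "l2_norm (y n)" M "l2_norm ?d"] by simp
      moreover have "cmod (l2_inner g ?d) \<le> l2_norm g * l2_norm ?d" using L2.cauchy_schwarz[OF g d(1)] by simp
      ultimately show ?thesis
        using N[OF that] norm_triangle_ineq[of "l2_inner (y n) ?d - l2_inner g ?d" "l2_inner (y n) (s k) - l2_inner g (s k)"]
          norm_triangle_ineq4[of "l2_inner (y n) ?d" "l2_inner g ?d"] by linarith
    qed
    also have "M * l2_norm ?d + l2_norm g * l2_norm ?d \<le> K * l2_norm ?d"
      using l2_norm_ge0[of ?d] by (simp add: K_def algebra_simps)
    also have "K * l2_norm ?d < e / 2" using d(2) K by (simp add: field_simps)
    finally show ?thesis by simp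
  qed
  then show "\<exists>no. \<forall>n\<ge>no. norm (l2_inner (y n) z - l2_inner g z) < e" by blast
qed

section \<open>Difference quotients and weak derivatives\<close>

lemma dq_L2: "f \<in> L2 \<Longrightarrow> dq j \<tau> f \<in> L2"
proof -
  assume f: "f \<in> L2"
  have "(\<lambda>x. (1 / of_real \<tau>) * (f (x + \<tau> *\<^sub>R axis j 1) - f x)) \<in> L2"
    by (intro L2_scale L2_diff L2_shift f)
  then show ?thesis by (simp add: dq_def[abs_def])
qed

lemma dq_adjoint:
  assumes f: "f \<in> L2" and g: "g \<in> L2"
  shows "(LINT x|lebesgue. dq j \<tau> f x * g x) = - (LINT x|lebesgue. f x * dq j (- \<tau>) g x)"
proof (cases "\<tau> = 0")
  case True
  then show ?thesis by (simp add: dq_def)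
next
  case False
  let ?a = "\<tau> *\<^sub>R axis j 1"
  have i: "integrable lebesgue (\<lambda>x. f (x + ?a) * g x)" "integrable lebesgue (\<lambda>x. f x * g x)" "integrable lebesgue (\<lambda>x. f x * g (x + - ?a))"
    by (intro L2_mult L2_shift f g)+
  have "(LINT x|lebesgue. f (x + ?a) * g x) = (LINT x|lebesgue. f x * g (x + - ?a))"
    using lebesgue_integral_shift[OF borel_measurable_integrable[OF i(3)], of ?a] by simp
  moreover have "(LINT x|lebesgue. dq j \<tau> f x * g x) = (LINT x|lebesgue. (f (x + ?a) * g x - f x * g x) / of_real \<tau>)"
    by (simp add: dq_def diff_divide_distrib left_diff_distrib)
  moreover have "(LINT x|lebesgue. f x * dq j (- \<tau>) g x) = (LINT x|lebesgue. (f x * g x - f x * g (x + - ?a)) / of_real \<tau>)"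
    by (simp add: dq_def diff_divide_distrib right_diff_distrib)
  ultimately show ?thesis using i by (simp add: diff_divide_distrib)
qed

lemma test_fun_lipschitz:
  assumes "test_fun \<phi>" obtains C where "C > 0" "\<And>x \<tau>. \<bar>\<phi> (x + \<tau> *\<^sub>R axis j 1) - \<phi> x\<bar> \<le> C * \<bar>\<tau>\<bar>"
proof -
  obtain C where C: "C > 0" "\<And>x. \<bar>pdiff j \<phi> x\<bar> \<le> C" using test_fun_bounded[OF test_fun_pdiff[OF assms]] by blast
  have "norm (\<phi> (x + \<tau> *\<^sub>R axis j 1) - \<phi> (x + 0 *\<^sub>R axis j 1)) \<le> C * norm (\<tau> - 0)" for x \<tau>
  proof (rule field_differentiable_bound[of UNIV])
    show "((\<lambda>t. \<phi> (x + t *\<^sub>R axis j 1)) has_field_derivative pdiff j \<phi> (x + t *\<^sub>R axis j 1)) (at t within UNIV)" for t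
      by (rule pdiff_derivative) (use assms in \<open>simp add: test_fun_def\<close>)
  qed (use C in auto)
  then show ?thesis using that C(1) by simp
qed

text \<open>Dominated convergence: the steps are bounded by H, so all quotients vanish outside the
  ball of radius R + H and are bounded by a Lipschitz constant.\<close>

lemma tendsto_dq_test:
  fixes v :: "real^'n \<Rightarrow> complex"
  assumes v: "v \<in> L2" and \<phi>: "test_fun \<phi>" and h: "h \<longlonglongrightarrow> 0" "\<And>n. h n \<noteq> 0"
  shows "(\<lambda>n. LINT x|lebesgue. v x * dq j (h n) (\<lambda>x. of_real (\<phi> x)) x) \<longlonglongrightarrow> (LINT x|lebesgue. v x * of_real (pdiff j \<phi> x))"
proof -
  obtain R where R: "R > 0" "\<And>x. norm x > R \<Longrightarrow> \<phi> x = 0" using test_fun_radius[OF \<phi>] by blast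
  obtain C where C: "C > 0" "\<And>x \<tau>. \<bar>\<phi> (x + \<tau> *\<^sub>R axis j 1) - \<phi> x\<bar> \<le> C * \<bar>\<tau>\<bar>" using test_fun_lipschitz[OF \<phi>] by blast
  obtain H where H: "\<And>n. \<bar>h n\<bar> \<le> H"
    using convergent_imp_Bseq[OF convergentI[OF h(1)]] by (auto simp: Bseq_def)
  let ?w = "\<lambda>x::real^'n. complex_of_real (C * indicator (cball 0 (R + H)) x)"
  have wL: "?w \<in> L2"
  proof (rule bounded_support_L2)
    have "(indicator (cball 0 (R + H)) :: real^'n \<Rightarrow> real) \<in> borel_measurable lebesgue"
      by (rule borel_measurable_indicator) auto
    then have "(\<lambda>x::real^'n. C * indicator (cball 0 (R + H)) x) \<in> borel_measurable lebesgue"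
      by (rule borel_measurable_times[OF borel_measurable_const])
    then show "?w \<in> borel_measurable lebesgue"
      by (rule borel_measurable_continuous_on[rotated]) (intro continuous_intros)
    show "cmod (?w x) \<le> C" for x using C(1) by (simp add: indicator_def)
    show "?w x = 0" if "R + H < norm x" for x using that by simp
  qed
  show ?thesis
  proof (rule integral_dominated_convergence)
    show "integrable lebesgue (\<lambda>x. norm (v x * ?w x))" by (intro integrable_norm L2_mult v wL)
    show "(\<lambda>x. v x * complex_of_real (pdiff j \<phi> x)) \<in> borel_measurable lebesgue"
      using L2_mult[OF v test_fun_L2[OF test_fun_pdiff[OF \<phi>]]] by (rule borel_measurable_integrable)
    show "(\<lambda>x. v x * dq j (h n) (\<lambda>x. of_real (\<phi> x)) x) \<in> borel_measurable lebesgue" for n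
      using L2_mult[OF v dq_L2[OF test_fun_L2[OF \<phi>]]] by (rule borel_measurable_integrable)
    show "AE x in lebesgue. (\<lambda>n. v x * dq j (h n) (\<lambda>x. of_real (\<phi> x)) x) \<longlonglongrightarrow> v x * complex_of_real (pdiff j \<phi> x)"
    proof (rule AE_I2)
      fix x
      have "((\<lambda>t. (\<phi> (x + (0 + t) *\<^sub>R axis j 1) - \<phi> (x + 0 *\<^sub>R axis j 1)) / t) \<longlongrightarrow> pdiff j \<phi> (x + 0 *\<^sub>R axis j 1)) (at 0)"
        using pdiff_derivative[of \<phi> x j 0] \<phi> by (simp add: test_fun_def DERIV_def)
      then have "(\<lambda>n. (\<phi> (x + (0 + h n) *\<^sub>R axis j 1) - \<phi> (x + 0 *\<^sub>R axis j 1)) / h n) \<longlonglongrightarrow> pdiff j \<phi> (x + 0 *\<^sub>R axis j 1)"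
        by (rule filterlim_compose) (use h in \<open>auto simp: filterlim_at\<close>)
      then have "(\<lambda>n. complex_of_real ((\<phi> (x + h n *\<^sub>R axis j 1) - \<phi> x) / h n)) \<longlonglongrightarrow> complex_of_real (pdiff j \<phi> x)"
        by (intro tendsto_of_real) simp
      then show "(\<lambda>n. v x * dq j (h n) (\<lambda>x. of_real (\<phi> x)) x) \<longlonglongrightarrow> v x * complex_of_real (pdiff j \<phi> x)"
        by (intro tendsto_intros) (simp add: dq_def)
    qed
    fix n
    have "cmod (dq j (h n) (\<lambda>x. of_real (\<phi> x)) x) \<le> cmod (?w x)" for x
    proof (cases "norm x \<le> R + H")
      case True
      have "cmod (dq j (h n) (\<lambda>x. of_real (\<phi> x)) x) = \<bar>\<phi> (x + h n *\<^sub>R axis j 1) - \<phi> x\<bar> / \<bar>h n\<bar>"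
        by (simp add: dq_def norm_divide flip: of_real_diff)
      also have "\<dots> \<le> C" using C(2)[of x "h n"] h(2)[of n] by (simp add: divide_le_eq)
      finally show ?thesis using True C(1) by simp
    next
      case False
      have "norm x \<le> norm (x + h n *\<^sub>R axis j 1) + \<bar>h n\<bar>"
        using norm_triangle_ineq4[of "x + h n *\<^sub>R axis j 1" "h n *\<^sub>R axis j 1"] by simp
      then have "norm (x + h n *\<^sub>R axis j 1) > R" using False H[of n] by linarith
      moreover have "norm x > R" using False H[of n] by linarith
      ultimately show ?thesis using R(2) by (simp add: dq_def)
    qed
    then have "norm (v x * dq j (h n) (\<lambda>x. of_real (\<phi> x)) x) \<le> norm (v x * ?w x)" for x
      unfolding norm_mult by (intro mult_left_mono) auto
    then show "AE x in lebesgue. norm (v x * dq j (h n) (\<lambda>x. of_real (\<phi> x)) x) \<le> norm (v x * ?w x)" by simp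
  qed
qed

lemma tendsto_dq_ctest:
  assumes v: "v \<in> L2" and \<psi>: "ctest \<psi>" and h: "h \<longlonglongrightarrow> 0" "\<And>n. h n \<noteq> 0"
  shows "(\<lambda>n. LINT x|lebesgue. v x * dq j (h n) \<psi> x) \<longlonglongrightarrow> (LINT x|lebesgue. v x * cpd j \<psi> x)"
proof -
  let ?p = "\<lambda>x. Re (\<psi> x)" and ?q = "\<lambda>x. Im (\<psi> x)"
  have t: "test_fun ?p" "test_fun ?q" using \<psi> by (auto simp: ctest_def)
  have L: "(\<lambda>x. complex_of_real (?p x)) \<in> L2" "(\<lambda>x. complex_of_real (?q x)) \<in> L2" using t test_fun_L2 by auto
  have "dq j (h n) \<psi> x = dq j (h n) (\<lambda>x. of_real (?p x)) x + \<i> * dq j (h n) (\<lambda>x. of_real (?q x)) x" for n x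
    by (simp add: dq_def field_simps complex_eq_iff)
  then have 1: "(LINT x|lebesgue. v x * dq j (h n) \<psi> x) = (LINT x|lebesgue. v x * dq j (h n) (\<lambda>x. of_real (?p x)) x) + \<i> * (LINT x|lebesgue. v x * dq j (h n) (\<lambda>x. of_real (?q x)) x)" for n
    using L2_mult[OF v dq_L2[OF L(1)], of j "h n"] L2_mult[OF v dq_L2[OF L(2)], of j "h n"]
    by (simp add: distrib_left mult.left_commute[of _ \<i>])
  have "(LINT x|lebesgue. v x * cpd j \<psi> x) = (LINT x|lebesgue. v x * of_real (pdiff j ?p x) + \<i> * (v x * of_real (pdiff j ?q x)))"
    by (simp add: cpd_def Complex_eq algebra_simps)
  also have "\<dots> = (LINT x|lebesgue. v x * of_real (pdiff j ?p x)) + \<i> * (LINT x|lebesgue. v x * of_real (pdiff j ?q x))"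
    using L2_mult[OF v test_fun_L2[OF test_fun_pdiff[OF t(1)]]] L2_mult[OF v test_fun_L2[OF test_fun_pdiff[OF t(2)]]] by simp
  finally show ?thesis unfolding 1 by (simp only:) (intro tendsto_intros tendsto_dq_test v t h)
qed

lemma weak_pd_ctest:
  assumes f: "f \<in> L2" and g: "g \<in> L2" and w: "has_weak_pd f j g" and \<psi>: "ctest \<psi>"
  shows "(LINT x|lebesgue. f x * cpd j \<psi> x) = - (LINT x|lebesgue. g x * \<psi> x)"
proof -
  let ?p = "\<lambda>x. Re (\<psi> x)" and ?q = "\<lambda>x. Im (\<psi> x)"
  have t: "test_fun ?p" "test_fun ?q" using \<psi> by (auto simp: ctest_def)
  have "(LINT x|lebesgue. f x * cpd j \<psi> x) = (LINT x|lebesgue. f x * of_real (pdiff j ?p x) + \<i> * (f x * of_real (pdiff j ?q x)))"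
    by (simp add: cpd_def Complex_eq algebra_simps)
  also have "\<dots> = (LINT x|lebesgue. f x * of_real (pdiff j ?p x)) + \<i> * (LINT x|lebesgue. f x * of_real (pdiff j ?q x))"
    using L2_mult[OF f test_fun_L2[OF test_fun_pdiff[OF t(1)]]] L2_mult[OF f test_fun_L2[OF test_fun_pdiff[OF t(2)]]] by simp
  also have "\<dots> = - ((LINT x|lebesgue. g x * of_real (?p x)) + \<i> * (LINT x|lebesgue. g x * of_real (?q x)))"
    using w t by (simp add: has_weak_pd_def)
  also have "(LINT x|lebesgue. g x * of_real (?p x)) + \<i> * (LINT x|lebesgue. g x * of_real (?q x)) = (LINT x|lebesgue. g x * of_real (?p x) + \<i> * (g x * of_real (?q x)))"
    using L2_mult[OF g test_fun_L2[OF t(1)]] L2_mult[OF g test_fun_L2[OF t(2)]] by simp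
  also have "\<dots> = (LINT x|lebesgue. g x * \<psi> x)"
    by (intro Bochner_Integration.integral_cong refl) (simp add: complex_eq_iff algebra_simps)
  finally show ?thesis .
qed

text \<open>A mean value inequality along translations. The shift is put on the test function, so
  the real part of \<integral> f \<Psi>(s) is differentiable in s with derivative the real part of
  \<integral> g \<Psi>(s), which Cauchy-Schwarz bounds. A final phase rotation passes from the real
  part to the modulus.\<close>

lemma dq_weak_bound:
  assumes f: "f \<in> L2" and g: "g \<in> L2" and w: "has_weak_pd f j g" and \<psi>: "ctest \<psi>"
  shows "cmod (LINT x|lebesgue. dq j \<tau> f x * \<psi> x) \<le> l2_norm g * l2_norm \<psi>"
proof -
  have re: "\<bar>Re (LINT x|lebesgue. dq j \<tau> f x * \<psi> x)\<bar> \<le> l2_norm g * l2_norm \<psi>" if \<psi>: "ctest \<psi>" for \<psi>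
  proof (cases "\<tau> = 0")
    case True
    then show ?thesis by (simp add: dq_def)
  next
    case False
    define \<Psi> where "\<Psi> s = (\<lambda>x. \<psi> (x + (- s) *\<^sub>R axis j 1))" for s
    have \<Psi>: "ctest (\<Psi> s)" "\<Psi> s \<in> L2" "l2_norm (\<Psi> s) = l2_norm \<psi>" for s
      unfolding \<Psi>_def by (rule ctest_shift[OF \<psi>] ctest_L2[OF ctest_shift[OF \<psi>]] l2_norm_shift[OF ctest_L2[OF \<psi>]])+
    define R where "R s = Re (LINT x|lebesgue. f x * \<Psi> s x)" for s
    have d: "(R has_real_derivative Re (LINT x|lebesgue. g x * \<Psi> s x)) (at s)" for s
      unfolding DERIV_def
    proof (subst tendsto_at_iff_sequentially, intro allI impI)
      fix h assume "\<forall>i. h i \<in> UNIV - {0::real}" "h \<longlonglongrightarrow> 0"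
      then have h: "(\<lambda>n. - h n) \<longlonglongrightarrow> 0" "\<And>n. - h n \<noteq> 0" using tendsto_minus[of h 0] by auto
      have "(R (s + h n) - R s) / h n = Re (- (LINT x|lebesgue. f x * dq j (- h n) (\<Psi> s) x))" for n
      proof -
        have e: "f x * \<Psi> (s + h n) x - f x * \<Psi> s x = - of_real (h n) * (f x * dq j (- h n) (\<Psi> s) x)" for x
        proof -
          have "dq j (- h n) (\<Psi> s) x = (\<Psi> (s + h n) x - \<Psi> s x) / (- of_real (h n))"
            by (simp add: \<Psi>_def dq_def algebra_simps)
          then show ?thesis using h(2)[of n] by (simp add: right_diff_distrib diff_divide_distrib)
        qed
        have "R (s + h n) - R s = Re ((LINT x|lebesgue. f x * \<Psi> (s + h n) x) - (LINT x|lebesgue. f x * \<Psi> s x))" by (simp add: R_def)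
        also have "(LINT x|lebesgue. f x * \<Psi> (s + h n) x) - (LINT x|lebesgue. f x * \<Psi> s x) = (LINT x|lebesgue. f x * \<Psi> (s + h n) x - f x * \<Psi> s x)"
          using L2_mult[OF f \<Psi>(2)] by simp
        also have "\<dots> = - of_real (h n) * (LINT x|lebesgue. f x * dq j (- h n) (\<Psi> s) x)" unfolding e by simp
        finally show ?thesis using h(2)[of n] by simp
      qed
      moreover have "(\<lambda>n. Re (- (LINT x|lebesgue. f x * dq j (- h n) (\<Psi> s) x))) \<longlonglongrightarrow> Re (- (LINT x|lebesgue. f x * cpd j (\<Psi> s) x))"
        by (intro tendsto_Re tendsto_minus tendsto_dq_ctest f \<Psi> h)
      ultimately show "((\<lambda>h. (R (s + h) - R s) / h) \<circ> h) \<longlonglongrightarrow> Re (LINT x|lebesgue. g x * \<Psi> s x)"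
        using weak_pd_ctest[OF f g w \<Psi>(1)] by (simp add: comp_def)
    qed
    have b: "\<bar>Re (LINT x|lebesgue. g x * \<Psi> s x)\<bar> \<le> l2_norm g * l2_norm \<psi>" for s
    proof -
      have "(LINT x|lebesgue. g x * \<Psi> s x) = l2_inner g (\<lambda>x. cnj (\<Psi> s x))" by (simp add: l2_inner_def)
      moreover have "l2_norm (\<lambda>x. cnj (\<Psi> s x)) = l2_norm \<psi>" using \<Psi>(3)[of s] by (simp add: l2_norm_def)
      ultimately show ?thesis
        using L2.cauchy_schwarz[OF g L2_cnj[OF \<Psi>(2)]] abs_Re_le_cmod order_trans by (metis L2_nrm)
    qed
    have "norm (R \<tau> - R 0) \<le> (l2_norm g * l2_norm \<psi>) * norm (\<tau> - 0)"
      by (rule field_differentiable_bound[of UNIV]) (use d b in auto)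
    moreover have "(LINT x|lebesgue. dq j \<tau> f x * \<psi> x) = ((LINT x|lebesgue. f x * \<Psi> \<tau> x) - (LINT x|lebesgue. f x * \<Psi> 0 x)) / of_real \<tau>"
    proof -
      have e: "- (f x * dq j (- \<tau>) \<psi> x) = (f x * \<Psi> \<tau> x - f x * \<Psi> 0 x) / of_real \<tau>" for x
        using False by (simp add: \<Psi>_def dq_def field_simps)
      have "(LINT x|lebesgue. dq j \<tau> f x * \<psi> x) = (LINT x|lebesgue. - (f x * dq j (- \<tau>) \<psi> x))"
        using dq_adjoint[OF f ctest_L2[OF \<psi>]] by simp
      also have "\<dots> = ((LINT x|lebesgue. f x * \<Psi> \<tau> x) - (LINT x|lebesgue. f x * \<Psi> 0 x)) / of_real \<tau>"
        unfolding e using L2_mult[OF f \<Psi>(2)] by simp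
      finally show ?thesis .
    qed
    ultimately show ?thesis using False by (simp add: R_def divide_le_eq abs_divide)
  qed
  let ?I = "LINT x|lebesgue. dq j \<tau> f x * \<psi> x"
  show ?thesis
  proof (cases "?I = 0")
    case True
    then show ?thesis by simp
  next
    case False
    define \<zeta> where "\<zeta> = cnj ?I / of_real (cmod ?I)"
    have z1: "cmod \<zeta> = 1" using False by (simp add: \<zeta>_def norm_divide)
    have "\<zeta> * ?I = cnj ?I * ?I / of_real (cmod ?I)" by (simp add: \<zeta>_def)
    also have "\<dots> = of_real (cmod ?I)" using complex_norm_square[of ?I] False by (simp add: power2_eq_square mult.commute divide_eq_eq)
    finally have z2: "\<zeta> * ?I = of_real (cmod ?I)" .
    have "dq j \<tau> f x * (\<zeta> * \<psi> x) = \<zeta> * (dq j \<tau> f x * \<psi> x)" for x by (rule mult.left_commute)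
    then have "(LINT x|lebesgue. dq j \<tau> f x * (\<zeta> * \<psi> x)) = (LINT x|lebesgue. \<zeta> * (dq j \<tau> f x * \<psi> x))"
      by presburger
    then have "(LINT x|lebesgue. dq j \<tau> f x * (\<zeta> * \<psi> x)) = \<zeta> * ?I"
      by (rule trans) (rule integral_mult_right_zero)
    moreover have "l2_norm (\<lambda>x. \<zeta> * \<psi> x) = l2_norm \<psi>" using z1 by (simp add: l2_norm_def norm_mult)
    moreover note re[OF ctest_scale[OF \<psi>, of \<zeta>]]
    ultimately have "\<bar>Re (of_real (cmod ?I))\<bar> \<le> l2_norm g * l2_norm \<psi>" by (simp only: z2)
    then show ?thesis by (simp only: Re_complex_of_real abs_norm_cancel)
  qed
qed

lemma dq_norm_le:
  assumes f: "f \<in> L2" and g: "g \<in> L2" and w: "has_weak_pd f j g"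
  shows "l2_norm (dq j \<tau> f) \<le> l2_norm g"
proof -
  let ?y = "\<lambda>x. cnj (dq j \<tau> f x)"
  have "l2_norm ?y \<le> l2_norm g"
  proof (rule dense_norm_bound)
    show "?y \<in> L2" by (intro L2_cnj dq_L2 f)
    show "cmod (l2_inner \<psi> ?y) \<le> l2_norm g * l2_norm \<psi>" if "ctest \<psi>" for \<psi>
      using dq_weak_bound[OF f g w that, of \<tau>] by (simp add: l2_inner_def mult.commute)
  qed simp
  then show ?thesis by (simp add: l2_norm_def)
qed

text \<open>The quotients converge weakly to g and their norms do not exceed that of g; together
  this gives strong convergence.\<close>

lemma dq_tendsto:
  assumes f: "f \<in> L2" and g: "g \<in> L2" and w: "has_weak_pd f j g" and h: "h \<longlonglongrightarrow> 0" "\<And>n. h n \<noteq> 0"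
  shows "(\<lambda>n. l2_norm (dq j (h n) f - g)) \<longlonglongrightarrow> 0"
proof -
  have "(\<lambda>n. l2_inner (dq j (h n) f) g) \<longlonglongrightarrow> l2_inner g g"
  proof (rule weak_limit_extend)
    fix \<psi> :: "real^'a \<Rightarrow> complex" assume "ctest \<psi>"
    then have c: "ctest (\<lambda>x. cnj (\<psi> x))" by (rule ctest_cnj)
    have h': "(\<lambda>n. - h n) \<longlonglongrightarrow> 0" "\<And>n. - h n \<noteq> 0" using tendsto_minus[OF h(1)] h(2) by auto
    have "(\<lambda>n. - (LINT x|lebesgue. f x * dq j (- h n) (\<lambda>x. cnj (\<psi> x)) x)) \<longlonglongrightarrow> - (LINT x|lebesgue. f x * cpd j (\<lambda>x. cnj (\<psi> x)) x)"
      by (intro tendsto_minus tendsto_dq_ctest f c h')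
    then show "(\<lambda>n. l2_inner (dq j (h n) f) \<psi>) \<longlonglongrightarrow> l2_inner g \<psi>"
      unfolding l2_inner_def using weak_pd_ctest[OF f g w c] dq_adjoint[OF f ctest_L2[OF c]] by simp
  qed (use dq_L2[OF f] g dq_norm_le[OF f g w] in auto)
  then have "(\<lambda>n. 2 * (l2_norm g)\<^sup>2 - 2 * Re (l2_inner (dq j (h n) f) g)) \<longlonglongrightarrow> 2 * (l2_norm g)\<^sup>2 - 2 * Re (l2_inner g g)"
    by (intro tendsto_intros)
  then have l0: "(\<lambda>n. 2 * (l2_norm g)\<^sup>2 - 2 * Re (l2_inner (dq j (h n) f) g)) \<longlonglongrightarrow> 0" by (simp add: l2_self[OF g])
  have "(\<lambda>n. (l2_norm (dq j (h n) f - g))\<^sup>2) \<longlonglongrightarrow> 0"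
  proof (rule Lim_null_comparison[OF _ l0], rule always_eventually, rule allI)
    fix n
    have "(l2_norm (dq j (h n) f))\<^sup>2 \<le> (l2_norm g)\<^sup>2" using dq_norm_le[OF f g w] by (intro power_mono) auto
    then show "norm ((l2_norm (dq j (h n) f - g))\<^sup>2) \<le> 2 * (l2_norm g)\<^sup>2 - 2 * Re (l2_inner (dq j (h n) f) g)"
      using L2.nrm_diff_sq[OF dq_L2[OF f] g, of j "h n"] unfolding real_norm_def abs_power2 L2_nrm by linarith
  qed
  then have "(\<lambda>n. sqrt ((l2_norm (dq j (h n) f - g))\<^sup>2)) \<longlonglongrightarrow> sqrt 0" by (rule tendsto_real_sqrt)
  then show ?thesis by simp
qed

text \<open>The converse of \<open>dq_norm_le\<close>: bounded quotients make integration of v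
  against derivatives of test functions an \<open>L2\<close>-bounded functional, and Riesz
  represents it. Conjugating v keeps the functional linear although the inner product is conjugate
  linear in its second slot.\<close>

lemma bounded_dq_weak_pd:
  assumes v: "v \<in> L2" and h: "h \<longlonglongrightarrow> 0" "\<And>n. h n \<noteq> 0" and M: "\<And>n. l2_norm (dq j (h n) v) \<le> M"
  obtains g where "g \<in> L2" "has_weak_pd v j g" "l2_norm g \<le> M"
proof -
  define l where "l \<psi> = - (LINT x|lebesgue. cnj (v x) * cpd j \<psi> x)" for \<psi>
  have h': "(\<lambda>n. - h n) \<longlonglongrightarrow> 0" "\<And>n. - h n \<noteq> 0" using tendsto_minus[OF h(1)] h(2) by auto
  have M0: "0 \<le> M" using M[of 0] l2_norm_ge0 order_trans by blast
  have bound: "cmod (l \<psi>) \<le> M * l2_norm \<psi>" if "ctest \<psi>" for \<psi>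
  proof (rule LIMSEQ_le_const2)
    show "(\<lambda>n. cmod (- (LINT x|lebesgue. cnj (v x) * dq j (- h n) \<psi> x))) \<longlonglongrightarrow> cmod (l \<psi>)"
      unfolding l_def by (intro tendsto_norm tendsto_minus tendsto_dq_ctest L2_cnj v that h')
    have "cmod (- (LINT x|lebesgue. cnj (v x) * dq j (- h n) \<psi> x)) \<le> M * l2_norm \<psi>" for n
    proof -
      have "- (LINT x|lebesgue. cnj (v x) * dq j (- h n) \<psi> x) = (LINT x|lebesgue. dq j (h n) (\<lambda>x. cnj (v x)) x * \<psi> x)"
        using dq_adjoint[OF L2_cnj[OF v] ctest_L2[OF that]] by simp
      also have "\<dots> = l2_inner \<psi> (dq j (h n) v)" by (simp add: l2_inner_def dq_def mult.commute)
      finally show ?thesis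
        using L2.cauchy_schwarz[OF ctest_L2[OF that] dq_L2[OF v], of j "h n"] M[of n]
          mult_right_mono[OF M[of n], of "l2_norm \<psi>"] by (simp add: mult.commute)
    qed
    then show "\<exists>N. \<forall>n\<ge>N. cmod (- (LINT x|lebesgue. cnj (v x) * dq j (- h n) \<psi> x)) \<le> M * l2_norm \<psi>" by blast
  qed
  obtain g where g: "g \<in> L2" "\<And>\<psi>. \<psi> \<in> Collect ctest \<Longrightarrow> l2_inner \<psi> g = l \<psi>" "l2_norm g \<le> M"
  proof (rule L2.riesz[OF subspace_ctest ctest_subset, of l M])
    show "l (\<psi> + \<eta>) = l \<psi> + l \<eta>" if "\<psi> \<in> Collect ctest" "\<eta> \<in> Collect ctest" for \<psi> \<eta>
      using that L2_mult[OF L2_cnj[OF v] cpd_L2[of \<psi>]] L2_mult[OF L2_cnj[OF v] cpd_L2[of \<eta>]]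
      by (simp add: l_def plus_fun_def cpd_add distrib_left)
    show "l (fsc c \<psi>) = c * l \<psi>" if "\<psi> \<in> Collect ctest" for c \<psi>
      using that by (simp add: l_def fsc_def cpd_scale mult.left_commute)
  qed (use M0 bound in auto)
  have "(LINT x|lebesgue. v x * of_real (pdiff j \<phi> x)) = - (LINT x|lebesgue. g x * of_real (\<phi> x))" if t: "test_fun \<phi>" for \<phi>
  proof -
    let ?\<psi> = "\<lambda>x. complex_of_real (\<phi> x)"
    have z: "pdiff j (\<lambda>x. 0) = (\<lambda>x. 0)" by (simp add: pdiff_def)
    have "cnj (l2_inner ?\<psi> g) = cnj (l ?\<psi>)" using g(2)[of ?\<psi>] ctest_real[OF t] by simp
    moreover have "cnj (l2_inner ?\<psi> g) = (LINT x|lebesgue. g x * of_real (\<phi> x))"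
      unfolding l2_inner_def by (subst Bochner_Integration.integral_cnj[symmetric]) (simp add: mult.commute)
    moreover have "cnj (l ?\<psi>) = - (LINT x|lebesgue. v x * of_real (pdiff j \<phi> x))"
      unfolding l_def complex_cnj_minus
      by (subst Bochner_Integration.integral_cnj[symmetric]) (simp add: cpd_def z Complex_eq)
    ultimately show ?thesis by simp
  qed
  then show ?thesis using that g by (auto simp: has_weak_pd_def)
qed

lemma weak_pd_unique:
  assumes g: "g \<in> L2" "g' \<in> L2" and w: "has_weak_pd f j g" "has_weak_pd f j g'"
  shows "AE x in lebesgue. g x = g' x"
proof -
  have "AE x in lebesgue. g x - g' x = 0"
  proof (rule fundamental_lemma)
    fix \<phi> :: "real^'a \<Rightarrow> real" assume t: "test_fun \<phi>"
    note i = L2_mult[OF g(1) test_fun_L2[OF t]] L2_mult[OF g(2) test_fun_L2[OF t]]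
    show "integrable lebesgue (\<lambda>x. (g x - g' x) * of_real (\<phi> x))" using i by (simp add: left_diff_distrib)
    show "(LINT x|lebesgue. (g x - g' x) * of_real (\<phi> x)) = 0"
      using i w t by (simp add: left_diff_distrib has_weak_pd_def)
  qed (use L2_diff[OF g] in \<open>simp add: L2_def\<close>)
  then show ?thesis by simp
qed

lemma H1_L2: "f \<in> H1 \<Longrightarrow> f \<in> L2" by (simp add: H1_def)

lemma wgrad: assumes "f \<in> H1" shows "wgrad f j \<in> L2" "has_weak_pd f j (wgrad f j)"
proof -
  have "\<exists>g. g \<in> L2 \<and> has_weak_pd f j g" using assms by (auto simp: H1_def)
  then have "wgrad f j \<in> L2 \<and> has_weak_pd f j (wgrad f j)" unfolding wgrad_def by (rule someI_ex)
  then show "wgrad f j \<in> L2" "has_weak_pd f j (wgrad f j)" by auto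
qed

lemma wgrad_AE: "\<lbrakk>f \<in> H1; g \<in> L2; has_weak_pd f j g\<rbrakk> \<Longrightarrow> AE x in lebesgue. wgrad f j x = g x"
  using weak_pd_unique wgrad by blast

lemma weak_pd_lincomb:
  assumes f: "f \<in> L2" "f' \<in> L2" and g: "g \<in> L2" "g' \<in> L2" and w: "has_weak_pd f j g" "has_weak_pd f' j g'"
  shows "has_weak_pd (\<lambda>x. a * f x + b * f' x) j (\<lambda>x. a * g x + b * g' x)"
  unfolding has_weak_pd_def
proof (intro allI impI)
  fix \<phi> :: "real^'a \<Rightarrow> real" assume t: "test_fun \<phi>"
  note i = L2_mult[OF f(1) test_fun_L2[OF test_fun_pdiff[OF t]], of j] L2_mult[OF f(2) test_fun_L2[OF test_fun_pdiff[OF t]], of j]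
    L2_mult[OF g(1) test_fun_L2[OF t]] L2_mult[OF g(2) test_fun_L2[OF t]]
  have "(LINT x|lebesgue. (a * f x + b * f' x) * of_real (pdiff j \<phi> x)) =
      a * (LINT x|lebesgue. f x * of_real (pdiff j \<phi> x)) + b * (LINT x|lebesgue. f' x * of_real (pdiff j \<phi> x))"
    using i by (simp add: distrib_right mult.assoc)
  also have "\<dots> = - (a * (LINT x|lebesgue. g x * of_real (\<phi> x)) + b * (LINT x|lebesgue. g' x * of_real (\<phi> x)))"
    using w t by (simp add: has_weak_pd_def)
  also have "\<dots> = - (LINT x|lebesgue. (a * g x + b * g' x) * of_real (\<phi> x))"
    using i by (simp add: distrib_right mult.assoc)
  finally show "(LINT x|lebesgue. (a * f x + b * f' x) * of_real (pdiff j \<phi> x)) = - (LINT x|lebesgue. (a * g x + b * g' x) * of_real (\<phi> x))" .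
qed

lemma H1_lincomb:
  assumes f: "f \<in> H1" "g \<in> H1"
  shows "(\<lambda>x. a * f x + b * g x) \<in> H1"
    "AE x in lebesgue. wgrad (\<lambda>x. a * f x + b * g x) j x = a * wgrad f j x + b * wgrad g j x"
proof -
  have L: "(\<lambda>x. a * wgrad f j x + b * wgrad g j x) \<in> L2" for j using wgrad(1) f by (intro L2_add L2_scale) auto
  have w: "has_weak_pd (\<lambda>x. a * f x + b * g x) j (\<lambda>x. a * wgrad f j x + b * wgrad g j x)" for j
    by (intro weak_pd_lincomb wgrad f H1_L2)
  show H: "(\<lambda>x. a * f x + b * g x) \<in> H1" using L w f by (auto simp: H1_def intro!: L2_add L2_scale)
  show "AE x in lebesgue. wgrad (\<lambda>x. a * f x + b * g x) j x = a * wgrad f j x + b * wgrad g j x"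
    by (rule wgrad_AE[OF H L w])
qed

section \<open>The Schroedinger form\<close>

lemma l2_inner_cong_AE:
  assumes "f \<in> L2" "g \<in> L2" "f' \<in> L2" "g' \<in> L2" "AE x in lebesgue. f x = f' x" "AE x in lebesgue. g x = g' x"
  shows "l2_inner f g = l2_inner f' g'"
  unfolding l2_inner_def
proof (rule integral_cong_AE)
  show "AE x in lebesgue. f x * cnj (g x) = f' x * cnj (g' x)" using assms(5,6) by eventually_elim simp
qed (use L2_mult_cnj[OF assms(1,2)] L2_mult_cnj[OF assms(3,4)] in \<open>auto intro: borel_measurable_integrable\<close>)

lemma H1_dqI:
  assumes v: "v \<in> L2" and M: "\<And>j \<tau>. \<lbrakk>0 < \<tau>; \<tau> \<le> 1\<rbrakk> \<Longrightarrow> l2_norm (dq j \<tau> v) \<le> M j"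
  shows "v \<in> H1"
proof -
  have "\<exists>g\<in>L2. has_weak_pd v j g" for j
  proof -
    have h: "(\<lambda>n. 1 / real (Suc n)) \<longlonglongrightarrow> 0" "\<And>n. 1 / real (Suc n) \<noteq> 0"
      using LIMSEQ_inverse_real_of_nat by (auto simp: inverse_eq_divide)
    have "l2_norm (dq j (1 / real (Suc n)) v) \<le> M j" for n by (rule M) auto
    then show ?thesis using bounded_dq_weak_pd[OF v h, of j "M j"] by metis
  qed
  then show ?thesis using v by (simp add: H1_def)
qed

lemma wgrad_norm_le:
  assumes v: "v \<in> H1" and h: "h \<longlonglongrightarrow> 0" "\<And>n. h n \<noteq> 0" and M: "\<And>n. l2_norm (dq j (h n) v) \<le> M"
  shows "l2_norm (wgrad v j) \<le> M"
proof -
  obtain g where g: "g \<in> L2" "has_weak_pd v j g" "l2_norm g \<le> M"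
    using bounded_dq_weak_pd[OF H1_L2[OF v] h M] by metis
  have "l2_norm (wgrad v j) = l2_norm g"
    using wgrad_AE[OF v g(1,2)] wgrad(1)[OF v, of j] g(1) by (intro l2_norm_cong_AE) (auto simp: L2_def)
  then show ?thesis using g by simp
qed

lemma dq_wgrad_le: "v \<in> H1 \<Longrightarrow> l2_norm (dq j \<tau> v) \<le> l2_norm (wgrad v j)"
  by (rule dq_norm_le) (auto intro: H1_L2 wgrad)

lemma dq_wgrad_tendsto: "\<lbrakk>v \<in> H1; h \<longlonglongrightarrow> 0; \<And>n. h n \<noteq> 0\<rbrakk> \<Longrightarrow> (\<lambda>n. l2_norm (dq j (h n) v - wgrad v j)) \<longlonglongrightarrow> 0"
  by (rule dq_tendsto) (auto intro: H1_L2 wgrad)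

lemma wgrad_null:
  assumes f: "f \<in> L2" and z: "AE x in lebesgue. f x = 0"
  shows "f \<in> H1" "AE x in lebesgue. wgrad f j x = 0"
proof -
  have w: "has_weak_pd f j (\<lambda>x. 0)" for j
    unfolding has_weak_pd_def
  proof (intro allI impI)
    fix \<phi> :: "real^'a \<Rightarrow> real"
    have "(LINT x|lebesgue. f x * of_real (pdiff j \<phi> x)) = 0"
      by (rule integral_eq_zero_AE) (use z in eventually_elim, simp)
    then show "(LINT x|lebesgue. f x * of_real (pdiff j \<phi> x)) = - (LINT x|lebesgue. 0 * of_real (\<phi> x))" by simp
  qed
  show H: "f \<in> H1" using f w L2_zero by (auto simp: H1_def)
  show "AE x in lebesgue. wgrad f j x = 0" by (rule wgrad_AE[OF H L2_zero w])
qed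

lemma form_domD: "f \<in> form_dom V \<Longrightarrow> f \<in> H1" "f \<in> form_dom V \<Longrightarrow> f \<in> L2"
    "f \<in> form_dom V \<Longrightarrow> integrable lebesgue (\<lambda>x. V x * of_real ((cmod (f x))\<^sup>2))"
  by (auto simp: form_dom_def H1_def)

text \<open>Piecewise linear in the norm with slope 1; smoothness is not sought because membership
  in \<open>H1\<close> is read off from difference quotients.\<close>

definition cutoff :: "real \<Rightarrow> real^'n \<Rightarrow> real" where
  "cutoff R x = max 0 (min 1 (R + 1 - norm x))"

lemma cutoff: "0 \<le> cutoff R x" "cutoff R x \<le> 1" "norm x \<le> R \<Longrightarrow> cutoff R x = 1" "norm x > R + 1 \<Longrightarrow> cutoff R x = 0"
    "\<bar>cutoff R x - cutoff R y\<bar> \<le> norm (x - y)"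
  using norm_triangle_ineq3[of x y] by (auto simp: cutoff_def max_def min_def)

lemma cutoff_measurable: "cutoff R \<in> borel_measurable lebesgue"
  unfolding cutoff_def[abs_def] by (intro continuous_lebesgue continuous_intros)

context
  fixes V :: "real^'n \<Rightarrow> complex"
  assumes V_loc: "L1_loc V"
begin

lemma V_meas: "V \<in> borel_measurable lebesgue"
  using V_loc by (simp add: L1_loc_def)

lemma form_dom_weight: "f \<in> form_dom V \<Longrightarrow> integrable lebesgue (\<lambda>x. cmod (V x) * (cmod (f x))\<^sup>2)"
  using integrable_norm[OF form_domD(3)] by (simp add: norm_mult norm_power)

lemma form_dom_mult:
  assumes f: "f \<in> form_dom V" and g: "g \<in> form_dom V"
  shows "integrable lebesgue (\<lambda>x. V x * f x * cnj (g x))"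
proof (rule Bochner_Integration.integrable_bound)
  note [measurable] = V_meas
  have [measurable]: "f \<in> borel_measurable lebesgue" "g \<in> borel_measurable lebesgue" "(\<lambda>x. cnj (g x)) \<in> borel_measurable lebesgue"
    using form_domD(2)[OF f] form_domD(2)[OF g] L2_cnj[OF form_domD(2)[OF g]] by (auto simp: L2_def)
  show "(\<lambda>x. V x * f x * cnj (g x)) \<in> borel_measurable lebesgue" by simp
  show "integrable lebesgue (\<lambda>x. cmod (V x) * (cmod (f x))\<^sup>2 + cmod (V x) * (cmod (g x))\<^sup>2)"
    using form_dom_weight f g by auto
  have "cmod (V x * f x * cnj (g x)) \<le> cmod (V x) * (cmod (f x))\<^sup>2 + cmod (V x) * (cmod (g x))\<^sup>2" for x
  proof -
    have "2 * (cmod (f x) * cmod (g x)) \<le> (cmod (f x))\<^sup>2 + (cmod (g x))\<^sup>2"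
      using sum_squares_bound[of "cmod (f x)" "cmod (g x)"] by simp
    moreover have "0 \<le> cmod (f x) * cmod (g x)" by simp
    ultimately have "cmod (f x) * cmod (g x) \<le> (cmod (f x))\<^sup>2 + (cmod (g x))\<^sup>2" by linarith
    then have "cmod (V x) * (cmod (f x) * cmod (g x)) \<le> cmod (V x) * ((cmod (f x))\<^sup>2 + (cmod (g x))\<^sup>2)"
      by (rule mult_left_mono) simp
    then show ?thesis by (simp add: norm_mult distrib_left mult.assoc)
  qed
  then show "AE x in lebesgue. norm (V x * f x * cnj (g x)) \<le> norm (cmod (V x) * (cmod (f x))\<^sup>2 + cmod (V x) * (cmod (g x))\<^sup>2)"
    by (intro AE_I2) (auto intro: order_trans)
qed

lemma form_domI:
  assumes f: "f \<in> H1" and i: "integrable lebesgue W" and le: "AE x in lebesgue. cmod (V x) * (cmod (f x))\<^sup>2 \<le> W x"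
  shows "f \<in> form_dom V"
proof -
  note [measurable] = V_meas
  have [measurable]: "f \<in> borel_measurable lebesgue" using H1_L2[OF f] by (simp add: L2_def)
  have "integrable lebesgue (\<lambda>x. V x * of_real ((cmod (f x))\<^sup>2))"
  proof (rule Bochner_Integration.integrable_bound[OF i])
    show "AE x in lebesgue. norm (V x * of_real ((cmod (f x))\<^sup>2)) \<le> norm (W x)"
      using le by eventually_elim (auto simp: norm_mult norm_power)
  qed simp
  then show ?thesis using f by (simp add: form_dom_def)
qed

lemma form_dom_lincomb:
  assumes f: "f \<in> form_dom V" and g: "g \<in> form_dom V"
  shows "(\<lambda>x. a * f x + b * g x) \<in> form_dom V"
proof (rule form_domI)
  show "(\<lambda>x. a * f x + b * g x) \<in> H1" using H1_lincomb(1) form_domD f g by blast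
  show "integrable lebesgue (\<lambda>x. 2 * (cmod a)\<^sup>2 * (cmod (V x) * (cmod (f x))\<^sup>2) + 2 * (cmod b)\<^sup>2 * (cmod (V x) * (cmod (g x))\<^sup>2))"
    using form_dom_weight f g by auto
  have "cmod (V x) * (cmod (a * f x + b * g x))\<^sup>2 \<le> 2 * (cmod a)\<^sup>2 * (cmod (V x) * (cmod (f x))\<^sup>2) + 2 * (cmod b)\<^sup>2 * (cmod (V x) * (cmod (g x))\<^sup>2)" for x
  proof -
    have "(cmod (a * f x + b * g x))\<^sup>2 \<le> (cmod (a * f x) + cmod (b * g x))\<^sup>2" by (intro power_mono norm_triangle_ineq) simp
    also have "\<dots> \<le> 2 * (cmod (a * f x))\<^sup>2 + 2 * (cmod (b * g x))\<^sup>2"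
      using sum_squares_bound[of "cmod (a * f x)" "cmod (b * g x)"] by (simp add: power2_sum)
    finally have "cmod (V x) * (cmod (a * f x + b * g x))\<^sup>2 \<le> cmod (V x) * (2 * (cmod (a * f x))\<^sup>2 + 2 * (cmod (b * g x))\<^sup>2)"
      by (rule mult_left_mono) simp
    then show ?thesis by (simp add: norm_mult power_mult_distrib algebra_simps)
  qed
  then show "AE x in lebesgue. cmod (V x) * (cmod (a * f x + b * g x))\<^sup>2 \<le> 2 * (cmod a)\<^sup>2 * (cmod (V x) * (cmod (f x))\<^sup>2) + 2 * (cmod b)\<^sup>2 * (cmod (V x) * (cmod (g x))\<^sup>2)"
    by simp
qed

lemma form_lincomb:
  assumes f: "f \<in> form_dom V" and g: "g \<in> form_dom V" and k: "k \<in> form_dom V"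
  shows "form V (\<lambda>x. a * f x + b * g x) k = a * form V f k + b * form V g k"
    and "form V k (\<lambda>x. a * f x + b * g x) = cnj a * form V k f + cnj b * form V k g"
proof -
  note H = form_domD(1)[OF f] form_domD(1)[OF g] form_domD(1)[OF k]
  have W: "wgrad f j \<in> L2" "wgrad g j \<in> L2" "wgrad k j \<in> L2" for j using H wgrad(1) by auto
  have e: "(\<lambda>x. a * u x + b * v x) = fsc a u + fsc b v" for u v :: "real^'n \<Rightarrow> complex" by (simp add: fsc_def fun_eq_iff)
  have AE: "l2_inner (wgrad (\<lambda>x. a * f x + b * g x) j) (wgrad k j) = l2_inner (fsc a (wgrad f j) + fsc b (wgrad g j)) (wgrad k j)"
    "l2_inner (wgrad k j) (wgrad (\<lambda>x. a * f x + b * g x) j) = l2_inner (wgrad k j) (fsc a (wgrad f j) + fsc b (wgrad g j))" for j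
    unfolding e[symmetric] using H H1_lincomb[OF H(1,2)] wgrad(1)
    by (intro l2_inner_cong_AE; auto intro!: L2_add L2_scale)+
  have 1: "l2_inner (wgrad (\<lambda>x. a * f x + b * g x) j) (wgrad k j) = a * l2_inner (wgrad f j) (wgrad k j) + b * l2_inner (wgrad g j) (wgrad k j)" for j
    unfolding AE L2.ip_add[OF L2.scale_mem[OF W(1)] L2.scale_mem[OF W(2)] W(3)] by (simp add: L2.ip_scale W)
  have 2: "l2_inner (wgrad k j) (wgrad (\<lambda>x. a * f x + b * g x) j) = cnj a * l2_inner (wgrad k j) (wgrad f j) + cnj b * l2_inner (wgrad k j) (wgrad g j)" for j
    unfolding AE L2.ip_add2[OF L2.scale_mem[OF W(1)] L2.scale_mem[OF W(2)] W(3)] by (simp add: L2.ip_scale2 W)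
  have 3: "(LINT x|lebesgue. V x * (a * f x + b * g x) * cnj (k x)) = a * (LINT x|lebesgue. V x * f x * cnj (k x)) + b * (LINT x|lebesgue. V x * g x * cnj (k x))"
  proof -
    have "V x * (a * f x + b * g x) * cnj (k x) = a * (V x * f x * cnj (k x)) + b * (V x * g x * cnj (k x))" for x
      by (simp add: algebra_simps)
    then show ?thesis using form_dom_mult[OF f k] form_dom_mult[OF g k] by simp
  qed
  have 4: "(LINT x|lebesgue. V x * k x * cnj (a * f x + b * g x)) = cnj a * (LINT x|lebesgue. V x * k x * cnj (f x)) + cnj b * (LINT x|lebesgue. V x * k x * cnj (g x))"
  proof -
    have "V x * k x * cnj (a * f x + b * g x) = cnj a * (V x * k x * cnj (f x)) + cnj b * (V x * k x * cnj (g x))" for x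
      by (simp add: algebra_simps)
    then show ?thesis using form_dom_mult[OF k f] form_dom_mult[OF k g] by simp
  qed
  show "form V (\<lambda>x. a * f x + b * g x) k = a * form V f k + b * form V g k"
    unfolding form_def 1 3 by (simp add: sum.distrib sum_distrib_left algebra_simps)
  show "form V k (\<lambda>x. a * f x + b * g x) = cnj a * form V k f + cnj b * form V k g"
    unfolding form_def 2 4 by (simp add: sum.distrib sum_distrib_left algebra_simps)
qed

lemma form_dom_null:
  assumes f: "f \<in> L2" "l2_norm f = 0" shows "f \<in> form_dom V" "form V f f = 0"
proof -
  have z: "AE x in lebesgue. f x = 0" using l2_norm_zero_iff f by blast
  show "f \<in> form_dom V"
    by (rule form_domI[of _ "\<lambda>x. 0"]) (use z wgrad_null[OF f(1) z] in \<open>auto elim: eventually_mono\<close>)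
  have "l2_inner (wgrad f j) (wgrad f j) = l2_inner (\<lambda>x::real^'n. 0) (\<lambda>x. 0)" for j
    using wgrad(1)[OF wgrad_null(1)[OF f(1) z]] wgrad_null(2)[OF f(1) z]
    by (intro l2_inner_cong_AE) (auto simp: L2_zero)
  moreover have "(LINT x|lebesgue. V x * f x * cnj (f x)) = 0"
    by (rule integral_eq_zero_AE) (use z in eventually_elim, simp)
  ultimately show "form V f f = 0" by (simp add: form_def l2_inner_def)
qed

lemma sesq_form: "sesq fsc (form_dom V) (form V)"
proof -
  interpret vector_space fsc by (rule vector_space_fsc)
  show ?thesis
  proof
    have z: "(\<lambda>x. 0) \<in> form_dom V" using form_dom_null(1)[OF L2_zero] by (simp add: l2_norm_def)
    have add: "x + y = (\<lambda>t. 1 * x t + 1 * y t)" and scl: "fsc c x = (\<lambda>t. c * x t + 0 * x t)" for c and x y :: "real^'n \<Rightarrow> complex"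
      by (simp_all add: fun_eq_iff fsc_def)
    show "subspace (form_dom V)"
      unfolding subspace_def
    proof (intro conjI ballI allI)
      show "0 \<in> form_dom V" using z by (simp add: zero_fun_def)
      show "x + y \<in> form_dom V" if "x \<in> form_dom V" "y \<in> form_dom V" for x y
        unfolding add by (rule form_dom_lincomb[OF that])
      show "fsc c x \<in> form_dom V" if "x \<in> form_dom V" for c x
        unfolding scl by (rule form_dom_lincomb[OF that that])
    qed
    fix x y k :: "real^'n \<Rightarrow> complex" and c
    assume D: "x \<in> form_dom V" "y \<in> form_dom V"
    show "form V (fsc c x) y = c * form V x y" "form V x (fsc c y) = cnj c * form V x y"
      unfolding scl form_lincomb(1)[OF D(1) D(1) D(2)] form_lincomb(2)[OF D(2) D(2) D(1)] by simp_all
    assume k: "k \<in> form_dom V"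
    show "form V (x + y) k = form V x k + form V y k" "form V k (x + y) = form V k x + form V k y"
      unfolding add form_lincomb(1)[OF D k] form_lincomb(2)[OF D k] by simp_all
  qed
qed

text \<open>For steps of at most 1 the quotients live in the ball of radius R + 1 and are bounded by
  a Lipschitz constant, hence bounded in \<open>L2\<close>. Local integrability of V handles the
  potential term.\<close>

lemma bounded_directional_lipschitz_form_dom:
  assumes m: "f \<in> borel_measurable lebesgue" and C: "\<And>x. cmod (f x) \<le> C" and R: "\<And>x. norm x > R \<Longrightarrow> f x = 0"
    and lip: "\<And>j. \<exists>K. \<forall>x \<tau>. cmod (f (x + \<tau> *\<^sub>R axis j 1) - f x) \<le> K * \<bar>\<tau>\<bar>"
  shows "f \<in> form_dom V"
proof -
  have fL: "f \<in> L2" by (rule bounded_support_L2[OF m C R])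
  obtain K where K: "\<And>j x \<tau>. cmod (f (x + \<tau> *\<^sub>R axis j 1) - f x) \<le> K j * \<bar>\<tau>\<bar>" using lip by metis
  let ?w = "\<lambda>j (x::real^'n). complex_of_real (K j * indicator (cball 0 (R + 1)) x)"
  have wL: "?w j \<in> L2" for j
  proof (rule bounded_support_L2)
    have "(indicator (cball 0 (R + 1)) :: real^'n \<Rightarrow> real) \<in> borel_measurable lebesgue"
      by (rule borel_measurable_indicator) auto
    then have "(\<lambda>x::real^'n. K j * indicator (cball 0 (R + 1)) x) \<in> borel_measurable lebesgue"
      by (rule borel_measurable_times[OF borel_measurable_const])
    then show "?w j \<in> borel_measurable lebesgue"
      by (rule borel_measurable_continuous_on[rotated]) (intro continuous_intros)
    show "cmod (?w j x) \<le> \<bar>K j\<bar>" for x by (simp add: indicator_def)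
    show "?w j x = 0" if "R + 1 < norm x" for x using that by simp
  qed
  have "f \<in> H1"
  proof (rule H1_dqI[OF fL])
    fix j and \<tau> :: real assume \<tau>: "0 < \<tau>" "\<tau> \<le> 1"
    have le: "cmod (dq j \<tau> f x) \<le> cmod (?w j x)" for x
    proof (cases "norm x \<le> R + 1")
      case True
      have "cmod (dq j \<tau> f x) = cmod (f (x + \<tau> *\<^sub>R axis j 1) - f x) / \<tau>" using \<tau> by (simp add: dq_def norm_divide)
      also have "\<dots> \<le> K j" using K[of x \<tau> j] \<tau> by (simp add: divide_le_eq)
      finally show ?thesis using True by simp
    next
      case False
      have "norm x \<le> norm (x + \<tau> *\<^sub>R axis j 1) + \<tau>"
        using norm_triangle_ineq4[of "x + \<tau> *\<^sub>R axis j 1" "\<tau> *\<^sub>R axis j 1"] \<tau> by simp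
      then have "norm (x + \<tau> *\<^sub>R axis j 1) > R" "norm x > R" using False \<tau> by linarith+
      then show ?thesis using R by (simp add: dq_def)
    qed
    have "(l2_norm (dq j \<tau> f))\<^sup>2 \<le> (l2_norm (?w j))\<^sup>2"
      unfolding l2_norm_sq[OF dq_L2[OF fL]] l2_norm_sq[OF wL]
      by (intro integral_mono L2_square dq_L2 fL wL power_mono le) auto
    then show "l2_norm (dq j \<tau> f) \<le> l2_norm (?w j)" by (simp add: abs_le_square_iff[symmetric])
  qed
  moreover have "integrable lebesgue (\<lambda>x. indicator (cball 0 R) x * cmod (V x) * C\<^sup>2)"
  proof -
    have "set_integrable lebesgue (cball 0 R) V" using V_loc by (auto simp: L1_loc_def)
    then have "integrable lebesgue (\<lambda>x. norm (indicator (cball 0 R) x *\<^sub>R V x))" unfolding set_integrable_def by (rule integrable_norm)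
    then show ?thesis by simp
  qed
  ultimately show ?thesis
  proof (rule form_domI)
    have "cmod (V x) * (cmod (f x))\<^sup>2 \<le> indicator (cball 0 R) x * cmod (V x) * C\<^sup>2" for x
      using R[of x] C[of x] by (cases "norm x \<le> R") (auto intro!: mult_left_mono power_mono)
    then show "AE x in lebesgue. cmod (V x) * (cmod (f x))\<^sup>2 \<le> indicator (cball 0 R) x * cmod (V x) * C\<^sup>2" by simp
  qed
qed

lemma ctest_form_dom: assumes "ctest \<psi>" shows "\<psi> \<in> form_dom V"
proof -
  let ?p = "\<lambda>x. Re (\<psi> x)" and ?q = "\<lambda>x. Im (\<psi> x)"
  have t: "test_fun ?p" "test_fun ?q" using assms by (auto simp: ctest_def)
  have r: "(\<lambda>x. complex_of_real (\<phi> x)) \<in> form_dom V" if t: "test_fun \<phi>" for \<phi>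
  proof -
    obtain R where R: "\<And>x. norm x > R \<Longrightarrow> \<phi> x = 0" using test_fun_radius[OF t] by blast
    obtain C where C: "\<And>x. \<bar>\<phi> x\<bar> \<le> C" using test_fun_bounded[OF t] by blast
    show ?thesis
    proof (rule bounded_directional_lipschitz_form_dom[of _ C R])
      fix j
      obtain K where "\<And>x \<tau>. \<bar>\<phi> (x + \<tau> *\<^sub>R axis j 1) - \<phi> x\<bar> \<le> K * \<bar>\<tau>\<bar>" using test_fun_lipschitz[OF t] by blast
      then show "\<exists>K. \<forall>x \<tau>. cmod (complex_of_real (\<phi> (x + \<tau> *\<^sub>R axis j 1)) - complex_of_real (\<phi> x)) \<le> K * \<bar>\<tau>\<bar>"
        by (auto simp flip: of_real_diff)
    qed (use test_fun_L2[OF t] R C in \<open>auto simp: L2_def\<close>)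
  qed
  have "(\<lambda>x. 1 * complex_of_real (?p x) + \<i> * complex_of_real (?q x)) \<in> form_dom V"
    by (intro form_dom_lincomb r t)
  moreover have "(\<lambda>x. 1 * complex_of_real (?p x) + \<i> * complex_of_real (?q x)) = \<psi>" by (simp add: fun_eq_iff complex_eq_iff)
  ultimately show ?thesis by simp
qed

text \<open>The frequency c leaves the modulus, hence norm and potential term, unchanged, while
  large c raises the kinetic energy; \<open>support_direction_pos\<close> exploits this.\<close>

lemma modulated_cutoff_form_dom:
  "(\<lambda>x. complex_of_real (cutoff R x) * cis (c * x $ i)) \<in> form_dom V" (is "?f \<in> _")
proof (rule bounded_directional_lipschitz_form_dom[of _ 1 "R + 1"])
  have "continuous_on UNIV ?f"
    unfolding cutoff_def[abs_def] cis_conv_exp by (intro continuous_intros)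
  then show "?f \<in> borel_measurable lebesgue" by (rule continuous_lebesgue)
  show "cmod (?f x) \<le> 1" for x using cutoff(1)[of R x] cutoff(2)[of R x] by (simp add: norm_mult)
  show "?f x = 0" if "norm x > R + 1" for x using cutoff(4)[OF that] by simp
  fix j
  have "cmod (?f (x + \<tau> *\<^sub>R axis j 1) - ?f x) \<le> (1 + \<bar>c\<bar>) * \<bar>\<tau>\<bar>" for x \<tau>
  proof -
    let ?y = "x + \<tau> *\<^sub>R axis j 1"
    have "?f ?y - ?f x = of_real (cutoff R ?y - cutoff R x) * cis (c * ?y $ i) + of_real (cutoff R x) * (cis (c * ?y $ i) - cis (c * x $ i))"
      by (simp add: algebra_simps)
    then have "cmod (?f ?y - ?f x) \<le> \<bar>cutoff R ?y - cutoff R x\<bar> + cutoff R x * cmod (cis (c * ?y $ i) - cis (c * x $ i))"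
      using norm_triangle_ineq[of "of_real (cutoff R ?y - cutoff R x) * cis (c * ?y $ i)" "of_real (cutoff R x) * (cis (c * ?y $ i) - cis (c * x $ i))"]
        cutoff(1)[of R x] by (simp only: norm_mult norm_of_real norm_cis) simp
    also have "\<dots> \<le> \<bar>\<tau>\<bar> + 1 * \<bar>c * \<tau>\<bar>"
    proof (intro add_mono mult_mono)
      show "\<bar>cutoff R ?y - cutoff R x\<bar> \<le> \<bar>\<tau>\<bar>" using cutoff(5)[of R ?y x] by simp
      have "cmod (cis (c * ?y $ i) - cis (c * x $ i)) \<le> \<bar>c * ?y $ i - c * x $ i\<bar>"
      proof -
        have "cis (c * ?y $ i) - cis (c * x $ i) = cis (c * x $ i) * (exp (\<i> * of_real (c * ?y $ i - c * x $ i)) - 1)"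
          by (simp add: cis_conv_exp right_diff_distrib flip: exp_add)
        then have "cmod (cis (c * ?y $ i) - cis (c * x $ i)) = 2 * \<bar>sin ((c * ?y $ i - c * x $ i) / 2)\<bar>"
          by (simp only: norm_mult norm_cis dist_exp_i_1)
        then show ?thesis using abs_sin_x_le_abs_x[of "(c * ?y $ i - c * x $ i) / 2"] by simp
      qed
      also have "c * ?y $ i - c * x $ i = c * (\<tau> * axis j 1 $ i)" by (simp add: algebra_simps)
      also have "\<bar>c * (\<tau> * axis j 1 $ i)\<bar> \<le> \<bar>c * \<tau>\<bar>" by (simp add: axis_def)
      finally show "cmod (cis (c * ?y $ i) - cis (c * x $ i)) \<le> \<bar>c * \<tau>\<bar>" .
    qed (use cutoff in auto)
    also have "\<dots> = (1 + \<bar>c\<bar>) * \<bar>\<tau>\<bar>" by (simp add: abs_mult algebra_simps)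
    finally show ?thesis .
  qed
  then show "\<exists>K. \<forall>x \<tau>. cmod (?f (x + \<tau> *\<^sub>R axis j 1) - ?f x) \<le> K * \<bar>\<tau>\<bar>" by blast
qed

lemma cutoff_form_dom: "(\<lambda>x. complex_of_real (cutoff R x)) \<in> form_dom V"
  using modulated_cutoff_form_dom[of R 0] by simp

end

section \<open>Sectoriality with a positive angle\<close>

lemma isCont_nonzero_ball:
  fixes g :: "real^'n \<Rightarrow> real"
  assumes "isCont g x0" "g x0 \<noteq> c" obtains r where "r > 0" "\<And>x. x \<in> ball x0 r \<Longrightarrow> g x \<noteq> c"
proof -
  have "\<forall>\<^sub>F x in nhds x0. g x \<noteq> c"
    using assms by (intro tendsto_imp_eventually_ne) (auto simp: isCont_def tendsto_at_iff_tendsto_nhds)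
  then show ?thesis using that unfolding eventually_nhds_metric by (metis dist_commute mem_ball)
qed

lemma not_AE_ball: "r > 0 \<Longrightarrow> \<not> (AE x in lebesgue. x \<notin> ball (x0::real^'n) r)"
  using mem_closed_if_AE_lebesgue[of "- ball x0 r" x0] by auto

lemma Im_form:
  assumes f: "f \<in> form_dom V"
  shows "Im (form V f f) = Im (LINT x|lebesgue. V x * of_real ((cmod (f x))\<^sup>2))"
proof -
  have 1: "Im (l2_inner (wgrad f j) (wgrad f j)) = 0" for j
  proof -
    have w: "wgrad f j \<in> L2" using wgrad(1) form_domD(1) f by blast
    have "l2_inner (wgrad f j) (wgrad f j) = of_real ((l2_norm (wgrad f j))\<^sup>2)" by (rule l2_self[OF w])
    then show ?thesis by (simp only: Im_complex_of_real)
  qed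
  have 2: "V x * f x * cnj (f x) = V x * of_real ((cmod (f x))\<^sup>2)" for x
    unfolding complex_norm_square by (rule mult.assoc)
  have "form V f f = (\<Sum>j\<in>UNIV. l2_inner (wgrad f j) (wgrad f j)) + (LINT x|lebesgue. V x * of_real ((cmod (f x))\<^sup>2))"
    unfolding form_def 2 ..
  then show ?thesis by (simp add: 1)
qed

lemma hypC1_value: assumes "hypC1 V" obtains x0 where "isCont (\<lambda>x. Im (V x)) x0" "Im (V x0) \<noteq> c"
proof -
  obtain x1 x2 where "isCont (\<lambda>x. Im (V x)) x1" "isCont (\<lambda>x. Im (V x)) x2" "Im (V x1) \<noteq> Im (V x2)"
    using assms unfolding hypC1_def by blast
  then show ?thesis using that by (cases "Im (V x1) = c") auto
qed

text \<open>Its purpose is a strictly positive tangent in \<open>closed_sectorial_form\<close>. If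
  the imaginary part of the form vanished on the whole domain, polarisation would give Im V = 0
  almost everywhere, against (C1).\<close>

lemma Im_potential_nonzero:
  fixes V :: "real^'n \<Rightarrow> complex"
  assumes V: "L1_loc V" and C1: "hypC1 V"
  shows "\<exists>f\<in>form_dom V. Im (form V f f) \<noteq> 0"
proof (rule ccontr)
  assume n: "\<not> ?thesis"
  have Vm: "V \<in> borel_measurable lebesgue" using V by (rule V_meas)
  have pot: "Im (LINT x|lebesgue. V x * of_real ((cmod (f x))\<^sup>2)) = 0" if f: "f \<in> form_dom V" for f
    unfolding Im_form[OF f, symmetric] using n f by blast
  have "AE x in lebesgue. complex_of_real (Im (V x)) * 1 = 0"
  proof (rule fundamental_lemma)
    show "(\<lambda>x. complex_of_real (Im (V x)) * 1) \<in> borel_measurable lebesgue" using Vm by simp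
    fix \<phi> :: "real^'n \<Rightarrow> real" assume t: "test_fun \<phi>"
    obtain R where R: "\<And>x. norm x > R \<Longrightarrow> \<phi> x = 0" using test_fun_radius[OF t] by blast
    let ?\<phi> = "\<lambda>x. complex_of_real (\<phi> x)" and ?c = "\<lambda>x. complex_of_real (cutoff R x)"
    have D: "?\<phi> \<in> form_dom V" "?c \<in> form_dom V" using ctest_form_dom[OF V ctest_real[OF t]] cutoff_form_dom[OF V] by auto
    have D2: "(\<lambda>x. 1 * ?\<phi> x + 1 * ?c x) \<in> form_dom V" "(\<lambda>x. 1 * ?\<phi> x + (-1) * ?c x) \<in> form_dom V"
      by (intro form_dom_lincomb[OF V] D)+
    have \<phi>c: "\<phi> x * cutoff R x = \<phi> x" for x using R[of x] cutoff(3)[of x R] by (cases "norm x \<le> R") auto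
    note i = form_domD(3)[OF D2(1)] form_domD(3)[OF D2(2)]
    \<comment> \<open>Polarisation against a cutoff \<chi> that is 1 on the support of \<phi>:
      (\<phi> + \<chi>)^2 - (\<phi> - \<chi>)^2 = 4 \<phi> \<chi> = 4 \<phi>.\<close>
    have e: "V x * of_real ((cmod (1 * ?\<phi> x + 1 * ?c x))\<^sup>2) - V x * of_real ((cmod (1 * ?\<phi> x + (-1) * ?c x))\<^sup>2) = 4 * (V x * of_real (\<phi> x))" for x
    proof -
      have "(cmod (1 * ?\<phi> x + 1 * ?c x))\<^sup>2 = (\<phi> x + cutoff R x)\<^sup>2" "(cmod (1 * ?\<phi> x + (-1) * ?c x))\<^sup>2 = (\<phi> x - cutoff R x)\<^sup>2"
        by (simp_all flip: of_real_add of_real_diff)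
      then have "of_real ((cmod (1 * ?\<phi> x + 1 * ?c x))\<^sup>2) - complex_of_real ((cmod (1 * ?\<phi> x + (-1) * ?c x))\<^sup>2) = of_real (4 * (\<phi> x * cutoff R x))"
        by (simp only: flip: of_real_diff) (simp add: power2_eq_square algebra_simps)
      then show ?thesis unfolding \<phi>c by (simp only: right_diff_distrib[symmetric]) simp
    qed
    have i4: "integrable lebesgue (\<lambda>x. 4 * (V x * of_real (\<phi> x)))"
      using Bochner_Integration.integrable_diff[OF i] by (simp only: e)
    have iV: "integrable lebesgue (\<lambda>x. V x * of_real (\<phi> x))"
      using integrable_mult_right[OF i4, of "1/4"] by simp
    have "(LINT x|lebesgue. 4 * (V x * of_real (\<phi> x))) = (LINT x|lebesgue. V x * of_real ((cmod (1 * ?\<phi> x + 1 * ?c x))\<^sup>2)) - (LINT x|lebesgue. V x * of_real ((cmod (1 * ?\<phi> x + (-1) * ?c x))\<^sup>2))"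
      using Bochner_Integration.integral_diff[OF i] by (simp only: e)
    then have "Im (LINT x|lebesgue. 4 * (V x * of_real (\<phi> x))) = 0" using pot[OF D2(1)] pot[OF D2(2)] by (simp only: minus_complex.sel)
    then have "Im (LINT x|lebesgue. V x * of_real (\<phi> x)) = 0" by simp
    then have Im0: "(LINT x|lebesgue. Im (V x * of_real (\<phi> x))) = 0" unfolding integral_Im[OF iV] .
    have eq: "complex_of_real (Im (V x)) * 1 * of_real (\<phi> x) = complex_of_real (Im (V x * of_real (\<phi> x)))" for x by simp
    show "integrable lebesgue (\<lambda>x. complex_of_real (Im (V x)) * 1 * of_real (\<phi> x))"
      unfolding eq using iV by (intro integrable_of_real integrable_Im)
    show "(LINT x|lebesgue. complex_of_real (Im (V x)) * 1 * of_real (\<phi> x)) = 0"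
      unfolding eq integral_complex_of_real Im0 by simp
  qed
  then have ae: "AE x in lebesgue. Im (V x) = 0" by simp
  obtain x0 where "isCont (\<lambda>x. Im (V x)) x0" "Im (V x0) \<noteq> 0" using hypC1_value[OF C1] by blast
  then obtain r where r: "r > 0" "\<And>x. x \<in> ball x0 r \<Longrightarrow> Im (V x) \<noteq> 0" using isCont_nonzero_ball by blast
  have "AE x in lebesgue. x \<notin> ball x0 r" using ae by eventually_elim (use r in blast)
  then show False using not_AE_ball r by blast
qed

lemma closed_sectorial_form:
  fixes V :: "real^'n \<Rightarrow> complex"
  assumes A1: "hypA1 V" and C1: "hypC1 V"
  obtains \<kappa> \<gamma> where "closed_sectorial fsc L2 l2_inner (form_dom V) (form V) \<kappa> \<gamma>"
proof -
  have V: "L1_loc V" "closed_form V" "sectorial_form V" using A1 by (auto simp: hypA1_def)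
  obtain \<gamma> \<theta> where \<theta>: "0 \<le> \<theta>" "\<theta> < pi/2"
    and sect: "\<And>f. f \<in> form_dom V \<Longrightarrow> \<bar>Im (form V f f)\<bar> \<le> tan \<theta> * (Re (form V f f) - \<gamma> * (l2_norm f)\<^sup>2)"
    using V(3) by (auto simp: sectorial_form_def)
  have "\<theta> \<noteq> 0" using Im_potential_nonzero[OF V(1) C1] sect by force
  then have \<kappa>: "tan \<theta> > 0" using \<theta> by (intro tan_gt_zero) auto
  interpret sesq fsc "form_dom V" "form V" by (rule sesq_form[OF V(1)])
  have "closed_sectorial fsc L2 l2_inner (form_dom V) (form V) (tan \<theta>) \<gamma>"
  proof
    show "form_dom V \<subseteq> L2" using form_domD by blast
    show "x \<in> form_dom V \<and> form V x x = 0" if "x \<in> L2" "L2.nrm x = 0" for x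
      using form_dom_null[OF V(1)] that by simp
    show "0 < tan \<theta>" by (rule \<kappa>)
    show "\<bar>Im (form V x x)\<bar> \<le> tan \<theta> * (Re (form V x x) - \<gamma> * (L2.nrm x)\<^sup>2)" if "x \<in> form_dom V" for x
      using sect[OF that] by simp
    show "x \<in> form_dom V \<and> (\<lambda>n. form V (s n - x) (s n - x)) \<longlonglongrightarrow> 0"
      if "\<And>n. s n \<in> form_dom V" "x \<in> L2" "(\<lambda>n. L2.nrm (s n - x)) \<longlonglongrightarrow> 0"
        "\<And>e. e > 0 \<Longrightarrow> \<exists>N. \<forall>n\<ge>N. \<forall>m\<ge>N. cmod (form V (s n - s m) (s n - s m)) < e" for s x
      using V(2)[unfolded closed_form_def, rule_format, of s x] that by (simp add: fun_diff_eq)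
    show "L2.nrm y = 0" if "y \<in> L2" "\<And>v. v \<in> form_dom V \<Longrightarrow> l2_inner v y = 0" for y
      using ctest_dense[OF that(1)] that(2) ctest_form_dom[OF V(1)] by simp
  qed
  then show ?thesis using that by blast
qed

section \<open>Propagation of zeros of positive supersolutions\<close>

lemma l2_norm_mono:
  assumes g: "g \<in> L2" and f: "f \<in> borel_measurable lebesgue" and le: "\<And>x. cmod (f x) \<le> cmod (g x)"
  shows "f \<in> L2" "l2_norm f \<le> l2_norm g"
proof -
  show fL: "f \<in> L2" by (rule L2_bound[OF g f]) (use le in simp)
  have "(l2_norm f)\<^sup>2 \<le> (l2_norm g)\<^sup>2"
    unfolding l2_norm_sq[OF fL] l2_norm_sq[OF g] by (intro integral_mono L2_square fL g power_mono le) auto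
  then show "l2_norm f \<le> l2_norm g" by (simp add: abs_le_square_iff[symmetric])
qed

lemma form_diag:
  assumes f: "f \<in> form_dom V"
  shows "form V f f = of_real (\<Sum>j\<in>UNIV. (l2_norm (wgrad f j))\<^sup>2) + (LINT x|lebesgue. V x * of_real ((cmod (f x))\<^sup>2))"
proof -
  have w: "wgrad f j \<in> L2" for j using wgrad(1) form_domD(1) f by blast
  have 2: "V x * f x * cnj (f x) = V x * of_real ((cmod (f x))\<^sup>2)" for x
    unfolding complex_norm_square by (rule mult.assoc)
  show ?thesis unfolding form_def 2 l2_self[OF w] of_real_sum ..
qed

lemma tendsto_l2_inner:
  assumes x: "\<And>n. x n \<in> L2" "a \<in> L2" "(\<lambda>n. l2_norm (x n - a)) \<longlonglongrightarrow> 0"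
    and y: "\<And>n. y n \<in> L2" "b \<in> L2" "(\<lambda>n. l2_norm (y n - b)) \<longlonglongrightarrow> 0"
  shows "(\<lambda>n. l2_inner (x n) (y n)) \<longlonglongrightarrow> l2_inner a b"
proof -
  have "(\<lambda>n. l2_inner (x n) (y n) - l2_inner a (y n)) \<longlonglongrightarrow> 0"
  proof (rule Lim_null_comparison)
    show "\<forall>\<^sub>F n in sequentially. norm (l2_inner (x n) (y n) - l2_inner a (y n)) \<le> l2_norm (x n - a) * l2_norm (y n)"
      using L2.cauchy_schwarz[OF L2.diff_mem[OF x(1,2)] y(1)] x y by (simp add: L2.ip_diff)
    have "(\<lambda>n. l2_norm (x n - a) * l2_norm (y n)) \<longlonglongrightarrow> 0 * l2_norm b"
      using L2.tendsto_nrm[OF y(1,2)] y(3) by (intro tendsto_mult x(3)) simp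
    then show "(\<lambda>n. l2_norm (x n - a) * l2_norm (y n)) \<longlonglongrightarrow> 0" by simp
  qed
  moreover have "(\<lambda>n. l2_inner a (y n)) \<longlonglongrightarrow> l2_inner a b"
    using L2.tendsto_ip(2)[OF y(1,2) x(2)] y(3) by simp
  ultimately show ?thesis using tendsto_add[of _ 0 sequentially _ "l2_inner a b"] by fastforce
qed

text \<open>With t = ln a - ln b the quotients are e^t and e^-t; for t \<ge> 0 add e^t \<ge> 1 + t +
  t^2/2 and e^-t \<ge> 1 - t.\<close>

lemma log_quotient_bound:
  fixes a b :: real
  assumes "a > 0" "b > 0" shows "(ln a - ln b)\<^sup>2 \<le> 2 * (a / b + b / a - 2)"
proof -
  define t where "t = ln a - ln b"
  have e: "a / b = exp t" "b / a = exp (- t)" using assms by (simp_all add: t_def exp_diff)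
  have "2 + s\<^sup>2 / 2 \<le> exp s + exp (- s)" if "0 \<le> s" for s :: real
    using exp_lower_Taylor_quadratic[OF that] exp_ge_add_one_self[of "- s"] by linarith
  from this[of t] this[of "- t"] have "2 + t\<^sup>2 / 2 \<le> exp t + exp (- t)" by (cases "0 \<le> t") auto
  then show ?thesis unfolding e t_def[symmetric] by simp
qed

text \<open>A discrete Picone identity: right side minus left side is (p b - r a)^2 / (a b). It is
  the two-point version of comparing grad u . grad (phi^2 / u) with |grad phi|^2, and where p = r =
  1 the defect controls the logarithmic increment.\<close>

lemma weighted_quotient_bound:
  fixes a b p r :: real
  assumes "a > 0" "b > 0"
  shows "(a - b) * (p\<^sup>2 / a - r\<^sup>2 / b) \<le> (p - r)\<^sup>2"
    "p = 1 \<Longrightarrow> r = 1 \<Longrightarrow> (ln a - ln b)\<^sup>2 \<le> 2 * ((p - r)\<^sup>2 - (a - b) * (p\<^sup>2 / a - r\<^sup>2 / b))"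
proof -
  have eq: "(p - r)\<^sup>2 - (a - b) * (p\<^sup>2 / a - r\<^sup>2 / b) = (p * b - r * a)\<^sup>2 / (a * b)"
    using assms by (simp add: power2_eq_square field_simps)
  moreover have "0 \<le> (p * b - r * a)\<^sup>2 / (a * b)" using assms by simp
  ultimately show "(a - b) * (p\<^sup>2 / a - r\<^sup>2 / b) \<le> (p - r)\<^sup>2" by linarith
  assume "p = 1" "r = 1"
  then have "(p * b - r * a)\<^sup>2 / (a * b) = a / b + b / a - 2"
    using assms by (simp add: power2_eq_square field_simps)
  then show "(ln a - ln b)\<^sup>2 \<le> 2 * ((p - r)\<^sup>2 - (a - b) * (p\<^sup>2 / a - r\<^sup>2 / b))"
    unfolding eq using log_quotient_bound[OF assms] by simp
qed

lemma weighted_quotient_diff: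
  fixes a b p r :: real
  assumes "a > 0" "b > 0"
  shows "p\<^sup>2 / a - r\<^sup>2 / b = (p - r) * (p + r) / a + r\<^sup>2 * (b - a) / (a * b)"
  using assms by (simp add: power2_eq_square field_simps)

lemma cutoff_L2: "(\<lambda>x. complex_of_real (cutoff R x)) \<in> L2"
proof (rule bounded_support_L2[of _ 1 "R + 1"])
  show "(\<lambda>x. complex_of_real (cutoff R x)) \<in> borel_measurable lebesgue"
    using cutoff_measurable by (rule borel_measurable_continuous_on[rotated]) (intro continuous_intros)
  show "cmod (complex_of_real (cutoff R x)) \<le> 1" for x using cutoff(1)[of R x] cutoff(2)[of R x] by simp
  show "complex_of_real (cutoff R x) = 0" if "norm x > R + 1" for x using cutoff(4)[OF that] by simp
qed

text \<open>\<open>super\<close> is the weak form of -\<Delta>u \<ge> -K (|V| + 1) u, tested with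
  nonnegative functions.\<close>

locale positive_supersolution =
  fixes V :: "real^'n \<Rightarrow> complex" and u :: "real^'n \<Rightarrow> real" and K :: real
  assumes V: "L1_loc V" and u0: "\<And>x. 0 \<le> u x" and u: "(\<lambda>x. complex_of_real (u x)) \<in> form_dom V" and K: "0 \<le> K"
    and super: "\<And>v. \<lbrakk>(\<lambda>x. complex_of_real (v x)) \<in> form_dom V; \<And>x. 0 \<le> v x\<rbrakk> \<Longrightarrow>
      - (K * ((LINT x|lebesgue. cmod (V x) * (u x * v x)) + (LINT x|lebesgue. u x * v x)))
        \<le> (\<Sum>j\<in>UNIV. Re (l2_inner (wgrad (\<lambda>x. complex_of_real (u x)) j) (wgrad (\<lambda>x. complex_of_real (v x)) j)))"
begin

abbreviation U :: "real^'n \<Rightarrow> complex" where "U \<equiv> \<lambda>x. complex_of_real (u x)"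
abbreviation cut :: "real \<Rightarrow> real^'n \<Rightarrow> complex" where "cut R \<equiv> \<lambda>x. complex_of_real (cutoff R x)"
text \<open>The test function of Moser's logarithmic estimate, with \<epsilon> keeping the
  denominator positive.\<close>

definition vt :: "real \<Rightarrow> real \<Rightarrow> real^'n \<Rightarrow> real" where "vt R \<epsilon> x = (cutoff R x)\<^sup>2 / (u x + \<epsilon>)"
abbreviation vc :: "real \<Rightarrow> real \<Rightarrow> real^'n \<Rightarrow> complex" where "vc R \<epsilon> \<equiv> \<lambda>x. complex_of_real (vt R \<epsilon> x)"

lemma U_L2: "U \<in> L2" and U_H1: "U \<in> H1" using u form_domD by auto

lemma u_meas: "u \<in> borel_measurable lebesgue"
proof -
  have "U \<in> borel_measurable lebesgue" using U_L2 by (simp add: L2_def)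
  then have "(\<lambda>x. Re (U x)) \<in> borel_measurable lebesgue"
    by (rule borel_measurable_continuous_on[rotated]) (intro continuous_intros)
  then show ?thesis by simp
qed

lemma vt_meas: "vt R \<epsilon> \<in> borel_measurable lebesgue"
  unfolding vt_def[abs_def] using u_meas cutoff_measurable by (intro borel_measurable_divide borel_measurable_power borel_measurable_add) auto

lemma vt_bounds: assumes e: "\<epsilon> > 0" shows "0 \<le> vt R \<epsilon> x" "vt R \<epsilon> x \<le> 1 / \<epsilon>" "u x * vt R \<epsilon> x \<le> (cutoff R x)\<^sup>2" "vt R \<epsilon> x \<le> cutoff R x / \<epsilon>"
proof -
  have c2: "(cutoff R x)\<^sup>2 \<le> cutoff R x" "cutoff R x \<le> 1" "0 \<le> cutoff R x"
    using cutoff(1)[of R x] cutoff(2)[of R x] by (auto simp: power2_eq_square mult_left_le)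
  show "0 \<le> vt R \<epsilon> x" using u0[of x] e by (simp add: vt_def)
  have "vt R \<epsilon> x \<le> cutoff R x / \<epsilon>" unfolding vt_def using c2 u0[of x] e by (intro frac_le) auto
  also have "\<dots> \<le> 1 / \<epsilon>" using c2 e by (intro divide_right_mono) auto
  finally show "vt R \<epsilon> x \<le> 1 / \<epsilon>" .
  show "vt R \<epsilon> x \<le> cutoff R x / \<epsilon>" by fact
  have "u x * vt R \<epsilon> x = (u x / (u x + \<epsilon>)) * (cutoff R x)\<^sup>2" by (simp add: vt_def)
  also have "\<dots> \<le> 1 * (cutoff R x)\<^sup>2" using u0[of x] e by (intro mult_right_mono) auto
  finally show "u x * vt R \<epsilon> x \<le> (cutoff R x)\<^sup>2" by simp
qed

lemma vc_L2: "\<epsilon> > 0 \<Longrightarrow> vc R \<epsilon> \<in> L2"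
proof (rule bounded_support_L2[of _ "1 / \<epsilon>" "R + 1"])
  show "vc R \<epsilon> \<in> borel_measurable lebesgue"
    using vt_meas by (rule borel_measurable_continuous_on[rotated]) (intro continuous_intros)
  show "cmod (vc R \<epsilon> x) \<le> 1 / \<epsilon>" if "\<epsilon> > 0" for x using vt_bounds[OF that, where R=R and x=x] by simp
  show "vc R \<epsilon> x = 0" if "norm x > R + 1" for x using cutoff(4)[OF that] by (simp add: vt_def)
qed

lemma vt_diff:
  assumes e: "\<epsilon> > 0"
  shows "\<bar>vt R \<epsilon> y - vt R \<epsilon> x\<bar> \<le> (2 / \<epsilon>) * \<bar>cutoff R y - cutoff R x\<bar> + (1 / \<epsilon>\<^sup>2) * \<bar>u y - u x\<bar>"
proof -
  let ?a = "u y + \<epsilon>" and ?b = "u x + \<epsilon>" and ?p = "cutoff R y" and ?r = "cutoff R x"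
  have ab: "?a \<ge> \<epsilon>" "?b \<ge> \<epsilon>" "?a > 0" "?b > 0" using u0[of x] u0[of y] e by linarith+
  have pr: "0 \<le> ?p" "?p \<le> 1" "0 \<le> ?r" "?r \<le> 1" using cutoff(1,2) by auto
  have "vt R \<epsilon> y - vt R \<epsilon> x = (?p - ?r) * (?p + ?r) / ?a + ?r\<^sup>2 * (?b - ?a) / (?a * ?b)"
    unfolding vt_def by (rule weighted_quotient_diff[OF ab(3,4)])
  then have "\<bar>vt R \<epsilon> y - vt R \<epsilon> x\<bar> \<le> \<bar>?p - ?r\<bar> * (?p + ?r) / ?a + ?r\<^sup>2 * \<bar>?b - ?a\<bar> / (?a * ?b)"
    using abs_triangle_ineq[of "(?p - ?r) * (?p + ?r) / ?a" "?r\<^sup>2 * (?b - ?a) / (?a * ?b)"] ab pr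
    by (simp add: abs_mult abs_divide)
  also have "\<dots> \<le> \<bar>?p - ?r\<bar> * 2 / \<epsilon> + 1 * \<bar>?b - ?a\<bar> / (\<epsilon> * \<epsilon>)"
    using ab pr e by (intro add_mono frac_le mult_left_mono mult_mono mult_nonneg_nonneg power_le_one) auto
  also have "\<dots> = (2 / \<epsilon>) * \<bar>?p - ?r\<bar> + (1 / \<epsilon>\<^sup>2) * \<bar>u y - u x\<bar>"
    by (simp add: power2_eq_square abs_minus_commute)
  finally show ?thesis .
qed

text \<open>By \<open>vt_diff\<close> the quotients are controlled by those of the cutoff and of u,
  both in \<open>H1\<close>. Constants that blow up as \<epsilon> tends to 0 do no harm here, since
  only membership is at stake.\<close>

lemma vc_form_dom:
  assumes e: "\<epsilon> > 0" shows "vc R \<epsilon> \<in> form_dom V"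
proof (rule form_domI[OF V])
  have cH: "cut R \<in> H1" using cutoff_form_dom[OF V] form_domD by blast
  show "vc R \<epsilon> \<in> H1"
  proof (rule H1_dqI[OF vc_L2[OF e]])
    fix j and \<tau> :: real assume \<tau>: "0 < \<tau>" "\<tau> \<le> 1"
    let ?A = "\<lambda>x. complex_of_real ((2 / \<epsilon>) * cmod (dq j \<tau> (cut R) x))" and ?B = "\<lambda>x. complex_of_real ((1 / \<epsilon>\<^sup>2) * cmod (dq j \<tau> U x))"
    have absL: "(\<lambda>x. complex_of_real (k * cmod (g x))) \<in> L2" "l2_norm (\<lambda>x. complex_of_real (k * cmod (g x))) = \<bar>k\<bar> * l2_norm g"
      if g: "g \<in> L2" for k and g :: "real^'n \<Rightarrow> complex"
    proof -
      have "(\<lambda>x. cmod (g x)) \<in> borel_measurable lebesgue" using L2_measurable[OF g] by (rule borel_measurable_continuous_on[rotated]) (intro continuous_intros)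
      then have "(\<lambda>x. k * cmod (g x)) \<in> borel_measurable lebesgue" by (intro borel_measurable_times) auto
      then have m: "(\<lambda>x. complex_of_real (k * cmod (g x))) \<in> borel_measurable lebesgue"
        by (rule borel_measurable_continuous_on[rotated]) (intro continuous_intros)
      show "(\<lambda>x. complex_of_real (k * cmod (g x))) \<in> L2"
        by (rule l2_norm_mono(1)[OF L2_scale[OF g, of k] m]) (simp add: norm_mult)
      show "l2_norm (\<lambda>x. complex_of_real (k * cmod (g x))) = \<bar>k\<bar> * l2_norm g"
        by (simp add: l2_norm_def norm_mult power_mult_distrib real_sqrt_mult)
    qed
    have A: "?A \<in> L2" "l2_norm ?A = \<bar>2 / \<epsilon>\<bar> * l2_norm (dq j \<tau> (cut R))" by (rule absL[OF dq_L2[OF cutoff_L2]])+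
    have B: "?B \<in> L2" "l2_norm ?B = \<bar>1 / \<epsilon>\<^sup>2\<bar> * l2_norm (dq j \<tau> U)" by (rule absL[OF dq_L2[OF U_L2]])+
    have le: "cmod (dq j \<tau> (vc R \<epsilon>) x) \<le> cmod ((?A + ?B) x)" for x
    proof -
      let ?y = "x + \<tau> *\<^sub>R axis j 1"
      have "cmod (dq j \<tau> (vc R \<epsilon>) x) = \<bar>vt R \<epsilon> ?y - vt R \<epsilon> x\<bar> / \<tau>"
        using \<tau> by (simp add: dq_def norm_divide flip: of_real_diff)
      also have "\<dots> \<le> ((2 / \<epsilon>) * \<bar>cutoff R ?y - cutoff R x\<bar> + (1 / \<epsilon>\<^sup>2) * \<bar>u ?y - u x\<bar>) / \<tau>"
        using vt_diff[OF e] \<tau> by (intro divide_right_mono) auto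
      also have "\<dots> = (2 / \<epsilon>) * cmod (dq j \<tau> (cut R) x) + (1 / \<epsilon>\<^sup>2) * cmod (dq j \<tau> U x)"
        using \<tau> by (simp add: dq_def norm_divide add_divide_distrib flip: of_real_diff)
      also have "\<dots> \<le> \<bar>\<dots>\<bar>" by (rule abs_ge_self)
      also have "\<dots> = cmod ((?A + ?B) x)" unfolding plus_fun_apply of_real_add[symmetric] norm_of_real ..
      finally show ?thesis .
    qed
    have "dq j \<tau> (vc R \<epsilon>) \<in> borel_measurable lebesgue" using dq_L2[OF vc_L2[OF e]] by (simp add: L2_def)
    then have "l2_norm (dq j \<tau> (vc R \<epsilon>)) \<le> l2_norm (?A + ?B)"
      by (rule l2_norm_mono(2)[OF L2.add_mem[OF A(1) B(1)] _ le])
    also have "\<dots> \<le> l2_norm ?A + l2_norm ?B" using L2.nrm_triangle[OF A(1) B(1)] by simp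
    also have "\<dots> \<le> \<bar>2 / \<epsilon>\<bar> * l2_norm (wgrad (cut R) j) + \<bar>1 / \<epsilon>\<^sup>2\<bar> * l2_norm (wgrad U j)"
      unfolding A(2) B(2) by (intro add_mono mult_left_mono dq_wgrad_le cH U_H1) auto
    finally show "l2_norm (dq j \<tau> (vc R \<epsilon>)) \<le> \<bar>2 / \<epsilon>\<bar> * l2_norm (wgrad (cut R) j) + \<bar>1 / \<epsilon>\<^sup>2\<bar> * l2_norm (wgrad U j)" .
  qed
  show "integrable lebesgue (\<lambda>x. (1 / \<epsilon>)\<^sup>2 * (cmod (V x) * (cmod (cut R x))\<^sup>2))"
    by (intro integrable_mult_right form_dom_weight[OF V] cutoff_form_dom[OF V])
  have "cmod (V x) * (cmod (vc R \<epsilon> x))\<^sup>2 \<le> (1 / \<epsilon>)\<^sup>2 * (cmod (V x) * (cmod (cut R x))\<^sup>2)" for x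
  proof -
    have "(cmod (vc R \<epsilon> x))\<^sup>2 \<le> (cutoff R x / \<epsilon>)\<^sup>2"
      using vt_bounds[OF e, where R=R and x=x] by (intro power_mono) auto
    then have "cmod (V x) * (cmod (vc R \<epsilon> x))\<^sup>2 \<le> cmod (V x) * (cutoff R x / \<epsilon>)\<^sup>2" by (rule mult_left_mono) simp
    then show ?thesis by (simp add: power_divide)
  qed
  then show "AE x in lebesgue. cmod (V x) * (cmod (vc R \<epsilon> x))\<^sup>2 \<le> (1 / \<epsilon>)\<^sup>2 * (cmod (V x) * (cmod (cut R x))\<^sup>2)" by simp
qed

text \<open>The energy of the cutoff phi plus K times the integral of (|V| + 1) phi^2. It is free of
  \<epsilon> because u times the test function is at most phi^2.\<close>

definition Cb :: "real \<Rightarrow> real" where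
  "Cb R = (\<Sum>j\<in>UNIV. (l2_norm (wgrad (cut R) j))\<^sup>2) + K * ((LINT x|lebesgue. cmod (V x) * (cmod (cut R x))\<^sup>2) + (LINT x|lebesgue. (cmod (cut R x))\<^sup>2))"

lemma gradient_lower_bound:
  assumes e: "\<epsilon> > 0"
  shows "(\<Sum>j\<in>UNIV. (l2_norm (wgrad (cut R) j))\<^sup>2) - Cb R \<le> (\<Sum>j\<in>UNIV. Re (l2_inner (wgrad U j) (wgrad (vc R \<epsilon>) j)))"
proof -
  have c: "(cmod (cut R x))\<^sup>2 = (cutoff R x)\<^sup>2" for x by simp
  have i1: "integrable lebesgue (\<lambda>x. cmod (V x) * (cmod (cut R x))\<^sup>2)" by (intro form_dom_weight[OF V] cutoff_form_dom[OF V])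
  have i2: "integrable lebesgue (\<lambda>x. (cmod (cut R x))\<^sup>2)" by (rule L2_square[OF cutoff_L2])
  have uv: "0 \<le> u x * vt R \<epsilon> x" "u x * vt R \<epsilon> x \<le> (cmod (cut R x))\<^sup>2" for x
    using vt_bounds[OF e, where R=R and x=x] u0[of x] by (auto simp: c)
  have "(LINT x|lebesgue. cmod (V x) * (u x * vt R \<epsilon> x)) \<le> (LINT x|lebesgue. cmod (V x) * (cmod (cut R x))\<^sup>2)"
    by (rule integral_mono_AE'[OF i1]) (use uv in \<open>auto intro!: AE_I2 mult_left_mono\<close>)
  moreover have "(LINT x|lebesgue. u x * vt R \<epsilon> x) \<le> (LINT x|lebesgue. (cmod (cut R x))\<^sup>2)"
    by (rule integral_mono_AE'[OF i2]) (use uv in \<open>auto intro!: AE_I2\<close>)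
  ultimately have "K * ((LINT x|lebesgue. cmod (V x) * (u x * vt R \<epsilon> x)) + (LINT x|lebesgue. u x * vt R \<epsilon> x))
      \<le> K * ((LINT x|lebesgue. cmod (V x) * (cmod (cut R x))\<^sup>2) + (LINT x|lebesgue. (cmod (cut R x))\<^sup>2))"
    using K by (intro mult_left_mono add_mono) auto
  then show ?thesis using super[OF vc_form_dom[OF e], of R] vt_bounds(1)[OF e] by (simp add: Cb_def)
qed

text \<open>The Picone defect of u + \<epsilon> and the cutoff at distance \<tau>, divided by
  \<tau>^2. Nonnegativity permits discarding directions and points; where the cutoff is 1 at both
  ends it dominates squared increments of ln (u + \<epsilon>).\<close>

definition Nq :: "real \<Rightarrow> real \<Rightarrow> 'n \<Rightarrow> real \<Rightarrow> real^'n \<Rightarrow> real" where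
  "Nq R \<epsilon> j \<tau> x = (cmod (dq j \<tau> (cut R) x))\<^sup>2 - Re (dq j \<tau> U x * cnj (dq j \<tau> (vc R \<epsilon>) x))"

lemma Nq_integral:
  assumes e: "\<epsilon> > 0"
  shows "integrable lebesgue (Nq R \<epsilon> j \<tau>)"
    "(LINT x|lebesgue. Nq R \<epsilon> j \<tau> x) = (l2_norm (dq j \<tau> (cut R)))\<^sup>2 - Re (l2_inner (dq j \<tau> U) (dq j \<tau> (vc R \<epsilon>)))"
proof -
  have L: "dq j \<tau> (cut R) \<in> L2" "dq j \<tau> U \<in> L2" "dq j \<tau> (vc R \<epsilon>) \<in> L2"
    using dq_L2 cutoff_L2 U_L2 vc_L2[OF e] by blast+
  note i = L2_square[OF L(1)] L2_mult_cnj[OF L(2,3)]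
  show "integrable lebesgue (Nq R \<epsilon> j \<tau>)" unfolding Nq_def[abs_def] by (intro Bochner_Integration.integrable_diff i integrable_Re)
  show "(LINT x|lebesgue. Nq R \<epsilon> j \<tau> x) = (l2_norm (dq j \<tau> (cut R)))\<^sup>2 - Re (l2_inner (dq j \<tau> U) (dq j \<tau> (vc R \<epsilon>)))"
    unfolding Nq_def l2_norm_sq[OF L(1)] l2_inner_def integral_Re[OF i(2), symmetric]
    by (intro Bochner_Integration.integral_diff i integrable_Re)
qed

lemma Nq_lower:
  assumes e: "\<epsilon> > 0" and \<tau>: "\<tau> \<noteq> 0"
  shows "0 \<le> Nq R \<epsilon> j \<tau> x"
    "\<lbrakk>norm x \<le> R; norm (x + \<tau> *\<^sub>R axis j 1) \<le> R\<rbrakk> \<Longrightarrow>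
      (ln (u (x + \<tau> *\<^sub>R axis j 1) + \<epsilon>) - ln (u x + \<epsilon>))\<^sup>2 \<le> 2 * \<tau>\<^sup>2 * Nq R \<epsilon> j \<tau> x"
proof -
  let ?y = "x + \<tau> *\<^sub>R axis j 1"
  let ?a = "u ?y + \<epsilon>" and ?b = "u x + \<epsilon>" and ?p = "cutoff R ?y" and ?r = "cutoff R x"
  have ab: "?a > 0" "?b > 0" using u0[of x] u0[of ?y] e by linarith+
  have "dq j \<tau> U x * cnj (dq j \<tau> (vc R \<epsilon>) x) = of_real ((?a - ?b) * (?p\<^sup>2 / ?a - ?r\<^sup>2 / ?b) / \<tau>\<^sup>2)"
    by (simp add: dq_def vt_def power2_eq_square)
  moreover have "(cmod (dq j \<tau> (cut R) x))\<^sup>2 = (?p - ?r)\<^sup>2 / \<tau>\<^sup>2"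
    by (simp add: dq_def norm_divide power_divide flip: of_real_diff)
  ultimately have N: "Nq R \<epsilon> j \<tau> x = ((?p - ?r)\<^sup>2 - (?a - ?b) * (?p\<^sup>2 / ?a - ?r\<^sup>2 / ?b)) / \<tau>\<^sup>2"
    by (simp only: Nq_def Re_complex_of_real diff_divide_distrib)
  show "0 \<le> Nq R \<epsilon> j \<tau> x" unfolding N using weighted_quotient_bound(1)[OF ab, of ?p ?r] by (intro divide_nonneg_nonneg) auto
  assume "norm x \<le> R" "norm ?y \<le> R"
  then have "?p = 1" "?r = 1" using cutoff(3) by auto
  from weighted_quotient_bound(2)[OF ab this] show "(ln ?a - ln ?b)\<^sup>2 \<le> 2 * \<tau>\<^sup>2 * Nq R \<epsilon> j \<tau> x"
    unfolding N using \<tau> by simp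
qed

text \<open>Difference quotients converge in \<open>L2\<close> to weak gradients, so for a short
  step the total defect is below its limiting bound \<open>Cb R\<close> plus 1; one direction is
  bounded by the sum, all terms being nonnegative. Steps of the form T / (n + 1) are taken so that n
  + 1 of them make up T.\<close>

lemma Nq_integral_bound:
  assumes e: "\<epsilon> > 0" and T: "T \<noteq> 0"
  shows "\<exists>n. (LINT x|lebesgue. Nq R \<epsilon> j (T / real (Suc n)) x) \<le> Cb R + 1"
proof -
  define h where "h n = T / real (Suc n)" for n
  have h: "h \<longlonglongrightarrow> 0" "\<And>n. h n \<noteq> 0"
    using tendsto_mult_right_zero[OF LIMSEQ_inverse_real_of_nat, of T] T by (auto simp: h_def[abs_def] divide_inverse)
  have cH: "cut R \<in> H1" using cutoff_form_dom[OF V] form_domD by blast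
  have vH: "vc R \<epsilon> \<in> H1" using vc_form_dom[OF e] form_domD by blast
  have "(\<lambda>n. l2_inner (dq j (h n) U) (dq j (h n) (vc R \<epsilon>))) \<longlonglongrightarrow> l2_inner (wgrad U j) (wgrad (vc R \<epsilon>) j)" for j
    by (intro tendsto_l2_inner dq_L2 U_L2 vc_L2 e wgrad(1) U_H1 vH dq_wgrad_tendsto h)
  then have "(\<lambda>n. (\<Sum>j\<in>UNIV. (l2_norm (wgrad (cut R) j))\<^sup>2) - (\<Sum>j\<in>UNIV. Re (l2_inner (dq j (h n) U) (dq j (h n) (vc R \<epsilon>)))))
      \<longlonglongrightarrow> (\<Sum>j\<in>UNIV. (l2_norm (wgrad (cut R) j))\<^sup>2) - (\<Sum>j\<in>UNIV. Re (l2_inner (wgrad U j) (wgrad (vc R \<epsilon>) j)))"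
    by (intro tendsto_intros)
  moreover have "(\<Sum>j\<in>UNIV. (l2_norm (wgrad (cut R) j))\<^sup>2) - (\<Sum>j\<in>UNIV. Re (l2_inner (wgrad U j) (wgrad (vc R \<epsilon>) j))) < Cb R + 1"
    using gradient_lower_bound[OF e, of R] by linarith
  ultimately have "\<forall>\<^sub>F n in sequentially. (\<Sum>j\<in>UNIV. (l2_norm (wgrad (cut R) j))\<^sup>2) - (\<Sum>j\<in>UNIV. Re (l2_inner (dq j (h n) U) (dq j (h n) (vc R \<epsilon>)))) < Cb R + 1"
    by (rule order_tendstoD)
  then obtain n where n: "(\<Sum>j\<in>UNIV. (l2_norm (wgrad (cut R) j))\<^sup>2) - (\<Sum>j\<in>UNIV. Re (l2_inner (dq j (h n) U) (dq j (h n) (vc R \<epsilon>)))) < Cb R + 1"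
    unfolding eventually_sequentially by blast
  have "(LINT x|lebesgue. Nq R \<epsilon> j (h n) x) \<le> (\<Sum>i\<in>UNIV. (LINT x|lebesgue. Nq R \<epsilon> i (h n) x))"
    by (rule member_le_sum) (auto intro!: integral_nonneg_AE AE_I2 Nq_lower(1)[OF e h(2)])
  also have "\<dots> \<le> (\<Sum>i\<in>UNIV. (l2_norm (wgrad (cut R) i))\<^sup>2 - Re (l2_inner (dq i (h n) U) (dq i (h n) (vc R \<epsilon>))))"
    unfolding Nq_integral(2)[OF e] by (intro sum_mono diff_right_mono power_mono dq_wgrad_le cH) auto
  also have "\<dots> < Cb R + 1" using n by (simp add: sum_subtractf)
  finally have "(LINT x|lebesgue. Nq R \<epsilon> j (h n) x) \<le> Cb R + 1" by simp
  then show ?thesis unfolding h_def by blast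
qed

text \<open>The bound does not depend on \<open>\<epsilon>\<close>; it comes from chaining many short steps of length \<open>T / n\<close>.\<close>

lemma log_estimate:
  fixes j :: 'n and x0 :: "real^'n"
  assumes e: "\<epsilon> > 0" and T: "T \<noteq> 0" and R: "norm x0 + r + \<bar>T\<bar> \<le> R"
  defines "F \<equiv> \<lambda>x. indicator (ball x0 r) x * (ln (u (x + T *\<^sub>R axis j 1) + \<epsilon>) - ln (u x + \<epsilon>))\<^sup>2"
  shows "integrable lebesgue F" "(LINT x|lebesgue. F x) \<le> 2 * T\<^sup>2 * (Cb R + 1)"
proof -
  obtain n where n: "(LINT x|lebesgue. Nq R \<epsilon> j (T / real (Suc n)) x) \<le> Cb R + 1" using Nq_integral_bound[OF e T] by blast
  define N where "N = Suc n"
  define \<tau> where "\<tau> = T / real N"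
  have N: "N > 0" "real N > 0" by (auto simp: N_def)
  have \<tau>: "\<tau> \<noteq> 0" "real N * \<tau> = T" using T N by (auto simp: \<tau>_def)
  let ?e = "axis j 1 :: real^'n"
  let ?L = "\<lambda>x. ln (u x + \<epsilon>)"
  \<comment> \<open>A majorant of \<open>F\<close>: Cauchy-Schwarz over N steps costs a factor N,
    each step contributes 2 \<tau>^2 times a defect, and N^2 \<tau>^2 = T^2 removes the number of
    steps from the integral.\<close>
  define H where "H x = real N * (\<Sum>i<N. 2 * \<tau>\<^sup>2 * Nq R \<epsilon> j \<tau> (x + (real i * \<tau>) *\<^sub>R ?e))" for x
  note Ni = Nq_integral(1)[OF e, of R j \<tau>]
  have sh: "integrable lebesgue (\<lambda>x. Nq R \<epsilon> j \<tau> (x + a))" "(LINT x|lebesgue. Nq R \<epsilon> j \<tau> (x + a)) = (LINT x|lebesgue. Nq R \<epsilon> j \<tau> x)" for a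
    using lebesgue_integrable_shift lebesgue_integral_shift Ni borel_measurable_integrable by blast+
  have Hi: "integrable lebesgue H" unfolding H_def[abs_def]
    by (intro integrable_mult_right Bochner_Integration.integrable_sum sh)
  have "(LINT x|lebesgue. H x) = real N * (\<Sum>i<N. 2 * \<tau>\<^sup>2 * (LINT x|lebesgue. Nq R \<epsilon> j \<tau> x))"
    unfolding H_def by (simp add: Bochner_Integration.integral_sum sh)
  also have "\<dots> = 2 * (real N * \<tau>)\<^sup>2 * (LINT x|lebesgue. Nq R \<epsilon> j \<tau> x)" by (simp add: power2_eq_square)
  also have "\<dots> \<le> 2 * T\<^sup>2 * (Cb R + 1)"
    unfolding \<tau>(2) using n by (intro mult_left_mono) (auto simp: \<tau>_def N_def)
  finally have HI: "(LINT x|lebesgue. H x) \<le> 2 * T\<^sup>2 * (Cb R + 1)" .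
  have FH: "0 \<le> F x" "F x \<le> H x" for x
  proof -
    show "0 \<le> F x" by (simp add: F_def)
    have Hn: "0 \<le> H x" unfolding H_def using Nq_lower(1)[OF e \<tau>(1)] by (intro mult_nonneg_nonneg sum_nonneg) auto
    show "F x \<le> H x"
    proof (cases "x \<in> ball x0 r")
      case False
      then show ?thesis using Hn by (simp add: F_def)
    next
      case True
      \<comment> \<open>All intermediate points stay where the cutoff is 1; this is what the
        condition on R provides.\<close>
      have nx: "norm (x + (real i * \<tau>) *\<^sub>R ?e) \<le> R" if "i \<le> N" for i
      proof -
        have "norm x \<le> norm x0 + norm (x - x0)" using norm_triangle_ineq[of x0 "x - x0"] by simp
        also have "norm (x - x0) \<le> r" using True by (simp add: dist_norm norm_minus_commute)
        finally have "norm x \<le> norm x0 + r" by simp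
        moreover have "norm ((real i * \<tau>) *\<^sub>R ?e) \<le> \<bar>T\<bar>"
        proof -
          have "real i * \<bar>\<tau>\<bar> \<le> real N * \<bar>\<tau>\<bar>" using that by (intro mult_right_mono) auto
          also have "\<dots> = \<bar>T\<bar>" using \<tau>(2) by (metis abs_mult abs_of_nat)
          finally show ?thesis by (simp add: abs_mult)
        qed
        ultimately show ?thesis using norm_triangle_ineq[of x "(real i * \<tau>) *\<^sub>R ?e"] R by linarith
      qed
      let ?d = "\<lambda>i. ?L (x + (real (Suc i) * \<tau>) *\<^sub>R ?e) - ?L (x + (real i * \<tau>) *\<^sub>R ?e)"
      have "?L (x + T *\<^sub>R ?e) - ?L x = (\<Sum>i<N. ?d i)"
        using sum_lessThan_telescope[of "\<lambda>i. ?L (x + (real i * \<tau>) *\<^sub>R ?e)" N] \<tau>(2) by simp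
      then have "F x = (\<Sum>i<N. 1 * ?d i)\<^sup>2" using True by (simp add: F_def)
      also have "\<dots> \<le> (\<Sum>i<N. 1\<^sup>2) * (\<Sum>i<N. (?d i)\<^sup>2)" by (rule Cauchy_Schwarz_ineq_sum)
      also have "\<dots> \<le> real N * (\<Sum>i<N. 2 * \<tau>\<^sup>2 * Nq R \<epsilon> j \<tau> (x + (real i * \<tau>) *\<^sub>R ?e))"
      proof -
        have "(?d i)\<^sup>2 \<le> 2 * \<tau>\<^sup>2 * Nq R \<epsilon> j \<tau> (x + (real i * \<tau>) *\<^sub>R ?e)" if i: "i \<in> {..<N}" for i
        proof -
          have s: "x + (real i * \<tau>) *\<^sub>R ?e + \<tau> *\<^sub>R ?e = x + (real (Suc i) * \<tau>) *\<^sub>R ?e" by (simp add: algebra_simps)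
          have "norm (x + (real i * \<tau>) *\<^sub>R ?e) \<le> R" "norm (x + (real i * \<tau>) *\<^sub>R ?e + \<tau> *\<^sub>R ?e) \<le> R"
            unfolding s by (rule nx; use i in simp)+
          from Nq_lower(2)[OF e \<tau>(1) this] show ?thesis unfolding s .
        qed
        then have "(\<Sum>i<N. (?d i)\<^sup>2) \<le> (\<Sum>i<N. 2 * \<tau>\<^sup>2 * Nq R \<epsilon> j \<tau> (x + (real i * \<tau>) *\<^sub>R ?e))" by (rule sum_mono)
        then show ?thesis by (simp add: mult_left_mono)
      qed
      finally show ?thesis by (simp only: H_def)
    qed
  qed
  have "F \<in> borel_measurable lebesgue"
  proof -
    have "(\<lambda>x. u (x + a)) \<in> borel_measurable lebesgue" for a using measurable_shift[OF u_meas] .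
    from this[of 0] this have "(\<lambda>x. ln (u (x + T *\<^sub>R ?e) + \<epsilon>)) \<in> borel_measurable lebesgue" "(\<lambda>x. ln (u x + \<epsilon>)) \<in> borel_measurable lebesgue"
      by (auto intro!: borel_measurable_ln borel_measurable_add)
    moreover have "(indicator (ball x0 r) :: real^'n \<Rightarrow> real) \<in> borel_measurable lebesgue" by (rule borel_measurable_indicator) auto
    ultimately show ?thesis unfolding F_def by (intro borel_measurable_times borel_measurable_power borel_measurable_diff)
  qed
  then show Fi: "integrable lebesgue F"
    by (rule Bochner_Integration.integrable_bound[OF Hi]) (use FH in \<open>auto intro!: AE_I2 intro: order_trans[OF _ abs_ge_self]\<close>)
  have "(LINT x|lebesgue. F x) \<le> (LINT x|lebesgue. H x)" by (rule integral_mono[OF Fi Hi FH(2)])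
  then show "(LINT x|lebesgue. F x) \<le> 2 * T\<^sup>2 * (Cb R + 1)" using HI by linarith
qed

text \<open>Where u vanishes, ln (u + \<epsilon>) is ln \<epsilon>. If u were at least \<delta>
  after the shift on a set A, then \<epsilon> = \<delta> e^-k would make the increment at least k on
  A; hence k^2 |A| \<le> C for every k, and A is null.\<close>

lemma zero_ball_shift:
  assumes z: "AE x in lebesgue. x \<in> ball x0 r \<longrightarrow> u x = 0" and r: "r > 0"
  shows "AE x in lebesgue. x \<in> ball (x0 + T *\<^sub>R axis j 1) r \<longrightarrow> u x = 0"
proof (cases "T = 0")
  case True
  then show ?thesis using z by simp
next
  case T: False
  let ?e = "axis j 1 :: real^'n"
  define R where "R = norm x0 + r + \<bar>T\<bar>"
  define C where "C = 2 * T\<^sup>2 * (Cb R + 1)"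
  have ush: "(\<lambda>x. u (x + T *\<^sub>R ?e)) \<in> borel_measurable lebesgue" using measurable_shift[OF u_meas] .
  have "AE x in lebesgue. \<not> (x \<in> ball x0 r \<and> \<delta> \<le> u (x + T *\<^sub>R ?e))" if \<delta>: "\<delta> > 0" for \<delta>
  proof -
    define A where "A = {x. x \<in> ball x0 r \<and> \<delta> \<le> u (x + T *\<^sub>R ?e)}"
    have A: "A \<in> sets lebesgue"
    proof -
      have "{x \<in> space lebesgue. \<delta> \<le> u (x + T *\<^sub>R ?e)} \<in> sets lebesgue" using ush by (rule borel_measurable_le[OF borel_measurable_const])
      moreover have "A = ball x0 r \<inter> {x \<in> space lebesgue. \<delta> \<le> u (x + T *\<^sub>R ?e)}" by (auto simp: A_def)
      ultimately show ?thesis by auto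
    qed
    have Ab: "A \<subseteq> ball x0 r" by (auto simp: A_def)
    have Al: "A \<in> lmeasurable" using A bounded_subset[OF bounded_ball Ab] by (intro bounded_set_imp_lmeasurable)
    have km: "(real k)\<^sup>2 * measure lebesgue A \<le> C" for k
    proof -
      let ?\<epsilon> = "\<delta> * exp (- real k)"
      have e: "?\<epsilon> > 0" using \<delta> by simp
      let ?F = "\<lambda>x. indicator (ball x0 r) x * (ln (u (x + T *\<^sub>R ?e) + ?\<epsilon>) - ln (u x + ?\<epsilon>))\<^sup>2"
      note est = log_estimate[OF e T, of x0 r R j]
      have "(LINT x|lebesgue. indicator A x * (real k)\<^sup>2) \<le> (LINT x|lebesgue. ?F x)"
      proof (rule integral_mono_AE)
        show "integrable lebesgue (\<lambda>x. indicator A x * (real k)\<^sup>2)"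
          using Al by (intro integrable_mult_left integrable_real_indicator) (auto simp: fmeasurable_def)
        show "integrable lebesgue ?F" using est(1) by (simp add: R_def)
        show "AE x in lebesgue. indicator A x * (real k)\<^sup>2 \<le> ?F x"
          using z
        proof eventually_elim
          fix x assume x: "x \<in> ball x0 r \<longrightarrow> u x = 0"
          show "indicator A x * (real k)\<^sup>2 \<le> ?F x"
          proof (cases "x \<in> A")
            case True
            then have xb: "x \<in> ball x0 r" and d: "\<delta> \<le> u (x + T *\<^sub>R ?e)" by (auto simp: A_def)
            have "real k = ln \<delta> - ln ?\<epsilon>" using \<delta> by (simp add: ln_mult)
            also have "\<dots> \<le> ln (u (x + T *\<^sub>R ?e) + ?\<epsilon>) - ln (u x + ?\<epsilon>)"
            proof (rule diff_mono)
              show "ln \<delta> \<le> ln (u (x + T *\<^sub>R ?e) + ?\<epsilon>)" using \<delta> d e by (subst ln_le_cancel_iff) linarith+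
              show "ln (u x + ?\<epsilon>) \<le> ln ?\<epsilon>" using x xb by simp
            qed
            finally have "(real k)\<^sup>2 \<le> (ln (u (x + T *\<^sub>R ?e) + ?\<epsilon>) - ln (u x + ?\<epsilon>))\<^sup>2" by (rule power_mono) simp
            then show ?thesis using True xb by simp
          qed simp
        qed
      qed
      also have "\<dots> \<le> C" using est(2) by (simp add: R_def C_def)
      finally show ?thesis using A by (simp add: mult.commute)
    qed
    have "measure lebesgue A = 0"
    proof (rule ccontr)
      assume "measure lebesgue A \<noteq> 0"
      then have p: "measure lebesgue A > 0" by (simp add: zero_less_measure_iff)
      obtain k :: nat where k: "real k > max 1 (C / measure lebesgue A)" using reals_Archimedean2 by blast
      then have "C < real k * measure lebesgue A" using p by (simp add: pos_divide_less_eq)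
      also have "\<dots> \<le> (real k)\<^sup>2 * measure lebesgue A" using k p by (intro mult_right_mono) (auto simp: power2_eq_square)
      finally show False using km[of k] by simp
    qed
    then have "A \<in> null_sets lebesgue" using Al by (intro null_setsI A) (simp add: emeasure_eq_measure2)
    then have "AE x in lebesgue. x \<notin> A" by (rule AE_not_in)
    then show ?thesis by (simp add: A_def)
  qed
  then have "AE x in lebesgue. \<forall>k::nat. \<not> (x \<in> ball x0 r \<and> 1 / real (Suc k) \<le> u (x + T *\<^sub>R ?e))"
    unfolding AE_all_countable by simp
  then have "AE x in lebesgue. x \<in> ball x0 r \<longrightarrow> u (x + T *\<^sub>R ?e) = 0"
  proof eventually_elim
    fix x assume x: "\<forall>k::nat. \<not> (x \<in> ball x0 r \<and> 1 / real (Suc k) \<le> u (x + T *\<^sub>R ?e))"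
    show "x \<in> ball x0 r \<longrightarrow> u (x + T *\<^sub>R ?e) = 0"
    proof (rule impI, rule ccontr)
      assume b: "x \<in> ball x0 r" and "u (x + T *\<^sub>R ?e) \<noteq> 0"
      then have "u (x + T *\<^sub>R ?e) > 0" using u0[of "x + T *\<^sub>R ?e"] by linarith
      then obtain k where "1 / real (Suc k) < u (x + T *\<^sub>R ?e)" using nat_approx_posE by blast
      then show False using x b by (meson less_imp_le)
    qed
  qed
  from AE_shift[OF this, of "- (T *\<^sub>R ?e)"] show ?thesis
  proof eventually_elim
    fix x assume x: "x + - (T *\<^sub>R ?e) \<in> ball x0 r \<longrightarrow> u (x + - (T *\<^sub>R ?e) + T *\<^sub>R ?e) = 0"
    have "dist x0 (x + - (T *\<^sub>R ?e)) = dist (x0 + T *\<^sub>R ?e) x" by (simp add: dist_norm algebra_simps)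
    then show "x \<in> ball (x0 + T *\<^sub>R ?e) r \<longrightarrow> u x = 0" using x by simp
  qed
qed

text \<open>Axis translations compose, one coordinate at a time, to move the ball to any centre.
  Centres from a countable dense set then cover space at the price of a single null set.\<close>

lemma zero_everywhere:
  assumes z: "AE x in lebesgue. x \<in> ball x0 r \<longrightarrow> u x = 0" and r: "r > 0"
  shows "AE x in lebesgue. u x = 0"
proof -
  have ball: "AE x in lebesgue. x \<in> ball y r \<longrightarrow> u x = 0" for y
  proof -
    have "AE x in lebesgue. x \<in> ball (\<chi> i. if i \<in> S then y $ i else x0 $ i) r \<longrightarrow> u x = 0" if "finite S" for S :: "'n set"
      using that
    proof (induction S)
      case empty
      then show ?case using z by simp
    next
      case (insert j S)
      have "(\<chi> i. if i \<in> insert j S then y $ i else x0 $ i) = (\<chi> i. if i \<in> S then y $ i else x0 $ i) + (y $ j - x0 $ j) *\<^sub>R axis j 1"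
        using insert(2) by (auto simp: vec_eq_iff axis_def)
      then show ?case using zero_ball_shift[OF insert.IH r, of "y $ j - x0 $ j" j] by simp
    qed
    from this[of UNIV] show ?thesis by simp
  qed
  obtain D :: "(real^'n) set" where D: "countable D" "\<And>X. open X \<Longrightarrow> X \<noteq> {} \<Longrightarrow> \<exists>d\<in>D. d \<in> X"
    using countable_dense_exists by metis
  have "AE x in lebesgue. \<forall>d\<in>D. x \<in> ball d r \<longrightarrow> u x = 0" using ball by (subst AE_ball_countable[OF D(1)]) blast
  then show ?thesis
  proof eventually_elim
    fix x assume x: "\<forall>d\<in>D. x \<in> ball d r \<longrightarrow> u x = 0"
    obtain d where d: "d \<in> D" "d \<in> ball x r" using D(2)[of "ball x r"] r by auto
    then have "x \<in> ball d r" by (simp add: dist_commute)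
    then show "u x = 0" using x d by blast
  qed
qed

end

section \<open>The kernel at a point of infinite curvature\<close>

text \<open>For oscillating cutoffs the kinetic energy grows at least like n^2 while norm and
  potential term stay fixed, so Re w < 0 would drive a nonnegative quantity to minus
  infinity.\<close>

lemma support_direction_pos:
  fixes V :: "real^'n \<Rightarrow> complex"
  assumes V: "L1_loc V" and w: "Re w \<noteq> 0"
    and Q: "\<And>v. v \<in> form_dom V \<Longrightarrow> 0 \<le> Re (cnj w * (form V v v - lam * l2_inner v v))"
  shows "Re w > 0"
proof (rule ccontr)
  assume "\<not> Re w > 0"
  then have w: "Re w < 0" using w by simp
  fix i :: 'n
  let ?c = "\<lambda>x::real^'n. complex_of_real (cutoff 1 x)"
  define \<psi> where "\<psi> n x = ?c x * cis ((real n * pi) * x $ i)" for n and x :: "real^'n"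
  define m where "m = (l2_norm ?c)\<^sup>2"
  define W where "W = (LINT x|lebesgue. V x * of_real ((cutoff 1 x)\<^sup>2))"
  have c0: "l2_norm ?c \<noteq> 0"
  proof
    assume "l2_norm ?c = 0"
    then have z: "AE x in lebesgue. ?c x = 0" using l2_norm_zero_iff[OF cutoff_L2] by blast
    have nb: "x \<notin> ball 0 1" if "?c x = 0" for x using cutoff(3)[of x 1] that by auto
    from z have "AE x in lebesgue. x \<notin> ball (0::real^'n) 1" by eventually_elim (rule nb)
    then show False using not_AE_ball[OF zero_less_one] by blast
  qed
  have D: "\<psi> n \<in> form_dom V" for n unfolding \<psi>_def[abs_def] by (rule modulated_cutoff_form_dom[OF V])
  have ab: "cmod (\<psi> n x) = cutoff 1 x" for n x using cutoff(1)[of 1 x] by (simp add: \<psi>_def norm_mult)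
  have nm: "l2_norm (\<psi> n) = l2_norm ?c" for n unfolding l2_norm_def ab by simp
  have G: "(real n)\<^sup>2 * m \<le> (\<Sum>j\<in>UNIV. (l2_norm (wgrad (\<psi> n) j))\<^sup>2)" if n: "n > 0" for n
  proof -
    \<comment> \<open>Half a period: the wave changes sign over this step, so the quotient has
      modulus n times the sum of two cutoff values. This bounds the energy from below without
      computing a gradient.\<close>
    let ?\<tau> = "1 / real n"
    have "cmod (complex_of_real (real n) * ?c x) \<le> cmod (dq i ?\<tau> (\<psi> n) x)" for x
    proof -
      let ?y = "x + ?\<tau> *\<^sub>R axis i 1"
      have "(real n * pi) * ?y $ i = (real n * pi) * x $ i + pi" using n by (simp add: algebra_simps)
      then have "\<psi> n ?y - \<psi> n x = - (of_real (cutoff 1 ?y + cutoff 1 x) * cis ((real n * pi) * x $ i))"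
        by (simp only: \<psi>_def cis_mult[symmetric] cis_pi) (simp add: algebra_simps)
      then have "cmod (\<psi> n ?y - \<psi> n x) = cutoff 1 ?y + cutoff 1 x"
        using cutoff(1)[of 1 x] cutoff(1)[of 1 ?y] by (simp only: norm_minus_cancel norm_mult norm_cis norm_of_real) simp
      then have "cmod (dq i ?\<tau> (\<psi> n) x) = real n * (cutoff 1 ?y + cutoff 1 x)" by (simp add: dq_def norm_divide norm_mult)
      also have "\<dots> \<ge> real n * cutoff 1 x" using cutoff(1)[of 1 ?y] by (intro mult_left_mono) auto
      finally show ?thesis using cutoff(1)[of 1 x] by (simp add: norm_mult)
    qed
    then have "l2_norm (\<lambda>x. complex_of_real (real n) * ?c x) \<le> l2_norm (dq i ?\<tau> (\<psi> n))"
      by (intro l2_norm_mono(2) dq_L2 form_domD(2)[OF D] L2_measurable L2_scale cutoff_L2)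
    also have "\<dots> \<le> l2_norm (wgrad (\<psi> n) i)" by (rule dq_wgrad_le[OF form_domD(1)[OF D]])
    finally have "real n * l2_norm ?c \<le> l2_norm (wgrad (\<psi> n) i)"
      by (simp add: l2_norm_def norm_mult power_mult_distrib real_sqrt_mult)
    then have "(real n * l2_norm ?c)\<^sup>2 \<le> (l2_norm (wgrad (\<psi> n) i))\<^sup>2" by (intro power_mono) auto
    also have "\<dots> \<le> (\<Sum>j\<in>UNIV. (l2_norm (wgrad (\<psi> n) j))\<^sup>2)" by (rule member_le_sum) auto
    finally show ?thesis by (simp add: m_def power_mult_distrib)
  qed
  define B where "B = Re (cnj w * (W - lam * of_real m))"
  have up: "- Re w * ((real n)\<^sup>2 * m) \<le> B" if n: "n > 0" for n
  proof -
    let ?G = "\<Sum>j\<in>UNIV. (l2_norm (wgrad (\<psi> n) j))\<^sup>2"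
    have "form V (\<psi> n) (\<psi> n) = of_real ?G + W" unfolding form_diag[OF D] ab W_def ..
    moreover have "l2_inner (\<psi> n) (\<psi> n) = of_real m" unfolding l2_self[OF form_domD(2)[OF D]] nm m_def ..
    ultimately have "form V (\<psi> n) (\<psi> n) - lam * l2_inner (\<psi> n) (\<psi> n) = of_real ?G + (W - lam * of_real m)" by simp
    then have "0 \<le> Re (cnj w * (of_real ?G + (W - lam * of_real m)))" using Q[OF D, of n] by simp
    then have "- Re w * ?G \<le> B" by (simp add: B_def distrib_left)
    moreover have "- Re w * ((real n)\<^sup>2 * m) \<le> - Re w * ?G" using G[OF n] w by (intro mult_left_mono) auto
    ultimately show ?thesis by linarith
  qed
  have p: "- Re w * m > 0" using c0 w by (simp add: m_def mult_neg_pos)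
  obtain n :: nat where n: "real n > max 1 (B / (- Re w * m))" using reals_Archimedean2 by blast
  then have "B / (- Re w * m) < real n" unfolding max_less_iff_conj by blast
  then have "B < real n * (- Re w * m)" unfolding pos_divide_less_eq[OF p] .
  also have "\<dots> \<le> (real n)\<^sup>2 * (- Re w * m)" using n p by (intro mult_right_mono) (auto simp: power2_eq_square)
  also have "\<dots> = - Re w * ((real n)\<^sup>2 * m)" by simp
  also have "\<dots> \<le> B" using n by (intro up) (auto intro: Nat.gr0I)
  finally show False by simp
qed

text \<open>By the reverse triangle inequality the modulus has smaller difference quotients
  pointwise, and the bound passes to weak gradients.\<close>

lemma form_dom_cmod:
  fixes V :: "real^'n \<Rightarrow> complex"
  assumes V: "L1_loc V" and f: "f \<in> form_dom V"
  defines "U \<equiv> \<lambda>x. complex_of_real (cmod (f x))"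
  shows "U \<in> form_dom V" "l2_norm (wgrad U j) \<le> l2_norm (wgrad f j)"
proof -
  have fL: "f \<in> L2" and fH: "f \<in> H1" using form_domD f by auto
  have meas: "U \<in> borel_measurable lebesgue"
    unfolding U_def using L2_measurable[OF fL] by (rule borel_measurable_continuous_on[rotated]) (intro continuous_intros)
  have UL: "U \<in> L2" by (rule l2_norm_mono(1)[OF fL meas]) (simp add: U_def)
  have le: "l2_norm (dq j \<tau> U) \<le> l2_norm (wgrad f j)" for j \<tau>
  proof -
    have "cmod (dq j \<tau> U x) \<le> cmod (dq j \<tau> f x)" for x
      using norm_triangle_ineq3[of "f (x + \<tau> *\<^sub>R axis j 1)" "f x"]
      by (simp add: dq_def U_def norm_divide divide_right_mono flip: of_real_diff)
    then have "l2_norm (dq j \<tau> U) \<le> l2_norm (dq j \<tau> f)" by (intro l2_norm_mono(2) dq_L2 L2_measurable fL UL)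
    also have "\<dots> \<le> l2_norm (wgrad f j)" by (rule dq_wgrad_le[OF fH])
    finally show ?thesis .
  qed
  have UH: "U \<in> H1" by (rule H1_dqI[OF UL le])
  show "U \<in> form_dom V" by (rule form_domI[OF V UH form_dom_weight[OF V f]]) (simp add: U_def)
  show "l2_norm (wgrad U j) \<le> l2_norm (wgrad f j)"
    by (rule wgrad_norm_le[OF UH LIMSEQ_inverse_real_of_nat _ le]) simp
qed

text \<open>Conjugate the second equation and test both with real functions: the kinetic parts
  coincide and cancel, which leaves (V - cnj V - (lam - cnj lam)) f with zero integral against every
  test function.\<close>

lemma kernel_support:
  fixes V :: "real^'n \<Rightarrow> complex"
  assumes V: "L1_loc V" and f: "f \<in> form_dom V"
    and l: "\<And>v. v \<in> form_dom V \<Longrightarrow> form V f v = lam * l2_inner f v"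
    and r: "\<And>v. v \<in> form_dom V \<Longrightarrow> form V v f = lam * l2_inner v f"
  shows "AE x in lebesgue. Im (V x) = Im lam \<or> f x = 0"
proof -
  have fL: "f \<in> L2" and fH: "f \<in> H1" using form_domD f by auto
  define g where "g x = (V x - cnj (V x) - (lam - cnj lam)) * f x" for x
  have "AE x in lebesgue. g x = 0"
  proof (rule fundamental_lemma)
    have "(\<lambda>x. cnj (V x)) \<in> borel_measurable lebesgue"
      using V_meas[OF V] by (rule borel_measurable_continuous_on[rotated]) (intro continuous_intros)
    then show "g \<in> borel_measurable lebesgue" unfolding g_def[abs_def]
      using V_meas[OF V] L2_measurable[OF fL] by (intro borel_measurable_times borel_measurable_diff) auto
  next
    fix \<phi> :: "real^'n \<Rightarrow> real" assume t: "test_fun \<phi>"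
    let ?\<Phi> = "\<lambda>x. complex_of_real (\<phi> x)"
    have \<Phi>: "?\<Phi> \<in> form_dom V" by (rule ctest_form_dom[OF V ctest_real[OF t]])
    define S where "S = (\<Sum>j\<in>UNIV. l2_inner (wgrad f j) (wgrad ?\<Phi> j))"
    have i1: "integrable lebesgue (\<lambda>x. V x * f x * ?\<Phi> x)" using form_dom_mult[OF V f \<Phi>] by simp
    have "integrable lebesgue (\<lambda>x. cnj (V x * ?\<Phi> x * cnj (f x)))"
      by (rule integrable_bounded_linear[OF bounded_linear_cnj form_dom_mult[OF V \<Phi> f]])
    then have i2: "integrable lebesgue (\<lambda>x. cnj (V x) * f x * ?\<Phi> x)" by (simp add: mult_ac)
    have i3: "integrable lebesgue (\<lambda>x. f x * ?\<Phi> x)" using L2_mult[OF fL form_domD(2)[OF \<Phi>]] .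
    have eq: "g x * ?\<Phi> x = V x * f x * ?\<Phi> x - cnj (V x) * f x * ?\<Phi> x - (lam - cnj lam) * (f x * ?\<Phi> x)" for x
      by (simp add: g_def algebra_simps)
    show "integrable lebesgue (\<lambda>x. g x * ?\<Phi> x)" unfolding eq
      by (intro Bochner_Integration.integrable_diff integrable_mult_right i1 i2 i3)
    have 1: "S + (LINT x|lebesgue. V x * f x * ?\<Phi> x) = lam * (LINT x|lebesgue. f x * ?\<Phi> x)"
      using l[OF \<Phi>] by (simp add: form_def S_def l2_inner_def)
    have "cnj (l2_inner (wgrad ?\<Phi> j) (wgrad f j)) = l2_inner (wgrad f j) (wgrad ?\<Phi> j)" for j
      by (rule L2.ip_cnj[symmetric]) (use wgrad(1) fH form_domD(1)[OF \<Phi>] in blast)+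
    then have "cnj (form V ?\<Phi> f) = S + cnj (LINT x|lebesgue. V x * ?\<Phi> x * cnj (f x))"
      by (simp add: form_def S_def)
    also have "cnj (LINT x|lebesgue. V x * ?\<Phi> x * cnj (f x)) = (LINT x|lebesgue. cnj (V x) * f x * ?\<Phi> x)"
    proof -
      have "cnj (LINT x|lebesgue. V x * ?\<Phi> x * cnj (f x)) = (LINT x|lebesgue. cnj (V x * ?\<Phi> x * cnj (f x)))"
        by (rule Bochner_Integration.integral_cnj[symmetric])
      then show ?thesis by (simp only: complex_cnj_mult complex_cnj_cnj complex_cnj_complex_of_real mult_ac)
    qed
    finally have 2: "S + (LINT x|lebesgue. cnj (V x) * f x * ?\<Phi> x) = cnj (form V ?\<Phi> f)" by simp
    have "cnj (l2_inner ?\<Phi> f) = l2_inner f ?\<Phi>" using L2.ip_cnj[OF form_domD(2)[OF \<Phi>] fL] by simp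
    then have "cnj (form V ?\<Phi> f) = cnj lam * (LINT x|lebesgue. f x * ?\<Phi> x)" using r[OF \<Phi>] by (simp add: l2_inner_def)
    with 2 have 3: "S + (LINT x|lebesgue. cnj (V x) * f x * ?\<Phi> x) = cnj lam * (LINT x|lebesgue. f x * ?\<Phi> x)" by (rule trans)
    have "(LINT x|lebesgue. V x * f x * ?\<Phi> x) - (LINT x|lebesgue. cnj (V x) * f x * ?\<Phi> x)
        = (S + (LINT x|lebesgue. V x * f x * ?\<Phi> x)) - (S + (LINT x|lebesgue. cnj (V x) * f x * ?\<Phi> x))" by simp
    then have "(LINT x|lebesgue. V x * f x * ?\<Phi> x) - (LINT x|lebesgue. cnj (V x) * f x * ?\<Phi> x)
        = (lam - cnj lam) * (LINT x|lebesgue. f x * ?\<Phi> x)" unfolding 1 3 left_diff_distrib .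
    then show "(LINT x|lebesgue. g x * ?\<Phi> x) = 0"
      unfolding eq using i1 i2 i3 by simp
  qed
  then show ?thesis
  proof eventually_elim
    fix x assume "g x = 0"
    then have "V x - cnj (V x) - (lam - cnj lam) = 0 \<or> f x = 0" by (simp add: g_def)
    then show "Im (V x) = Im lam \<or> f x = 0" by (auto simp: complex_eq_iff)
  qed
qed

text \<open>Passing to \<open>\<bar>f\<bar>\<close> does not increase the quadratic form \<open>Re (w\<^sup>* (\<E> - \<lambda>))\<close>, so \<open>\<bar>f\<bar>\<close> is again
  a minimiser, and the Cauchy--Schwarz inequality gives its Euler equation.\<close>

lemma kernel_positive_supersolution:
  fixes V :: "real^'n \<Rightarrow> complex"
  assumes V: "L1_loc V" and f: "f \<in> form_dom V" and l: "form V f f = lam * l2_inner f f" and w: "Re w > 0"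
    and cs: "closed_sectorial fsc L2 l2_inner (form_dom V) (form V) \<kappa> \<gamma>"
    and Q: "\<And>v. v \<in> form_dom V \<Longrightarrow> 0 \<le> Re (cnj w * (form V v v - lam * l2_inner v v))"
  shows "positive_supersolution V (\<lambda>x. cmod (f x)) (cmod w / Re w * (1 + cmod lam))"
proof
  let ?U = "\<lambda>x. complex_of_real (cmod (f x))"
  let ?K = "cmod w / Re w * (1 + cmod lam)"
  interpret C: closed_sectorial fsc L2 l2_inner "form_dom V" "form V" \<kappa> \<gamma> by (rule cs)
  interpret P: spectral_point fsc L2 l2_inner "form_dom V" "form V" \<kappa> \<gamma> lam ..
  interpret b: semi_ip fsc "form_dom V" "P.al.herm w"
    by (rule P.al.semi_ip_herm) (use Q in \<open>simp add: P.al_def\<close>)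
  show "L1_loc V" by fact
  show "0 \<le> cmod (f x)" for x by simp
  show U: "?U \<in> form_dom V" by (rule form_dom_cmod(1)[OF V f])
  show "0 \<le> ?K" using w by simp
  have UL: "?U \<in> L2" and UH: "?U \<in> H1" and fL: "f \<in> L2" using form_domD U f by auto
  have U0: "b.nrm ?U = 0"
  proof -
    define W where "W = (LINT x|lebesgue. V x * of_real ((cmod (f x))\<^sup>2)) - lam * of_real ((l2_norm f)\<^sup>2)"
    let ?G = "\<lambda>g. \<Sum>j\<in>UNIV. (l2_norm (wgrad g j))\<^sup>2"
    have nm: "l2_norm ?U = l2_norm f" by (simp add: l2_norm_def)
    \<comment> \<open>f and its modulus share norm and potential term \<open>W\<close>, so the two
      values differ only in the kinetic energy.\<close>
    have "form V f f - lam * l2_inner f f = of_real (?G f) + W" "form V ?U ?U - lam * l2_inner ?U ?U = of_real (?G ?U) + W"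
      unfolding form_diag[OF f] form_diag[OF U] l2_self[OF fL] l2_self[OF UL] nm W_def by simp_all
    then have 1: "Re (cnj w * (form V f f - lam * l2_inner f f)) = Re w * ?G f + Re (cnj w * W)"
      and 2: "Re (cnj w * (form V ?U ?U - lam * l2_inner ?U ?U)) = Re w * ?G ?U + Re (cnj w * W)"
      by (simp_all add: distrib_left)
    have "?G ?U \<le> ?G f" by (intro sum_mono power_mono form_dom_cmod(2)[OF V f]) auto
    then have "Re w * ?G ?U \<le> Re w * ?G f" using w by (intro mult_left_mono) auto
    then have "Re (cnj w * (form V ?U ?U - lam * l2_inner ?U ?U)) \<le> 0" using 1 2 l by simp
    then have "Re (cnj w * P.al ?U ?U) = 0" using Q[OF U] by (simp add: P.al_def)
    then show ?thesis by (simp add: b.nrm_def P.al.herm_self)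
  qed
  fix v :: "real^'n \<Rightarrow> real"
  let ?v = "\<lambda>x. complex_of_real (v x)"
  assume v: "?v \<in> form_dom V" and v0: "\<And>x. 0 \<le> v x"
  have vL: "?v \<in> L2" and vH: "?v \<in> H1" using form_domD v by auto
  define S where "S = (\<Sum>j\<in>UNIV. l2_inner (wgrad ?U j) (wgrad ?v j))"
  define I where "I = (LINT x|lebesgue. V x * ?U x * cnj (?v x))"
  define J where "J = l2_inner ?U ?v"
  define A where "A = (LINT x|lebesgue. cmod (V x) * (cmod (f x) * v x))"
  define B where "B = (LINT x|lebesgue. cmod (f x) * v x)"
  have c: "l2_inner (wgrad ?v j) (wgrad ?U j) = cnj (l2_inner (wgrad ?U j) (wgrad ?v j))" for j
    by (rule L2.ip_cnj) (use wgrad(1) UH vH in blast)+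
  have aUv: "P.al ?U ?v = S + (I - lam * J)" by (simp add: P.al_def form_def S_def I_def J_def)
  have "(LINT x|lebesgue. V x * ?v x * cnj (?U x)) = I" "l2_inner ?v ?U = J"
    by (simp_all add: I_def J_def l2_inner_def mult_ac)
  then have avU: "P.al ?v ?U = cnj S + (I - lam * J)" by (simp add: P.al_def form_def S_def c)
  have "P.al.herm w ?U ?v = 0" by (rule b.null_ip(1)[OF U v U0])
  then have "cnj w * (S + (I - lam * J)) + w * cnj (cnj S + (I - lam * J)) = 0"
    unfolding P.al.herm_def aUv avU by simp
  then have "Re (cnj w * (S + (I - lam * J)) + w * cnj (cnj S + (I - lam * J))) = 0" by simp
  \<comment> \<open>The kinetic terms add up to (cnj w + w) S = 2 (Re w) S, while the remaining two
    are conjugate to each other; this makes Re w the coefficient of Re S.\<close>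
  then have RS: "Re w * Re S = - Re (cnj w * (I - lam * J))" by (simp add: algebra_simps)
  have Ic: "cmod (V x * ?U x * cnj (?v x)) = cmod (V x) * (cmod (f x) * v x)" for x
    using v0[of x] by (simp add: norm_mult)
  have I: "cmod I \<le> A"
    using integral_norm_bound[of lebesgue "\<lambda>x. V x * ?U x * cnj (?v x)"] unfolding Ic I_def A_def .
  have Jc: "cmod (?U x * cnj (?v x)) = cmod (f x) * v x" for x
    using v0[of x] by (simp add: norm_mult)
  have J: "cmod J \<le> B"
    using integral_norm_bound[of lebesgue "\<lambda>x. ?U x * cnj (?v x)"] unfolding Jc J_def B_def l2_inner_def .
  have AB: "0 \<le> A" "0 \<le> B" using I J norm_ge_zero order_trans by blast+
  have "cmod (I - lam * J) \<le> cmod I + cmod lam * cmod J" using norm_triangle_ineq4[of I "lam * J"] by (simp add: norm_mult)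
  also have "\<dots> \<le> A + cmod lam * B" using I J by (intro add_mono mult_left_mono) auto
  also have "\<dots> \<le> (1 + cmod lam) * (A + B)" using AB by (simp add: algebra_simps)
  finally have IJ: "cmod (I - lam * J) \<le> (1 + cmod lam) * (A + B)" .
  have "Re (cnj w * (I - lam * J)) \<le> cmod w * cmod (I - lam * J)"
    using complex_Re_le_cmod[of "cnj w * (I - lam * J)"] by (simp add: norm_mult)
  also have "\<dots> \<le> cmod w * ((1 + cmod lam) * (A + B))" using IJ by (rule mult_left_mono) simp
  also have "\<dots> = Re w * (?K * (A + B))" using w by simp
  finally have "Re w * - (?K * (A + B)) \<le> Re w * Re S" unfolding RS by simp
  then have "- (?K * (A + B)) \<le> Re S" using w by (simp only: mult_le_cancel_left_pos)
  then show "- (?K * ((LINT x|lebesgue. cmod (V x) * (cmod (f x) * v x)) + (LINT x|lebesgue. cmod (f x) * v x)))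
      \<le> (\<Sum>j\<in>UNIV. Re (l2_inner (wgrad ?U j) (wgrad ?v j)))"
    by (simp only: S_def A_def B_def Re_sum)
qed

lemma infinite_curvature_sigma_ess:
  fixes V :: "real^'n \<Rightarrow> complex"
  assumes A1: "hypA1 V" and C1: "hypC1 V" and lam: "lam \<in> frontier (numrange V)"
    and curv: "unilateral_infinite_curvature (closure (numrange V)) lam"
  shows "lam \<in> sigma_ess V"
proof (rule ccontr)
  assume "lam \<notin> sigma_ess V"
  then have cl: "l2_closed (H_range V lam)" by (simp add: sigma_ess_def H_fredholm_def)
  have V: "L1_loc V" using A1 by (simp add: hypA1_def)
  obtain \<kappa> \<gamma> where cs: "closed_sectorial fsc L2 l2_inner (form_dom V) (form V) \<kappa> \<gamma>" using closed_sectorial_form[OF A1 C1] .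
  interpret C: closed_sectorial fsc L2 l2_inner "form_dom V" "form V" \<kappa> \<gamma> by (rule cs)
  interpret P: spectral_point fsc L2 l2_inner "form_dom V" "form V" \<kappa> \<gamma> lam ..
  have rel: "H_rel V f u \<longleftrightarrow> C.rel f u" for f u by (simp add: H_rel_def C.rel_def)
  have Dom: "H_dom V = C.Dom" by (simp add: H_dom_def C.Dom_def rel)
  have op: "C.rel f (H_op V f)" if "f \<in> C.Dom" for f
    using someI_ex[of "H_rel V f"] that by (simp add: H_op_def C.Dom_def rel)
  \<comment> \<open>\<open>H_op\<close> is a choice; density of the form domain determines its value
    almost everywhere.\<close>
  have uniq: "AE x in lebesgue. u x = H_op V f x" if r: "C.rel f u" for f u
  proof -
    have "f \<in> C.Dom" using r by (auto simp: C.Dom_def)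
    then have d: "C.rel (f - f) (u - H_op V f)" using C.rel_diff[OF r op] by blast
    then have m: "u - H_op V f \<in> L2" by (rule C.rel_mem(2))
    have "l2_inner v (u - H_op V f) = 0" if v: "v \<in> form_dom V" for v
    proof -
      have "l2_inner (u - H_op V f) v = form V (f - f) v" using d v by (simp add: C.rel_def)
      also have "\<dots> = 0" using v by simp
      finally show ?thesis using L2.ip_cnj[OF m, of v] C.D_X[OF v] by simp
    qed
    then have "L2.nrm (u - H_op V f) = 0" by (rule C.dense_D[OF m])
    then have "AE x in lebesgue. (u - H_op V f) x = 0" using l2_norm_zero_iff[OF m] by simp
    then show ?thesis by eventually_elim simp
  qed
  have num: "C.numr = numrange V"
  proof -
    have "l2_inner (H_op V f) f = form V f f" if "f \<in> C.Dom" for f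
      using op[OF that] by (simp add: C.rel_def)
    then show ?thesis unfolding C.numr_def numrange_def Dom L2_nrm by (intro Collect_cong ex_cong1) auto
  qed
  \<comment> \<open>Both ranges are saturated under null sets, one through an almost everywhere
    equation, the other through the norm, so they agree as sets of functions.\<close>
  have rng: "H_range V lam = P.Rng"
  proof (intro set_eqI iffI)
    fix g assume "g \<in> H_range V lam"
    then obtain f where f: "f \<in> C.Dom" and g: "AE x in lebesgue. g x = H_op V f x - lam * f x"
      by (auto simp: H_range_def Dom)
    have m: "H_op V f - fsc lam f \<in> L2" using C.rel_mem[OF op[OF f]] by blast
    have gL: "g \<in> L2" by (rule L2_cong_AE[OF m]) (use g in \<open>eventually_elim, simp add: fsc_apply\<close>)
    have "l2_norm (g - (H_op V f - fsc lam f)) = 0"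
      using l2_norm_zero_iff[OF L2.diff_mem[OF gL m]] g by (simp add: fsc_apply)
    then show "g \<in> P.Rng" using gL op[OF f] by (auto simp: P.Rng_def)
  next
    fix g assume "g \<in> P.Rng"
    then obtain f u where gL: "g \<in> L2" and r: "C.rel f u" and n: "l2_norm (g - (u - fsc lam f)) = 0"
      by (auto simp: P.Rng_def)
    have "g - (u - fsc lam f) \<in> L2" using gL C.rel_mem[OF r] by blast
    then have "AE x in lebesgue. g x - (u x - lam * f x) = 0" using l2_norm_zero_iff n by (fastforce simp: fsc_apply)
    with uniq[OF r] have "AE x in lebesgue. g x = H_op V f x - lam * f x" by eventually_elim simp
    moreover have "f \<in> H_dom V" using r by (auto simp: Dom C.Dom_def)
    ultimately show "g \<in> H_range V lam" by (auto simp: H_range_def)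
  qed
  have "(\<exists>f\<in>P.N. L2.nrm f \<noteq> 0) \<and> (\<exists>w. Re w \<noteq> 0 \<and> (\<forall>f\<in>form_dom V. 0 \<le> Re (cnj w * P.al f f)))"
  proof (rule P.infinite_curvature_kernel)
    fix s x assume "\<And>n. s n \<in> P.Rng" "x \<in> L2" "(\<lambda>n. L2.nrm (s n - x)) \<longlonglongrightarrow> 0"
    then show "x \<in> P.Rng"
      using cl[unfolded l2_closed_def rng, rule_format, of s x] by (simp add: fun_diff_eq)
  qed (use lam curv num in auto)
  then obtain f w where fN: "f \<in> P.N" and fn: "l2_norm f \<noteq> 0" and w0: "Re w \<noteq> 0"
    and Q: "\<And>v. v \<in> form_dom V \<Longrightarrow> 0 \<le> Re (cnj w * (form V v v - lam * l2_inner v v))"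
    by (auto simp: P.al_def)
  have f: "f \<in> form_dom V" and l: "\<And>v. v \<in> form_dom V \<Longrightarrow> form V f v = lam * l2_inner f v"
    and r: "\<And>v. v \<in> form_dom V \<Longrightarrow> form V v f = lam * l2_inner v f" using fN by (auto simp: P.N_def P.al_def)
  have w: "Re w > 0" by (rule support_direction_pos[OF V w0 Q])
  interpret S: positive_supersolution V "\<lambda>x. cmod (f x)" "cmod w / Re w * (1 + cmod lam)"
    by (rule kernel_positive_supersolution[OF V f l[OF f] w cs Q])
  obtain x0 where "isCont (\<lambda>x. Im (V x)) x0" "Im (V x0) \<noteq> Im lam" using hypC1_value[OF C1] .
  then obtain \<rho> where \<rho>: "\<rho> > 0" "\<And>x. x \<in> ball x0 \<rho> \<Longrightarrow> Im (V x) \<noteq> Im lam" using isCont_nonzero_ball by blast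
  have "AE x in lebesgue. Im (V x) = Im lam \<or> f x = 0" by (rule kernel_support[OF V f l r])
  then have "AE x in lebesgue. x \<in> ball x0 \<rho> \<longrightarrow> cmod (f x) = 0" by eventually_elim (use \<rho>(2) in auto)
  then have "AE x in lebesgue. cmod (f x) = 0" using \<rho>(1) by (rule S.zero_everywhere)
  then have "l2_norm f = 0" using l2_norm_zero_iff[OF form_domD(2)[OF f]] by simp
  then show False using fn by simp
qed

theorem mainTheorem12:
  fixes V :: "real^'n \<Rightarrow> complex"
  assumes "hypA1 V" and "hypA2 V" and "hypA3 V" and "hypC1 V"
  shows "(\<forall>lam. lam \<in> frontier (numrange V) \<and>
             unilateral_infinite_curvature (closure (numrange V)) lam \<longrightarrow> lam \<in> sigma_ess V)
       \<and> (sigma_ess V = {} \<longrightarrow>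
             \<not> (\<exists>lam \<in> frontier (numrange V). unilateral_infinite_curvature (closure (numrange V)) lam))"
  using infinite_curvature_sigma_ess[OF assms(1,4)] by auto

end
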